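(* Let $0<p,q<\infty$ and $\alpha,\beta>-1$, and let $\{X_n\}_{n\ge1}$ be a standard random sequence. Then $\mathcal{R}f\in\mathcal{A}^q_\beta$ almost surely for each $f\in\mathcal{A}^p_\alpha$ if and only if one of the following holds: (i) $p\geq2$ and $\frac{\alpha+1}{p}<\frac{\beta+1}{q}$; or (ii) $q\geq p\geq2$ and $\frac{\alpha+1}{p}=\frac{\beta+1}{q}$.
   Context: A standard random sequence $\{X_n\}$ is a sequence of independent identically distributed random variables on a probability space, all of one of the following three types: Bernoulli ($\mathbb{P}(X_n=1)=\mathbb{P}(X_n=-1)=1/2$), Steinhaus (uniformly distributed on the unit circle), or Gaussian $N(0,1)$ (zero mean, unit variance). For $\theta\in\mathbb{R}$ let $\mathbb{C}_\theta=\{s\in\mathbb{C}:\Re s>\theta\}$. $\mathcal{D}$ is the space of Dirichlet series $\sum_{n\ge1}a_nn^{-s}$ ($a_n\in\mathbb{C}$) converging on some half plane $\mathbb{C}_\theta$, and $\mathcal{P}$ is the space of Dirichlet polynomials $\sum_{n=1}^Na_nn^{-s}$. For $f(s)=\sum_{n\ge1}a_nn^{-s}$ in $\mathcal{D}$, the randomization is $\mathcal{R}f(s)=\sum_{n\ge1}a_nX_nn^{-s}$. Let $p_j$ be the $j$th prime and write $n=\prod_j p_j^{\nu_j(n)}$. The Bohr lift of $P(s)=\sum_{n=1}^N a_nn^{-s}$ is $\mathscr{B}P(z)=\sum_{n=1}^N a_nz^{\nu(n)}$, where $z=(z_1,z_2,\dots)$ and $z^{\nu(n)}=\prod_jz_j^{\nu_j(n)}$.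 For $P\in\mathcal{P}$ and $0<p<\infty$, $\|P\|_{\mathscr{H}^p}=\left(\int_{\mathbb{T}^\infty}|\mathscr{B}P(z)|^p\,dm_\infty(z)\right)^{1/p}$, where $m_\infty$ is the Haar probability measure on the infinite torus $\mathbb{T}^\infty$. For $\sigma\ge0$, $P_\sigma(s)=P(s+\sigma)$. For $0<p<\infty$ and $\alpha>-1$, the Bergman space $\mathcal{A}^p_\alpha$ is the completion of $\mathcal{P}$ with respect to the (quasi-)norm $\|P\|_{\mathcal{A}^p_\alpha}=\left(\int_0^{+\infty}\|P_\sigma\|_{\mathscr{H}^p}^p\,d\mu_\alpha(\sigma)\right)^{1/p}$, where $d\mu_\alpha(\sigma)=\frac{2^{\alpha+1}}{\Gamma(\alpha+1)}\sigma^\alpha e^{-2\sigma}d\sigma$. Its elements are identified with Dirichlet series in $\mathcal{D}$ converging on $\mathbb{C}_{1/2}$. *)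

theory Defs
  imports "HOL-Probability.Probability" "HOL-Number_Theory.Number_Theory"
begin

text \<open>
  A Dirichlet series is represented by its coefficient sequence \<open>a :: nat \<Rightarrow> complex\<close>, indexed
  by \<open>n \<ge> 1\<close>. The value \<open>a 0\<close> is ignored throughout; in particular the term \<open>n = 0\<close> below
  vanishes because \<open>0 powr z = 0\<close>.
\<close>

definition dirichlet_term :: "(nat \<Rightarrow> complex) \<Rightarrow> complex \<Rightarrow> nat \<Rightarrow> complex" where
  "dirichlet_term a s n = a n * of_nat n powr (- s)"

definition dirichlet_eval :: "(nat \<Rightarrow> complex) \<Rightarrow> complex \<Rightarrow> complex" where
  "dirichlet_eval a s = (\<Sum>n. dirichlet_term a s n)"

definition half_plane :: "real \<Rightarrow> complex set" where
  "half_plane \<theta> = {s. Re s > \<theta>}"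

definition dirichlet_polys :: "(nat \<Rightarrow> complex) set" where
  "dirichlet_polys = {a. finite {n. a n \<noteq> 0}}"

text \<open>The coefficients of \<open>s \<mapsto> P (s + \<sigma>)\<close>.\<close>

definition dirichlet_shift :: "real \<Rightarrow> (nat \<Rightarrow> complex) \<Rightarrow> nat \<Rightarrow> complex" where
  "dirichlet_shift \<sigma> a n = a n * of_real (real n powr (- \<sigma>))"

text \<open>Primes and torus coordinates are numbered from 0.\<close>

definition nth_prime :: "nat \<Rightarrow> nat" where
  "nth_prime j = enumerate {p. prime p} j"

definition prime_exponent :: "nat \<Rightarrow> nat \<Rightarrow> nat" where
  "prime_exponent j n = multiplicity (nth_prime j) n"

definition bohr_lift :: "(nat \<Rightarrow> complex) \<Rightarrow> (nat \<Rightarrow> complex) \<Rightarrow> complex" where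
  "bohr_lift a z =
     (\<Sum>n | n \<ge> 1 \<and> a n \<noteq> 0. a n * (\<Prod>j | prime_exponent j n \<noteq> 0. z j ^ prime_exponent j n))"

text \<open>
  Normalised arc length on the unit circle, as a Borel measure on the complex plane. The Haar
  probability measure of the infinite torus is the countable product of its copies; it is
  accordingly a measure on \<open>nat \<Rightarrow> complex\<close>, carried by the sequences of unimodular numbers.
\<close>

definition circle_measure :: "complex measure" where
  "circle_measure = distr (uniform_measure lborel {0..2 * pi}) borel cis"

definition torus_measure :: "(nat \<Rightarrow> complex) measure" where
  "torus_measure = (\<Pi>\<^sub>M j\<in>UNIV. circle_measure)"

definition hardy_norm :: "real \<Rightarrow> (nat \<Rightarrow> complex) \<Rightarrow> real" where
  "hardy_norm p P = (\<integral>z. norm (bohr_lift P z) powr p \<partial>torus_measure) powr (1 / p)"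

definition bergman_weight :: "real \<Rightarrow> real measure" where
  "bergman_weight \<alpha> = density lborel (\<lambda>\<sigma>. ennreal (indicator {0<..} \<sigma> *
     (2 powr (\<alpha> + 1) / Gamma (\<alpha> + 1) * \<sigma> powr \<alpha> * exp (- 2 * \<sigma>))))"

definition bergman_norm :: "real \<Rightarrow> real \<Rightarrow> (nat \<Rightarrow> complex) \<Rightarrow> real" where
  "bergman_norm p \<alpha> P =
     (\<integral>\<sigma>. hardy_norm p (dirichlet_shift \<sigma> P) powr p \<partial>bergman_weight \<alpha>) powr (1 / p)"

text \<open>
  An element of the completion is given by a sequence of Dirichlet polynomials that is Cauchy
  for the (quasi-)norm. Point evaluations on \<open>half_plane (1/2)\<close> are continuous for this
  (quasi-)norm, and the element is identified with the Dirichlet series, convergent on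
  \<open>half_plane (1/2)\<close>, to which the polynomials converge there.
\<close>

definition bergman_Cauchy :: "real \<Rightarrow> real \<Rightarrow> (nat \<Rightarrow> nat \<Rightarrow> complex) \<Rightarrow> bool" where
  "bergman_Cauchy p \<alpha> P \<longleftrightarrow>
     (\<forall>e>0. \<exists>N. \<forall>k\<ge>N. \<forall>l\<ge>N. bergman_norm p \<alpha> (\<lambda>n. P k n - P l n) < e)"

definition bergman_space :: "real \<Rightarrow> real \<Rightarrow> (nat \<Rightarrow> complex) set" where
  "bergman_space p \<alpha> = {a.
     (\<forall>s\<in>half_plane (1/2). summable (dirichlet_term a s)) \<and>
     (\<exists>P. (\<forall>k. P k \<in> dirichlet_polys) \<and> bergman_Cauchy p \<alpha> P \<and>
       (\<forall>s\<in>half_plane (1/2). (\<lambda>k. dirichlet_eval (P k) s) \<longlonglongrightarrow> dirichlet_eval a s))}"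

definition bernoulli_var :: "'w measure \<Rightarrow> ('w \<Rightarrow> complex) \<Rightarrow> bool" where
  "bernoulli_var M Y \<longleftrightarrow>
     measure M {\<omega>\<in>space M. Y \<omega> = 1} = 1 / 2 \<and> measure M {\<omega>\<in>space M. Y \<omega> = - 1} = 1 / 2"

definition steinhaus_var :: "'w measure \<Rightarrow> ('w \<Rightarrow> complex) \<Rightarrow> bool" where
  "steinhaus_var M Y \<longleftrightarrow> distr M borel Y = circle_measure"

text \<open>The real normal distribution \<open>N(0,1)\<close>, viewed as a distribution on the complex plane.\<close>

definition gaussian_var :: "'w measure \<Rightarrow> ('w \<Rightarrow> complex) \<Rightarrow> bool" where
  "gaussian_var M Y \<longleftrightarrow>
     distr M borel Y = distr (density lborel (normal_density 0 1)) borel complex_of_real"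

definition standard_random_sequence :: "'w measure \<Rightarrow> (nat \<Rightarrow> 'w \<Rightarrow> complex) \<Rightarrow> bool" where
  "standard_random_sequence M X \<longleftrightarrow>
     prob_space M \<and> prob_space.indep_vars M (\<lambda>_. borel) X {1..} \<and>
     ((\<forall>n\<ge>1. bernoulli_var M (X n)) \<or> (\<forall>n\<ge>1. steinhaus_var M (X n)) \<or>
      (\<forall>n\<ge>1. gaussian_var M (X n)))"

definition randomization ::
    "(nat \<Rightarrow> 'w \<Rightarrow> complex) \<Rightarrow> 'w \<Rightarrow> (nat \<Rightarrow> complex) \<Rightarrow> nat \<Rightarrow> complex" where
  "randomization X \<omega> a n = a n * X n \<omega>"

end

theory Submission
  imports Defs "HOL-Complex_Analysis.Complex_Analysis" "HOL-Real_Asymp.Real_Asymp"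
    "HOL-Computational_Algebra.Squarefree"
begin

text \<open>
  Write \<open>m(\<sigma>)\<close> for the \<open>H\<^sup>2\<close> norm of \<open>f(\<cdot> + \<sigma>)\<close>. By Khinchine's inequality the random series lies in
  \<open>A\<^sup>q\<^sub>\<beta>\<close> essentially when \<open>m\<close> is in \<open>L\<^sup>q(\<mu>\<^sub>\<beta>)\<close>. If \<open>f\<close> is in \<open>A\<^sup>p\<^sub>\<alpha>\<close> with \<open>p \<ge> 2\<close>, then \<open>m\<close> is in \<open>L\<^sup>p(\<mu>\<^sub>\<alpha>)\<close>, and
  since \<open>m\<close> decreases, \<open>m(\<sigma>) \<le> C \<sigma> powr (-(\<alpha>+1)/p)\<close>; this gives the sufficiency.

  For the converse a hump is a Dirichlet polynomial in the primes beyond a given one with norm at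
  most 1 in \<open>A\<^sup>p\<^sub>\<alpha>\<close> and with \<open>m\<close> large in \<open>L\<^sup>q(\<mu>\<^sub>\<beta>)\<close>. If \<open>p < 2\<close>, products of the factors
  \<open>(1 + z\<^sub>i) / \<surd>2\<close> are humps, because each factor has \<open>H\<^sup>2\<close> norm 1 and smaller \<open>H\<^sup>p\<close> norm; otherwise
  sums of \<open>log(p\<^sub>j) powr ((\<alpha>+1)/p) z\<^sub>j\<close> over a lacunary set of primes are. A series of humps in disjoint sets of primes
  is the counterexample: setting the variables outside one of the sets to zero is contractive on
  \<open>A\<^sup>q\<^sub>\<beta>\<close> for every \<open>q > 0\<close> (subharmonicity), so the random humps would be almost surely bounded,
  against the lower Khinchine inequality on events of probability close to one.
\<close>

section \<open>The circle and the infinite torus\<close>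

text \<open>A prime with logarithm \<open>L\<close> is damped by \<open>exp (- \<sigma> * L)\<close>
  and so lives on the scale \<sigma> ~ 1 / L; the coefficient
  \<open>L powr ((\<alpha> + 1) / p)\<close> gives it the same size in A^p_\<alpha> for every
  \<open>L\<close>. If the two ratios agree, N such primes on separate scales are N equal shares of
  both integrals, and normalising leaves a gain of N powr (1 - q / p): this is where q \<ge> p
  enters. Exponents below 1 shape the rest. There is no triangle inequality, so Cauchy sequences
  need increments that decay faster than the powers of the quasi-norm constant. Coefficients cannot
  be bounded by integrating against a character; variables are set to zero, the rest is dilated, and
  Parseval is applied. Membership speaks only of point values in a half plane, so convergence of
  coefficients has to be recovered from it. The bound for the random humps is a random variable
  without known moments, hence the lower inequality on events. The three laws are used only through
  mean zero, unit variance and a subgaussian exponential moment.\<close>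

lemma cis_borel [measurable]: "cis \<in> borel_measurable borel"
  by (intro borel_measurable_continuous_onI) (auto intro!: continuous_intros)

lemma prob_space_circle: "prob_space circle_measure"
  unfolding circle_measure_def
  by (intro prob_space.prob_space_distr prob_space_uniform_measure)
     (auto simp: measurable_cong_sets[OF sets_uniform_measure refl])

lemma sets_circle [simp, measurable_cong]: "sets circle_measure = sets borel"
  and space_circle [simp]: "space circle_measure = UNIV"
  by (simp_all add: circle_measure_def)

lemma nn_integral_circle:
  assumes [measurable]: "h \<in> borel_measurable borel"
  shows "(\<integral>\<^sup>+x. h x \<partial>circle_measure)
    = (\<integral>\<^sup>+t. h (cis t) * indicator {0..2 * pi} t \<partial>lborel) / ennreal (2 * pi)"
  unfolding circle_measure_def
  by (subst nn_integral_distr, simp_all, subst nn_integral_uniform_measure, simp_all)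

text \<open>The Cauchy formula produces gauge integrals over \<open>{0..2 * pi}\<close>; this is the
  passage from them to the circle measure.\<close>

lemma nn_integral_circle_continuous:
  assumes c: "continuous_on UNIV h" and nn: "\<And>x. h x \<ge> (0::real)"
  shows "(\<integral>\<^sup>+x. ennreal (h x) \<partial>circle_measure)
    = ennreal (integral {0..2 * pi} (\<lambda>t. h (cis t)) / (2 * pi))"
proof -
  have m [measurable]: "h \<in> borel_measurable borel"
    using c by (simp add: borel_measurable_continuous_onI)
  have ct: "continuous_on {0..2 * pi} (\<lambda>t. h (cis t))"
    by (rule continuous_on_compose2[OF c]) (auto intro!: continuous_intros)
  have "((\<lambda>t. h (cis t)) has_integral integral {0..2 * pi} (\<lambda>t. h (cis t))) {0..2 * pi}"
    using ct by (intro integrable_integral integrable_continuous_real)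
  then have "(\<integral>\<^sup>+t. ennreal (h (cis t)) * indicator {0..2 * pi} t \<partial>lborel)
      = ennreal (integral {0..2 * pi} (\<lambda>t. h (cis t)))"
    using nn_integral_has_integral_lebesgue[of "{0..2 * pi}" "\<lambda>t. h (cis t)"] nn
    by (simp add: nn_integral_completion ennreal_mult' mult.commute flip: ennreal_indicator)
  then show ?thesis
    by (subst nn_integral_circle)
       (auto simp: divide_ennreal integral_nonneg nn ct integrable_continuous_real)
qed

lemma AE_circle_norm: "AE x in circle_measure. norm x = 1"
  unfolding circle_measure_def
  by (subst AE_distr_iff) (auto)

lemma integral_norm_powr_nonneg: "0 \<le> integral {a..b} (\<lambda>t. norm (g t :: complex) powr q)"
  by (cases "(\<lambda>t. norm (g t) powr q) integrable_on {a..b}")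
     (auto intro: integral_nonneg simp: not_integrable_integral)

text \<open>On the circle only the frequency \<open>k = m - n\<close> is left, and
  \<open>cis (k * t) / (k * \<i>)\<close> is a primitive with period \<open>2 * pi\<close>. This
  gives both the orthogonality of the monomials and the mean of a Steinhaus variable.\<close>

lemma circle_integral_power:
  fixes m n :: nat
  assumes "m \<noteq> n"
  shows "(\<integral>x. x ^ m * cnj x ^ n \<partial>circle_measure) = 0"
proof -
  define k where "k = real m - real n"
  have k: "k \<noteq> 0" using assms by (simp add: k_def)
  have eq: "cis t ^ m * cnj (cis t) ^ n = cis (k * t)" for t
    by (simp add: k_def cis_cnj Complex.DeMoivre cis_mult algebra_simps)
  have "((\<lambda>t. cis (k * t)) has_integral
      (cis (k * (2 * pi)) / (k * \<i>) - cis (k * 0) / (k * \<i>))) {0..2 * pi}"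
  proof (rule fundamental_theorem_of_calculus)
    show "((\<lambda>t. cis (k * t) / (complex_of_real k * \<i>)) has_vector_derivative cis (k * t)) (at t within {0..2 * pi})" for t
    proof -
      have "((\<lambda>t. cis (k * t) / (complex_of_real k * \<i>)) has_vector_derivative
        (k *\<^sub>R (\<i> * cis (k * t))) / (complex_of_real k * \<i>)) (at t within {0..2 * pi})"
        unfolding has_vector_derivative_def
        by (auto intro!: derivative_eq_intros simp: scaleR_conv_of_real k algebra_simps)
      then show ?thesis using k by (simp add: scaleR_conv_of_real)
    qed
  qed simp
  moreover have "cis (k * (2 * pi)) = 1"
  proof -
    have "cis (2 * pi * of_int (int m - int n)) = 1" by (rule cis_multiple_2pi) auto
    then show ?thesis by (simp add: k_def algebra_simps)
  qed
  ultimately have hi: "((\<lambda>t. cis (k * t)) has_integral 0) {0..2 * pi}" by simp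
  have ai: "(\<lambda>t. cis (k * t)) absolutely_integrable_on {0..2 * pi}"
    by (intro absolutely_integrable_continuous_real continuous_intros)
  have "(\<integral>x. x ^ m * cnj x ^ n \<partial>circle_measure)
      = (\<integral>t. cis (k * t) \<partial>uniform_measure lborel {0..2 * pi})"
  proof -
    have [measurable]: "(\<lambda>x. x ^ m * cnj x ^ n) \<in> borel_measurable borel"
      by (intro borel_measurable_continuous_onI continuous_intros)
    show ?thesis unfolding circle_measure_def by (subst integral_distr) (auto simp: eq)
  qed
  also have "uniform_measure lborel {0..2 * pi}
      = density lborel (\<lambda>t. ennreal (indicator {0..2 * pi} t / (2 * pi)))"
    unfolding uniform_measure_def
    by (intro density_cong) (auto simp: divide_ennreal simp flip: ennreal_indicator)
  also have "(\<integral>t. cis (k * t) \<partial>density lborel (\<lambda>t. ennreal (indicator {0..2 * pi} t / (2 * pi))))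
      = (\<integral>t. (1 / (2 * pi)) *\<^sub>R (indicator {0..2 * pi} t *\<^sub>R cis (k * t)) \<partial>lborel)"
    by (subst integral_density) (auto simp: mult.commute)
  also have "\<dots> = (1 / (2 * pi)) *\<^sub>R (LINT t:{0..2 * pi}|lborel. cis (k * t))"
    unfolding set_lebesgue_integral_def by (rule integral_scaleR_right)
  also have "(LINT t:{0..2 * pi}|lborel. cis (k * t)) = integral {0..2 * pi} (\<lambda>t. cis (k * t))"
    by (intro set_borel_integral_eq_integral borel_integrable_atLeastAtMost') (auto intro!: continuous_intros)
  also have "\<dots> = 0" using hi by (rule integral_unique)
  finally show ?thesis by simp
qed

section \<open>Haar measure of the infinite torus\<close>

lemma prob_space_torus: "prob_space torus_measure"
  unfolding torus_measure_def by (intro prob_space_PiM prob_space_circle)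

lemma space_torus [simp]: "space torus_measure = UNIV"
  by (simp add: torus_measure_def space_PiM)

lemma torus_component [measurable]: "(\<lambda>z. z j) \<in> borel_measurable torus_measure"
proof -
  have "(\<lambda>z. z j) \<in> torus_measure \<rightarrow>\<^sub>M circle_measure"
    unfolding torus_measure_def by (rule measurable_component_singleton) simp
  then show ?thesis by (simp add: measurable_cong_sets[OF refl sets_circle])
qed

lemma AE_torus_norm: "AE z in torus_measure. \<forall>j. norm (z j) = 1"
  unfolding torus_measure_def AE_all_countable
proof
  fix j :: nat
  show "AE z in \<Pi>\<^sub>M j\<in>UNIV. circle_measure. norm (z j) = 1"
    by (rule AE_PiM_component) (auto intro: prob_space_circle AE_circle_norm)
qed

text \<open>Replacing one coordinate by an independent copy does not change the Haar measure. Every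
  argument that treats one variable of the torus at a time rests on this.\<close>

lemma distr_torus_update:
  "distr (circle_measure \<Otimes>\<^sub>M torus_measure) torus_measure (\<lambda>(x, z). z(j := x)) = torus_measure"
  using distr_pair_PiM_eq_PiM[of UNIV "\<lambda>_. circle_measure" j]
  by (simp add: torus_measure_def prob_space_circle insert_absorb)

lemma torus_update_measurable [measurable]:
  "(\<lambda>(x, z). z(j := x)) \<in> circle_measure \<Otimes>\<^sub>M torus_measure \<rightarrow>\<^sub>M torus_measure"
proof -
  have "(\<lambda>p. (case p of (x, z) \<Rightarrow> z(j := x)) i) \<in> circle_measure \<Otimes>\<^sub>M torus_measure \<rightarrow>\<^sub>M circle_measure" for i
  proof (cases "i = j")
    case True
    then show ?thesis by (simp add: case_prod_unfold)
  next
    case False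
    have "(\<lambda>z. z i) \<in> torus_measure \<rightarrow>\<^sub>M circle_measure"
      unfolding torus_measure_def by (rule measurable_component_singleton) simp
    then have "(\<lambda>p. (snd p) i) \<in> circle_measure \<Otimes>\<^sub>M torus_measure \<rightarrow>\<^sub>M circle_measure"
      by (rule measurable_compose[OF measurable_snd])
    then show ?thesis using False by (simp add: case_prod_unfold)
  qed
  then have "(\<lambda>(x, z). z(j := x)) \<in> circle_measure \<Otimes>\<^sub>M torus_measure \<rightarrow>\<^sub>M (\<Pi>\<^sub>M i\<in>UNIV. circle_measure)"
    by (intro measurable_PiM_single') auto
  then show ?thesis by (simp add: torus_measure_def)
qed

lemma nn_integral_torus_update:
  assumes [measurable]: "h \<in> borel_measurable torus_measure"
  shows "(\<integral>\<^sup>+z. h z \<partial>torus_measure) = (\<integral>\<^sup>+z. \<integral>\<^sup>+x. h (z(j := x)) \<partial>circle_measure \<partial>torus_measure)"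
proof -
  interpret c: prob_space circle_measure by (rule prob_space_circle)
  interpret t: prob_space torus_measure by (rule prob_space_torus)
  interpret pair_sigma_finite circle_measure torus_measure ..
  have [measurable]: "(\<lambda>p. h (case p of (x, z) \<Rightarrow> z(j := x))) \<in> borel_measurable (circle_measure \<Otimes>\<^sub>M torus_measure)"
    by measurable
  have "(\<integral>\<^sup>+z. h z \<partial>torus_measure)
      = (\<integral>\<^sup>+z. h z \<partial>distr (circle_measure \<Otimes>\<^sub>M torus_measure) torus_measure (\<lambda>(x, z). z(j := x)))"
    by (simp add: distr_torus_update)
  also have "\<dots> = (\<integral>\<^sup>+p. h (case p of (x, z) \<Rightarrow> z(j := x)) \<partial>(circle_measure \<Otimes>\<^sub>M torus_measure))"
    by (subst nn_integral_distr) auto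
  also have "\<dots> = (\<integral>\<^sup>+z. \<integral>\<^sup>+x. h (z(j := x)) \<partial>circle_measure \<partial>torus_measure)"
    by (subst nn_integral_snd[symmetric]) auto
  finally show ?thesis .
qed

lemma integral_torus_update:
  fixes h :: "(nat \<Rightarrow> complex) \<Rightarrow> complex"
  assumes h: "integrable torus_measure h"
  shows "(\<integral>z. h z \<partial>torus_measure) = (\<integral>z. \<integral>x. h (z(j := x)) \<partial>circle_measure \<partial>torus_measure)"
proof -
  interpret c: prob_space circle_measure by (rule prob_space_circle)
  interpret t: prob_space torus_measure by (rule prob_space_torus)
  interpret pair_sigma_finite circle_measure torus_measure ..
  have [measurable]: "h \<in> borel_measurable torus_measure" using h by auto
  have "integrable (distr (circle_measure \<Otimes>\<^sub>M torus_measure) torus_measure (\<lambda>(x, z). z(j := x))) h"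
    using h by (simp add: distr_torus_update)
  then have i: "integrable (circle_measure \<Otimes>\<^sub>M torus_measure) (\<lambda>p. h (case p of (x, z) \<Rightarrow> z(j := x)))"
    by (subst (asm) integrable_distr_eq) auto
  have "(\<integral>z. h z \<partial>torus_measure)
      = (\<integral>z. h z \<partial>distr (circle_measure \<Otimes>\<^sub>M torus_measure) torus_measure (\<lambda>(x, z). z(j := x)))"
    by (simp add: distr_torus_update)
  also have "\<dots> = (\<integral>p. h (case p of (x, z) \<Rightarrow> z(j := x)) \<partial>(circle_measure \<Otimes>\<^sub>M torus_measure))"
    by (subst integral_distr) auto
  also have "\<dots> = (\<integral>z. \<integral>x. h (z(j := x)) \<partial>circle_measure \<partial>torus_measure)"
    using integral_snd[of "\<lambda>x z. h (z(j := x))"] i by (simp add: case_prod_unfold)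
  finally show ?thesis .
qed



lemma distr_torus_component: "distr torus_measure borel (\<lambda>z. z j) = circle_measure"
proof -
  have "distr torus_measure borel (\<lambda>z. z j) = distr torus_measure circle_measure (\<lambda>z. z j)"
    by (rule distr_cong) auto
  then show ?thesis
    using distr_PiM_component[of UNIV "\<lambda>_. circle_measure" j]
    by (simp add: torus_measure_def prob_space_circle)
qed

text \<open>The coordinates are themselves a Steinhaus sequence. Products of functions of separate
  coordinates therefore integrate factor by factor, and Khinchine's inequality applies on the torus
  as well as on the probability space.\<close>

lemma torus_indep: "prob_space.indep_vars torus_measure (\<lambda>_. borel) (\<lambda>j z. z j) UNIV"
proof -
  interpret t: prob_space torus_measure by (rule prob_space_torus)
  have "distr torus_measure (\<Pi>\<^sub>M i\<in>UNIV. borel) (\<lambda>z. \<lambda>i\<in>UNIV. z i) = distr torus_measure torus_measure (\<lambda>z. z)"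
    by (rule distr_cong) (auto simp: torus_measure_def intro!: sets_PiM_cong)
  also have "\<dots> = (\<Pi>\<^sub>M i\<in>UNIV. distr torus_measure borel (\<lambda>z. z i))"
    unfolding distr_torus_component by (simp add: distr_id2 torus_measure_def)
  finally show ?thesis
    by (subst t.indep_vars_iff_distr_eq_PiM) auto
qed

section \<open>Point evaluation of polynomials in one variable\<close>

text \<open>The identity behind the Blaschke factor \<open>(z - a) / (1 - cnj a * z)\<close>: for
  \<open>norm a < 1\<close> it has modulus at most 1 on the closed disc and exactly 1 on the
  circle.\<close>

lemma norm_blaschke_diff:
  fixes a z :: complex
  shows "(norm (1 - cnj a * z))\<^sup>2 - (norm (z - a))\<^sup>2 = (1 - (norm a)\<^sup>2) * (1 - (norm z)\<^sup>2)"
proof -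
  have "complex_of_real ((norm (1 - cnj a * z))\<^sup>2 - (norm (z - a))\<^sup>2) = complex_of_real ((1 - (norm a)\<^sup>2) * (1 - (norm z)\<^sup>2))"
    by (simp only: of_real_diff of_real_mult of_real_1 complex_norm_square) (simp add: algebra_simps)
  then show ?thesis by (simp only: of_real_eq_iff)
qed

lemma norm_blaschke_le:
  fixes a z :: complex
  assumes "norm a < 1" and "norm z \<le> 1"
  shows "norm (z - a) \<le> norm (1 - cnj a * z)"
proof -
  have "0 \<le> (1 - (norm a)\<^sup>2) * (1 - (norm z)\<^sup>2)"
    using assms by (intro mult_nonneg_nonneg) (auto simp: power_le_one)
  then have "(norm (z - a))\<^sup>2 \<le> (norm (1 - cnj a * z))\<^sup>2"
    using norm_blaschke_diff[of a z] by linarith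
  then show ?thesis by (rule power2_le_imp_le) simp
qed

lemma norm_blaschke_eq:
  fixes a z :: complex
  assumes "norm z = 1"
  shows "norm (1 - cnj a * z) = norm (z - a)"
  using norm_blaschke_diff[of a z] assms by simp

text \<open>The inner-outer factorisation for polynomials. Each zero \<open>a\<close> in the open
  disc is reflected, that is, \<open>z - a\<close> is exchanged for \<open>1 - cnj a * z\<close>:
  the modulus stays the same on the circle, does not decrease inside, and the zero leaves the
  disc.\<close>

lemma poly_zero_free_majorant:
  fixes p :: "complex poly"
  assumes "p \<noteq> 0"
  shows "\<exists>g. (\<forall>z. norm z < 1 \<longrightarrow> poly g z \<noteq> 0) \<and> (\<forall>z. norm z = 1 \<longrightarrow> norm (poly g z) = norm (poly p z))
    \<and> (\<forall>z. norm z \<le> 1 \<longrightarrow> norm (poly p z) \<le> norm (poly g z))"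
  using assms
proof (induction "degree p" arbitrary: p rule: less_induct)
  case less
  show ?case
  proof (cases "\<exists>a. norm a < 1 \<and> poly p a = 0")
    case False
    then show ?thesis by (intro exI[of _ p]) auto
  next
    case True
    then obtain a where a: "norm a < 1" "poly p a = 0" by auto
    then obtain r where r: "p = [:- a, 1:] * r" unfolding poly_eq_0_iff_dvd by (elim dvdE)
    with less.prems have "r \<noteq> 0" by auto
    with r have "degree r < degree p" using degree_mult_eq[of "[:- a, 1:]" r] by simp
    from less.hyps[OF this \<open>r \<noteq> 0\<close>] obtain g where
      G: "(\<forall>z. norm z < 1 \<longrightarrow> poly g z \<noteq> 0) \<and> (\<forall>z. norm z = 1 \<longrightarrow> norm (poly g z) = norm (poly r z))
    \<and> (\<forall>z. norm z \<le> 1 \<longrightarrow> norm (poly r z) \<le> norm (poly g z))" ..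
    have g: "norm z < 1 \<Longrightarrow> poly g z \<noteq> 0" "norm z = 1 \<Longrightarrow> norm (poly g z) = norm (poly r z)"
         "norm z \<le> 1 \<Longrightarrow> norm (poly r z) \<le> norm (poly g z)" for z using G by simp_all
    have pz: "poly p z = (z - a) * poly r z" for z by (simp add: r algebra_simps)
    have gz: "poly ([:1, - cnj a:] * g) z = (1 - cnj a * z) * poly g z" for z
      by (simp add: algebra_simps)
    have nz: "1 - cnj a * z \<noteq> 0" if "norm z < 1" for z
    proof
      assume "1 - cnj a * z = 0"
      then have "norm (cnj a * z) = 1" by simp
      moreover have "norm (cnj a * z) < 1"
        using that a(1) mult_left_le[of "norm z" "norm a"] by (simp add: norm_mult)
      ultimately show False by simp
    qed
    show ?thesis
      unfolding pz
    proof (rule exI[of _ "[:1, - cnj a:] * g"], unfold gz norm_mult, intro conjI allI impI)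
      fix z :: complex
      show "(1 - cnj a * z) * poly g z \<noteq> 0" if "norm z < 1" using nz[OF that] g(1)[OF that] by simp
      show "norm (1 - cnj a * z) * norm (poly g z) = norm (z - a) * norm (poly r z)" if "norm z = 1"
        using g(2)[OF that] norm_blaschke_eq[OF that] by simp
      show "norm (z - a) * norm (poly r z) \<le> norm (1 - cnj a * z) * norm (poly g z)" if "norm z \<le> 1"
        using g(3)[OF that] norm_blaschke_le[OF a(1) that] by (intro mult_mono) auto
    qed
  qed
qed

lemma continuous_norm_poly_powr:
  assumes "q > 0"
  shows "continuous_on UNIV (\<lambda>x. norm (poly (p :: complex poly) x) powr q)"
  using assms by (intro continuous_on_powr' continuous_intros) auto

text \<open>Without zeros in the disc there is a holomorphic logarithm, so \<open>g\<close> has a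
  holomorphic power of any real exponent \<open>q > 0\<close>, and the Cauchy formula applies to
  that power even when \<open>q < 1\<close>. On the circle of radius \<open>r\<close> the kernel is
  at most \<open>r / (r - norm w)\<close>.\<close>

lemma zero_free_point_bound:
  fixes g :: "complex poly"
  assumes q: "q > 0" and nz: "\<And>z. norm z < 1 \<Longrightarrow> poly g z \<noteq> 0" and w: "norm w < 1"
  shows "norm (poly g w) powr q
    \<le> 1 / (1 - norm w) * (integral {0..2 * pi} (\<lambda>t. norm (poly g (cis t)) powr q) / (2 * pi))"
proof -
  obtain L where L: "L holomorphic_on ball 0 1" "\<And>x. x \<in> ball 0 1 \<Longrightarrow> exp (L x) = poly g x"
    by (rule holomorphic_logarithm_exists[of "ball 0 1" "poly g" 0])
       (auto intro!: holomorphic_intros simp: nz)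
  define h where "h = (\<lambda>x. exp (of_real q * L x))"
  have holh: "h holomorphic_on ball 0 1" unfolding h_def by (intro holomorphic_intros L)
  have nh: "norm (h x) = norm (poly g x) powr q" if "x \<in> ball 0 1" for x
  proof -
    have "norm (h x) = exp (q * Re (L x))" by (simp add: h_def)
    also have "\<dots> = exp (Re (L x)) powr q" by (simp add: powr_def)
    also have "exp (Re (L x)) = norm (poly g x)" using L(2)[OF that] by (metis norm_exp_eq_Re)
    finally show ?thesis .
  qed
  define I where "I = (\<lambda>r::real. integral (cbox 0 (2 * pi)) (\<lambda>t. norm (poly g (r * cis t)) powr q))"
  have bound: "norm (poly g w) powr q \<le> r / (r - norm w) * (I r / (2 * pi))"
    if r: "norm w < r" "r < 1" for r
  proof -
    have sub: "cball 0 r \<subseteq> ball (0::complex) 1" using r by auto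
    have r0: "r > 0" using r norm_ge_zero[of w] by linarith
    have "((\<lambda>u. h u / (u - w)) has_contour_integral (2 * of_real pi * \<i> * h w)) (part_circlepath 0 r 0 (2 * pi))"
      using Cauchy_integral_circlepath_simple[OF holomorphic_on_subset[OF holh sub], of w] r
      by (simp add: circlepath_def)
    then have hi: "((\<lambda>t. h (r * cis t) / (r * cis t - w) * r * \<i> * cis t) has_integral (2 * of_real pi * \<i> * h w)) (cbox 0 (2 * pi))"
      by (subst (asm) has_contour_integral_part_circlepath_iff) auto
    have ci: "(\<lambda>t. r / (r - norm w) * (norm (poly g (r * cis t)) powr q)) integrable_on (cbox 0 (2 * pi))"
      using q by (intro integrable_continuous continuous_on_mult continuous_on_powr' continuous_intros) auto
    have "norm (2 * of_real pi * \<i> * h w)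
       \<le> integral (cbox 0 (2 * pi)) (\<lambda>t. r / (r - norm w) * (norm (poly g (r * cis t)) powr q))"
      unfolding integral_unique[OF hi, symmetric]
    proof (rule integral_norm_bound_integral[OF has_integral_integrable[OF hi] ci])
      fix t
      have mem: "r * cis t \<in> ball 0 1" using r r0 by (simp add: norm_mult)
      have "norm (r * cis t - w) \<ge> r - norm w"
        using norm_triangle_ineq2[of "r * cis t" w] r0 by (simp add: norm_mult)
      then have "norm (h (r * cis t)) * r / norm (r * cis t - w) \<le> norm (h (r * cis t)) * r / (r - norm w)"
        using r r0 by (intro divide_left_mono mult_pos_pos mult_nonneg_nonneg) auto
      moreover have "norm (h (r * cis t) / (r * cis t - w) * r * \<i> * cis t)
          = norm (h (r * cis t)) * r / norm (r * cis t - w)"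
        using r0 by (simp add: norm_mult norm_divide)
      ultimately show "norm (h (r * cis t) / (r * cis t - w) * r * \<i> * cis t)
          \<le> r / (r - norm w) * (norm (poly g (r * cis t)) powr q)"
        unfolding nh[OF mem] by (simp add: mult.commute)
    qed
    also have "\<dots> = r / (r - norm w) * I r" unfolding I_def by simp
    finally have "2 * pi * norm (poly g w) powr q \<le> r / (r - norm w) * I r"
      using w by (simp add: norm_mult nh)
    then have "2 * pi * norm (poly g w) powr q / (2 * pi) \<le> r / (r - norm w) * I r / (2 * pi)"
      by (intro divide_right_mono) auto
    then show ?thesis by simp
  qed
  \<comment> \<open>\<open>g\<close> may vanish on the unit circle, so the logarithm exists only
    inside and the bound is known only for \<open>r < 1\<close>. The mean \<open>I\<close>, however,
    is continuous up to \<open>r = 1\<close>.\<close>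
  have "continuous_on {0..1} I"
    unfolding I_def
  proof (rule integral_continuous_on_param)
    show "continuous_on ({0..1} \<times> cbox 0 (2 * pi)) (\<lambda>(x, t). norm (poly g (complex_of_real x * cis t)) powr q)"
      unfolding case_prod_unfold using q by (intro continuous_on_powr' continuous_intros) auto
  qed
  then have "(I \<longlongrightarrow> I 1) (at 1 within {0..1})" by (simp add: continuous_on)
  then have "(I \<longlongrightarrow> I 1) (at_left 1)"
    using at_within_Icc_at_left[of 0 "1::real"] by simp
  moreover have "((\<lambda>r. r / (r - norm w)) \<longlongrightarrow> 1 / (1 - norm w)) (at_left (1::real))"
    using w by (intro tendsto_intros) auto
  ultimately have T: "((\<lambda>r. r / (r - norm w) * (I r / (2 * pi))) \<longlongrightarrow> 1 / (1 - norm w) * (I 1 / (2 * pi))) (at_left 1)"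
    using w by (intro tendsto_intros) auto
  have "eventually (\<lambda>r. norm (poly g w) powr q \<le> r / (r - norm w) * (I r / (2 * pi))) (at_left 1)"
    using eventually_at_left[OF w] bound w by blast
  with T have "norm (poly g w) powr q \<le> 1 / (1 - norm w) * (I 1 / (2 * pi))"
    by (rule tendsto_lowerbound) (auto simp: trivial_limit_at_left_real)
  then show ?thesis by (simp add: I_def)
qed

text \<open>Zeros are harmless because the zero-free majorant has the same circle mean. The constant
  is exactly 1 at \<open>\<rho> = 0\<close>; this is the sub-mean value property that makes setting
  a variable to zero contractive.\<close>

lemma poly_point_bound:
  fixes p :: "complex poly"
  assumes q: "q > 0" and w: "norm w \<le> \<rho>" and \<rho>: "\<rho> < 1"
  shows "ennreal (norm (poly p w) powr q)
    \<le> ennreal (1 / (1 - \<rho>)) * (\<integral>\<^sup>+x. ennreal (norm (poly p x) powr q) \<partial>circle_measure)"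
proof (cases "p = 0")
  case False
  from poly_zero_free_majorant[OF this] obtain g where
    G: "(\<forall>z. norm z < 1 \<longrightarrow> poly g z \<noteq> 0) \<and> (\<forall>z. norm z = 1 \<longrightarrow> norm (poly g z) = norm (poly p z))
    \<and> (\<forall>z. norm z \<le> 1 \<longrightarrow> norm (poly p z) \<le> norm (poly g z))" ..
  have g: "norm z < 1 \<Longrightarrow> poly g z \<noteq> 0" "norm z = 1 \<Longrightarrow> norm (poly g z) = norm (poly p z)"
       "norm z \<le> 1 \<Longrightarrow> norm (poly p z) \<le> norm (poly g z)" for z using G by simp_all
  let ?J = "integral {0..2 * pi} (\<lambda>t. norm (poly g (cis t)) powr q) / (2 * pi)"
  have J: "?J \<ge> 0" using integral_norm_powr_nonneg[of 0 "2 * pi" "\<lambda>t. poly g (cis t)" q] by simp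
  have "norm (poly p w) powr q \<le> norm (poly g w) powr q"
    using g(3)[of w] w \<rho> q by (intro powr_mono2) auto
  also have "\<dots> \<le> 1 / (1 - norm w) * ?J"
    using w \<rho> by (intro zero_free_point_bound q g(1)) auto
  also have "\<dots> \<le> 1 / (1 - \<rho>) * ?J"
    using w \<rho> J by (intro mult_right_mono) (auto simp: field_simps)
  finally have "ennreal (norm (poly p w) powr q) \<le> ennreal (1 / (1 - \<rho>)) * ennreal ?J"
    using w \<rho> J by (simp add: ennreal_mult'[symmetric] ennreal_leI)
  also have "ennreal ?J = (\<integral>\<^sup>+x. ennreal (norm (poly p x) powr q) \<partial>circle_measure)"
    by (subst nn_integral_circle_continuous)
       (auto simp: g(2) continuous_norm_poly_powr[OF q])
  finally show ?thesis .
qed auto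

section \<open>The Bohr lift\<close>

lemma nth_prime_prime: "prime (nth_prime j)"
  using enumerate_in_set[of "{p::nat. prime p}" j] by (simp add: nth_prime_def primes_infinite)

lemma nth_prime_strict_mono: "strict_mono nth_prime"
  unfolding nth_prime_def by (rule strict_mono_enumerate) (rule primes_infinite)

lemma nth_prime_surj: "prime p \<Longrightarrow> \<exists>j. p = nth_prime j"
  using enumerate_Ex[OF primes_infinite] unfolding nth_prime_def by (metis mem_Collect_eq)

lemma nth_prime_gt: "nth_prime j > 1"
  using nth_prime_prime[of j] by (rule prime_gt_1_nat)

lemma nth_prime_ge: "nth_prime j \<ge> j + 2"
proof (induction j)
  case 0
  then show ?case using nth_prime_gt[of 0] by simp
next
  case (Suc j)
  then show ?case using strict_monoD[OF nth_prime_strict_mono, of j "Suc j"] by simp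
qed

lemma inj_nth_prime: "inj nth_prime"
  by (rule strict_mono_imp_inj_on[OF nth_prime_strict_mono])

lemma finite_prime_exponent:
  assumes "n \<ge> 1"
  shows "finite {j. prime_exponent j n \<noteq> 0}"
proof (rule finite_subset)
  show "{j. prime_exponent j n \<noteq> 0} \<subseteq> nth_prime -` prime_factors n"
    using assms nth_prime_prime
    by (auto simp: prime_exponent_def prime_factors_multiplicity)
  show "finite (nth_prime -` prime_factors n)"
    by (intro finite_vimageI inj_nth_prime) auto
qed

lemma prime_exponent_1 [simp]: "prime_exponent j 1 = 0" "prime_exponent j (Suc 0) = 0"
  by (simp_all add: prime_exponent_def)

lemma prime_exponent_mult:
  assumes "m \<ge> 1" "n \<ge> 1"
  shows "prime_exponent j (m * n) = prime_exponent j m + prime_exponent j n"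
  unfolding prime_exponent_def
  using assms nth_prime_prime[of j] by (intro prime_elem_multiplicity_mult_distrib) auto

lemma prime_exponent_nth_prime [simp]:
  "prime_exponent j (nth_prime i) = (if i = j then 1 else 0)"
proof (cases "i = j")
  case False
  then have "nth_prime i \<noteq> nth_prime j" using inj_nth_prime by (auto dest: injD)
  then have "\<not> nth_prime j dvd nth_prime i" using nth_prime_prime primes_dvd_imp_eq by metis
  then show ?thesis using False by (simp add: prime_exponent_def not_dvd_imp_multiplicity_0)
qed (use nth_prime_prime[of i] in \<open>simp add: prime_exponent_def\<close>)

definition bohr_monomial :: "(nat \<Rightarrow> complex) \<Rightarrow> nat \<Rightarrow> complex" where
  "bohr_monomial z n = (\<Prod>j | prime_exponent j n \<noteq> 0. z j ^ prime_exponent j n)"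

lemma bohr_monomial_superset:
  assumes "finite J" "{j. prime_exponent j n \<noteq> 0} \<subseteq> J"
  shows "bohr_monomial z n = (\<Prod>j\<in>J. z j ^ prime_exponent j n)"
  unfolding bohr_monomial_def using assms by (intro prod.mono_neutral_left) auto

lemma bohr_monomial_1 [simp]: "bohr_monomial z 1 = 1" "bohr_monomial z (Suc 0) = 1"
  by (simp_all add: bohr_monomial_def)

lemma bohr_monomial_mult_left:
  "bohr_monomial (\<lambda>j. u j * v j) n = bohr_monomial u n * bohr_monomial v n"
  by (simp add: bohr_monomial_def power_mult_distrib prod.distrib)

lemma bohr_monomial_mult:
  assumes "m \<ge> 1" "n \<ge> 1"
  shows "bohr_monomial z (m * n) = bohr_monomial z m * bohr_monomial z n"
proof -
  let ?J = "{j. prime_exponent j m \<noteq> 0} \<union> {j. prime_exponent j n \<noteq> 0}"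
  have "finite ?J" using assms finite_prime_exponent by auto
  then show ?thesis
    using assms
    by (subst (1 2 3) bohr_monomial_superset[of ?J]) (auto simp: prime_exponent_mult power_add prod.distrib)
qed

lemma bohr_monomial_nth_prime [simp]: "bohr_monomial z (nth_prime i) = z i"
  by (subst bohr_monomial_superset[of "{i}"]) (auto split: if_splits)

lemma bohr_monomial_cong:
  assumes "\<And>j. prime_exponent j n \<noteq> 0 \<Longrightarrow> u j = v j"
  shows "bohr_monomial u n = bohr_monomial v n"
  unfolding bohr_monomial_def using assms by (intro prod.cong) auto

lemma norm_bohr_monomial_le: "(\<And>j. norm (z j) \<le> 1) \<Longrightarrow> norm (bohr_monomial z n) \<le> 1"
  unfolding bohr_monomial_def
  by (auto simp: prod_norm[symmetric] norm_power intro!: prod_le_1 power_le_one)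

lemma norm_bohr_monomial_eq: "(\<And>j. norm (z j) = 1) \<Longrightarrow> norm (bohr_monomial z n) = 1"
  unfolding bohr_monomial_def by (simp add: prod_norm[symmetric] norm_power)

text \<open>\<open>n powr (- \<sigma>)\<close> is completely multiplicative in \<open>n\<close>,
  hence a monomial evaluated at the point with coordinates
  \<open>nth_prime j powr (- \<sigma>)\<close>. A horizontal shift of the series thus becomes a
  dilation of the torus variables.\<close>

lemma bohr_monomial_nth_prime_powr:
  assumes "n \<ge> 1"
  shows "bohr_monomial (\<lambda>j. of_real (real (nth_prime j) powr (- \<sigma>))) n = of_real (real n powr (- \<sigma>))"
  using assms
proof (induction n rule: prime_divisors_induct)
  case (unit n)
  then show ?case by auto
next
  case (factor p n)
  then obtain i where i: "p = nth_prime i" using nth_prime_surj by blast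
  have "p \<ge> 1" "n \<ge> 1" using factor by auto
  then show ?case
    using factor unfolding i
    by (simp add: bohr_monomial_mult powr_mult)
qed auto

lemma prime_exponent_cong_imp_eq:
  assumes "m \<ge> 1" "n \<ge> 1" and "\<And>j. prime_exponent j m = prime_exponent j n"
  shows "m = n"
proof (rule multiplicity_eq_nat)
  fix p :: nat assume "prime p"
  then show "multiplicity p m = multiplicity p n"
    using nth_prime_surj[of p] assms(3) by (auto simp: prime_exponent_def)
qed (use assms in auto)

lemma dirichlet_polysI: "finite {n. a n \<noteq> 0} \<Longrightarrow> a \<in> dirichlet_polys"
  by (simp add: dirichlet_polys_def)

lemma finite_support: "a \<in> dirichlet_polys \<Longrightarrow> finite {n. a n \<noteq> 0}"
  by (simp add: dirichlet_polys_def)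

lemma dirichlet_polys_subset:
  "a \<in> dirichlet_polys \<Longrightarrow> (\<And>n. b n \<noteq> 0 \<Longrightarrow> a n \<noteq> 0) \<Longrightarrow> b \<in> dirichlet_polys"
  unfolding dirichlet_polys_def by (auto elim!: rev_finite_subset)

lemma dirichlet_polys_diff:
  assumes "a \<in> dirichlet_polys" "b \<in> dirichlet_polys"
  shows "(\<lambda>n. a n - b n) \<in> dirichlet_polys"
  using assms unfolding dirichlet_polys_def mem_Collect_eq
  by (intro finite_subset[of "{n. a n - b n \<noteq> 0}" "{n. a n \<noteq> 0} \<union> {n. b n \<noteq> 0}"]) auto

text \<open>Lets several polynomials share one index set. The set has to omit 0 because the lift
  ignores \<open>a 0\<close>, which may be nonzero.\<close>

lemma bohr_lift_superset:
  assumes "finite T" "\<And>n. n \<ge> 1 \<Longrightarrow> a n \<noteq> 0 \<Longrightarrow> n \<in> T" "0 \<notin> T"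
  shows "bohr_lift a z = (\<Sum>n\<in>T. a n * bohr_monomial z n)"
  unfolding bohr_lift_def bohr_monomial_def using assms
  by (intro sum.mono_neutral_left) (auto simp: not_less_eq_eq intro: Suc_leI gr0I)

lemma bohr_lift_diff:
  assumes "a \<in> dirichlet_polys" "b \<in> dirichlet_polys"
  shows "bohr_lift (\<lambda>n. a n - b n) z = bohr_lift a z - bohr_lift b z"
proof -
  let ?T = "({n. a n \<noteq> 0} \<union> {n. b n \<noteq> 0}) - {0}"
  have "finite ?T" using assms finite_support by auto
  then show ?thesis
    by (subst (1 2 3) bohr_lift_superset[of ?T]) (auto simp: sum_subtractf algebra_simps)
qed

lemma bohr_lift_dilate:
  assumes "a \<in> dirichlet_polys"
  shows "bohr_lift (\<lambda>n. a n * bohr_monomial \<rho> n) z = bohr_lift a (\<lambda>j. \<rho> j * z j)"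
proof -
  let ?T = "{n. a n \<noteq> 0} - {0}"
  have "finite ?T" using assms finite_support by auto
  then show ?thesis
    by (subst (1 2) bohr_lift_superset[of ?T]) (auto simp: bohr_monomial_mult_left algebra_simps)
qed

lemma dirichlet_shift_polys:
  "a \<in> dirichlet_polys \<Longrightarrow> dirichlet_shift \<sigma> a \<in> dirichlet_polys"
  by (erule dirichlet_polys_subset) (auto simp: dirichlet_shift_def)

lemma bohr_lift_shift:
  assumes "a \<in> dirichlet_polys"
  shows "bohr_lift (dirichlet_shift \<sigma> a) z
    = bohr_lift a (\<lambda>j. of_real (real (nth_prime j) powr (- \<sigma>)) * z j)"
proof -
  let ?T = "{n. a n \<noteq> 0} - {0}"
  have "finite ?T" using assms finite_support by auto
  then have "bohr_lift (dirichlet_shift \<sigma> a) z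
     = bohr_lift (\<lambda>n. a n * bohr_monomial (\<lambda>j. of_real (real (nth_prime j) powr (- \<sigma>))) n) z"
    by (subst (1 2) bohr_lift_superset[of ?T])
       (auto simp: dirichlet_shift_def bohr_monomial_nth_prime_powr intro!: sum.cong)
  then show ?thesis using assms by (simp add: bohr_lift_dilate)
qed

lemma norm_bohr_lift_le:
  assumes "finite T" "\<And>n. n \<ge> 1 \<Longrightarrow> a n \<noteq> 0 \<Longrightarrow> n \<in> T" "0 \<notin> T" and "\<And>j. norm (z j) \<le> 1"
  shows "norm (bohr_lift a z) \<le> (\<Sum>n\<in>T. norm (a n))"
proof -
  have "bohr_lift a z = (\<Sum>n\<in>T. a n * bohr_monomial z n)"
    by (rule bohr_lift_superset) (use assms in auto)
  also have "norm \<dots> \<le> (\<Sum>n\<in>T. norm (a n))"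
    by (intro sum_norm_le) (auto simp: norm_mult intro!: mult_left_le norm_bohr_monomial_le assms)
  finally show ?thesis .
qed

lemma bohr_monomial_measurable [measurable (raw)]:
  assumes "\<And>j. (\<lambda>x. g x j) \<in> borel_measurable M"
  shows "(\<lambda>x. bohr_monomial (g x) n) \<in> borel_measurable M"
  unfolding bohr_monomial_def using assms by measurable

lemma bohr_lift_measurable [measurable (raw)]:
  assumes "\<And>j. (\<lambda>x. g x j) \<in> borel_measurable M"
  shows "(\<lambda>x. bohr_lift a (g x)) \<in> borel_measurable M"
  unfolding bohr_lift_def using assms by measurable

lemma bohr_monomial_section:
  assumes "n \<ge> 1"
  shows "bohr_monomial (z(j := y)) n = bohr_monomial (z(j := 1)) n * y ^ prime_exponent j n"
proof -
  let ?J = "insert j {i. prime_exponent i n \<noteq> 0}"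
  have J: "finite ?J" using finite_prime_exponent[OF assms] by auto
  have "(\<Prod>i\<in>?J. (z(j := c)) i ^ prime_exponent i n)
      = c ^ prime_exponent j n * (\<Prod>i\<in>?J - {j}. z i ^ prime_exponent i n)" for c
    using J by (subst prod.remove[of _ j]) (auto intro!: prod.cong)
  then show ?thesis using J by (subst (1 2) bohr_monomial_superset[of ?J]) auto
qed

lemma bohr_lift_section:
  assumes "a \<in> dirichlet_polys"
  shows "\<exists>p. \<forall>y. bohr_lift a (z(j := y)) = poly p y"
proof -
  let ?T = "{n. a n \<noteq> 0} - {0}"
  have fin: "finite ?T" using assms finite_support by auto
  let ?p = "\<Sum>n\<in>?T. Polynomial.monom (a n * bohr_monomial (z(j := 1)) n) (prime_exponent j n)"
  have "bohr_lift a (z(j := y)) = poly ?p y" for y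
  proof -
    have "bohr_lift a (z(j := y)) = (\<Sum>n\<in>?T. a n * bohr_monomial (z(j := y)) n)"
      using fin by (intro bohr_lift_superset) auto
    also have "\<dots> = (\<Sum>n\<in>?T. a n * bohr_monomial (z(j := 1)) n * y ^ prime_exponent j n)"
    proof (rule sum.cong)
      fix n assume "n \<in> ?T"
      then have "n \<ge> 1" by auto
      then show "a n * bohr_monomial (z(j := y)) n = a n * bohr_monomial (z(j := 1)) n * y ^ prime_exponent j n"
        by (subst bohr_monomial_section) (simp_all add: mult.assoc)
    qed simp
    also have "\<dots> = poly ?p y" by (simp add: poly_sum poly_monom)
    finally show ?thesis .
  qed
  then show ?thesis by blast
qed

text \<open>Induction over the coordinates: each one is averaged over the circle by the one-variable
  bound and then absorbed into the torus integral. \<open>override_on\<close> records which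
  coordinates have been averaged already, with the others frozen at \<open>z\<close>.\<close>

lemma bohr_point_bound_override:
  assumes a: "a \<in> dirichlet_polys" and q: "q > 0" and "finite J"
    and "\<And>j. j \<in> J \<Longrightarrow> norm (w j) \<le> \<rho> j \<and> \<rho> j < 1"
  shows "ennreal (norm (bohr_lift a (override_on z w J)) powr q) \<le>
    ennreal (\<Prod>j\<in>J. 1 / (1 - \<rho> j)) *
      (\<integral>\<^sup>+x. ennreal (norm (bohr_lift a (override_on z x J)) powr q) \<partial>torus_measure)"
  using assms(3,4)
proof (induction J arbitrary: z rule: finite_induct)
  case empty
  interpret t: prob_space torus_measure by (rule prob_space_torus)
  show ?case using t.emeasure_space_1 by simp
next
  case (insert j J)
  interpret c: prob_space circle_measure by (rule prob_space_circle)
  interpret t: prob_space torus_measure by (rule prob_space_torus)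
  let ?G = "\<lambda>x. ennreal (norm (bohr_lift a (override_on z x (insert j J))) powr q)"
  let ?K = "\<Prod>j\<in>J. 1 / (1 - \<rho> j)"
  have "\<rho> i \<le> 1" if "i \<in> J" for i using insert.prems[of i] that by simp
  then have K: "?K \<ge> 0" by (intro prod_nonneg) auto
  have m: "(\<lambda>x. override_on z x I i) \<in> borel_measurable torus_measure" for I i
    by (cases "i \<in> I") auto
  have [measurable]: "?G \<in> borel_measurable torus_measure"
    using m by measurable
  have "ennreal (norm (bohr_lift a (override_on z w (insert j J))) powr q)
      = ennreal (norm (bohr_lift a (override_on (z(j := w j)) w J)) powr q)"
    using insert.hyps by (intro arg_cong[of _ _ "\<lambda>v. ennreal (norm (bohr_lift a v) powr q)"]) (auto simp: override_on_def fun_eq_iff)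
  also have "\<dots> \<le> ennreal ?K *
      (\<integral>\<^sup>+x. ennreal (norm (bohr_lift a (override_on (z(j := w j)) x J)) powr q) \<partial>torus_measure)"
    using insert.prems by (intro insert.IH) auto
  also have "\<dots> \<le> ennreal ?K * (\<integral>\<^sup>+x. ennreal (1 / (1 - \<rho> j)) * (\<integral>\<^sup>+y. ?G (x(j := y)) \<partial>circle_measure) \<partial>torus_measure)"
  proof (intro mult_left_mono nn_integral_mono)
    fix x :: "nat \<Rightarrow> complex"
    let ?z = "override_on z x J"
    obtain p where p: "\<And>y. bohr_lift a (?z(j := y)) = poly p y" using bohr_lift_section[OF a] by blast
    have e: "override_on (z(j := w j)) x J = ?z(j := w j)" "override_on z (x(j := y)) (insert j J) = ?z(j := y)" for y
      using insert.hyps by (auto simp: override_on_def fun_eq_iff)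
    show "ennreal (norm (bohr_lift a (override_on (z(j := w j)) x J)) powr q)
       \<le> ennreal (1 / (1 - \<rho> j)) * (\<integral>\<^sup>+y. ?G (x(j := y)) \<partial>circle_measure)"
      unfolding e p using insert.prems by (intro poly_point_bound q) auto
  qed auto
  also have "\<dots> = ennreal ?K * (ennreal (1 / (1 - \<rho> j)) * (\<integral>\<^sup>+x. \<integral>\<^sup>+y. ?G (x(j := y)) \<partial>circle_measure \<partial>torus_measure))"
  proof (subst nn_integral_cmult)
    have "(\<lambda>(x, y). ?G (x(j := y))) = (\<lambda>p. ?G (case p of (y, z) \<Rightarrow> z(j := y))) \<circ> (\<lambda>(x, y). (y, x))" by auto
    also have "\<dots> \<in> borel_measurable (torus_measure \<Otimes>\<^sub>M circle_measure)" by measurable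
    finally show "(\<lambda>x. \<integral>\<^sup>+y. ?G (x(j := y)) \<partial>circle_measure) \<in> borel_measurable torus_measure"
      by (intro c.borel_measurable_nn_integral) auto
  qed auto
  also have "(\<integral>\<^sup>+x. \<integral>\<^sup>+y. ?G (x(j := y)) \<partial>circle_measure \<partial>torus_measure) = (\<integral>\<^sup>+x. ?G x \<partial>torus_measure)"
    by (rule nn_integral_torus_update[symmetric]) measurable
  also have "ennreal ?K * (ennreal (1 / (1 - \<rho> j)) * (\<integral>\<^sup>+x. ?G x \<partial>torus_measure))
     = ennreal (\<Prod>j\<in>insert j J. 1 / (1 - \<rho> j)) * (\<integral>\<^sup>+x. ?G x \<partial>torus_measure)"
  proof -
    have "(\<Prod>j\<in>insert j J. 1 / (1 - \<rho> j)) = ?K * (1 / (1 - \<rho> j))"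
      using insert.hyps by (simp add: mult.commute)
    then have "ennreal (\<Prod>j\<in>insert j J. 1 / (1 - \<rho> j)) = ennreal ?K * ennreal (1 / (1 - \<rho> j))"
      using ennreal_mult'[OF K] by (simp only:)
    then show ?thesis by (simp only: mult.assoc)
  qed
  finally show ?case .
qed

text \<open>The q-th power of the Hardy quasi-norm, taken in the extended nonnegative reals so that
  Tonelli and Fatou apply without integrability conditions. \<open>bergman_power\<close> plays the
  same role for the Bergman quasi-norm.\<close>

definition hardy_power :: "real \<Rightarrow> (nat \<Rightarrow> complex) \<Rightarrow> ennreal" where
  "hardy_power q a = (\<integral>\<^sup>+z. ennreal (norm (bohr_lift a z) powr q) \<partial>torus_measure)"

lemma bohr_lift_eq_override:
  assumes "a \<in> dirichlet_polys" "\<And>n j. n \<ge> 1 \<Longrightarrow> a n \<noteq> 0 \<Longrightarrow> prime_exponent j n \<noteq> 0 \<Longrightarrow> j \<in> J"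
  shows "bohr_lift a (override_on z w J) = bohr_lift a w"
proof -
  let ?T = "{n. a n \<noteq> 0} - {0}"
  have fin: "finite ?T" using assms finite_support by auto
  show ?thesis
    using fin assms(2)
    by (subst (1 2) bohr_lift_superset[of ?T])
       (auto intro!: sum.cong bohr_monomial_cong override_on_apply_in simp: Suc_le_eq)
qed

lemma bohr_point_bound:
  assumes a: "a \<in> dirichlet_polys" and q: "q > 0" and J: "finite J"
    and "\<And>n j. n \<ge> 1 \<Longrightarrow> a n \<noteq> 0 \<Longrightarrow> prime_exponent j n \<noteq> 0 \<Longrightarrow> j \<in> J"
    and "\<And>j. j \<in> J \<Longrightarrow> norm (w j) \<le> \<rho> j \<and> \<rho> j < 1"
  shows "ennreal (norm (bohr_lift a w) powr q) \<le> ennreal (\<Prod>j\<in>J. 1 / (1 - \<rho> j)) * hardy_power q a"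
proof -
  have "bohr_lift a (override_on z v J) = bohr_lift a v" for z v
    using assms(4) by (intro bohr_lift_eq_override[OF a])
  then show ?thesis
    using bohr_point_bound_override[OF a q J, of w \<rho> w] assms(5) by (simp add: hardy_power_def)
qed

lemma bohr_lift_drop_prime:
  assumes "a \<in> dirichlet_polys"
  shows "bohr_lift (\<lambda>n. if prime_exponent j n = 0 then a n else 0) z = bohr_lift a (z(j := 0))"
proof -
  let ?T = "{n. a n \<noteq> 0} - {0}"
  have fin: "finite ?T" using assms finite_support by auto
  have "bohr_monomial (z(j := 0)) n = (if prime_exponent j n = 0 then bohr_monomial z n else 0)" if "n \<ge> 1" for n
  proof (cases "prime_exponent j n = 0")
    case True
    then show ?thesis by (auto intro!: bohr_monomial_cong)
  next
    case False
    then show ?thesis using finite_prime_exponent[OF that]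
      by (auto simp: bohr_monomial_def prod_zero_iff intro!: bexI[of _ j])
  qed
  note mono = this
  let ?b = "\<lambda>n. if prime_exponent j n = 0 then a n else 0"
  have "bohr_lift ?b z = (\<Sum>n\<in>?T. ?b n * bohr_monomial z n)"
    using fin by (intro bohr_lift_superset) (auto split: if_splits)
  also have "\<dots> = (\<Sum>n\<in>?T. a n * bohr_monomial (z(j := 0)) n)"
    by (intro sum.cong) (auto simp: mono)
  also have "\<dots> = bohr_lift a (z(j := 0))"
    using fin by (intro bohr_lift_superset[symmetric]) auto
  finally show ?thesis .
qed

text \<open>Discarding the integers divisible by a prime means setting its variable to zero, and the
  one-variable bound at the origin has constant 1.\<close>

lemma hardy_power_drop_prime:
  assumes a: "a \<in> dirichlet_polys" and q: "q > 0"
  shows "hardy_power q (\<lambda>n. if prime_exponent j n = 0 then a n else 0) \<le> hardy_power q a"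
proof -
  let ?G = "\<lambda>x. ennreal (norm (bohr_lift a x) powr q)"
  have [measurable]: "?G \<in> borel_measurable torus_measure" by measurable
  have "hardy_power q (\<lambda>n. if prime_exponent j n = 0 then a n else 0)
      \<le> (\<integral>\<^sup>+z. \<integral>\<^sup>+x. ?G (z(j := x)) \<partial>circle_measure \<partial>torus_measure)"
    unfolding hardy_power_def bohr_lift_drop_prime[OF a]
  proof (rule nn_integral_mono)
    fix z :: "nat \<Rightarrow> complex"
    obtain p where p: "\<And>y. bohr_lift a (z(j := y)) = poly p y" using bohr_lift_section[OF a] by blast
    show "?G (z(j := 0)) \<le> (\<integral>\<^sup>+x. ?G (z(j := x)) \<partial>circle_measure)"
      unfolding p using poly_point_bound[OF q, of 0 0 p] by simp
  qed
  also have "\<dots> = hardy_power q a"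
    unfolding hardy_power_def by (rule nn_integral_torus_update[symmetric]) measurable
  finally show ?thesis .
qed

lemma hardy_power_drop_primes:
  assumes a: "a \<in> dirichlet_polys" and q: "q > 0" and "finite J"
  shows "hardy_power q (\<lambda>n. if \<forall>j\<in>J. prime_exponent j n = 0 then a n else 0) \<le> hardy_power q a"
  using assms(3)
proof (induction J rule: finite_induct)
  case empty
  then show ?case by simp
next
  case (insert j J)
  let ?b = "\<lambda>n. if \<forall>j\<in>J. prime_exponent j n = 0 then a n else 0"
  have "?b \<in> dirichlet_polys" by (rule dirichlet_polys_subset[OF a]) (auto split: if_splits)
  from hardy_power_drop_prime[OF this q, of j]
  have "hardy_power q (\<lambda>n. if prime_exponent j n = 0 then ?b n else 0) \<le> hardy_power q ?b" .
  moreover have "(\<lambda>n. if prime_exponent j n = 0 then ?b n else 0)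
      = (\<lambda>n. if \<forall>j\<in>insert j J. prime_exponent j n = 0 then a n else 0)" by auto
  ultimately show ?case using insert.IH by auto
qed

section \<open>Orthogonality and Parseval on the torus\<close>

lemma cnj_borel [measurable]: "cnj \<in> borel_measurable borel"
  by (intro borel_measurable_continuous_onI continuous_intros)

lemma bohr_monomial_integrable:
  "integrable torus_measure (\<lambda>z. bohr_monomial z m * cnj (bohr_monomial z n))"
proof -
  interpret t: prob_space torus_measure by (rule prob_space_torus)
  show ?thesis
    by (rule t.integrable_const_bound[where B = 1])
       (use AE_torus_norm in \<open>auto elim!: eventually_mono simp: norm_mult norm_bohr_monomial_eq
          intro!: borel_measurable_times measurable_compose[OF _ cnj_borel] bohr_monomial_measurable\<close>)
qed

text \<open>Different integers differ in the exponent of some prime; integrating that one coordinate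
  already gives zero.\<close>

lemma bohr_monomial_orthonormal:
  assumes "m \<ge> 1" "n \<ge> 1"
  shows "(\<integral>z. bohr_monomial z m * cnj (bohr_monomial z n) \<partial>torus_measure) = (if m = n then 1 else 0)"
proof (cases "m = n")
  case True
  interpret t: prob_space torus_measure by (rule prob_space_torus)
  have "(\<integral>z. bohr_monomial z m * cnj (bohr_monomial z n) \<partial>torus_measure) = (\<integral>z. 1 \<partial>torus_measure)"
    using AE_torus_norm True
    by (intro integral_cong_AE)
       (auto elim!: eventually_mono simp: complex_norm_square[symmetric] norm_bohr_monomial_eq)
  then show ?thesis using True t.prob_space by simp
next
  case False
  then obtain j where j: "prime_exponent j m \<noteq> prime_exponent j n"
    using prime_exponent_cong_imp_eq[OF assms] by blast
  have "(\<integral>x. bohr_monomial (z(j := x)) m * cnj (bohr_monomial (z(j := x)) n) \<partial>circle_measure)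
      = (\<integral>x. bohr_monomial (z(j := 1)) m * cnj (bohr_monomial (z(j := 1)) n)
           * (x ^ prime_exponent j m * cnj x ^ prime_exponent j n) \<partial>circle_measure)" for z
  proof -
    have "bohr_monomial (z(j := x)) m * cnj (bohr_monomial (z(j := x)) n)
        = bohr_monomial (z(j := 1)) m * cnj (bohr_monomial (z(j := 1)) n)
           * (x ^ prime_exponent j m * cnj x ^ prime_exponent j n)" for x
      unfolding bohr_monomial_section[OF assms(1), of z j x] bohr_monomial_section[OF assms(2), of z j x]
      by (simp only: complex_cnj_mult complex_cnj_power mult_ac)
    then show ?thesis by (intro Bochner_Integration.integral_cong refl)
  qed
  then have "(\<integral>x. bohr_monomial (z(j := x)) m * cnj (bohr_monomial (z(j := x)) n) \<partial>circle_measure) = 0" for z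
    by (simp add: circle_integral_power[OF j])
  then show ?thesis
    using False by (subst integral_torus_update[OF bohr_monomial_integrable, of _ _ j]) simp
qed

lemma parseval_torus:
  assumes T: "finite T" "\<And>n. n \<ge> 1 \<Longrightarrow> a n \<noteq> 0 \<Longrightarrow> n \<in> T" "0 \<notin> T"
  shows "hardy_power 2 a = ennreal (\<Sum>n\<in>T. (norm (a n))\<^sup>2)"
proof -
  interpret t: prob_space torus_measure by (rule prob_space_torus)
  have T1: "n \<ge> 1" if "n \<in> T" for n using that T(3) by (cases n) auto
  have eq: "complex_of_real ((norm (bohr_lift a z))\<^sup>2)
      = (\<Sum>m\<in>T. \<Sum>n\<in>T. (a m * cnj (a n)) * (bohr_monomial z m * cnj (bohr_monomial z n)))" for z
  proof -
    have "bohr_lift a z = (\<Sum>n\<in>T. a n * bohr_monomial z n)"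
      by (rule bohr_lift_superset) (use T in auto)
    then have "bohr_lift a z * cnj (bohr_lift a z)
        = (\<Sum>m\<in>T. \<Sum>n\<in>T. (a m * bohr_monomial z m) * cnj (a n * bohr_monomial z n))"
      by (simp only: cnj_sum sum_product)
    also have "\<dots> = (\<Sum>m\<in>T. \<Sum>n\<in>T. (a m * cnj (a n)) * (bohr_monomial z m * cnj (bohr_monomial z n)))"
      by (intro sum.cong refl) (simp only: complex_cnj_mult mult_ac)
    finally show ?thesis unfolding complex_norm_square .
  qed
  have "(\<integral>z. complex_of_real ((norm (bohr_lift a z))\<^sup>2) \<partial>torus_measure)
      = (\<Sum>m\<in>T. \<Sum>n\<in>T. (a m * cnj (a n)) * (if m = n then 1 else 0))"
    unfolding eq using T1
    by (simp add: Bochner_Integration.integral_sum bohr_monomial_integrable bohr_monomial_orthonormal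
         Bochner_Integration.integrable_sum del: mult_cancel_left1 cong: sum.cong)
  also have "\<dots> = complex_of_real (\<Sum>n\<in>T. (norm (a n))\<^sup>2)"
    using T(1) unfolding of_real_sum complex_norm_square by (simp add: sum.delta if_distrib cong: if_cong)
  finally have I: "(\<integral>z. (norm (bohr_lift a z))\<^sup>2 \<partial>torus_measure) = (\<Sum>n\<in>T. (norm (a n))\<^sup>2)"
    by (simp only: integral_complex_of_real of_real_eq_iff)
  have int: "integrable torus_measure (\<lambda>z. (norm (bohr_lift a z))\<^sup>2)"
  proof (rule t.integrable_const_bound[where B = "(\<Sum>n\<in>T. norm (a n))\<^sup>2"])
    show "AE z in torus_measure. norm ((norm (bohr_lift a z))\<^sup>2) \<le> (\<Sum>n\<in>T. norm (a n))\<^sup>2"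
      using AE_torus_norm
      by eventually_elim (auto intro!: power_mono norm_bohr_lift_le[OF T])
  qed measurable
  have "hardy_power 2 a = (\<integral>\<^sup>+z. ennreal ((norm (bohr_lift a z))\<^sup>2) \<partial>torus_measure)"
    unfolding hardy_power_def by (simp add: powr_numeral)
  also have "\<dots> = ennreal (\<integral>z. (norm (bohr_lift a z))\<^sup>2 \<partial>torus_measure)"
    by (rule nn_integral_eq_integral[OF int]) auto
  finally show ?thesis by (simp add: I)
qed

section \<open>The Bergman weight\<close>

lemma nn_integral_gamma_scaled:
  assumes s: "s > 0" and c: "c > 0"
  shows "(\<integral>\<^sup>+t. ennreal (indicator {0<..} t * (t powr (s - 1) * exp (- c * t))) \<partial>lborel) = ennreal (Gamma s / c powr s)"
proof -
  have "ennreal (Gamma s) = (\<integral>\<^sup>+t. ennreal (indicator {0..} t * t powr (s - 1) / exp t) \<partial>lborel)"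
    by (rule Gamma_conv_nn_integral_real[OF s])
  also have "\<dots> = ennreal \<bar>c\<bar> * (\<integral>\<^sup>+t. ennreal (indicator {0..} (0 + c * t) * (0 + c * t) powr (s - 1) / exp (0 + c * t)) \<partial>lborel)"
  proof (rule nn_integral_real_affine[of "\<lambda>t. ennreal (indicator {0..} t * t powr (s - 1) / exp t)" c 0])
    show "(\<lambda>t. ennreal (indicator {0..} t * t powr (s - 1) / exp t)) \<in> borel_measurable borel" by measurable
    show "c \<noteq> 0" using c by simp
  qed
  also have "(\<integral>\<^sup>+t. ennreal (indicator {0..} (0 + c * t) * (0 + c * t) powr (s - 1) / exp (0 + c * t)) \<partial>lborel)
     = (\<integral>\<^sup>+t. ennreal (c powr (s - 1)) * ennreal (indicator {0<..} t * (t powr (s - 1) * exp (- c * t))) \<partial>lborel)"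
  proof (rule nn_integral_cong_AE, rule AE_mp[OF AE_lborel_singleton[of 0]], rule AE_I2, rule impI)
    fix t :: real assume "t \<noteq> 0"
    then show "ennreal (indicator {0..} (0 + c * t) * (0 + c * t) powr (s - 1) / exp (0 + c * t))
      = ennreal (c powr (s - 1)) * ennreal (indicator {0<..} t * (t powr (s - 1) * exp (- c * t)))"
      using c by (cases "t > 0")
        (auto simp: indicator_def powr_mult exp_minus field_simps ennreal_mult'[symmetric] zero_le_mult_iff)
  qed
  also have "\<dots> = ennreal (c powr (s - 1)) * (\<integral>\<^sup>+t. ennreal (indicator {0<..} t * (t powr (s - 1) * exp (- c * t))) \<partial>lborel)"
    by (rule nn_integral_cmult) auto
  finally have eq: "ennreal (Gamma s) = ennreal (c powr s) * (\<integral>\<^sup>+t. ennreal (indicator {0<..} t * (t powr (s - 1) * exp (- c * t))) \<partial>lborel)"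
    using c by (simp add: mult.assoc[symmetric] ennreal_mult'[symmetric] powr_diff)
  have "ennreal (Gamma s / c powr s) = ennreal (1 / c powr s) * ennreal (Gamma s)"
    using c by (simp add: ennreal_mult'[symmetric])
  also have "\<dots> = ennreal (1 / c powr s) * ennreal (c powr s) * (\<integral>\<^sup>+t. ennreal (indicator {0<..} t * (t powr (s - 1) * exp (- c * t))) \<partial>lborel)"
    unfolding eq by (simp only: mult.assoc)
  also have "ennreal (1 / c powr s) * ennreal (c powr s) = 1"
    using c by (simp add: ennreal_mult'[symmetric])
  finally show ?thesis by simp
qed

definition weight_const :: "real \<Rightarrow> real" where
  "weight_const \<beta> = 2 powr (\<beta> + 1) / Gamma (\<beta> + 1)"

lemma weight_const_pos: "\<beta> > -1 \<Longrightarrow> weight_const \<beta> > 0"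
  unfolding weight_const_def by (intro divide_pos_pos Gamma_real_pos) auto

lemma sets_bergman_weight [simp, measurable_cong]: "sets (bergman_weight \<beta>) = sets borel"
  and space_bergman_weight [simp]: "space (bergman_weight \<beta>) = UNIV"
  by (simp_all add: bergman_weight_def)

lemma nn_integral_bergman_weight:
  assumes [measurable]: "f \<in> borel_measurable borel" and \<beta>: "\<beta> > -1"
  shows "(\<integral>\<^sup>+\<sigma>. f \<sigma> \<partial>bergman_weight \<beta>)
    = ennreal (weight_const \<beta>) * (\<integral>\<^sup>+\<sigma>. ennreal (indicator {0<..} \<sigma> * (\<sigma> powr \<beta> * exp (- 2 * \<sigma>))) * f \<sigma> \<partial>lborel)"
proof -
  have "(\<integral>\<^sup>+\<sigma>. f \<sigma> \<partial>bergman_weight \<beta>)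
    = (\<integral>\<^sup>+\<sigma>. ennreal (weight_const \<beta>) * (ennreal (indicator {0<..} \<sigma> * (\<sigma> powr \<beta> * exp (- 2 * \<sigma>))) * f \<sigma>) \<partial>lborel)"
    unfolding bergman_weight_def
    by (subst nn_integral_density)
       (use weight_const_pos[OF \<beta>] in \<open>auto intro!: nn_integral_cong simp: weight_const_def ennreal_mult'[symmetric] mult.assoc[symmetric]
          split: split_indicator\<close>)
  also have "\<dots> = ennreal (weight_const \<beta>) * (\<integral>\<^sup>+\<sigma>. ennreal (indicator {0<..} \<sigma> * (\<sigma> powr \<beta> * exp (- 2 * \<sigma>))) * f \<sigma> \<partial>lborel)"
    by (rule nn_integral_cmult) measurable
  finally show ?thesis .
qed

lemma prob_space_bergman_weight:
  assumes \<beta>: "\<beta> > -1"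
  shows "prob_space (bergman_weight \<beta>)"
proof
  have "emeasure (bergman_weight \<beta>) (space (bergman_weight \<beta>)) = (\<integral>\<^sup>+\<sigma>. 1 \<partial>bergman_weight \<beta>)" by simp
  also have "\<dots> = ennreal (weight_const \<beta>) * ennreal (Gamma (\<beta> + 1) / 2 powr (\<beta> + 1))"
    using nn_integral_gamma_scaled[of "\<beta> + 1" 2] \<beta> by (subst nn_integral_bergman_weight) simp_all
  also have "\<dots> = ennreal (weight_const \<beta> * (Gamma (\<beta> + 1) / 2 powr (\<beta> + 1)))"
    using weight_const_pos[OF \<beta>] by (simp add: ennreal_mult'[symmetric])
  also have "weight_const \<beta> * (Gamma (\<beta> + 1) / 2 powr (\<beta> + 1)) = 1"
    using Gamma_real_pos[of "\<beta> + 1"] \<beta> by (simp add: weight_const_def less_imp_neq[symmetric])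
  finally show "emeasure (bergman_weight \<beta>) (space (bergman_weight \<beta>)) = 1" by simp
qed

lemma AE_bergman_weight_pos: "AE \<sigma> in bergman_weight \<beta>. \<sigma> > 0"
  unfolding bergman_weight_def
  by (subst AE_density) (auto intro!: AE_I2 split: split_indicator)

text \<open>On the unit interval the exponential factor is at least \<open>exp (- 2)\<close>, so the
  mass is comparable with that of the pure power. With \<open>a = 0\<close> this turns monotonicity
  in \<sigma> into a pointwise bound; with \<open>a = b / 2\<close> it gives the mass of one dyadic
  scale.\<close>

lemma bergman_weight_interval_ge:
  assumes \<beta>: "\<beta> > -1" and ab: "0 \<le> a" "a \<le> b" "b \<le> 1"
  shows "emeasure (bergman_weight \<beta>) {a<..b}
    \<ge> ennreal (weight_const \<beta> * exp (- 2) / (\<beta> + 1) * (b powr (\<beta> + 1) - a powr (\<beta> + 1)))"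
proof -
  \<comment> \<open>For \<beta> < 0 the power is unbounded at 0, so the integral over
    \<open>{a..b}\<close> is taken as a difference of two integrals that start at 0.\<close>
  have hi: "((\<lambda>x. x powr \<beta>) has_integral (b powr (\<beta> + 1) / (\<beta> + 1) - a powr (\<beta> + 1) / (\<beta> + 1))) {a..b}"
  proof -
    have hb: "((\<lambda>x. x powr \<beta>) has_integral b powr (\<beta> + 1) / (\<beta> + 1)) {0..b}"
      and ha: "((\<lambda>x. x powr \<beta>) has_integral a powr (\<beta> + 1) / (\<beta> + 1)) {0..a}"
      using ab \<beta> by (auto intro!: has_integral_powr_from_0)
    have "(\<lambda>x. x powr \<beta>) integrable_on {a..b}"
      by (rule integrable_subinterval_real[of _ 0 b]) (use hb ab in auto)
    then obtain I where I: "((\<lambda>x. x powr \<beta>) has_integral I) {a..b}" by auto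
    have "((\<lambda>x. x powr \<beta>) has_integral (a powr (\<beta> + 1) / (\<beta> + 1) + I)) {0..b}"
      by (rule has_integral_combine[of 0 a b]) (use ha I ab in auto)
    with hb have "a powr (\<beta> + 1) / (\<beta> + 1) + I = b powr (\<beta> + 1) / (\<beta> + 1)"
      by (rule has_integral_unique[rotated])
    then have "I = b powr (\<beta> + 1) / (\<beta> + 1) - a powr (\<beta> + 1) / (\<beta> + 1)" by linarith
    with I show ?thesis by simp
  qed
  have "ennreal (weight_const \<beta> * exp (- 2) / (\<beta> + 1) * (b powr (\<beta> + 1) - a powr (\<beta> + 1)))
     = ennreal (weight_const \<beta> * exp (- 2)) * ennreal (b powr (\<beta> + 1) / (\<beta> + 1) - a powr (\<beta> + 1) / (\<beta> + 1))"
    using weight_const_pos[OF \<beta>] by (simp add: ennreal_mult'[symmetric] diff_divide_distrib algebra_simps)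
  also have "ennreal (b powr (\<beta> + 1) / (\<beta> + 1) - a powr (\<beta> + 1) / (\<beta> + 1))
     = (\<integral>\<^sup>+x. ennreal (x powr \<beta>) * indicator {a..b} x \<partial>lborel)"
    using hi by (intro nn_integral_has_integral_lebesgue'[symmetric]) auto
  also have "ennreal (weight_const \<beta> * exp (- 2)) * \<dots>
     = ennreal (weight_const \<beta>) * (\<integral>\<^sup>+x. ennreal (exp (- 2)) * (ennreal (x powr \<beta>) * indicator {a..b} x) \<partial>lborel)"
    using weight_const_pos[OF \<beta>] by (subst nn_integral_cmult) (auto simp: ennreal_mult' mult.assoc)
  also have "\<dots> \<le> ennreal (weight_const \<beta>) * (\<integral>\<^sup>+\<sigma>. ennreal (indicator {0<..} \<sigma> * (\<sigma> powr \<beta> * exp (- 2 * \<sigma>))) * indicator {a<..b} \<sigma> \<partial>lborel)"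
  proof (rule mult_left_mono, rule nn_integral_mono_AE, rule AE_mp[OF AE_lborel_singleton[of a]], rule AE_I2, rule impI)
    fix x assume "x \<noteq> a"
    then show "ennreal (exp (- 2)) * (ennreal (x powr \<beta>) * indicator {a..b} x)
      \<le> ennreal (indicator {0<..} x * (x powr \<beta> * exp (- 2 * x))) * indicator {a<..b} x"
      using ab by (auto simp: ennreal_mult'[symmetric] mult.commute intro!: ennreal_leI mult_left_mono split: split_indicator)
  qed auto
  also have "\<dots> = emeasure (bergman_weight \<beta>) {a<..b}"
    using \<beta> by (subst nn_integral_bergman_weight[symmetric]) simp_all
  finally show ?thesis .
qed

lemma bergman_weight_interval_pos:
  assumes "\<beta> > -1" "0 < b"
  shows "emeasure (bergman_weight \<beta>) {0<..b} > 0"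
proof -
  have "0 < ennreal (weight_const \<beta> * exp (- 2) / (\<beta> + 1) * (min b 1 powr (\<beta> + 1) - 0 powr (\<beta> + 1)))"
    using assms weight_const_pos[OF assms(1)] by (intro ennreal_less_zero_iff[THEN iffD2] mult_pos_pos divide_pos_pos) auto
  also have "\<dots> \<le> emeasure (bergman_weight \<beta>) {0<..min b 1}"
    using assms by (intro bergman_weight_interval_ge) auto
  also have "\<dots> \<le> emeasure (bergman_weight \<beta>) {0<..b}"
    by (intro emeasure_mono) auto
  finally show ?thesis .
qed

section \<open>The Bergman norm as an iterated integral\<close>

definition bergman_power :: "real \<Rightarrow> real \<Rightarrow> (nat \<Rightarrow> complex) \<Rightarrow> ennreal" where
  "bergman_power q \<beta> a = (\<integral>\<^sup>+\<sigma>. hardy_power q (dirichlet_shift \<sigma> a) \<partial>bergman_weight \<beta>)"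

lemma bohr_lift_shift_sum:
  assumes T: "finite T" "\<And>n. n \<ge> 1 \<Longrightarrow> a n \<noteq> 0 \<Longrightarrow> n \<in> T" "0 \<notin> T"
  shows "bohr_lift (dirichlet_shift \<sigma> a) z = (\<Sum>n\<in>T. a n * of_real (real n powr (- \<sigma>)) * bohr_monomial z n)"
  using bohr_lift_superset[of T "dirichlet_shift \<sigma> a" z] assms by (simp add: dirichlet_shift_def)

lemma bohr_lift_shift_measurable:
  assumes "a \<in> dirichlet_polys"
  shows "(\<lambda>(\<sigma>, z). bohr_lift (dirichlet_shift \<sigma> a) z) \<in> borel_measurable (borel \<Otimes>\<^sub>M torus_measure)"
proof -
  have "(\<lambda>(\<sigma>, z). bohr_lift (dirichlet_shift \<sigma> a) z) =
    (\<lambda>p. \<Sum>n\<in>{n. a n \<noteq> 0} - {0}. a n * of_real (real n powr (- fst p)) * bohr_monomial (snd p) n)"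
    using assms finite_support by (subst bohr_lift_shift_sum[of "{n. a n \<noteq> 0} - {0}"]) auto
  also have "\<dots> \<in> borel_measurable (borel \<Otimes>\<^sub>M torus_measure)"
    by (intro borel_measurable_sum borel_measurable_times bohr_monomial_measurable
        measurable_compose[OF measurable_snd torus_component]) measurable
  finally show ?thesis .
qed

lemma hardy_power_shift_measurable [measurable]:
  assumes "a \<in> dirichlet_polys"
  shows "(\<lambda>\<sigma>. hardy_power q (dirichlet_shift \<sigma> a)) \<in> borel_measurable borel"
proof -
  interpret t: prob_space torus_measure by (rule prob_space_torus)
  note [measurable] = bohr_lift_shift_measurable[OF assms]
  show ?thesis unfolding hardy_power_def by measurable
qed

lemma hardy_power_bound:
  assumes T: "finite T" "\<And>n. n \<ge> 1 \<Longrightarrow> a n \<noteq> 0 \<Longrightarrow> n \<in> T" "0 \<notin> T" and q: "q > 0"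
  shows "hardy_power q a \<le> ennreal ((\<Sum>n\<in>T. norm (a n)) powr q)"
proof -
  interpret t: prob_space torus_measure by (rule prob_space_torus)
  have "hardy_power q a \<le> (\<integral>\<^sup>+z. ennreal ((\<Sum>n\<in>T. norm (a n)) powr q) \<partial>torus_measure)"
    unfolding hardy_power_def
  proof (rule nn_integral_mono_AE, use AE_torus_norm in eventually_elim)
    fix z :: "nat \<Rightarrow> complex" assume z: "\<forall>j. norm (z j) = 1"
    have "norm (bohr_lift a z) \<le> (\<Sum>n\<in>T. norm (a n))"
      by (rule norm_bohr_lift_le) (use T z in auto)
    then show "ennreal (norm (bohr_lift a z) powr q) \<le> ennreal ((\<Sum>n\<in>T. norm (a n)) powr q)"
      using q by (intro ennreal_leI powr_mono2) auto
  qed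
  then show ?thesis using t.emeasure_space_1 by simp
qed

text \<open>For a polynomial the integrand is bounded on the torus, so the Bochner integral inside
  \<open>hardy_norm\<close> is a true value and not the default 0.\<close>

lemma hardy_norm_powr:
  assumes a: "a \<in> dirichlet_polys" and q: "q > 0"
  shows "ennreal (hardy_norm q a powr q) = hardy_power q a"
proof -
  interpret t: prob_space torus_measure by (rule prob_space_torus)
  have m: "(\<lambda>z. norm (bohr_lift a z) powr q) \<in> borel_measurable torus_measure" by measurable
  have "hardy_power q a < \<infinity>"
    by (rule le_less_trans[OF hardy_power_bound[of "{n. a n \<noteq> 0} - {0}"]])
       (use a q finite_support in auto)
  then have int: "integrable torus_measure (\<lambda>z. norm (bohr_lift a z) powr q)"
    using m by (intro integrableI_nonneg) (auto simp: hardy_power_def)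
  have "hardy_power q a = ennreal (\<integral>z. norm (bohr_lift a z) powr q \<partial>torus_measure)"
    unfolding hardy_power_def by (rule nn_integral_eq_integral[OF int]) auto
  moreover have "hardy_norm q a powr q = (\<integral>z. norm (bohr_lift a z) powr q \<partial>torus_measure)"
    using q by (simp add: hardy_norm_def powr_powr)
  ultimately show ?thesis by simp
qed

lemma bergman_power_finite:
  assumes a: "a \<in> dirichlet_polys" and q: "q > 0" and \<beta>: "\<beta> > -1"
  shows "bergman_power q \<beta> a < \<infinity>"
proof -
  interpret w: prob_space "bergman_weight \<beta>" by (rule prob_space_bergman_weight[OF \<beta>])
  let ?T = "{n. a n \<noteq> 0} - {0}"
  have fin: "finite ?T" using a finite_support by auto
  have "bergman_power q \<beta> a \<le> (\<integral>\<^sup>+\<sigma>. ennreal ((\<Sum>n\<in>?T. norm (a n)) powr q) \<partial>bergman_weight \<beta>)"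
    unfolding bergman_power_def
  proof (rule nn_integral_mono_AE, use AE_bergman_weight_pos in eventually_elim)
    fix \<sigma> :: real assume \<sigma>: "\<sigma> > 0"
    have "hardy_power q (dirichlet_shift \<sigma> a) \<le> ennreal ((\<Sum>n\<in>?T. norm (dirichlet_shift \<sigma> a n)) powr q)"
      by (rule hardy_power_bound) (use fin q in \<open>auto simp: dirichlet_shift_def\<close>)
    also have "(\<Sum>n\<in>?T. norm (dirichlet_shift \<sigma> a n)) \<le> (\<Sum>n\<in>?T. norm (a n))"
    proof (rule sum_mono)
      fix n assume "n \<in> ?T"
      then have "real n powr (- \<sigma>) \<le> 1" using \<sigma> powr_mono[of "- \<sigma>" 0 "real n"] by auto
      then show "norm (dirichlet_shift \<sigma> a n) \<le> norm (a n)"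
        by (simp add: dirichlet_shift_def norm_mult mult_left_le)
    qed
    then have "ennreal ((\<Sum>n\<in>?T. norm (dirichlet_shift \<sigma> a n)) powr q) \<le> ennreal ((\<Sum>n\<in>?T. norm (a n)) powr q)"
      using q by (intro ennreal_leI powr_mono2 sum_nonneg) auto
    finally show "hardy_power q (dirichlet_shift \<sigma> a) \<le> ennreal ((\<Sum>n\<in>?T. norm (a n)) powr q)" .
  qed
  also have "\<dots> < \<infinity>" using w.emeasure_space_1 by simp
  finally show ?thesis .
qed

lemma bergman_norm_powr:
  assumes a: "a \<in> dirichlet_polys" and q: "q > 0" and \<beta>: "\<beta> > -1"
  shows "ennreal (bergman_norm q \<beta> a powr q) = bergman_power q \<beta> a"
proof -
  let ?h = "\<lambda>\<sigma>. hardy_norm q (dirichlet_shift \<sigma> a) powr q"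
  have eq: "ennreal (?h \<sigma>) = hardy_power q (dirichlet_shift \<sigma> a)" for \<sigma>
    using a q by (intro hardy_norm_powr dirichlet_shift_polys)
  have "?h = (\<lambda>\<sigma>. enn2real (hardy_power q (dirichlet_shift \<sigma> a)))"
    by (simp add: eq[symmetric])
  moreover have "(\<lambda>\<sigma>. enn2real (hardy_power q (dirichlet_shift \<sigma> a))) \<in> borel_measurable borel"
    using a by measurable
  ultimately have m: "?h \<in> borel_measurable (bergman_weight \<beta>)" by simp
  have int: "integrable (bergman_weight \<beta>) ?h"
    using m bergman_power_finite[OF assms] by (intro integrableI_nonneg) (auto simp: eq bergman_power_def)
  have "bergman_power q \<beta> a = ennreal (\<integral>\<sigma>. ?h \<sigma> \<partial>bergman_weight \<beta>)"
    unfolding bergman_power_def eq[symmetric] by (rule nn_integral_eq_integral[OF int]) auto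
  moreover have "bergman_norm q \<beta> a powr q = (\<integral>\<sigma>. ?h \<sigma> \<partial>bergman_weight \<beta>)"
    using q by (simp add: bergman_norm_def powr_powr)
  ultimately show ?thesis by simp
qed

lemma bergman_norm_nonneg: "bergman_norm q \<beta> a \<ge> 0"
  by (simp add: bergman_norm_def)

lemma bergman_norm_less_iff:
  assumes a: "a \<in> dirichlet_polys" and q: "q > 0" and \<beta>: "\<beta> > -1" and e: "e > 0"
  shows "bergman_norm q \<beta> a < e \<longleftrightarrow> bergman_power q \<beta> a < ennreal (e powr q)"
proof -
  have "bergman_norm q \<beta> a < e \<longleftrightarrow> bergman_norm q \<beta> a powr q < e powr q"
    using q e bergman_norm_nonneg[of q \<beta> a]
    by (meson linorder_not_less powr_less_mono2 powr_mono2 less_imp_le)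
  then show ?thesis
    using q e by (subst bergman_norm_powr[OF a q \<beta>, symmetric]) (simp add: ennreal_less_iff)
qed

text \<open>The substitute for the triangle inequality, valid for every exponent
  \<open>q > 0\<close>; its constant \<open>2 powr q\<close> reappears in the decay rates of all
  Cauchy sequences below.\<close>

lemma norm_diff_powr_le:
  fixes x y :: "'a :: real_normed_vector"
  assumes q: "q > 0"
  shows "norm (x - y) powr q \<le> 2 powr q * (norm x powr q + norm y powr q)"
proof -
  have "norm (x - y) \<le> 2 * max (norm x) (norm y)" using norm_triangle_ineq4[of x y] by linarith
  then have "norm (x - y) powr q \<le> (2 * max (norm x) (norm y)) powr q" using q by (intro powr_mono2) auto
  also have "\<dots> = 2 powr q * max (norm x) (norm y) powr q" by (simp add: powr_mult)
  also have "max (norm x) (norm y) powr q \<le> norm x powr q + norm y powr q" by (auto simp: max_def)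
  finally show ?thesis by simp
qed

lemma bergman_power_diff_le:
  assumes a: "a \<in> dirichlet_polys" and b: "b \<in> dirichlet_polys" and q: "q > 0"
  shows "bergman_power q \<beta> (\<lambda>n. a n - b n) \<le> ennreal (2 powr q) * (bergman_power q \<beta> a + bergman_power q \<beta> b)"
proof -
  interpret t: prob_space torus_measure by (rule prob_space_torus)
  have H: "hardy_power q (dirichlet_shift \<sigma> (\<lambda>n. a n - b n))
      \<le> ennreal (2 powr q) * (hardy_power q (dirichlet_shift \<sigma> a) + hardy_power q (dirichlet_shift \<sigma> b))" for \<sigma>
  proof -
    have "dirichlet_shift \<sigma> (\<lambda>n. a n - b n) = (\<lambda>n. dirichlet_shift \<sigma> a n - dirichlet_shift \<sigma> b n)"
      by (simp add: dirichlet_shift_def algebra_simps fun_eq_iff)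
    then have "hardy_power q (dirichlet_shift \<sigma> (\<lambda>n. a n - b n))
      \<le> (\<integral>\<^sup>+z. ennreal (2 powr q) * (ennreal (norm (bohr_lift (dirichlet_shift \<sigma> a) z) powr q) +
             ennreal (norm (bohr_lift (dirichlet_shift \<sigma> b) z) powr q)) \<partial>torus_measure)"
      unfolding hardy_power_def
      by (intro nn_integral_mono)
         (auto simp: bohr_lift_diff dirichlet_shift_polys a b ennreal_mult'[symmetric] ennreal_plus[symmetric]
            simp del: ennreal_plus intro!: ennreal_leI norm_diff_powr_le q)
    also have "\<dots> = ennreal (2 powr q) * (hardy_power q (dirichlet_shift \<sigma> a) + hardy_power q (dirichlet_shift \<sigma> b))"
      unfolding hardy_power_def by (subst nn_integral_cmult, measurable, subst nn_integral_add, measurable)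
    finally show ?thesis .
  qed
  have "bergman_power q \<beta> (\<lambda>n. a n - b n) \<le> (\<integral>\<^sup>+\<sigma>. ennreal (2 powr q) *
     (hardy_power q (dirichlet_shift \<sigma> a) + hardy_power q (dirichlet_shift \<sigma> b)) \<partial>bergman_weight \<beta>)"
    unfolding bergman_power_def by (intro nn_integral_mono H)
  also have "\<dots> = ennreal (2 powr q) * (bergman_power q \<beta> a + bergman_power q \<beta> b)"
    unfolding bergman_power_def using a b
    by (subst nn_integral_cmult, measurable, subst nn_integral_add, measurable)
  finally show ?thesis .
qed

section \<open>Coefficients and point values are controlled by the Bergman norm\<close>

lemma prod_prime_exponent_le:
  assumes n: "n \<ge> 1" and c: "\<And>j. prime_exponent j n \<noteq> 0 \<Longrightarrow> 0 \<le> c j \<and> c j \<le> real (nth_prime j) ^ prime_exponent j n"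
  shows "(\<Prod>j | prime_exponent j n \<noteq> 0. c j) \<le> real n"
proof -
  have "(\<Prod>j | prime_exponent j n \<noteq> 0. c j) \<le> (\<Prod>j | prime_exponent j n \<noteq> 0. real (nth_prime j) ^ prime_exponent j n)"
    using c by (intro prod_mono) auto
  also have "complex_of_real \<dots> = bohr_monomial (\<lambda>j. of_real (real (nth_prime j) powr (- (-1)))) n"
    using nth_prime_gt by (simp add: bohr_monomial_def)
  then have "(\<Prod>j | prime_exponent j n \<noteq> 0. real (nth_prime j) ^ prime_exponent j n) = real n"
    using n by (simp only: bohr_monomial_nth_prime_powr of_real_eq_iff) simp
  finally show ?thesis .
qed

text \<open>A coefficient is an integral against a character, which an L^q quasi-norm with
  \<open>q < 1\<close> does not control. After dilation by 1/2, however, the lift is bounded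
  pointwise, and Parseval bounds its coefficients. The costs are a factor 2 for each prime divisor
  of \<open>n\<close> and a factor 2 to the number of prime factors with multiplicity, both at most
  \<open>n\<close>; the latter enters with the power \<open>q\<close>, hence the exponent
  \<open>q + 1\<close>.\<close>

lemma coeff_hardy_bound:
  assumes a: "a \<in> dirichlet_polys" and q: "q > 0" and n: "n \<ge> 1"
  shows "ennreal (norm (a n) powr q) \<le> ennreal (real n powr (q + 1)) * hardy_power q a"
proof -
  interpret t: prob_space torus_measure by (rule prob_space_torus)
  let ?V = "\<Union>m\<in>{m. a m \<noteq> 0} - {0}. {j. prime_exponent j m \<noteq> 0}"
  let ?K = "{j. prime_exponent j n \<noteq> 0}"
  have V: "finite ?V" using a finite_support finite_prime_exponent by auto
  have K: "finite ?K" using finite_prime_exponent[OF n] .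
  \<comment> \<open>Only the primes dividing \<open>n\<close> are kept. The constant of point
    evaluation then depends on \<open>n\<close> alone and not on the polynomial.\<close>
  define b where "b = (\<lambda>m. if \<forall>j\<in>?V - ?K. prime_exponent j m = 0 then a m else 0)"
  have b: "b \<in> dirichlet_polys"
    unfolding b_def by (rule dirichlet_polys_subset[OF a]) (auto split: if_splits)
  have hb: "hardy_power q b \<le> hardy_power q a"
    unfolding b_def using V by (intro hardy_power_drop_primes a q) auto
  have bK: "j \<in> ?K" if "m \<ge> 1" "b m \<noteq> 0" "prime_exponent j m \<noteq> 0" for m j
  proof (rule ccontr)
    assume "j \<notin> ?K"
    moreover from that have "a m \<noteq> 0" by (auto simp: b_def split: if_splits)
    then have "j \<in> ?V" using that by (intro UN_I[of m]) auto
    ultimately have "j \<in> ?V - ?K" by blast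
    moreover from that have "\<forall>j\<in>?V - ?K. prime_exponent j m = 0"
      unfolding b_def by (metis (no_types, lifting))
    ultimately have "prime_exponent j m = 0" by (rule bspec[rotated])
    then show False using that(3) by (rule notE[rotated])
  qed
  \<comment> \<open>Dilation by 1/2 in each variable moves the torus to radius 1/2, where each
    variable costs \<open>1 / (1 - 1 / 2) = 2\<close>.\<close>
  define c where "c = (\<lambda>m. b m * bohr_monomial (\<lambda>_. 1 / 2) m)"
  have c: "c \<in> dirichlet_polys"
    unfolding c_def by (rule dirichlet_polys_subset[OF b]) auto
  define H where "H = enn2real (hardy_power q a)"
  have "hardy_power q a < \<infinity>"
    by (rule le_less_trans[OF hardy_power_bound[of "{n. a n \<noteq> 0} - {0}"]])
       (use a q finite_support in auto)
  then have H: "hardy_power q a = ennreal H" "H \<ge> 0" by (auto simp: H_def)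
  define B where "B = (2 ^ card ?K * H) powr (1 / q)"
  have pt: "norm (bohr_lift c z) \<le> B" if z: "\<forall>j. norm (z j) = 1" for z
  proof -
    have "ennreal (norm (bohr_lift b (\<lambda>j. 1 / 2 * z j)) powr q)
       \<le> ennreal (\<Prod>j\<in>?K. 1 / (1 - 1 / 2)) * hardy_power q b"
    proof (rule bohr_point_bound[OF b q K, of "\<lambda>j. 1 / 2 * z j" "\<lambda>_. 1 / 2"])
      show "norm (1 / 2 * z j) \<le> 1 / 2 \<and> 1 / 2 < (1 :: real)" for j
        using z by (simp add: norm_mult norm_divide)
    qed (use bK in blast)
    also have "\<dots> \<le> ennreal (2 ^ card ?K) * ennreal H"
      using hb H(1) by (intro mult_mono) auto
    also have "\<dots> = ennreal (2 ^ card ?K * H)" by (simp add: ennreal_mult'[symmetric])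
    finally have "norm (bohr_lift c z) powr q \<le> 2 ^ card ?K * H"
      using H(2) unfolding c_def bohr_lift_dilate[OF b] by (simp add: ennreal_le_iff)
    then have "(norm (bohr_lift c z) powr q) powr (1 / q) \<le> B"
      unfolding B_def using q by (intro powr_mono2) auto
    then show ?thesis using q by (simp add: powr_powr)
  qed
  have B: "B \<ge> 0" by (simp add: B_def)
  let ?T = "insert n ({m. c m \<noteq> 0} - {0})"
  have T: "finite ?T" using c finite_support by auto
  have "ennreal ((norm (c n))\<^sup>2) \<le> ennreal (\<Sum>m\<in>?T. (norm (c m))\<^sup>2)"
    using T by (intro ennreal_leI member_le_sum) auto
  also have "\<dots> = hardy_power 2 c"
    using n T by (intro parseval_torus[symmetric]) auto
  also have "\<dots> \<le> (\<integral>\<^sup>+z. ennreal (B\<^sup>2) \<partial>torus_measure)"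
    unfolding hardy_power_def
    by (rule nn_integral_mono_AE, use AE_torus_norm in eventually_elim)
       (auto intro!: power_mono pt ennreal_leI simp: powr_numeral)
  also have "\<dots> = ennreal (B\<^sup>2)" using t.emeasure_space_1 by simp
  finally have "norm (c n) \<le> B" using B by (simp add: ennreal_le_iff power2_le_iff_abs_le)
  then have "norm (c n) powr q \<le> B powr q" using q by (intro powr_mono2) auto
  also have "\<dots> = 2 ^ card ?K * H" using q H(2) by (simp add: B_def powr_powr)
  finally have cn: "norm (c n) powr q \<le> 2 ^ card ?K * H" .
  have "b n = a n" by (auto simp: b_def)
  define E where "E = (\<Prod>j\<in>?K. 2 ^ prime_exponent j n :: real)"
  have nc: "norm (c n) = norm (a n) / E"
    unfolding c_def E_def using \<open>b n = a n\<close>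
    by (simp add: norm_mult bohr_monomial_def prod_norm[symmetric] norm_power norm_divide power_divide prod_dividef)
  have p2: "2 \<le> nth_prime j" for j using nth_prime_gt[of j] by simp
  have E: "E > 0" unfolding E_def by (intro prod_pos) auto
  have E2: "E \<le> real n"
    unfolding E_def
  proof (rule prod_prime_exponent_le[OF n])
    fix j
    have "(2::real) \<le> real (nth_prime j)" using p2[of j] by simp
    then show "0 \<le> (2::real) ^ prime_exponent j n \<and> (2::real) ^ prime_exponent j n \<le> real (nth_prime j) ^ prime_exponent j n"
      by (simp add: power_mono)
  qed
  have K2: "2 ^ card ?K \<le> real n"
  proof -
    have "(\<Prod>j\<in>?K. 2 :: real) \<le> real n"
    proof (rule prod_prime_exponent_le[OF n])
      fix j assume "prime_exponent j n \<noteq> 0"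
      then have "(2::real) ^ 1 \<le> 2 ^ prime_exponent j n" by (intro power_increasing) auto
      also have "\<dots> \<le> real (nth_prime j) ^ prime_exponent j n" using p2 by (intro power_mono) auto
      finally show "0 \<le> (2::real) \<and> 2 \<le> real (nth_prime j) ^ prime_exponent j n" by simp
    qed
    then show ?thesis by simp
  qed
  have "norm (a n) powr q = E powr q * norm (c n) powr q"
    using E nc by (simp add: powr_divide)
  also have "\<dots> \<le> real n powr q * (real n * H)"
    using cn K2 H(2) E E2 q by (intro mult_mono powr_mono2 order_trans[OF cn] mult_right_mono) auto
  also have "\<dots> = real n powr (q + 1) * H" using n by (simp add: powr_add)
  finally show ?thesis using H by (simp add: ennreal_mult'[symmetric] ennreal_leI)
qed

text \<open>The Hardy bound is integrated over 0 < \<sigma> \<le> 1, where undoing the shift costs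
  at most a factor \<open>n\<close>. Together with the exponent \<open>(q + 1) / q\<close> of the
  Hardy bound this makes \<open>2 + 1 / q\<close>.\<close>

lemma coeff_bergman_bound:
  assumes q: "q > 0" and \<beta>: "\<beta> > -1"
  obtains C where "C \<ge> 0"
    "\<And>a n. a \<in> dirichlet_polys \<Longrightarrow> n \<ge> 1 \<Longrightarrow> norm (a n) \<le> C * real n powr (2 + 1 / q) * bergman_norm q \<beta> a"
proof -
  interpret w: prob_space "bergman_weight \<beta>" by (rule prob_space_bergman_weight[OF \<beta>])
  define m where "m = measure (bergman_weight \<beta>) {0<..1}"
  have m: "m > 0" using bergman_weight_interval_pos[OF \<beta>, of 1]
    by (simp add: m_def w.emeasure_eq_measure)
  have "norm (a n) \<le> (1 / m) powr (1 / q) * real n powr (2 + 1 / q) * bergman_norm q \<beta> a"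
    if a: "a \<in> dirichlet_polys" and n: "n \<ge> 1" for a n
  proof -
    have "ennreal (m * (norm (a n) powr q * real n powr (- q)))
       = (\<integral>\<^sup>+\<sigma>. ennreal (norm (a n) powr q * real n powr (- q)) * indicator {0<..1} \<sigma> \<partial>bergman_weight \<beta>)"
      using m by (subst nn_integral_cmult_indicator) (simp_all add: w.emeasure_eq_measure m_def[symmetric] ennreal_mult'[symmetric] mult.commute)
    also have "\<dots> \<le> (\<integral>\<^sup>+\<sigma>. ennreal (real n powr (q + 1)) * hardy_power q (dirichlet_shift \<sigma> a) \<partial>bergman_weight \<beta>)"
    proof (rule nn_integral_mono)
      fix \<sigma> :: real
      show "ennreal (norm (a n) powr q * real n powr (- q)) * indicator {0<..1} \<sigma>
        \<le> ennreal (real n powr (q + 1)) * hardy_power q (dirichlet_shift \<sigma> a)"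
      proof (cases "\<sigma> \<in> {0<..1}")
        case True
        have "norm (a n) powr q * real n powr (- q) \<le> norm (a n) powr q * real n powr (- \<sigma> * q)"
          using True n q by (intro mult_left_mono powr_mono) (auto simp: mult_le_cancel_right1)
        also have "\<dots> = norm (dirichlet_shift \<sigma> a n) powr q"
          by (simp add: dirichlet_shift_def norm_mult powr_mult powr_powr)
        finally have "ennreal (norm (a n) powr q * real n powr (- q)) \<le> ennreal (norm (dirichlet_shift \<sigma> a n) powr q)"
          by (rule ennreal_leI)
        also have "\<dots> \<le> ennreal (real n powr (q + 1)) * hardy_power q (dirichlet_shift \<sigma> a)"
          by (intro coeff_hardy_bound dirichlet_shift_polys a q n)
        finally show ?thesis using True by simp
      qed auto
    qed
    also have "\<dots> = ennreal (real n powr (q + 1)) * bergman_power q \<beta> a"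
      unfolding bergman_power_def using a by (intro nn_integral_cmult) measurable
    also have "\<dots> = ennreal (real n powr (q + 1) * bergman_norm q \<beta> a powr q)"
      by (simp add: bergman_norm_powr[OF a q \<beta>, symmetric] ennreal_mult')
    finally have "m * (norm (a n) powr q * real n powr (- q)) \<le> real n powr (q + 1) * bergman_norm q \<beta> a powr q"
      by (simp add: ennreal_le_iff)
    then have "norm (a n) powr q \<le> 1 / m * (real n powr (2 * q + 1) * bergman_norm q \<beta> a powr q)"
    proof -
      have "real n powr (2 * q + 1) = real n powr (q + 1) * real n powr q"
        by (simp add: powr_add[symmetric] algebra_simps)
      moreover have "real n powr (- q) = 1 / real n powr q" by (simp add: powr_minus_divide)
      moreover have "real n powr q > 0" using n by simp
      ultimately show ?thesis
        using m \<open>m * (norm (a n) powr q * real n powr (- q)) \<le> real n powr (q + 1) * bergman_norm q \<beta> a powr q\<close>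
        by (simp add: pos_divide_le_eq pos_le_divide_eq mult.assoc mult.commute mult.left_commute)
    qed
    then have "(norm (a n) powr q) powr (1 / q) \<le> (1 / m * (real n powr (2 * q + 1) * bergman_norm q \<beta> a powr q)) powr (1 / q)"
      using q by (intro powr_mono2) auto
    also have "\<dots> = (1 / m) powr (1 / q) * real n powr (2 + 1 / q) * bergman_norm q \<beta> a"
      using q m bergman_norm_nonneg[of q \<beta> a] by (simp add: powr_mult powr_powr powr_divide field_simps)
    finally show ?thesis using q by (simp add: powr_powr)
  qed
  then show ?thesis by (intro that[of "(1 / m) powr (1 / q)"]) auto
qed

section \<open>Point values determine the coefficients\<close>

lemma suminf_norm_le_suminf:
  fixes f :: "nat \<Rightarrow> 'a :: banach"
  assumes "\<And>n. norm (f n) \<le> g n" and g: "summable g"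
  shows "norm (suminf f) \<le> suminf g"
proof -
  have s: "summable (\<lambda>n. norm (f n))"
    by (rule summable_comparison_test'[OF g, of 0]) (use assms in auto)
  have "norm (suminf f) \<le> (\<Sum>n. norm (f n))" by (rule summable_norm[OF s])
  also have "\<dots> \<le> suminf g" by (rule suminf_le[OF assms(1) s g])
  finally show ?thesis .
qed

lemma norm_dirichlet_term: "norm (dirichlet_term d s k) = norm (d k) * real k powr (- Re s)"
proof -
  have "norm (of_nat k powr (- s)) = real k powr (- Re s)"
    by (cases "k = 0") (simp_all add: norm_powr_real_powr)
  then show ?thesis by (simp add: dirichlet_term_def norm_mult)
qed

text \<open>Far to the right the first nonzero term dominates: relative to the term at
  \<open>N\<close>, the remainder decays like \<open>(N / (N + 1)) powr t\<close>.\<close>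

lemma dirichlet_coefficients_zero:
  fixes d :: "nat \<Rightarrow> complex"
  assumes bound: "\<And>n. n \<ge> 1 \<Longrightarrow> norm (d n) \<le> C * real n powr A"
    and sums: "\<And>s::real. s > \<theta> \<Longrightarrow> (\<lambda>n. dirichlet_term d (of_real s) n) sums 0"
    and "n \<ge> 1"
  shows "d n = 0"
proof (rule ccontr)
  assume "d n \<noteq> 0"
  define N where "N = (LEAST n. n \<ge> 1 \<and> d n \<noteq> 0)"
  have N: "N \<ge> 1" "d N \<noteq> 0"
    using LeastI[of "\<lambda>n. n \<ge> 1 \<and> d n \<noteq> 0" n] \<open>d n \<noteq> 0\<close> \<open>n \<ge> 1\<close> by (auto simp: N_def)
  have below: "d k = 0" if "k \<ge> 1" "k < N" for k
    using not_less_Least[of k "\<lambda>n. n \<ge> 1 \<and> d n \<noteq> 0"] that by (auto simp: N_def)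
  have C: "C \<ge> 0" using order_trans[OF norm_ge_zero bound[of 1]] by simp
  have nt: "norm (dirichlet_term d (of_real s) k) = norm (d k) * real k powr (- s)" for s k
    by (simp add: norm_dirichlet_term)
  \<comment> \<open>Right of \<open>s1\<close> the series is known to vanish, and the exponent
    \<open>A - s1\<close> is at most -2, so the majorant is summable.\<close>
  define s1 where "s1 = max \<theta> (A + 2)"
  define S where "S = (\<Sum>k. real k powr (A - s1))"
  have Ssum: "summable (\<lambda>k. real k powr (A - s1))"
    using summable_real_powr_iff[of "A - s1"] by (simp add: s1_def)
  define r where "r = real N / real (N + 1)"
  have r: "0 < r" "r < 1" using N by (auto simp: r_def)
  have key: "norm (d N) \<le> r powr t * (C * real N powr s1 * S)" if t: "t > 0" for t
  proof -
    let ?s = "s1 + t"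
    let ?f = "dirichlet_term d (of_real ?s)"
    have le: "norm (if k = N then 0 else ?f k) \<le> C * real (N + 1) powr (- t) * real k powr (A - s1)" for k
    proof (cases "k \<le> N")
      case True
      then have "(if k = N then 0 else ?f k) = 0"
        using below[of k] by (cases "k = 0") (auto simp: dirichlet_term_def)
      then show ?thesis using C by simp
    next
      case False
      then have k: "real k \<ge> real (N + 1)" "k \<ge> 1" by simp_all
      have "norm (?f k) \<le> C * real k powr A * real k powr (- ?s)"
        unfolding nt using bound[OF k(2)] by (intro mult_right_mono) auto
      also have "\<dots> = C * real k powr (- t) * real k powr (A - s1)"
        using k by (simp add: powr_add[symmetric] mult.assoc algebra_simps)
      also have "\<dots> \<le> C * real (N + 1) powr (- t) * real k powr (A - s1)"
        using k t C by (intro mult_right_mono mult_left_mono powr_mono2') auto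
      finally show ?thesis using False by simp
    qed
    have sm: "summable (\<lambda>k. C * real (N + 1) powr (- t) * real k powr (A - s1))"
      by (intro summable_mult Ssum)
    have "?f sums 0" using sums[of ?s] t by (simp add: s1_def)
    moreover have "(\<lambda>k. if k = N then ?f N else 0) sums ?f N" by (rule sums_single)
    ultimately have "(\<lambda>k. ?f k - (if k = N then ?f N else 0)) sums (0 - ?f N)" by (rule sums_diff)
    moreover have "(\<lambda>k. ?f k - (if k = N then ?f N else 0)) = (\<lambda>k. if k = N then 0 else ?f k)" by auto
    ultimately have "(\<lambda>k. if k = N then 0 else ?f k) sums (- ?f N)" by simp
    then have "norm (?f N) = norm (\<Sum>k. if k = N then 0 else ?f k)" by (simp add: sums_iff)
    also have "\<dots> \<le> (\<Sum>k. C * real (N + 1) powr (- t) * real k powr (A - s1))"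
      by (rule suminf_norm_le_suminf) (use le sm in auto)
    also have "\<dots> = C * real (N + 1) powr (- t) * S"
      unfolding S_def by (rule suminf_mult[OF Ssum])
    finally have "norm (d N) * real N powr (- ?s) \<le> C * real (N + 1) powr (- t) * S" by (simp only: nt)
    then have "norm (d N) * real N powr (- ?s) * real N powr ?s \<le> C * real (N + 1) powr (- t) * S * real N powr ?s"
      by (intro mult_right_mono) auto
    also have "norm (d N) * real N powr (- ?s) * real N powr ?s = norm (d N)"
      using N by (simp add: mult.assoc powr_add[symmetric])
    also have "C * real (N + 1) powr (- t) * S * real N powr ?s = r powr t * (C * real N powr s1 * S)"
      using N by (simp add: r_def powr_divide powr_add powr_minus field_simps)
    finally show ?thesis .
  qed
  have "((\<lambda>t. r powr t * (C * real N powr s1 * S)) \<longlongrightarrow> 0 * (C * real N powr s1 * S)) at_top"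
    using r by (intro tendsto_mult tendsto_const) real_asymp
  moreover have "\<forall>\<^sub>F t in at_top. norm (d N) \<le> r powr t * (C * real N powr s1 * S)"
    using eventually_gt_at_top[of 0] by eventually_elim (rule key)
  ultimately have "norm (d N) \<le> 0 * (C * real N powr s1 * S)"
    by (rule tendsto_lowerbound) simp
  then show False using N by simp
qed

lemma dirichlet_poly_sums:
  assumes "a \<in> dirichlet_polys"
  shows "dirichlet_term a s sums dirichlet_eval a s"
proof -
  have "summable (dirichlet_term a s)"
    by (rule summable_finite[OF finite_support[OF assms]]) (auto simp: dirichlet_term_def)
  then show ?thesis by (simp add: dirichlet_eval_def summable_sums)
qed

text \<open>The coefficient bound makes the coefficients Cauchy, uniformly after division by
  \<open>n powr A\<close>; let \<open>b\<close> be their limit. Far to the right the point values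
  then converge to the series of \<open>b\<close> as well as to that of \<open>a\<close>, and
  uniqueness identifies the two.\<close>

lemma bergman_Cauchy_coeff_tendsto:
  assumes q: "q > 0" and \<beta>: "\<beta> > -1" and P: "\<And>k. P k \<in> dirichlet_polys"
    and Cauchy: "bergman_Cauchy q \<beta> P"
    and a: "\<And>s. s \<in> half_plane (1/2) \<Longrightarrow> summable (dirichlet_term a s)"
    and lim: "\<And>s. s \<in> half_plane (1/2) \<Longrightarrow> (\<lambda>k. dirichlet_eval (P k) s) \<longlonglongrightarrow> dirichlet_eval a s"
    and n: "n \<ge> 1"
  shows "(\<lambda>k. P k n) \<longlonglongrightarrow> a n"
proof -
  define A where "A = 2 + 1 / q"
  have A: "A > 0" using q by (simp add: A_def add_pos_pos)
  obtain C where C: "C \<ge> 0" and coeff: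
    "\<And>a n. a \<in> dirichlet_polys \<Longrightarrow> n \<ge> 1 \<Longrightarrow> norm (a n) \<le> C * real n powr A * bergman_norm q \<beta> a"
    using coeff_bergman_bound[OF q \<beta>] unfolding A_def by metis
  have close: "\<exists>N. \<forall>k\<ge>N. \<forall>l\<ge>N. \<forall>n\<ge>1. norm (P k n - P l n) \<le> e * real n powr A" if e: "e > 0" for e
  proof -
    have "e / (C + 1) > 0" using e C by simp
    then obtain N where N: "\<And>k l. k \<ge> N \<Longrightarrow> l \<ge> N \<Longrightarrow> bergman_norm q \<beta> (\<lambda>n. P k n - P l n) < e / (C + 1)"
      using Cauchy unfolding bergman_Cauchy_def by meson
    have "norm (P k n - P l n) \<le> e * real n powr A" if kl: "k \<ge> N" "l \<ge> N" and n: "n \<ge> 1" for k l n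
    proof -
      have "norm (P k n - P l n) \<le> C * real n powr A * bergman_norm q \<beta> (\<lambda>n. P k n - P l n)"
        using coeff[OF dirichlet_polys_diff[OF P P] n] .
      also have "\<dots> \<le> C * real n powr A * (e / (C + 1))"
        using N[OF kl] C by (intro mult_left_mono) auto
      also have "\<dots> = (C / (C + 1)) * (e * real n powr A)" by simp
      also have "\<dots> \<le> 1 * (e * real n powr A)" using C e by (intro mult_right_mono) auto
      finally show ?thesis by simp
    qed
    then show ?thesis by blast
  qed
  have "convergent (\<lambda>k. P k n)" if n: "n \<ge> 1" for n
  proof (rule Cauchy_convergent, rule metric_CauchyI)
    fix e :: real assume e: "e > 0"
    have "e / (2 * real n powr A) > 0" using e n by simp
    from close[OF this] obtain N where N: "\<And>k l. k \<ge> N \<Longrightarrow> l \<ge> N \<Longrightarrow> norm (P k n - P l n) \<le> e / (2 * real n powr A) * real n powr A"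
      using n by blast
    have "e / (2 * real n powr A) * real n powr A = e / 2" using n by simp
    then have "dist (P k n) (P l n) < e" if "k \<ge> N" "l \<ge> N" for k l
      using N[OF that] e unfolding dist_norm by linarith
    then show "\<exists>M. \<forall>m\<ge>M. \<forall>k\<ge>M. dist (P m n) (P k n) < e" by blast
  qed
  then have "\<exists>b. \<forall>n\<ge>1. (\<lambda>k. P k n) \<longlonglongrightarrow> b n"
    by (intro exI[of _ "\<lambda>n. lim (\<lambda>k. P k n)"]) (auto simp: convergent_LIMSEQ_iff)
  then obtain b where b: "\<And>n. n \<ge> 1 \<Longrightarrow> (\<lambda>k. P k n) \<longlonglongrightarrow> b n" by blast
  have close': "\<exists>N. \<forall>k\<ge>N. \<forall>n\<ge>1. norm (P k n - b n) \<le> e * real n powr A" if e: "e > 0" for e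
  proof -
    obtain N where N: "\<And>k l n. k \<ge> N \<Longrightarrow> l \<ge> N \<Longrightarrow> n \<ge> 1 \<Longrightarrow> norm (P k n - P l n) \<le> e * real n powr A"
      using close[OF e] by blast
    have "norm (P k n - b n) \<le> e * real n powr A" if "k \<ge> N" "n \<ge> 1" for k n
    proof (rule tendsto_upperbound)
      show "(\<lambda>l. norm (P k n - P l n)) \<longlonglongrightarrow> norm (P k n - b n)"
        by (intro tendsto_intros b that)
      show "\<forall>\<^sub>F l in sequentially. norm (P k n - P l n) \<le> e * real n powr A"
        using eventually_ge_at_top[of N] by eventually_elim (use N that in auto)
    qed simp
    then show ?thesis by blast
  qed
  have nt: "norm (dirichlet_term d (of_real s) k) = norm (d k) * real k powr (- s)" for s k d
    by (simp add: norm_dirichlet_term)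
  have bA: "\<exists>B. \<forall>n\<ge>1. norm (b n) \<le> B * real n powr A"
  proof -
    obtain N where N: "\<And>n. n \<ge> 1 \<Longrightarrow> norm (P N n - b n) \<le> 1 * real n powr A"
      using close'[of 1] by auto
    have "norm (b n) \<le> (1 + C * bergman_norm q \<beta> (P N)) * real n powr A" if "n \<ge> 1" for n
      using N[OF that] coeff[OF P that, of N] norm_triangle_ineq2[of "b n" "P N n"]
      by (simp add: algebra_simps norm_minus_commute)
    then show ?thesis by blast
  qed
  then obtain B where B: "\<And>n. n \<ge> 1 \<Longrightarrow> norm (b n) \<le> B * real n powr A" by blast
  \<comment> \<open>For \<open>s > A + 2\<close> the weights \<open>n powr A\<close> are summable
    against \<open>n powr (- s)\<close>, so closeness of coefficients passes to the sums.\<close>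
  have bsums: "dirichlet_term b (of_real s) sums dirichlet_eval a (of_real s)" if s: "s > A + 2" for s :: real
  proof -
    have su: "summable (\<lambda>k. real k powr (A - s))" using summable_real_powr_iff[of "A - s"] s by simp
    have mem: "of_real s \<in> half_plane (1/2)" using s A by (simp add: half_plane_def)
    have ble: "norm (dirichlet_term d (of_real s) k) \<le> e * real k powr (A - s)"
      if "\<And>n. n \<ge> 1 \<Longrightarrow> norm (d n) \<le> e * real n powr A" for d k e
    proof (cases "k = 0")
      case False
      then have "norm (d k) * real k powr (- s) \<le> e * real k powr A * real k powr (- s)"
        using that[of k] by (intro mult_right_mono) auto
      also have "\<dots> = e * real k powr (A - s)" by (simp add: mult.assoc powr_add[symmetric])
      finally show ?thesis by (simp add: nt)
    qed (simp add: nt)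
    have bs: "summable (dirichlet_term b (of_real s))"
      by (rule summable_comparison_test'[OF summable_mult[OF su, of B], of 0]) (use ble[OF B] in auto)
    have "(\<lambda>k. dirichlet_eval (P k) (of_real s)) \<longlonglongrightarrow> suminf (dirichlet_term b (of_real s))"
    proof (rule LIMSEQ_I)
      fix e :: real assume e: "e > 0"
      define S where "S = (\<Sum>k. real k powr (A - s))"
      have S: "S \<ge> 0" unfolding S_def by (intro suminf_nonneg su) auto
      have e': "e / (S + 1) > 0" using e S by simp
      obtain N where N: "\<And>k n. k \<ge> N \<Longrightarrow> n \<ge> 1 \<Longrightarrow> norm (P k n - b n) \<le> e / (S + 1) * real n powr A"
        using close'[OF e'] by blast
      have "norm (dirichlet_eval (P k) (of_real s) - suminf (dirichlet_term b (of_real s))) < e" if k: "k \<ge> N" for k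
      proof -
        have "(\<lambda>n. dirichlet_term (P k) (of_real s) n - dirichlet_term b (of_real s) n) sums
           (dirichlet_eval (P k) (of_real s) - suminf (dirichlet_term b (of_real s)))"
          by (intro sums_diff dirichlet_poly_sums P summable_sums bs)
        also have "(\<lambda>n. dirichlet_term (P k) (of_real s) n - dirichlet_term b (of_real s) n)
            = dirichlet_term (\<lambda>n. P k n - b n) (of_real s)"
          by (simp add: dirichlet_term_def fun_eq_iff algebra_simps)
        finally have "norm (dirichlet_eval (P k) (of_real s) - suminf (dirichlet_term b (of_real s)))
           = norm (suminf (dirichlet_term (\<lambda>n. P k n - b n) (of_real s)))" by (simp add: sums_iff)
        also have "\<dots> \<le> (\<Sum>n. e / (S + 1) * real n powr (A - s))"
          by (rule suminf_norm_le_suminf) (use ble[of "\<lambda>n. P k n - b n" "e / (S + 1)"] N k su in \<open>auto intro!: summable_divide summable_mult\<close>)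
        also have "\<dots> = e / (S + 1) * S" unfolding S_def by (rule suminf_mult[OF su])
        also have "\<dots> < e" using e S by (simp add: field_simps)
        finally show ?thesis .
      qed
      then show "\<exists>N. \<forall>k\<ge>N. norm (dirichlet_eval (P k) (of_real s) - suminf (dirichlet_term b (of_real s))) < e" by blast
    qed
    with lim[OF mem] have "dirichlet_eval a (of_real s) = suminf (dirichlet_term b (of_real s))"
      by (rule LIMSEQ_unique)
    then show ?thesis using bs by (simp add: summable_sums)
  qed
  \<comment> \<open>Uniqueness needs polynomial growth of \<open>a\<close> too. It follows from
    convergence at the point 1, which makes the terms there bounded.\<close>
  have aA: "\<exists>B. \<forall>n\<ge>1. norm (a n) \<le> B * real n powr A"
  proof -
    have "summable (dirichlet_term a (of_real 1))" by (rule a) (simp add: half_plane_def)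
    then obtain D where D: "\<And>n. norm (dirichlet_term a (of_real 1) n) \<le> D"
      using summable_imp_bounded[of "dirichlet_term a (of_real 1)"] unfolding bounded_iff by auto
    have "norm (a n) \<le> D * real n powr A" if "n \<ge> 1" for n
    proof -
      have "norm (a n) \<le> D * real n powr 1"
        using D[of n] that unfolding nt by (simp add: powr_minus field_simps)
      also have "\<dots> \<le> D * real n powr A"
        using that A q order_trans[OF norm_ge_zero D] unfolding A_def by (intro mult_left_mono powr_mono) auto
      finally show ?thesis .
    qed
    then show ?thesis by blast
  qed
  then obtain D where D: "\<And>n. n \<ge> 1 \<Longrightarrow> norm (a n) \<le> D * real n powr A" by blast
  have "a n - b n = 0"
  proof (rule dirichlet_coefficients_zero[where d = "\<lambda>n. a n - b n" and C = "D + B" and A = A and \<theta> = "A + 2"])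
    fix n :: nat assume "n \<ge> 1"
    then show "norm (a n - b n) \<le> (D + B) * real n powr A"
      using norm_triangle_ineq4[of "a n" "b n"] B[of n] D[of n] by (simp add: algebra_simps)
  next
    fix s :: real assume s: "s > A + 2"
    have "dirichlet_term a (of_real s) sums dirichlet_eval a (of_real s)"
      unfolding dirichlet_eval_def using s A by (intro summable_sums a) (simp add: half_plane_def)
    from sums_diff[OF this bsums[OF s]]
    show "dirichlet_term (\<lambda>n. a n - b n) (of_real s) sums 0"
      by (simp add: dirichlet_term_def[abs_def] algebra_simps)
  qed (rule n)
  then show ?thesis using b[OF n] by simp
qed

section \<open>Restriction to finitely many primes\<close>

lemma bohr_lift_cong:
  assumes "\<And>n. n \<ge> 1 \<Longrightarrow> a n = b n"
  shows "bohr_lift a z = bohr_lift b z"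
  unfolding bohr_lift_def using assms by (intro sum.cong) auto

text \<open>The integers that involve only primes with index in \<open>S\<close>. The number 1 lies
  in every block, so blocks of disjoint sets of primes are disjoint only from 2 on.\<close>

definition prime_block :: "nat set \<Rightarrow> nat set" where
  "prime_block S = {n. n \<ge> 1 \<and> (\<forall>j. prime_exponent j n \<noteq> 0 \<longrightarrow> j \<in> S)}"

definition block_part :: "nat set \<Rightarrow> (nat \<Rightarrow> complex) \<Rightarrow> nat \<Rightarrow> complex" where
  "block_part S a n = (if n \<in> prime_block S then a n else 0)"

lemma block_part_polys: "a \<in> dirichlet_polys \<Longrightarrow> block_part S a \<in> dirichlet_polys"
  by (erule dirichlet_polys_subset) (auto simp: block_part_def split: if_splits)

lemma block_part_shift: "dirichlet_shift \<sigma> (block_part S a) = block_part S (dirichlet_shift \<sigma> a)"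
  by (auto simp: dirichlet_shift_def block_part_def)

lemma block_part_diff: "block_part S (\<lambda>n. a n - b n) = (\<lambda>n. block_part S a n - block_part S b n)"
  by (auto simp: block_part_def)

text \<open>\<open>S\<close> is arbitrary: only finitely many primes occur in \<open>a\<close>, and
  those outside \<open>S\<close> are removed one at a time.\<close>

lemma hardy_power_block_part:
  assumes a: "a \<in> dirichlet_polys" and q: "q > 0"
  shows "hardy_power q (block_part S a) \<le> hardy_power q a"
proof -
  let ?V = "\<Union>m\<in>{m. a m \<noteq> 0} - {0}. {j. prime_exponent j m \<noteq> 0}"
  let ?b = "\<lambda>m. if \<forall>j\<in>?V - S. prime_exponent j m = 0 then a m else 0"
  have V: "finite ?V" using a finite_support finite_prime_exponent by auto
  have "block_part S a n = ?b n" if n: "n \<ge> 1" for n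
  proof (cases "a n = 0")
    case False
    have "(\<forall>j\<in>?V - S. prime_exponent j n = 0) \<longleftrightarrow> (\<forall>j. prime_exponent j n \<noteq> 0 \<longrightarrow> j \<in> S)"
    proof
      assume *: "\<forall>j\<in>?V - S. prime_exponent j n = 0"
      show "\<forall>j. prime_exponent j n \<noteq> 0 \<longrightarrow> j \<in> S"
      proof (intro allI impI, rule ccontr)
        fix j assume j: "prime_exponent j n \<noteq> 0" "j \<notin> S"
        have "j \<in> ?V" using n j False by (intro UN_I[of n]) auto
        then have "j \<in> ?V - S" using j(2) by (rule DiffI)
        with * have "prime_exponent j n = 0" by (rule bspec)
        then show False using j(1) by (rule notE[rotated])
      qed
    qed auto
    then show ?thesis using n by (simp only: block_part_def prime_block_def mem_Collect_eq simp_thms)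
  qed (simp add: block_part_def)
  then have "hardy_power q (block_part S a) = hardy_power q ?b"
    unfolding hardy_power_def by (subst bohr_lift_cong) auto
  also have "\<dots> \<le> hardy_power q a"
    using V by (intro hardy_power_drop_primes a q) auto
  finally show ?thesis .
qed

lemma bergman_power_block_part:
  assumes a: "a \<in> dirichlet_polys" and q: "q > 0"
  shows "bergman_power q \<beta> (block_part S a) \<le> bergman_power q \<beta> a"
  unfolding bergman_power_def block_part_shift
  by (intro nn_integral_mono hardy_power_block_part dirichlet_shift_polys a q)

section \<open>Point evaluation after a horizontal shift, for finitely many primes\<close>

definition block_const :: "nat set \<Rightarrow> real \<Rightarrow> real" where
  "block_const S \<epsilon> = (\<Prod>j\<in>S. 1 / (1 - real (nth_prime j) powr (- \<epsilon>)))"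

lemma nth_prime_powr_less_1: "\<epsilon> > 0 \<Longrightarrow> real (nth_prime j) powr (- \<epsilon>) < 1"
  using nth_prime_gt[of j] powr_less_mono[of "- \<epsilon>" 0 "real (nth_prime j)"] by simp

lemma block_const_pos: "\<epsilon> > 0 \<Longrightarrow> block_const S \<epsilon> > 0"
  unfolding block_const_def by (intro prod_pos) (auto simp: nth_prime_powr_less_1)

text \<open>An additional shift by at least \<epsilon> moves the torus into the polydisc of radii
  \<open>nth_prime j powr (- \<epsilon>)\<close>, where point evaluation costs
  \<open>block_const\<close>.\<close>

lemma bohr_shift_point_bound:
  assumes b: "b \<in> dirichlet_polys" and q: "q > 0" and S: "finite S" and bS: "\<And>n. n \<ge> 1 \<Longrightarrow> b n \<noteq> 0 \<Longrightarrow> n \<in> prime_block S"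
    and z: "\<And>j. norm (z j) \<le> 1" and \<epsilon>: "\<epsilon> > 0" "\<sigma> + \<epsilon> \<le> \<eta>"
  shows "ennreal (norm (bohr_lift (dirichlet_shift \<eta> b) z) powr q)
    \<le> ennreal (block_const S \<epsilon>) * hardy_power q (dirichlet_shift \<sigma> b)"
proof -
  let ?w = "\<lambda>j. of_real (real (nth_prime j) powr (- (\<eta> - \<sigma>))) * z j"
  have "dirichlet_shift (\<eta> - \<sigma>) (dirichlet_shift \<sigma> b) = dirichlet_shift \<eta> b"
    by (auto simp: dirichlet_shift_def fun_eq_iff powr_add[symmetric] simp flip: of_real_mult)
  then have "bohr_lift (dirichlet_shift \<eta> b) z = bohr_lift (dirichlet_shift \<sigma> b) ?w"
    using bohr_lift_shift[OF dirichlet_shift_polys[OF b], of "\<eta> - \<sigma>" \<sigma> z] by simp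
  moreover have "ennreal (norm (bohr_lift (dirichlet_shift \<sigma> b) ?w) powr q)
    \<le> ennreal (\<Prod>j\<in>S. 1 / (1 - real (nth_prime j) powr (- \<epsilon>))) * hardy_power q (dirichlet_shift \<sigma> b)"
  proof (rule bohr_point_bound[OF dirichlet_shift_polys[OF b] q S])
    fix n j assume "n \<ge> 1" "dirichlet_shift \<sigma> b n \<noteq> 0" "prime_exponent j n \<noteq> 0"
    then show "j \<in> S" using bS[of n] by (auto simp: dirichlet_shift_def prime_block_def)
  next
    fix j assume "j \<in> S"
    have "norm (?w j) \<le> real (nth_prime j) powr (- (\<eta> - \<sigma>)) * 1"
      unfolding norm_mult using z[of j] by (intro mult_mono) auto
    also have "\<dots> \<le> real (nth_prime j) powr (- \<epsilon>)"
      using nth_prime_gt[of j] \<epsilon> by (simp add: powr_mono)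
    finally show "norm (?w j) \<le> real (nth_prime j) powr (- \<epsilon>) \<and> real (nth_prime j) powr (- \<epsilon>) < 1"
      using nth_prime_powr_less_1[OF \<epsilon>(1)] by simp
  qed
  ultimately show ?thesis by (simp add: block_const_def)
qed

text \<open>The previous bound averaged over all \<sigma> in \<open>{0<..\<eta> / 2}\<close>, each
  of which leaves a gap of at least \<open>\<eta> / 2\<close> to \<eta>.\<close>

lemma bohr_shift_bergman_bound:
  assumes b: "b \<in> dirichlet_polys" and q: "q > 0" and S: "finite S" and bS: "\<And>n. n \<ge> 1 \<Longrightarrow> b n \<noteq> 0 \<Longrightarrow> n \<in> prime_block S"
    and z: "\<And>j. norm (z j) \<le> 1" and \<eta>: "\<eta> > 0"
  shows "ennreal (norm (bohr_lift (dirichlet_shift \<eta> b) z) powr q) * emeasure (bergman_weight \<beta>) {0<..\<eta> / 2}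
    \<le> ennreal (block_const S (\<eta> / 2)) * bergman_power q \<beta> b"
proof -
  let ?c = "ennreal (norm (bohr_lift (dirichlet_shift \<eta> b) z) powr q)"
  have "?c * emeasure (bergman_weight \<beta>) {0<..\<eta> / 2} = (\<integral>\<^sup>+\<sigma>. ?c * indicator {0<..\<eta> / 2} \<sigma> \<partial>bergman_weight \<beta>)"
    by (subst nn_integral_cmult_indicator) auto
  also have "\<dots> \<le> (\<integral>\<^sup>+\<sigma>. ennreal (block_const S (\<eta> / 2)) * hardy_power q (dirichlet_shift \<sigma> b) \<partial>bergman_weight \<beta>)"
  proof (rule nn_integral_mono)
    fix \<sigma> :: real
    show "?c * indicator {0<..\<eta> / 2} \<sigma> \<le> ennreal (block_const S (\<eta> / 2)) * hardy_power q (dirichlet_shift \<sigma> b)"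
    proof (cases "\<sigma> \<in> {0<..\<eta> / 2}")
      case True
      have "?c \<le> ennreal (block_const S (\<eta> / 2)) * hardy_power q (dirichlet_shift \<sigma> b)"
        using True \<eta> by (intro bohr_shift_point_bound b q S bS z) auto
      then show ?thesis using True by simp
    qed auto
  qed
  also have "\<dots> = ennreal (block_const S (\<eta> / 2)) * bergman_power q \<beta> b"
    unfolding bergman_power_def using b by (intro nn_integral_cmult) measurable
  finally show ?thesis .
qed

text \<open>\<open>A\<close> is given only as a coefficientwise limit, while the supports of the
  \<open>P k\<close> may grow. Half of the shift makes the differences of the \<open>P k\<close>
  uniformly small, hence by Parseval square-summably small; that estimate survives the
  coefficientwise limit on each finite set of indices. The other half turns the resulting l^2 bound
  back into a pointwise one.\<close>

lemma bohr_lift_shift_block_tendsto: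
  assumes q: "q > 0" and \<beta>: "\<beta> > -1" and P: "\<And>k. P k \<in> dirichlet_polys"
    and Cauchy: "bergman_Cauchy q \<beta> P" and S: "finite S"
    and PS: "\<And>k n. n \<ge> 1 \<Longrightarrow> P k n \<noteq> 0 \<Longrightarrow> n \<in> prime_block S"
    and A: "A \<in> dirichlet_polys" and AS: "\<And>n. n \<ge> 1 \<Longrightarrow> A n \<noteq> 0 \<Longrightarrow> n \<in> prime_block S"
    and lim: "\<And>n. n \<ge> 1 \<Longrightarrow> (\<lambda>k. P k n) \<longlonglongrightarrow> A n"
    and \<sigma>: "\<sigma> > 0" and z: "\<And>j. norm (z j) \<le> 1"
  shows "(\<lambda>k. bohr_lift (dirichlet_shift \<sigma> (P k)) z) \<longlonglongrightarrow> bohr_lift (dirichlet_shift \<sigma> A) z"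
proof (rule LIMSEQ_I)
  fix e :: real assume e: "e > 0"
  interpret w: prob_space "bergman_weight \<beta>" by (rule prob_space_bergman_weight[OF \<beta>])
  interpret t: prob_space torus_measure by (rule prob_space_torus)
  define \<eta> where "\<eta> = \<sigma> / 2"
  have \<eta>: "\<eta> > 0" using \<sigma> by (simp add: \<eta>_def)
  define m where "m = measure (bergman_weight \<beta>) {0<..\<eta> / 2}"
  have m: "m > 0" using bergman_weight_interval_pos[OF \<beta>, of "\<eta> / 2"] \<eta>
    by (simp add: m_def w.emeasure_eq_measure)
  define K where "K = block_const S (\<eta> / 2)"
  have K: "K > 0" using \<eta> by (simp add: K_def block_const_pos)
  define L where "L = block_const S \<eta>"
  have L: "L > 0" using \<eta> by (simp add: L_def block_const_pos)
  \<comment> \<open>Chosen backwards: the last evaluation multiplies squares by \<open>L\<close>,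
    and \<open>L * \<epsilon>^2 = (e / 2)^2\<close>. In the same way \<delta> is such that the
    Bergman bound with constants \<open>K\<close> and \<open>m\<close> returns exactly
    \<open>\<epsilon> powr q\<close>.\<close>
  define \<epsilon> where "\<epsilon> = e / (2 * sqrt L)"
  have \<epsilon>: "\<epsilon> > 0" using e L by (simp add: \<epsilon>_def)
  define \<delta> where "\<delta> = (\<epsilon> powr q * m / K) powr (1 / q)"
  have \<delta>: "\<delta> > 0" using \<epsilon> m K by (simp add: \<delta>_def)
  have \<delta>q: "\<delta> powr q = \<epsilon> powr q * m / K" using q \<epsilon> m K by (simp add: \<delta>_def powr_powr)
  obtain N where N: "\<And>k l. k \<ge> N \<Longrightarrow> l \<ge> N \<Longrightarrow> bergman_norm q \<beta> (\<lambda>n. P k n - P l n) < \<delta>"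
    using Cauchy \<delta> unfolding bergman_Cauchy_def by meson
  have D: "(\<lambda>n. P k n - P l n) \<in> dirichlet_polys" for k l by (intro dirichlet_polys_diff P)
  have unif: "norm (bohr_lift (dirichlet_shift \<eta> (\<lambda>n. P k n - P l n)) x) \<le> \<epsilon>"
    if kl: "k \<ge> N" "l \<ge> N" and x: "\<And>j. norm (x j) \<le> 1" for k l x
  proof -
    let ?v = "norm (bohr_lift (dirichlet_shift \<eta> (\<lambda>n. P k n - P l n)) x)"
    have "ennreal (?v powr q) * emeasure (bergman_weight \<beta>) {0<..\<eta> / 2}
        \<le> ennreal K * bergman_power q \<beta> (\<lambda>n. P k n - P l n)"
      unfolding K_def
    proof (rule bohr_shift_bergman_bound[OF D q S _ x \<eta>])
      fix n :: nat assume "n \<ge> 1" "P k n - P l n \<noteq> 0"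
      then show "n \<in> prime_block S" using PS[of n k] PS[of n l] by (cases "P k n = 0") auto
    qed
    also have "\<dots> \<le> ennreal K * ennreal (\<delta> powr q)"
      using N[OF kl] \<delta> bergman_norm_less_iff[OF D q \<beta> \<delta>] by (intro mult_left_mono) auto
    finally have "?v powr q * m \<le> K * \<delta> powr q"
      using K m by (simp add: w.emeasure_eq_measure m_def[symmetric] ennreal_mult'[symmetric] ennreal_le_iff)
    then have "?v powr q \<le> \<epsilon> powr q" using K m by (simp add: \<delta>q)
    then show ?thesis using q \<epsilon> by (meson powr_less_mono2 linorder_not_less norm_ge_zero less_imp_le)
  qed
  have fin: "(\<Sum>n\<in>T. (norm (dirichlet_shift \<eta> (\<lambda>n. P k n - P l n) n))\<^sup>2) \<le> \<epsilon>\<^sup>2"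
    if kl: "k \<ge> N" "l \<ge> N" and T: "finite T" "0 \<notin> T" for k l T
  proof -
    let ?d = "dirichlet_shift \<eta> (\<lambda>n. P k n - P l n)"
    let ?U = "T \<union> ({n. ?d n \<noteq> 0} - {0})"
    have U: "finite ?U" using T finite_support[OF dirichlet_shift_polys[OF D]] by auto
    have "ennreal (\<Sum>n\<in>T. (norm (?d n))\<^sup>2) \<le> ennreal (\<Sum>n\<in>?U. (norm (?d n))\<^sup>2)"
      using U by (intro ennreal_leI sum_mono2) auto
    also have "\<dots> = hardy_power 2 ?d"
      using U T by (intro parseval_torus[symmetric]) auto
    also have "\<dots> \<le> (\<integral>\<^sup>+x. ennreal (\<epsilon>\<^sup>2) \<partial>torus_measure)"
      unfolding hardy_power_def
      by (rule nn_integral_mono_AE, use AE_torus_norm in eventually_elim)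
         (auto intro!: power_mono unif kl ennreal_leI simp: powr_numeral)
    also have "\<dots> = ennreal (\<epsilon>\<^sup>2)" using t.emeasure_space_1 by simp
    finally show ?thesis by (simp add: ennreal_le_iff)
  qed
  have "norm (bohr_lift (dirichlet_shift \<sigma> (P k)) z - bohr_lift (dirichlet_shift \<sigma> A) z) < e" if k: "k \<ge> N" for k
  proof -
    define d where "d = (\<lambda>n. P k n - A n)"
    have dp: "d \<in> dirichlet_polys" unfolding d_def by (intro dirichlet_polys_diff P A)
    let ?T = "{n. d n \<noteq> 0} - {0}"
    have T: "finite ?T" using finite_support[OF dp] by auto
    have "(\<Sum>n\<in>?T. (norm (dirichlet_shift \<eta> d n))\<^sup>2) \<le> \<epsilon>\<^sup>2"
    proof (rule tendsto_upperbound)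
      show "(\<lambda>l. \<Sum>n\<in>?T. (norm (dirichlet_shift \<eta> (\<lambda>n. P k n - P l n) n))\<^sup>2)
          \<longlonglongrightarrow> (\<Sum>n\<in>?T. (norm (dirichlet_shift \<eta> d n))\<^sup>2)"
        unfolding dirichlet_shift_def d_def by (intro tendsto_intros lim) auto
      show "\<forall>\<^sub>F l in sequentially. (\<Sum>n\<in>?T. (norm (dirichlet_shift \<eta> (\<lambda>n. P k n - P l n) n))\<^sup>2) \<le> \<epsilon>\<^sup>2"
        using eventually_ge_at_top[of N] by eventually_elim (use fin[OF k _ T] in auto)
    qed simp
    then have h2: "hardy_power 2 (dirichlet_shift \<eta> d) \<le> ennreal (\<epsilon>\<^sup>2)"
      by (subst parseval_torus[OF T]) (auto simp: dirichlet_shift_def intro: ennreal_leI)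
    have "ennreal (norm (bohr_lift (dirichlet_shift \<sigma> d) z) powr 2)
       \<le> ennreal L * hardy_power 2 (dirichlet_shift \<eta> d)"
      unfolding L_def
    proof (rule bohr_shift_point_bound[OF dp _ S _ z \<eta>])
      fix n :: nat assume "n \<ge> 1" "d n \<noteq> 0"
      then show "n \<in> prime_block S" using PS[of n k] AS[of n] by (cases "P k n = 0") (auto simp: d_def)
    qed (auto simp: \<eta>_def)
    also have "\<dots> \<le> ennreal L * ennreal (\<epsilon>\<^sup>2)" by (intro mult_left_mono h2) auto
    finally have "(norm (bohr_lift (dirichlet_shift \<sigma> d) z))\<^sup>2 \<le> L * \<epsilon>\<^sup>2"
      using L by (simp add: ennreal_mult'[symmetric] ennreal_le_iff powr_numeral)
    also have "\<dots> = (e / 2)\<^sup>2" using L by (simp add: \<epsilon>_def power_divide power_mult_distrib)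
    finally have "norm (bohr_lift (dirichlet_shift \<sigma> d) z) \<le> e / 2"
      by (rule power2_le_imp_le) (use e in simp)
    moreover have "dirichlet_shift \<sigma> d = (\<lambda>n. dirichlet_shift \<sigma> (P k) n - dirichlet_shift \<sigma> A n)"
      by (simp add: d_def dirichlet_shift_def fun_eq_iff algebra_simps)
    ultimately show ?thesis using e by (simp add: bohr_lift_diff dirichlet_shift_polys P A)
  qed
  then show "\<exists>N. \<forall>k\<ge>N. norm (bohr_lift (dirichlet_shift \<sigma> (P k)) z - bohr_lift (dirichlet_shift \<sigma> A) z) < e" by blast
qed

lemma bergman_space_approx:
  assumes q: "q > 0" and \<beta>: "\<beta> > -1" and a: "a \<in> bergman_space q \<beta>"
  shows "\<exists>P B. (\<forall>k. P k \<in> dirichlet_polys) \<and> bergman_Cauchy q \<beta> P \<and> (\<forall>n\<ge>1. (\<lambda>k. P k n) \<longlonglongrightarrow> a n) \<and>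
    (\<forall>\<^sub>F k in sequentially. bergman_power q \<beta> (P k) \<le> ennreal B)"
proof -
  from a have "\<exists>P. (\<forall>k. P k \<in> dirichlet_polys) \<and> bergman_Cauchy q \<beta> P \<and>
       (\<forall>s\<in>half_plane (1/2). (\<lambda>k. dirichlet_eval (P k) s) \<longlonglongrightarrow> dirichlet_eval a s)"
    unfolding bergman_space_def mem_Collect_eq by (rule conjunct2)
  then obtain P where PP: "(\<forall>k. P k \<in> dirichlet_polys) \<and> bergman_Cauchy q \<beta> P \<and>
       (\<forall>s\<in>half_plane (1/2). (\<lambda>k. dirichlet_eval (P k) s) \<longlonglongrightarrow> dirichlet_eval a s)" ..
  have a_sum: "summable (dirichlet_term a s)" if "s \<in> half_plane (1/2)" for s
    using a that unfolding bergman_space_def mem_Collect_eq by (elim conjE bspec)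
  have P: "P k \<in> dirichlet_polys" for k using PP by simp
  have Cauchy: "bergman_Cauchy q \<beta> P" using PP by simp
  have lim: "(\<lambda>k. dirichlet_eval (P k) s) \<longlonglongrightarrow> dirichlet_eval a s" if "s \<in> half_plane (1/2)" for s
    using PP that by simp
  have coeff: "(\<lambda>k. P k n) \<longlonglongrightarrow> a n" if "n \<ge> 1" for n
    by (rule bergman_Cauchy_coeff_tendsto[OF q \<beta> P Cauchy a_sum lim that])
  obtain N where N: "\<And>k l. k \<ge> N \<Longrightarrow> l \<ge> N \<Longrightarrow> bergman_norm q \<beta> (\<lambda>n. P k n - P l n) < 1"
    using Cauchy zero_less_one unfolding bergman_Cauchy_def by meson
  \<comment> \<open>Late approximants differ from \<open>P N\<close> by at most 1, so one use of the
    quasi-triangle inequality bounds them all. The value is finite since \<open>P N\<close> is a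
    polynomial.\<close>
  define B where "B = enn2real (ennreal (2 powr q) * (bergman_power q \<beta> (P N) + 1))"
  have B: "ennreal (2 powr q) * (bergman_power q \<beta> (P N) + 1) = ennreal B"
    using bergman_power_finite[OF P q \<beta>, of N]
    by (simp add: B_def ennreal_mult_less_top)
  have PB: "bergman_power q \<beta> (P k) \<le> ennreal B" if k: "k \<ge> N" for k
  proof -
    have "bergman_power q \<beta> (\<lambda>n. P N n - P k n) < ennreal (1 powr q)"
      using N[of N k] k bergman_norm_less_iff[OF dirichlet_polys_diff[OF P P] q \<beta>, of 1 N k] by simp
    then have "bergman_power q \<beta> (\<lambda>n. P N n - P k n) \<le> 1" by simp
    moreover have "bergman_power q \<beta> (\<lambda>n. P N n - (P N n - P k n))
        \<le> ennreal (2 powr q) * (bergman_power q \<beta> (P N) + bergman_power q \<beta> (\<lambda>n. P N n - P k n))"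
      by (intro bergman_power_diff_le dirichlet_polys_diff P q)
    ultimately have "bergman_power q \<beta> (\<lambda>n. P N n - (P N n - P k n)) \<le> ennreal (2 powr q) * (bergman_power q \<beta> (P N) + 1)"
      by (elim order_trans) (intro mult_left_mono add_left_mono, auto)
    then show ?thesis using B by simp
  qed
  then have "\<forall>\<^sub>F k in sequentially. bergman_power q \<beta> (P k) \<le> ennreal B"
    by (auto simp: eventually_sequentially)
  then show ?thesis using PP coeff by (intro exI[of _ P] exI[of _ B] conjI allI impI) simp_all
qed

text \<open>Block parts of the approximants are Cauchy and satisfy the same bound, by contractivity.
  On a finite block their lifts converge pointwise after each positive shift, so Fatou, over the
  torus and then over \<sigma>, transfers the bound to \<open>a\<close>. As \<open>B\<close> comes
  from the approximants, it serves all blocks at once.\<close>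

lemma bergman_space_block_bound:
  assumes q: "q > 0" and \<beta>: "\<beta> > -1" and a: "a \<in> bergman_space q \<beta>"
  shows "\<exists>B::real. \<forall>S. finite S \<longrightarrow> block_part S a \<in> dirichlet_polys \<longrightarrow> bergman_power q \<beta> (block_part S a) \<le> ennreal B"
proof -
  obtain P B where PP: "(\<forall>k. P k \<in> dirichlet_polys) \<and> bergman_Cauchy q \<beta> P \<and> (\<forall>n\<ge>1. (\<lambda>k. P k n) \<longlonglongrightarrow> a n) \<and>
    (\<forall>\<^sub>F k in sequentially. bergman_power q \<beta> (P k) \<le> ennreal B)"
    using bergman_space_approx[OF assms] by (elim exE)
  then have P: "P k \<in> dirichlet_polys" and Cauchy: "bergman_Cauchy q \<beta> P"
    and coeff: "n \<ge> 1 \<Longrightarrow> (\<lambda>k. P k n) \<longlonglongrightarrow> a n"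
    and PB: "\<forall>\<^sub>F k in sequentially. bergman_power q \<beta> (P k) \<le> ennreal B" for k n
    by simp_all
  have "bergman_power q \<beta> (block_part S a) \<le> ennreal B"
    if S: "finite S" and A: "block_part S a \<in> dirichlet_polys" for S
  proof -
    interpret t: prob_space torus_measure by (rule prob_space_torus)
    let ?R = "\<lambda>k. block_part S (P k)" and ?A = "block_part S a"
    have R: "?R k \<in> dirichlet_polys" for k by (intro block_part_polys P)
    have RC: "bergman_Cauchy q \<beta> ?R"
      unfolding bergman_Cauchy_def
    proof (intro allI impI)
      fix e :: real assume e: "e > 0"
      then obtain M where M: "\<And>k l. k \<ge> M \<Longrightarrow> l \<ge> M \<Longrightarrow> bergman_norm q \<beta> (\<lambda>n. P k n - P l n) < e"
        using Cauchy unfolding bergman_Cauchy_def by meson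
      have "bergman_norm q \<beta> (\<lambda>n. ?R k n - ?R l n) < e" if "k \<ge> M" "l \<ge> M" for k l
      proof -
        have "bergman_power q \<beta> (\<lambda>n. ?R k n - ?R l n) \<le> bergman_power q \<beta> (\<lambda>n. P k n - P l n)"
          using bergman_power_block_part[OF dirichlet_polys_diff[OF P P] q, of \<beta> S k l] by (simp add: block_part_diff)
        also have "\<dots> < ennreal (e powr q)"
          using M[OF that] bergman_norm_less_iff[OF dirichlet_polys_diff[OF P P] q \<beta> e] by blast
        finally show ?thesis
          using bergman_norm_less_iff[OF dirichlet_polys_diff[OF R R] q \<beta> e] by blast
      qed
      then show "\<exists>N. \<forall>k\<ge>N. \<forall>l\<ge>N. bergman_norm q \<beta> (\<lambda>n. ?R k n - ?R l n) < e" by blast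
    qed
    have conv: "(\<lambda>k. bohr_lift (dirichlet_shift \<sigma> (?R k)) z) \<longlonglongrightarrow> bohr_lift (dirichlet_shift \<sigma> ?A) z"
      if "\<sigma> > 0" "\<And>j. norm (z j) \<le> 1" for \<sigma> z
    proof (rule bohr_lift_shift_block_tendsto[OF q \<beta> R RC S _ A _ _ that])
      show "(\<lambda>k. ?R k n) \<longlonglongrightarrow> ?A n" if "n \<ge> 1" for n
        using coeff[OF that] by (auto simp: block_part_def)
    qed (auto simp: block_part_def split: if_splits)
    have H: "hardy_power q (dirichlet_shift \<sigma> ?A) \<le> liminf (\<lambda>k. hardy_power q (dirichlet_shift \<sigma> (?R k)))" if \<sigma>: "\<sigma> > 0" for \<sigma>
    proof -
      have "hardy_power q (dirichlet_shift \<sigma> ?A)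
          = (\<integral>\<^sup>+z. liminf (\<lambda>k. ennreal (norm (bohr_lift (dirichlet_shift \<sigma> (?R k)) z) powr q)) \<partial>torus_measure)"
        unfolding hardy_power_def
      proof (rule nn_integral_cong_AE, use AE_torus_norm in eventually_elim)
        fix z :: "nat \<Rightarrow> complex" assume z: "\<forall>j. norm (z j) = 1"
        have "(\<lambda>k. ennreal (norm (bohr_lift (dirichlet_shift \<sigma> (?R k)) z) powr q))
            \<longlonglongrightarrow> ennreal (norm (bohr_lift (dirichlet_shift \<sigma> ?A) z) powr q)"
          using q z by (intro tendsto_ennrealI tendsto_powr2 tendsto_norm conv \<sigma> tendsto_const) auto
        then show "ennreal (norm (bohr_lift (dirichlet_shift \<sigma> ?A) z) powr q)
            = liminf (\<lambda>k. ennreal (norm (bohr_lift (dirichlet_shift \<sigma> (?R k)) z) powr q))"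
          by (rule lim_imp_Liminf[symmetric, rotated]) simp
      qed
      also have "\<dots> \<le> liminf (\<lambda>k. hardy_power q (dirichlet_shift \<sigma> (?R k)))"
        unfolding hardy_power_def by (rule nn_integral_liminf) measurable
      finally show ?thesis .
    qed
    have "bergman_power q \<beta> ?A \<le> (\<integral>\<^sup>+\<sigma>. liminf (\<lambda>k. hardy_power q (dirichlet_shift \<sigma> (?R k))) \<partial>bergman_weight \<beta>)"
      unfolding bergman_power_def
      by (rule nn_integral_mono_AE, use AE_bergman_weight_pos in eventually_elim) (rule H)
    also have "\<dots> \<le> liminf (\<lambda>k. bergman_power q \<beta> (?R k))"
      unfolding bergman_power_def using R by (intro nn_integral_liminf) measurable
    also have "\<dots> \<le> limsup (\<lambda>k. bergman_power q \<beta> (?R k))" by (rule Liminf_le_Limsup) simp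
    also have "\<dots> \<le> ennreal B"
    proof (rule Limsup_bounded)
      show "\<forall>\<^sub>F k in sequentially. bergman_power q \<beta> (?R k) \<le> ennreal B"
        using PB by eventually_elim (rule order_trans[OF bergman_power_block_part[OF P q]])
    qed
    finally show ?thesis .
  qed
  then show ?thesis by blast
qed

section \<open>Sums of independent subgaussian variables\<close>

text \<open>The common denominator of the three laws. The complex parameter \<open>c\<close> makes
  the exponential bound cover the real part, the imaginary part and every other direction.\<close>

definition normalized_subgaussian :: "'w measure \<Rightarrow> ('w \<Rightarrow> complex) \<Rightarrow> bool" where
  "normalized_subgaussian M Y \<longleftrightarrow> integrable M Y \<and> (\<integral>\<omega>. Y \<omega> \<partial>M) = 0 \<and>
    (\<integral>\<^sup>+\<omega>. ennreal ((norm (Y \<omega>))\<^sup>2) \<partial>M) = 1 \<and>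
    (\<forall>c. (\<integral>\<^sup>+\<omega>. ennreal (exp (Re (c * Y \<omega>))) \<partial>M) \<le> ennreal (exp ((norm c)\<^sup>2 / 2)))"

text \<open>Hoeffding's lemma: \<open>Re (c * Y)\<close> has mean zero and lies in an interval of
  length \<open>2 * norm c\<close>, and \<open>(2 * norm c)^2 / 8\<close> is the required exponent.
  Bernoulli and Steinhaus variables are both of this kind.\<close>

lemma normalized_subgaussian_unimodular:
  assumes "prob_space M" and m: "Y \<in> borel_measurable M"
    and one: "AE \<omega> in M. norm (Y \<omega>) = 1" and mean: "(\<integral>\<omega>. Y \<omega> \<partial>M) = 0"
  shows "normalized_subgaussian M Y"
proof -
  interpret prob_space M by fact
  have int: "integrable M Y"
    by (rule integrable_const_bound[where B = 1, OF _ m]) (use one in \<open>auto elim: eventually_mono\<close>)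
  have "(\<integral>\<^sup>+\<omega>. ennreal ((norm (Y \<omega>))\<^sup>2) \<partial>M) = (\<integral>\<^sup>+\<omega>. 1 \<partial>M)"
    by (rule nn_integral_cong_AE) (use one in \<open>auto elim: eventually_mono\<close>)
  then have sq: "(\<integral>\<^sup>+\<omega>. ennreal ((norm (Y \<omega>))\<^sup>2) \<partial>M) = 1" by (simp add: emeasure_space_1)
  have "(\<integral>\<^sup>+\<omega>. ennreal (exp (Re (c * Y \<omega>))) \<partial>M) \<le> ennreal (exp ((norm c)\<^sup>2 / 2))" for c
  proof -
    interpret interval_bounded_random_variable M "\<lambda>\<omega>. Re (c * Y \<omega>)" "- norm c" "norm c"
    proof
      show "(\<lambda>\<omega>. Re (c * Y \<omega>)) \<in> borel_measurable M" using m by measurable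
      show "AE \<omega> in M. Re (c * Y \<omega>) \<in> {- norm c..norm c}"
        using one
      proof eventually_elim
        case (elim \<omega>)
        then show ?case using abs_Re_le_cmod[of "c * Y \<omega>"] by (simp add: norm_mult abs_le_iff)
      qed
    qed
    have "expectation (\<lambda>\<omega>. Re (c * Y \<omega>)) = Re (\<integral>\<omega>. c * Y \<omega> \<partial>M)"
      by (rule integral_Re) (use int in simp)
    also have "\<dots> = 0" using mean by simp
    finally have "nn_integral M (\<lambda>x. ennreal (exp (1 * Re (c * Y x)))) \<le> ennreal (exp (1\<^sup>2 * (norm c - - norm c)\<^sup>2 / 8))"
      by (intro Hoeffdings_lemma_nn_integral_0) simp_all
    then show ?thesis by (simp add: power2_eq_square)
  qed
  then show ?thesis using int mean sq by (simp add: normalized_subgaussian_def)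
qed

lemma normalized_subgaussian_bernoulli:
  assumes "prob_space M" and m: "Y \<in> borel_measurable M" and b: "bernoulli_var M Y"
  shows "normalized_subgaussian M Y"
proof -
  interpret prob_space M by fact
  let ?A = "{\<omega>\<in>space M. Y \<omega> = 1}" and ?B = "{\<omega>\<in>space M. Y \<omega> = - 1}"
  have [measurable]: "?A \<in> sets M" "?B \<in> sets M" using m by measurable
  have "prob (?A \<union> ?B) = prob ?A + prob ?B"
    by (rule finite_measure_Union) auto
  then have "prob (?A \<union> ?B) = 1" using b by (simp add: bernoulli_var_def)
  then have "AE \<omega> in M. \<omega> \<in> ?A \<union> ?B" by (rule AE_prob_1)
  then have pm: "AE \<omega> in M. Y \<omega> = 1 \<or> Y \<omega> = - 1" by eventually_elim auto
  have "(\<integral>\<omega>. Y \<omega> \<partial>M) = (\<integral>\<omega>. of_real (indicator ?A \<omega> - indicator ?B \<omega>) \<partial>M)"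
  proof (rule integral_cong_AE)
    show "AE \<omega> in M. Y \<omega> = of_real (indicator ?A \<omega> - indicator ?B \<omega>)"
      using pm AE_space by eventually_elim auto
  qed (use m in measurable)
  also have "\<dots> = of_real (prob ?A - prob ?B)"
    by (subst integral_complex_of_real, subst Bochner_Integration.integral_diff)
       (auto intro!: integrable_real_indicator simp: emeasure_eq_measure)
  finally have "(\<integral>\<omega>. Y \<omega> \<partial>M) = 0" using b by (simp add: bernoulli_var_def)
  then show ?thesis
    using pm by (intro normalized_subgaussian_unimodular m assms(1)) (auto elim: eventually_mono)
qed

lemma normalized_subgaussian_steinhaus:
  assumes "prob_space M" and m [measurable]: "Y \<in> borel_measurable M" and b: "steinhaus_var M Y"
  shows "normalized_subgaussian M Y"
proof (rule normalized_subgaussian_unimodular[OF assms(1) m])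
  have d: "distr M borel Y = circle_measure" using b by (simp add: steinhaus_var_def)
  have "AE x in distr M borel Y. norm x = 1" unfolding d by (rule AE_circle_norm)
  then show "AE \<omega> in M. norm (Y \<omega>) = 1" by (subst (asm) AE_distr_iff) auto
  have "(\<integral>\<omega>. Y \<omega> \<partial>M) = (\<integral>x. x \<partial>distr M borel Y)" by (subst integral_distr) auto
  also have "\<dots> = 0" unfolding d using circle_integral_power[of 1 0] by simp
  finally show "(\<integral>\<omega>. Y \<omega> \<partial>M) = 0" .
qed

lemma normalized_subgaussian_gaussian:
  assumes "prob_space M" and m [measurable]: "Y \<in> borel_measurable M" and b: "gaussian_var M Y"
  shows "normalized_subgaussian M Y"
proof -
  interpret prob_space M by fact
  let ?N = "density lborel (\<lambda>x. ennreal (std_normal_density x))"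
  have d: "distr M borel Y = distr ?N borel complex_of_real" using b by (simp add: gaussian_var_def)
  have mr [measurable]: "complex_of_real \<in> borel_measurable ?N" by simp
  have tr: "(\<integral>\<^sup>+\<omega>. h (Y \<omega>) \<partial>M) = (\<integral>\<^sup>+x. ennreal (std_normal_density x) * h (of_real x) \<partial>lborel)"
    if [measurable]: "h \<in> borel_measurable borel" for h :: "complex \<Rightarrow> ennreal"
  proof -
    have "(\<integral>\<^sup>+\<omega>. h (Y \<omega>) \<partial>M) = (\<integral>\<^sup>+x. h x \<partial>distr M borel Y)" by (subst nn_integral_distr) auto
    also have "\<dots> = (\<integral>\<^sup>+x. h (of_real x) \<partial>?N)" unfolding d by (subst nn_integral_distr) auto
    also have "\<dots> = (\<integral>\<^sup>+x. ennreal (std_normal_density x) * h (of_real x) \<partial>lborel)"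
      by (subst nn_integral_density) auto
    finally show ?thesis .
  qed
  have iN: "integrable ?N complex_of_real"
  proof (rule integrable_of_real)
    show "integrable ?N (\<lambda>x. x)" using integrable_std_normal_distribution_moment[of 1] by (simp only: power_one_right)
  qed
  have "integrable (distr ?N borel complex_of_real) (\<lambda>x. x)"
    by (subst integrable_distr_eq[OF mr]) (rule measurable_ident_sets[OF refl], rule iN)
  then have "integrable (distr M borel Y) (\<lambda>x. x)" unfolding d .
  then have int: "integrable M Y"
    by (subst (asm) integrable_distr_eq[OF m]) (rule measurable_ident_sets[OF refl])
  have "(\<integral>\<omega>. Y \<omega> \<partial>M) = (\<integral>x. x \<partial>distr M borel Y)" by (subst integral_distr) auto
  also have "\<dots> = (\<integral>x. complex_of_real x \<partial>?N)" unfolding d by (subst integral_distr) auto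
  also have "\<dots> = of_real (\<integral>x. std_normal_density x * x \<partial>lborel)"
    by (subst integral_complex_of_real, subst integral_density) auto
  also have "\<dots> = 0" using integral_std_normal_moment_odd[of 0] by simp
  finally have mean: "(\<integral>\<omega>. Y \<omega> \<partial>M) = 0" .
  have "(\<integral>\<^sup>+\<omega>. ennreal ((norm (Y \<omega>))\<^sup>2) \<partial>M) = (\<integral>\<^sup>+x. ennreal (std_normal_density x * x ^ (2 * 1)) \<partial>lborel)"
    by (subst tr) (auto simp: ennreal_mult' intro!: nn_integral_cong)
  also have "\<dots> = ennreal (\<integral>x. std_normal_density x * x ^ (2 * 1) \<partial>lborel)"
    using std_normal_moment_even[of 1] by (intro nn_integral_eq_integral) (auto elim: integrable.intros)
  also have "\<dots> = 1" unfolding integral_std_normal_moment_even by simp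
  finally have sq: "(\<integral>\<^sup>+\<omega>. ennreal ((norm (Y \<omega>))\<^sup>2) \<partial>M) = 1" .
  have "(\<integral>\<^sup>+\<omega>. ennreal (exp (Re (c * Y \<omega>))) \<partial>M) \<le> ennreal (exp ((norm c)\<^sup>2 / 2))" for c
  proof -
    have "(\<integral>\<^sup>+\<omega>. ennreal (exp (Re (c * Y \<omega>))) \<partial>M)
        = (\<integral>\<^sup>+x. ennreal (exp ((Re c)\<^sup>2 / 2)) * ennreal (normal_density (Re c) 1 x) \<partial>lborel)"
    proof (subst tr, measurable, rule nn_integral_cong)
      fix x :: real
      \<comment> \<open>Completing the square: the exponential tilt moves the mean of the normal
        density to \<open>Re c\<close>.\<close>
      have "exp (- x\<^sup>2 / 2) * exp (Re c * x) = exp ((Re c)\<^sup>2 / 2) * exp (- (x - Re c)\<^sup>2 / 2)"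
        unfolding exp_add[symmetric] by (simp add: power2_eq_square algebra_simps diff_divide_distrib add_divide_distrib)
      then have "std_normal_density x * exp (Re (c * of_real x)) = exp ((Re c)\<^sup>2 / 2) * normal_density (Re c) 1 x"
        by (simp add: normal_density_def)
      then show "ennreal (std_normal_density x) * ennreal (exp (Re (c * of_real x)))
          = ennreal (exp ((Re c)\<^sup>2 / 2)) * ennreal (normal_density (Re c) 1 x)"
        by (simp only: ennreal_mult'[symmetric] normal_density_nonneg exp_ge_zero)
    qed
    also have "\<dots> = ennreal (exp ((Re c)\<^sup>2 / 2)) * (\<integral>\<^sup>+x. ennreal (normal_density (Re c) 1 x) \<partial>lborel)"
      by (rule nn_integral_cmult) simp
    also have "(\<integral>\<^sup>+x. ennreal (normal_density (Re c) 1 x) \<partial>lborel) = 1"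
      by (subst nn_integral_eq_integral) (auto simp: normal_density_nonneg)
    also have "ennreal (exp ((Re c)\<^sup>2 / 2)) * 1 \<le> ennreal (exp ((norm c)\<^sup>2 / 2))"
      by (simp add: cmod_power2 ennreal_leI)
    finally show ?thesis .
  qed
  then show ?thesis using int mean sq by (simp add: normalized_subgaussian_def)
qed

lemma standard_random_sequence_subgaussian:
  assumes "standard_random_sequence M X" "n \<ge> 1"
  shows "normalized_subgaussian M (X n)"
proof -
  interpret prob_space M using assms by (simp add: standard_random_sequence_def)
  have "indep_vars (\<lambda>_. borel) X {1..}" using assms by (simp add: standard_random_sequence_def)
  then have "X n \<in> borel_measurable M" using assms(2) by (auto simp: indep_vars_def)
  then show ?thesis
    using assms prob_space_axioms normalized_subgaussian_bernoulli normalized_subgaussian_steinhaus normalized_subgaussian_gaussian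
    unfolding standard_random_sequence_def by blast
qed

section \<open>Khinchine's inequalities\<close>

lemma powr_le_exp:
  fixes x q :: real
  assumes "q > 0" "x \<ge> 0"
  shows "x powr q \<le> q powr q * exp x"
proof -
  have "x / q \<le> exp (x / q)" using exp_ge_add_one_self[of "x / q"] by linarith
  then have "(x / q) powr q \<le> exp (x / q) powr q" using assms by (intro powr_mono2) auto
  then show ?thesis using assms by (simp add: powr_divide powr_def[of "exp _"] field_simps)
qed

text \<open>Up to a factor 2 the modulus is the largest of \<open>Re (u * s)\<close> over the four
  units \<open>u = 1, -1, \<i>, -\<i>\<close>, so exponential moments in four directions control
  every power.\<close>

lemma norm_powr_le_exp_sum:
  fixes s :: complex
  assumes q: "q > 0"
  shows "norm s powr q \<le> (2 * q) powr q * (exp (Re s) + exp (Re (- s)) + exp (Re (\<i> * s)) + exp (Re (- \<i> * s)))"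
proof -
  define x where "x = max \<bar>Re s\<bar> \<bar>Im s\<bar>"
  have x: "x \<ge> 0" by (simp add: x_def)
  have "norm s \<le> 2 * x" using cmod_le[of s] by (simp add: x_def)
  then have "norm s powr q \<le> (2 * x) powr q" using q by (intro powr_mono2) auto
  also have "\<dots> = 2 powr q * x powr q" using x by (simp add: powr_mult)
  also have "\<dots> \<le> 2 powr q * (q powr q * exp x)" using powr_le_exp[OF q x] by (intro mult_left_mono) auto
  also have "\<dots> = (2 * q) powr q * exp x" using q by (simp add: powr_mult)
  finally have *: "norm s powr q \<le> (2 * q) powr q * exp x" .
  have "exp x \<le> exp (Re s) + exp (Re (- s)) + exp (Re (\<i> * s)) + exp (Re (- \<i> * s))"
  proof -
    have "exp x = exp (Re s) \<or> exp x = exp (Re (- s)) \<or> exp x = exp (Re (\<i> * s)) \<or> exp x = exp (Re (- \<i> * s))"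
      by (auto simp: x_def max_def abs_if)
    then show ?thesis
      using exp_gt_zero[of "Re s"] exp_gt_zero[of "Re (- s)"] exp_gt_zero[of "Re (\<i> * s)"] exp_gt_zero[of "Re (- \<i> * s)"]
      by linarith
  qed
  then have "(2 * q) powr q * exp x \<le> (2 * q) powr q * (exp (Re s) + exp (Re (- s)) + exp (Re (\<i> * s)) + exp (Re (- \<i> * s)))"
    by (rule mult_left_mono) simp
  with * show ?thesis by (rule order_trans)
qed

definition khinchine_const :: "real \<Rightarrow> real" where
  "khinchine_const q = (2 * q) powr q * (4 * exp (1 / 2))"

lemma khinchine_const_pos: "q > 0 \<Longrightarrow> khinchine_const q > 0"
  by (simp add: khinchine_const_def)

lemma exp_sum_bound:
  assumes M: "prob_space M" and ind: "prob_space.indep_vars M (\<lambda>_. borel) Y I" and I: "finite I"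
    and sg: "\<And>i. i \<in> I \<Longrightarrow> normalized_subgaussian M (Y i)"
  shows "(\<integral>\<^sup>+\<omega>. ennreal (exp (Re (\<Sum>i\<in>I. c i * Y i \<omega>))) \<partial>M) \<le> ennreal (exp ((\<Sum>i\<in>I. (norm (c i))\<^sup>2) / 2))"
proof -
  interpret prob_space M by fact
  have "(\<integral>\<^sup>+\<omega>. ennreal (exp (Re (\<Sum>i\<in>I. c i * Y i \<omega>))) \<partial>M) = (\<integral>\<^sup>+\<omega>. (\<Prod>i\<in>I. ennreal (exp (Re (c i * Y i \<omega>)))) \<partial>M)"
    using I by (simp add: exp_sum prod_ennreal Re_sum)
  also have "\<dots> = (\<Prod>i\<in>I. \<integral>\<^sup>+\<omega>. ennreal (exp (Re (c i * Y i \<omega>))) \<partial>M)"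
    by (rule indep_vars_nn_integral[OF I]) (rule indep_vars_compose2[OF ind], auto)
  also have "\<dots> \<le> (\<Prod>i\<in>I. ennreal (exp ((norm (c i))\<^sup>2 / 2)))"
    using sg by (intro prod_mono_ennreal) (auto simp: normalized_subgaussian_def)
  also have "\<dots> = ennreal (exp ((\<Sum>i\<in>I. (norm (c i))\<^sup>2) / 2))"
    using I by (simp add: prod_ennreal exp_sum sum_divide_distrib)
  finally show ?thesis .
qed

lemma nn_integral_cmult_add4:
  assumes "f1 \<in> borel_measurable M" "f2 \<in> borel_measurable M" "f3 \<in> borel_measurable M" "f4 \<in> borel_measurable M"
  shows "(\<integral>\<^sup>+x. k * (f1 x + f2 x + f3 x + f4 x) \<partial>M)
    = k * ((\<integral>\<^sup>+x. f1 x \<partial>M) + (\<integral>\<^sup>+x. f2 x \<partial>M) + (\<integral>\<^sup>+x. f3 x \<partial>M) + (\<integral>\<^sup>+x. f4 x \<partial>M))"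
  using assms by (simp add: nn_integral_cmult nn_integral_add)

text \<open>Divided by its standard deviation \<open>sqrt V\<close>, the sum has exponential moments
  at most \<open>exp (1 / 2)\<close> in each of the four directions; this is the origin of
  \<open>khinchine_const\<close>. The case \<open>V = 0\<close> is separate because of the
  division.\<close>

lemma khinchine_upper:
  assumes M: "prob_space M" and ind: "prob_space.indep_vars M (\<lambda>_. borel) Y I" and I: "finite I"
    and sg: "\<And>i. i \<in> I \<Longrightarrow> normalized_subgaussian M (Y i)" and q: "q > 0"
  shows "(\<integral>\<^sup>+\<omega>. ennreal (norm (\<Sum>i\<in>I. c i * Y i \<omega>) powr q) \<partial>M)
    \<le> ennreal (khinchine_const q * (\<Sum>i\<in>I. (norm (c i))\<^sup>2) powr (q / 2))"
proof -
  interpret prob_space M by fact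
  have [measurable]: "Y i \<in> borel_measurable M" if "i \<in> I" for i
    using sg[OF that] by (auto simp: normalized_subgaussian_def)
  define V where "V = (\<Sum>i\<in>I. (norm (c i))\<^sup>2)"
  show ?thesis
  proof (cases "V = 0")
    case True
    then have "c i = 0" if "i \<in> I" for i using that I by (simp add: V_def sum_nonneg_eq_0_iff)
    then show ?thesis by simp
  next
    case False
    then have V: "V > 0" unfolding V_def using sum_nonneg[of I "\<lambda>i. (norm (c i))\<^sup>2"] by auto
    let ?S = "\<lambda>\<omega>. \<Sum>i\<in>I. c i * Y i \<omega>"
    let ?T = "\<lambda>(u::complex) \<omega>. \<Sum>i\<in>I. (u / sqrt V * c i) * Y i \<omega>"
    have Tu: "?T u \<omega> = u * (?S \<omega> / sqrt V)" for u \<omega> by (simp add: sum_distrib_left sum_divide_distrib mult_ac)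
    have E: "(\<integral>\<^sup>+\<omega>. ennreal (exp (Re (u * (?S \<omega> / sqrt V)))) \<partial>M) \<le> ennreal (exp (1 / 2))" if "norm u = 1" for u
    proof -
      have "(\<Sum>i\<in>I. (norm (u / sqrt V * c i))\<^sup>2) = 1"
        using that V by (simp add: norm_mult norm_divide power_mult_distrib power_divide sum_divide_distrib[symmetric] V_def[symmetric])
      then have "(\<integral>\<^sup>+\<omega>. ennreal (exp (Re (?T u \<omega>))) \<partial>M) \<le> ennreal (exp (1 / 2))"
        using exp_sum_bound[OF M ind I sg, where c = "\<lambda>i. u / sqrt V * c i"] by (simp only: simp_thms)
      then show ?thesis by (simp only: Tu)
    qed
    define f where "f = (\<lambda>(u::complex) \<omega>. ennreal (exp (Re (u * (?S \<omega> / sqrt V)))))"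
    have Sm: "?S \<in> borel_measurable M" by measurable
    then have fm: "f u \<in> borel_measurable M" for u unfolding f_def by measurable
    have Ef: "(\<integral>\<^sup>+\<omega>. f u \<omega> \<partial>M) \<le> ennreal (exp (1 / 2))" if "norm u = 1" for u
      unfolding f_def by (rule E[OF that])
    have "(\<integral>\<^sup>+\<omega>. ennreal (norm (?S \<omega>) powr q) \<partial>M) = (\<integral>\<^sup>+\<omega>. ennreal (V powr (q / 2)) * ennreal (norm (?S \<omega> / sqrt V) powr q) \<partial>M)"
    proof (rule nn_integral_cong)
      fix \<omega>
      have "sqrt V powr q = V powr (q / 2)" using V by (simp add: powr_half_sqrt[symmetric] powr_powr)
      then have "norm (?S \<omega>) powr q = V powr (q / 2) * norm (?S \<omega> / sqrt V) powr q"
        using V by (simp add: norm_divide powr_divide)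
      then show "ennreal (norm (?S \<omega>) powr q) = ennreal (V powr (q / 2)) * ennreal (norm (?S \<omega> / sqrt V) powr q)"
        by (simp add: ennreal_mult'[symmetric])
    qed
    also have "\<dots> = ennreal (V powr (q / 2)) * (\<integral>\<^sup>+\<omega>. ennreal (norm (?S \<omega> / sqrt V) powr q) \<partial>M)"
      by (rule nn_integral_cmult) measurable
    finally have eqS: "(\<integral>\<^sup>+\<omega>. ennreal (norm (?S \<omega>) powr q) \<partial>M)
       = ennreal (V powr (q / 2)) * (\<integral>\<^sup>+\<omega>. ennreal (norm (?S \<omega> / sqrt V) powr q) \<partial>M)" .
    have "(\<integral>\<^sup>+\<omega>. ennreal (norm (?S \<omega> / sqrt V) powr q) \<partial>M)
       \<le> (\<integral>\<^sup>+\<omega>. ennreal ((2 * q) powr q) * (f 1 \<omega> + f (-1) \<omega> + f \<i> \<omega> + f (- \<i>) \<omega>) \<partial>M)"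
    proof (rule nn_integral_mono)
      have "ennreal (norm s powr q) \<le> ennreal ((2 * q) powr q) * (ennreal (exp (Re (1 * s))) + ennreal (exp (Re ((-1) * s)))
          + ennreal (exp (Re (\<i> * s))) + ennreal (exp (Re ((- \<i>) * s))))" for s
        using ennreal_leI[OF norm_powr_le_exp_sum[OF q, of s]]
        by (simp add: ennreal_mult'[symmetric] ennreal_plus[symmetric] del: ennreal_plus)
      then show "ennreal (norm (?S \<omega> / sqrt V) powr q) \<le> ennreal ((2 * q) powr q) * (f 1 \<omega> + f (-1) \<omega> + f \<i> \<omega> + f (- \<i>) \<omega>)" for \<omega>
        unfolding f_def .
    qed
    also have "\<dots> = ennreal ((2 * q) powr q) * ((\<integral>\<^sup>+\<omega>. f 1 \<omega> \<partial>M) + (\<integral>\<^sup>+\<omega>. f (-1) \<omega> \<partial>M)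
        + (\<integral>\<^sup>+\<omega>. f \<i> \<omega> \<partial>M) + (\<integral>\<^sup>+\<omega>. f (- \<i>) \<omega> \<partial>M))"
      by (rule nn_integral_cmult_add4[OF fm fm fm fm])
    also have "\<dots> \<le> ennreal ((2 * q) powr q) * (ennreal (exp (1 / 2)) + ennreal (exp (1 / 2)) + ennreal (exp (1 / 2)) + ennreal (exp (1 / 2)))"
      by (rule mult_left_mono, intro add_mono Ef) auto
    also have "\<dots> = ennreal (khinchine_const q)"
      by (simp add: khinchine_const_def ennreal_mult'[symmetric] ennreal_plus[symmetric] del: ennreal_plus)
    finally have "ennreal (V powr (q / 2)) * (\<integral>\<^sup>+\<omega>. ennreal (norm (?S \<omega> / sqrt V) powr q) \<partial>M)
       \<le> ennreal (V powr (q / 2)) * ennreal (khinchine_const q)" by (rule mult_left_mono) simp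
    then show ?thesis
      unfolding eqS V_def[symmetric]
      by (simp only: mult.commute[of "khinchine_const q"] ennreal_mult'[OF powr_ge_zero])
  qed
qed

lemma indep_sum_second_moment:
  assumes M: "prob_space M" and ind: "prob_space.indep_vars M (\<lambda>_. borel) Y I" and I: "finite I"
    and sg: "\<And>i. i \<in> I \<Longrightarrow> normalized_subgaussian M (Y i)"
  shows "(\<integral>\<^sup>+\<omega>. ennreal ((norm (\<Sum>i\<in>I. c i * Y i \<omega>))\<^sup>2) \<partial>M) = ennreal (\<Sum>i\<in>I. (norm (c i))\<^sup>2)"
proof -
  interpret prob_space M by fact
  have int: "integrable M (Y i)" if "i \<in> I" for i using sg[OF that] by (simp add: normalized_subgaussian_def)
  have [measurable]: "Y i \<in> borel_measurable M" if "i \<in> I" for i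
    by (rule borel_measurable_integrable[OF int[OF that]])
  have cov: "integrable M (\<lambda>\<omega>. Y i \<omega> * cnj (Y j \<omega>)) \<and> (\<integral>\<omega>. Y i \<omega> * cnj (Y j \<omega>) \<partial>M) = (if i = j then 1 else 0)"
    if ij: "i \<in> I" "j \<in> I" for i j
  proof (cases "i = j")
    case True
    have sq: "(\<integral>\<^sup>+\<omega>. ennreal ((norm (Y i \<omega>))\<^sup>2) \<partial>M) = ennreal 1"
      using sg[OF ij(1)] by (simp add: normalized_subgaussian_def)
    have si: "integrable M (\<lambda>\<omega>. (norm (Y i \<omega>))\<^sup>2)"
      by (rule integrableI_nonneg) (use ij sq in auto)
    have "ennreal (\<integral>\<omega>. (norm (Y i \<omega>))\<^sup>2 \<partial>M) = ennreal 1"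
      using nn_integral_eq_integral[OF si] sq by simp
    then have "(\<integral>\<omega>. (norm (Y i \<omega>))\<^sup>2 \<partial>M) = 1" by (subst (asm) ennreal_inj) (auto intro: integral_nonneg_AE)
    moreover have "(\<lambda>\<omega>. Y i \<omega> * cnj (Y j \<omega>)) = (\<lambda>\<omega>. complex_of_real ((norm (Y i \<omega>))\<^sup>2))"
      using True by (simp only: complex_norm_square)
    ultimately show ?thesis using True si by (simp only: integral_complex_of_real integrable_of_real) simp
  next
    case False
    \<comment> \<open>Conjugating only the factor at \<open>j\<close> writes the covariance as a
      product over \<open>{i, j}\<close>, the shape in which independence factors an
      integral.\<close>
    let ?Z = "\<lambda>k \<omega>. (if k = i then (\<lambda>x. x) else cnj) (Y k \<omega>)"
    have sub: "indep_vars (\<lambda>_. borel) Y {i, j}" using ij by (intro indep_vars_subset[OF ind]) auto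
    have indZ: "indep_vars (\<lambda>_. borel) ?Z {i, j}"
      by (rule indep_vars_compose2[OF sub]) auto
    have intZ: "integrable M (?Z k)" if "k \<in> {i, j}" for k
      using int that ij by (auto intro: integrable_cnj)
    have p: "(\<Prod>k\<in>{i, j}. ?Z k \<omega>) = Y i \<omega> * cnj (Y j \<omega>)" for \<omega> using False by simp
    have m: "(\<integral>\<omega>. Y i \<omega> \<partial>M) = 0" using sg[OF ij(1)] by (simp add: normalized_subgaussian_def)
    show ?thesis
      using indep_vars_lebesgue_integral[OF _ indZ intZ] indep_vars_integrable[OF _ indZ intZ] False m
      unfolding p by simp
  qed
  let ?S = "\<lambda>\<omega>. \<Sum>i\<in>I. c i * Y i \<omega>"
  have eq: "complex_of_real ((norm (?S \<omega>))\<^sup>2) = (\<Sum>i\<in>I. \<Sum>j\<in>I. (c i * cnj (c j)) * (Y i \<omega> * cnj (Y j \<omega>)))" for \<omega>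
  proof -
    have "?S \<omega> * cnj (?S \<omega>) = (\<Sum>i\<in>I. \<Sum>j\<in>I. (c i * Y i \<omega>) * cnj (c j * Y j \<omega>))"
      by (simp only: cnj_sum sum_product)
    also have "\<dots> = (\<Sum>i\<in>I. \<Sum>j\<in>I. (c i * cnj (c j)) * (Y i \<omega> * cnj (Y j \<omega>)))"
      by (intro sum.cong refl) (simp only: complex_cnj_mult mult_ac)
    finally show ?thesis unfolding complex_norm_square .
  qed
  have ci: "integrable M (\<lambda>\<omega>. complex_of_real ((norm (?S \<omega>))\<^sup>2))"
    unfolding eq using cov by (intro Bochner_Integration.integrable_sum integrable_mult_right) auto
  have "integrable M (\<lambda>\<omega>. Re (complex_of_real ((norm (?S \<omega>))\<^sup>2)))" by (rule integrable_Re[OF ci])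
  then have si: "integrable M (\<lambda>\<omega>. (norm (?S \<omega>))\<^sup>2)" by (simp only: Re_complex_of_real)
  have "complex_of_real (\<integral>\<omega>. (norm (?S \<omega>))\<^sup>2 \<partial>M) = (\<integral>\<omega>. complex_of_real ((norm (?S \<omega>))\<^sup>2) \<partial>M)"
    by (rule integral_complex_of_real[symmetric])
  also have "\<dots> = (\<Sum>i\<in>I. \<Sum>j\<in>I. (c i * cnj (c j)) * (if i = j then 1 else 0))"
    unfolding eq using cov
    by (simp add: Bochner_Integration.integral_sum Bochner_Integration.integrable_sum cong: sum.cong)
  also have "\<dots> = complex_of_real (\<Sum>i\<in>I. (norm (c i))\<^sup>2)"
    unfolding of_real_sum complex_norm_square using I by (simp add: if_distrib cong: if_cong)
  finally have "(\<integral>\<omega>. (norm (?S \<omega>))\<^sup>2 \<partial>M) = (\<Sum>i\<in>I. (norm (c i))\<^sup>2)" by (simp only: of_real_eq_iff)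
  then show ?thesis using nn_integral_eq_integral[OF si] by simp
qed

text \<open>Paley--Zygmund: the fourth moment keeps a fixed part of the mass of the sum away from zero,
  and this part survives the restriction to an event of probability close to one.\<close>

lemma khinchine_lower_on_event:
  assumes q: "q > 0"
  obtains \<kappa> where "0 < \<kappa>"
    "\<And>(M :: 'w measure) Y (I :: 'i set) c E. prob_space M \<Longrightarrow> prob_space.indep_vars M (\<lambda>_. borel) Y I \<Longrightarrow> finite I \<Longrightarrow>
      (\<And>i. i \<in> I \<Longrightarrow> normalized_subgaussian M (Y i)) \<Longrightarrow> E \<in> sets M \<Longrightarrow> measure M E \<ge> 1 - \<kappa> \<Longrightarrow>
      ennreal (\<kappa> * (\<Sum>i\<in>I. (norm (c i))\<^sup>2) powr (q / 2))
        \<le> (\<integral>\<^sup>+\<omega>. ennreal (norm (\<Sum>i\<in>I. c i * Y i \<omega>) powr q) * indicator E \<omega> \<partial>M)"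
proof -
  define C where "C = khinchine_const 4"
  have C: "C > 0" unfolding C_def by (rule khinchine_const_pos) simp
  \<comment> \<open>A lower bound for the probability that the squared modulus of the sum is at
    least half its mean. Being built from the fourth moment constant, it is the same for all index
    sets and coefficients.\<close>
  define p0 where "p0 = 1 / (4 * C)"
  have p0: "p0 > 0" using C by (simp add: p0_def)
  \<comment> \<open>The first entry keeps at least half of \<open>p0\<close> after intersection with
    \<open>E\<close>; the second is the contribution to the moment of order \<open>q\<close> from
    that remaining event.\<close>
  define \<kappa> where "\<kappa> = min (p0 / 2) ((1 / 2) powr (q / 2) * (p0 / 2))"
  have \<kappa>: "\<kappa> > 0" using p0 by (simp add: \<kappa>_def)
  have main: "ennreal (\<kappa> * (\<Sum>i\<in>I. (norm (c i))\<^sup>2) powr (q / 2))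
        \<le> (\<integral>\<^sup>+\<omega>. ennreal (norm (\<Sum>i\<in>I. c i * Y i \<omega>) powr q) * indicator E \<omega> \<partial>M)"
    if M: "prob_space M" and ind: "prob_space.indep_vars M (\<lambda>_. borel) Y I" and I: "finite I"
      and sg: "\<And>i. i \<in> I \<Longrightarrow> normalized_subgaussian M (Y i)" and E: "E \<in> sets M" "measure M E \<ge> 1 - \<kappa>"
    for M :: "'w measure" and Y and I :: "'i set" and c E
  proof -
    interpret prob_space M by fact
    have [measurable]: "Y i \<in> borel_measurable M" if "i \<in> I" for i
      using sg[OF that] by (auto simp: normalized_subgaussian_def)
    define V where "V = (\<Sum>i\<in>I. (norm (c i))\<^sup>2)"
    let ?S = "\<lambda>\<omega>. \<Sum>i\<in>I. c i * Y i \<omega>"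
    define A where "A = {\<omega>\<in>space M. (norm (?S \<omega>))\<^sup>2 \<ge> V / 2}"
    have Am [measurable]: "A \<in> sets M" unfolding A_def by measurable
    show ?thesis
    proof (cases "V = 0")
      case True
      then show ?thesis by (simp add: V_def)
    next
      case False
      then have V: "V > 0" unfolding V_def using sum_nonneg[of I "\<lambda>i. (norm (c i))\<^sup>2"] by auto
      \<comment> \<open>Young's inequality in the form
        \<open>y \<le> y^2 / (4 * C * V) + C * V\<close> stands in for Cauchy-Schwarz. In the mean
        the three terms give \<open>V \<le> V / 2 + V / 4 + C * V * prob A\<close>.\<close>
      have pw: "(norm (?S \<omega>))\<^sup>2 \<le> V / 2 + norm (?S \<omega>) powr 4 / (4 * C * V) + C * V * indicator A \<omega>" if "\<omega> \<in> space M" for \<omega>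
      proof (cases "\<omega> \<in> A")
        case False
        then have "(norm (?S \<omega>))\<^sup>2 < V / 2" using that by (auto simp: A_def)
        moreover have "norm (?S \<omega>) powr 4 / (4 * C * V) \<ge> 0" using C V by simp
        ultimately show ?thesis using False by simp
      next
        case True
        let ?y = "(norm (?S \<omega>))\<^sup>2"
        have "0 \<le> (?y - 2 * C * V)\<^sup>2 / (4 * C * V)" using C V by simp
        also have "\<dots> = ?y\<^sup>2 / (4 * C * V) - ?y + C * V"
          using C V by (simp add: power2_eq_square field_simps)
        also have "?y\<^sup>2 = norm (?S \<omega>) powr 4" by (simp add: powr_numeral power_mult[symmetric])
        finally have "?y \<le> norm (?S \<omega>) powr 4 / (4 * C * V) + C * V" by linarith
        then show ?thesis using True V by simp
      qed
      have "ennreal V = (\<integral>\<^sup>+\<omega>. ennreal ((norm (?S \<omega>))\<^sup>2) \<partial>M)"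
        unfolding V_def using indep_sum_second_moment[OF M ind I sg] by simp
      also have "\<dots> \<le> (\<integral>\<^sup>+\<omega>. (ennreal (V / 2) + ennreal (1 / (4 * C * V)) * ennreal (norm (?S \<omega>) powr 4)) + ennreal (C * V) * indicator A \<omega> \<partial>M)"
      proof (rule nn_integral_mono)
        fix \<omega> assume "\<omega> \<in> space M"
        from ennreal_leI[OF pw[OF this]]
        show "ennreal ((norm (?S \<omega>))\<^sup>2) \<le> (ennreal (V / 2) + ennreal (1 / (4 * C * V)) * ennreal (norm (?S \<omega>) powr 4)) + ennreal (C * V) * indicator A \<omega>"
          using C V by (simp add: ennreal_mult'[symmetric] ennreal_plus[symmetric] del: ennreal_plus flip: ennreal_indicator)
      qed
      also have "\<dots> = (ennreal (V / 2) + ennreal (1 / (4 * C * V)) * (\<integral>\<^sup>+\<omega>. ennreal (norm (?S \<omega>) powr 4) \<partial>M)) + ennreal (C * V) * emeasure M A"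
        by (subst nn_integral_add, measurable, subst nn_integral_add, measurable, subst nn_integral_cmult, measurable)
           (simp add: emeasure_space_1 nn_integral_cmult_indicator)
      also have "\<dots> \<le> (ennreal (V / 2) + ennreal (1 / (4 * C * V)) * ennreal (C * V powr (4 / 2))) + ennreal (C * V) * emeasure M A"
        unfolding C_def V_def using khinchine_upper[OF M ind I sg, of 4 c]
        by (intro add_mono mult_left_mono) auto
      also have "\<dots> = ennreal (V / 2 + 1 / (4 * C * V) * (C * V powr 2) + C * V * prob A)"
        using C V by (simp add: emeasure_eq_measure ennreal_mult'[symmetric] ennreal_plus[symmetric] del: ennreal_plus)
      finally have "V \<le> V / 2 + 1 / (4 * C * V) * (C * V powr 2) + C * V * prob A"
        by (subst (asm) ennreal_le_iff) (use C V in \<open>intro add_nonneg_nonneg mult_nonneg_nonneg, auto\<close>)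
      also have "1 / (4 * C * V) * (C * V powr 2) = V / 4" using C V by (simp add: powr_numeral power2_eq_square)
      finally have "V * (1 / 4) \<le> V * (C * prob A)" by (simp add: algebra_simps)
      then have "1 / 4 \<le> C * prob A" using V by simp
      then have pA: "prob A \<ge> p0" using C by (simp add: p0_def field_simps)
      have "prob A \<le> prob ((A \<inter> E) \<union> (space M - E))"
        using E sets.sets_into_space[OF Am] by (intro finite_measure_mono) auto
      also have "\<dots> \<le> prob (A \<inter> E) + prob (space M - E)"
        using E by (intro measure_Un_le) auto
      also have "prob (space M - E) = 1 - prob E" using E by (intro prob_compl) auto
      finally have "prob (A \<inter> E) \<ge> p0 / 2"
        using pA E(2) by (simp add: \<kappa>_def min_def split: if_splits)
      have "ennreal (\<kappa> * V powr (q / 2)) \<le> ennreal ((V / 2) powr (q / 2) * prob (A \<inter> E))"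
      proof (rule ennreal_leI)
        have "\<kappa> * V powr (q / 2) \<le> (1 / 2) powr (q / 2) * (p0 / 2) * V powr (q / 2)"
          by (intro mult_right_mono) (auto simp: \<kappa>_def)
        also have "\<dots> = (V / 2) powr (q / 2) * (p0 / 2)" using V by (simp add: powr_divide)
        also have "\<dots> \<le> (V / 2) powr (q / 2) * prob (A \<inter> E)"
          using \<open>prob (A \<inter> E) \<ge> p0 / 2\<close> by (intro mult_left_mono) auto
        finally show "\<kappa> * V powr (q / 2) \<le> (V / 2) powr (q / 2) * prob (A \<inter> E)" .
      qed
      also have "\<dots> = (\<integral>\<^sup>+\<omega>. ennreal ((V / 2) powr (q / 2)) * indicator (A \<inter> E) \<omega> \<partial>M)"
        using E by (subst nn_integral_cmult_indicator) (auto simp: emeasure_eq_measure ennreal_mult')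
      also have "\<dots> \<le> (\<integral>\<^sup>+\<omega>. ennreal (norm (?S \<omega>) powr q) * indicator E \<omega> \<partial>M)"
      proof (rule nn_integral_mono)
        fix \<omega>
        show "ennreal ((V / 2) powr (q / 2)) * indicator (A \<inter> E) \<omega> \<le> ennreal (norm (?S \<omega>) powr q) * indicator E \<omega>"
        proof (cases "\<omega> \<in> A \<inter> E")
          case True
          then have "V / 2 \<le> (norm (?S \<omega>))\<^sup>2" by (simp add: A_def)
          then have "(V / 2) powr (q / 2) \<le> ((norm (?S \<omega>))\<^sup>2) powr (q / 2)"
            using V q by (intro powr_mono2) auto
          also have "\<dots> = norm (?S \<omega>) powr q"
            by (simp add: powr_powr flip: powr_numeral)
          finally show ?thesis using True by (simp add: ennreal_leI)
        qed auto
      qed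
      finally show ?thesis by (simp add: V_def)
    qed
  qed
  show ?thesis by (rule that[OF \<kappa> main])
qed

section \<open>Random Dirichlet polynomials\<close>

definition random_poly :: "(nat \<Rightarrow> 'w \<Rightarrow> complex) \<Rightarrow> 'w \<Rightarrow> nat set \<Rightarrow> (nat \<Rightarrow> complex) \<Rightarrow> nat \<Rightarrow> complex" where
  "random_poly X \<omega> T c n = (if n \<in> T then c n * X n \<omega> else 0)"

text \<open>The square of the norm \<open>m(\<sigma>)\<close> of the overview, restricted to the
  indices in \<open>T\<close>.\<close>

definition square_sum :: "(nat \<Rightarrow> complex) \<Rightarrow> nat set \<Rightarrow> real \<Rightarrow> real" where
  "square_sum c T \<sigma> = (\<Sum>n\<in>T. (norm (c n))\<^sup>2 * real n powr (- 2 * \<sigma>))"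

lemma square_sum_nonneg: "square_sum c T \<sigma> \<ge> 0"
  unfolding square_sum_def by (intro sum_nonneg) auto

lemma square_sum_measurable [measurable]: "square_sum c T \<in> borel_measurable borel"
  unfolding square_sum_def by measurable

lemma square_sum_antimono:
  assumes "0 \<notin> T" "s \<le> t"
  shows "square_sum c T t \<le> square_sum c T s"
  unfolding square_sum_def
proof (intro sum_mono mult_left_mono)
  fix n assume "n \<in> T"
  with assms(1) have "n \<ge> 1" by (cases n) auto
  then show "real n powr (- 2 * t) \<le> real n powr (- 2 * s)" using assms(2) by (intro powr_mono) auto
qed auto

lemma random_poly_polys: "finite T \<Longrightarrow> random_poly X \<omega> T c \<in> dirichlet_polys"
  by (rule dirichlet_polysI) (auto simp: random_poly_def elim!: rev_finite_subset)

context
  fixes M :: "'w measure" and X :: "nat \<Rightarrow> 'w \<Rightarrow> complex"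
  assumes M: "prob_space M" and ind: "prob_space.indep_vars M (\<lambda>_. borel) X {1..}"
    and sg: "\<And>n. n \<ge> 1 \<Longrightarrow> normalized_subgaussian M (X n)"
begin

lemma random_measurable: "n \<ge> 1 \<Longrightarrow> X n \<in> borel_measurable M"
  using sg[of n] by (auto simp: normalized_subgaussian_def)

lemma random_poly_lift_measurable:
  assumes T: "finite T" "0 \<notin> T"
  shows "(\<lambda>(\<omega>, \<sigma>, z). bohr_lift (dirichlet_shift \<sigma> (random_poly X \<omega> T c)) z)
    \<in> borel_measurable (M \<Otimes>\<^sub>M (borel \<Otimes>\<^sub>M torus_measure))"
proof -
  have T1: "n \<ge> 1" if "n \<in> T" for n using that T(2) by (cases n) auto
  have "(\<lambda>(\<omega>, \<sigma>, z). bohr_lift (dirichlet_shift \<sigma> (random_poly X \<omega> T c)) z) =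
    (\<lambda>p. \<Sum>n\<in>T. c n * X n (fst p) * of_real (real n powr (- fst (snd p))) * bohr_monomial (snd (snd p)) n)"
    using T by (subst bohr_lift_shift_sum[of T]) (auto simp: random_poly_def split: if_splits)
  also have "\<dots> \<in> borel_measurable (M \<Otimes>\<^sub>M (borel \<Otimes>\<^sub>M torus_measure))"
    by (intro borel_measurable_sum borel_measurable_times bohr_monomial_measurable
        measurable_compose[OF measurable_fst random_measurable[OF T1]]
        measurable_compose[OF measurable_compose[OF measurable_snd measurable_snd] torus_component]) measurable
  finally show ?thesis .
qed

text \<open>Moves the expectation inside, where for fixed \<sigma> and \<open>z\<close> the lift is
  a weighted sum of the \<open>X n\<close> and Khinchine's inequality applies. The event
  \<open>E\<close> is carried along for the lower bound.\<close>

lemma random_poly_fubini: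
  assumes T: "finite T" "0 \<notin> T" and E: "E \<in> sets M" and \<beta>: "\<beta> > -1"
  shows "(\<integral>\<^sup>+\<omega>. bergman_power q \<beta> (random_poly X \<omega> T c) * indicator E \<omega> \<partial>M)
    = (\<integral>\<^sup>+\<sigma>. \<integral>\<^sup>+z. (\<integral>\<^sup>+\<omega>. ennreal (norm (bohr_lift (dirichlet_shift \<sigma> (random_poly X \<omega> T c)) z) powr q) * indicator E \<omega> \<partial>M)
        \<partial>torus_measure \<partial>bergman_weight \<beta>)"
    and "(\<lambda>\<omega>. bergman_power q \<beta> (random_poly X \<omega> T c)) \<in> borel_measurable M"
proof -
  interpret M: prob_space M by (rule M)
  interpret t: prob_space torus_measure by (rule prob_space_torus)
  interpret w: prob_space "bergman_weight \<beta>" by (rule prob_space_bergman_weight[OF \<beta>])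
  interpret Mw: pair_sigma_finite M "bergman_weight \<beta>" ..
  interpret Mt: pair_sigma_finite M torus_measure ..
  let ?g = "\<lambda>\<omega> \<sigma> z. ennreal (norm (bohr_lift (dirichlet_shift \<sigma> (random_poly X \<omega> T c)) z) powr q)"
  let ?h = "\<lambda>\<omega> \<sigma>. \<integral>\<^sup>+z. ?g \<omega> \<sigma> z \<partial>torus_measure"
  have g3: "(\<lambda>(\<omega>, \<sigma>, z). ?g \<omega> \<sigma> z) \<in> borel_measurable (M \<Otimes>\<^sub>M (borel \<Otimes>\<^sub>M torus_measure))"
    using measurable_compose[OF random_poly_lift_measurable[OF T, of c], of "\<lambda>x. ennreal (norm x powr q)" borel]
    by (simp add: case_prod_unfold)
  have g3': "(\<lambda>(p, z). ?g (fst p) (snd p) z) \<in> borel_measurable ((M \<Otimes>\<^sub>M borel) \<Otimes>\<^sub>M torus_measure)"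
  proof -
    have "(\<lambda>x. (fst (fst x), snd (fst x), snd x)) \<in> (M \<Otimes>\<^sub>M borel) \<Otimes>\<^sub>M torus_measure \<rightarrow>\<^sub>M M \<Otimes>\<^sub>M (borel \<Otimes>\<^sub>M torus_measure)"
      by measurable
    from measurable_compose[OF this g3] show ?thesis by (simp add: case_prod_unfold)
  qed
  have h2: "(\<lambda>(\<omega>, \<sigma>). ?h \<omega> \<sigma>) \<in> borel_measurable (M \<Otimes>\<^sub>M borel)"
    using t.borel_measurable_nn_integral[OF g3'] by (simp add: case_prod_unfold)
  have sets_eq: "sets (M \<Otimes>\<^sub>M bergman_weight \<beta>) = sets (M \<Otimes>\<^sub>M borel)" by (intro sets_pair_measure_cong) auto
  have h2w: "(\<lambda>(\<omega>, \<sigma>). ?h \<omega> \<sigma>) \<in> borel_measurable (M \<Otimes>\<^sub>M bergman_weight \<beta>)"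
    using h2 by (simp add: measurable_cong_sets[OF sets_eq refl])
  have gz: "(\<lambda>(\<omega>, z). ?g \<omega> \<sigma> z) \<in> borel_measurable (M \<Otimes>\<^sub>M torus_measure)" for \<sigma>
  proof -
    have "(\<lambda>x. (fst x, \<sigma>, snd x)) \<in> M \<Otimes>\<^sub>M torus_measure \<rightarrow>\<^sub>M M \<Otimes>\<^sub>M (borel \<Otimes>\<^sub>M torus_measure)"
      by measurable
    from measurable_compose[OF this g3] show ?thesis by (simp add: case_prod_unfold)
  qed
  have iEw: "(\<lambda>p. indicator E (fst p) :: ennreal) \<in> borel_measurable (M \<Otimes>\<^sub>M bergman_weight \<beta>)"
    and iEt: "(\<lambda>p. indicator E (fst p) :: ennreal) \<in> borel_measurable (M \<Otimes>\<^sub>M torus_measure)"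
    using E by measurable
  have bp: "bergman_power q \<beta> (random_poly X \<omega> T c) = (\<integral>\<^sup>+\<sigma>. ?h \<omega> \<sigma> \<partial>bergman_weight \<beta>)" for \<omega>
    by (simp add: bergman_power_def hardy_power_def)
  show "(\<lambda>\<omega>. bergman_power q \<beta> (random_poly X \<omega> T c)) \<in> borel_measurable M"
    unfolding bp using h2w by (rule w.borel_measurable_nn_integral)
  have hw: "(\<lambda>\<sigma>. ?h \<omega> \<sigma>) \<in> borel_measurable (bergman_weight \<beta>)" if "\<omega> \<in> space M" for \<omega>
    using measurable_Pair2[OF h2w that] by simp
  have "(\<integral>\<^sup>+\<omega>. bergman_power q \<beta> (random_poly X \<omega> T c) * indicator E \<omega> \<partial>M)
     = (\<integral>\<^sup>+\<omega>. \<integral>\<^sup>+\<sigma>. ?h \<omega> \<sigma> * indicator E \<omega> \<partial>bergman_weight \<beta> \<partial>M)"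
    unfolding bp by (intro nn_integral_cong nn_integral_multc[symmetric] hw)
  also have "\<dots> = (\<integral>\<^sup>+\<sigma>. \<integral>\<^sup>+\<omega>. ?h \<omega> \<sigma> * indicator E \<omega> \<partial>M \<partial>bergman_weight \<beta>)"
    using borel_measurable_times_ennreal[OF h2w[unfolded case_prod_unfold] iEw]
    by (intro Mw.Fubini'[symmetric]) (simp add: case_prod_unfold)
  also have "\<dots> = (\<integral>\<^sup>+\<sigma>. \<integral>\<^sup>+z. (\<integral>\<^sup>+\<omega>. ?g \<omega> \<sigma> z * indicator E \<omega> \<partial>M) \<partial>torus_measure \<partial>bergman_weight \<beta>)"
  proof (rule nn_integral_cong)
    fix \<sigma> :: real
    have gm: "(\<lambda>z. ?g \<omega> \<sigma> z) \<in> borel_measurable torus_measure" if "\<omega> \<in> space M" for \<omega>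
      using measurable_Pair2[OF gz that] by simp
    have "(\<integral>\<^sup>+\<omega>. ?h \<omega> \<sigma> * indicator E \<omega> \<partial>M) = (\<integral>\<^sup>+\<omega>. \<integral>\<^sup>+z. ?g \<omega> \<sigma> z * indicator E \<omega> \<partial>torus_measure \<partial>M)"
      by (intro nn_integral_cong nn_integral_multc[symmetric] gm)
    also have "\<dots> = (\<integral>\<^sup>+z. (\<integral>\<^sup>+\<omega>. ?g \<omega> \<sigma> z * indicator E \<omega> \<partial>M) \<partial>torus_measure)"
      using borel_measurable_times_ennreal[OF gz[unfolded case_prod_unfold] iEt]
      by (intro Mt.Fubini'[symmetric]) (simp add: case_prod_unfold)
    finally show "(\<integral>\<^sup>+\<omega>. ?h \<omega> \<sigma> * indicator E \<omega> \<partial>M) = \<dots>" .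
  qed
  finally show "(\<integral>\<^sup>+\<omega>. bergman_power q \<beta> (random_poly X \<omega> T c) * indicator E \<omega> \<partial>M)
    = (\<integral>\<^sup>+\<sigma>. \<integral>\<^sup>+z. (\<integral>\<^sup>+\<omega>. ?g \<omega> \<sigma> z * indicator E \<omega> \<partial>M) \<partial>torus_measure \<partial>bergman_weight \<beta>)" .
qed

lemma random_poly_lift:
  assumes T: "finite T" "0 \<notin> T"
  shows "bohr_lift (dirichlet_shift \<sigma> (random_poly X \<omega> T c)) z
    = (\<Sum>n\<in>T. (c n * of_real (real n powr (- \<sigma>)) * bohr_monomial z n) * X n \<omega>)"
  using T by (subst bohr_lift_shift_sum[of T]) (auto simp: random_poly_def mult_ac split: if_splits)

text \<open>Unimodular monomials do not change the moduli of the coefficients, so both Khinchine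
  bounds are the same at almost every point of the torus.\<close>

lemma square_sum_twisted:
  assumes "\<forall>j. norm (z j) = 1"
  shows "(\<Sum>n\<in>T. (norm (c n * of_real (real n powr (- \<sigma>)) * bohr_monomial z n))\<^sup>2) = square_sum c T \<sigma>"
proof -
  have "(real n powr (- \<sigma>))\<^sup>2 = real n powr (- 2 * \<sigma>)" for n
    by (simp add: power2_eq_square powr_add[symmetric])
  then show ?thesis
    using assms by (simp add: square_sum_def norm_mult norm_bohr_monomial_eq power_mult_distrib)
qed

lemma indep_restrict: "0 \<notin> T \<Longrightarrow> prob_space.indep_vars M (\<lambda>_. borel) X T"
  by (rule prob_space.indep_vars_subset[OF M ind]) (auto intro: Suc_leI gr0I simp: Suc_le_eq)

lemma subgaussian_restrict: "0 \<notin> T \<Longrightarrow> n \<in> T \<Longrightarrow> normalized_subgaussian M (X n)"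
  by (rule sg) (cases n, auto)

lemma random_poly_expectation_le:
  assumes T: "finite T" "0 \<notin> T" and q: "q > 0" and \<beta>: "\<beta> > -1"
  shows "(\<integral>\<^sup>+\<omega>. bergman_power q \<beta> (random_poly X \<omega> T c) \<partial>M)
    \<le> ennreal (khinchine_const q) * (\<integral>\<^sup>+\<sigma>. ennreal (square_sum c T \<sigma> powr (q / 2)) \<partial>bergman_weight \<beta>)"
proof -
  interpret M: prob_space M by (rule M)
  interpret t: prob_space torus_measure by (rule prob_space_torus)
  have "(\<integral>\<^sup>+\<omega>. bergman_power q \<beta> (random_poly X \<omega> T c) \<partial>M)
     = (\<integral>\<^sup>+\<omega>. bergman_power q \<beta> (random_poly X \<omega> T c) * indicator (space M) \<omega> \<partial>M)"
    by (intro nn_integral_cong) auto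
  also have "\<dots> = (\<integral>\<^sup>+\<sigma>. \<integral>\<^sup>+z. (\<integral>\<^sup>+\<omega>. ennreal (norm (bohr_lift (dirichlet_shift \<sigma> (random_poly X \<omega> T c)) z) powr q) * indicator (space M) \<omega> \<partial>M)
        \<partial>torus_measure \<partial>bergman_weight \<beta>)"
    by (rule random_poly_fubini[OF T _ \<beta>]) simp
  also have "\<dots> \<le> (\<integral>\<^sup>+\<sigma>. \<integral>\<^sup>+z. ennreal (khinchine_const q * square_sum c T \<sigma> powr (q / 2)) \<partial>torus_measure \<partial>bergman_weight \<beta>)"
  proof (rule nn_integral_mono, rule nn_integral_mono_AE, use AE_torus_norm in eventually_elim)
    fix \<sigma> :: real and z :: "nat \<Rightarrow> complex" assume z: "\<forall>j. norm (z j) = 1"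
    have "(\<integral>\<^sup>+\<omega>. ennreal (norm (bohr_lift (dirichlet_shift \<sigma> (random_poly X \<omega> T c)) z) powr q) * indicator (space M) \<omega> \<partial>M)
       = (\<integral>\<^sup>+\<omega>. ennreal (norm (\<Sum>n\<in>T. (c n * of_real (real n powr (- \<sigma>)) * bohr_monomial z n) * X n \<omega>) powr q) \<partial>M)"
      unfolding random_poly_lift[OF T] by (intro nn_integral_cong) auto
    also have "\<dots> \<le> ennreal (khinchine_const q * (\<Sum>n\<in>T. (norm (c n * of_real (real n powr (- \<sigma>)) * bohr_monomial z n))\<^sup>2) powr (q / 2))"
      by (rule khinchine_upper[OF M indep_restrict[OF T(2)] T(1) subgaussian_restrict[OF T(2)] q])
    finally show "(\<integral>\<^sup>+\<omega>. ennreal (norm (bohr_lift (dirichlet_shift \<sigma> (random_poly X \<omega> T c)) z) powr q) * indicator (space M) \<omega> \<partial>M)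
       \<le> ennreal (khinchine_const q * square_sum c T \<sigma> powr (q / 2))"
      unfolding square_sum_twisted[OF z] .
  qed
  also have "\<dots> = (\<integral>\<^sup>+\<sigma>. ennreal (khinchine_const q) * ennreal (square_sum c T \<sigma> powr (q / 2)) \<partial>bergman_weight \<beta>)"
    using t.emeasure_space_1 khinchine_const_pos[OF q] by (simp add: ennreal_mult')
  also have "\<dots> = ennreal (khinchine_const q) * (\<integral>\<^sup>+\<sigma>. ennreal (square_sum c T \<sigma> powr (q / 2)) \<partial>bergman_weight \<beta>)"
    by (rule nn_integral_cmult) measurable
  finally show ?thesis .
qed

text \<open>The lower inequality enters as a hypothesis for all coefficients at once:
  \<open>E\<close> and \<kappa> are fixed, while the coefficients to which it is applied vary with
  \<sigma> and \<open>z\<close>.\<close>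

lemma random_poly_expectation_ge:
  assumes T: "finite T" "0 \<notin> T" and \<beta>: "\<beta> > -1" and E: "E \<in> sets M" and \<kappa>: "\<kappa> > 0"
    and lower: "\<And>c. ennreal (\<kappa> * (\<Sum>n\<in>T. (norm (c n))\<^sup>2) powr (q / 2))
        \<le> (\<integral>\<^sup>+\<omega>. ennreal (norm (\<Sum>n\<in>T. c n * X n \<omega>) powr q) * indicator E \<omega> \<partial>M)"
  shows "ennreal \<kappa> * (\<integral>\<^sup>+\<sigma>. ennreal (square_sum c T \<sigma> powr (q / 2)) \<partial>bergman_weight \<beta>)
    \<le> (\<integral>\<^sup>+\<omega>. bergman_power q \<beta> (random_poly X \<omega> T c) * indicator E \<omega> \<partial>M)"
proof -
  interpret M: prob_space M by (rule M)
  interpret t: prob_space torus_measure by (rule prob_space_torus)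
  have "ennreal \<kappa> * (\<integral>\<^sup>+\<sigma>. ennreal (square_sum c T \<sigma> powr (q / 2)) \<partial>bergman_weight \<beta>)
      = (\<integral>\<^sup>+\<sigma>. ennreal \<kappa> * ennreal (square_sum c T \<sigma> powr (q / 2)) \<partial>bergman_weight \<beta>)"
    by (rule nn_integral_cmult[symmetric]) measurable
  also have "\<dots> = (\<integral>\<^sup>+\<sigma>. \<integral>\<^sup>+z. ennreal (\<kappa> * square_sum c T \<sigma> powr (q / 2)) \<partial>torus_measure \<partial>bergman_weight \<beta>)"
    using t.emeasure_space_1 \<kappa> by (simp add: ennreal_mult')
  also have "\<dots> \<le> (\<integral>\<^sup>+\<sigma>. \<integral>\<^sup>+z. (\<integral>\<^sup>+\<omega>. ennreal (norm (bohr_lift (dirichlet_shift \<sigma> (random_poly X \<omega> T c)) z) powr q) * indicator E \<omega> \<partial>M)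
        \<partial>torus_measure \<partial>bergman_weight \<beta>)"
  proof (rule nn_integral_mono, rule nn_integral_mono_AE, use AE_torus_norm in eventually_elim)
    fix \<sigma> :: real and z :: "nat \<Rightarrow> complex" assume z: "\<forall>j. norm (z j) = 1"
    from lower[of "\<lambda>n. c n * of_real (real n powr (- \<sigma>)) * bohr_monomial z n"]
    show "ennreal (\<kappa> * square_sum c T \<sigma> powr (q / 2))
      \<le> (\<integral>\<^sup>+\<omega>. ennreal (norm (bohr_lift (dirichlet_shift \<sigma> (random_poly X \<omega> T c)) z) powr q) * indicator E \<omega> \<partial>M)"
      unfolding square_sum_twisted[OF z] random_poly_lift[OF T] .
  qed
  also have "\<dots> = (\<integral>\<^sup>+\<omega>. bergman_power q \<beta> (random_poly X \<omega> T c) * indicator E \<omega> \<partial>M)"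
    by (rule random_poly_fubini(1)[OF T E \<beta>, symmetric])
  finally show ?thesis .
qed

lemma random_abs_expectation_le: "n \<ge> 1 \<Longrightarrow> (\<integral>\<^sup>+\<omega>. ennreal (norm (X n \<omega>)) \<partial>M) \<le> 1"
proof -
  assume n: "n \<ge> 1"
  interpret M: prob_space M by (rule M)
  note [measurable] = random_measurable[OF n]
  have "(\<integral>\<^sup>+\<omega>. ennreal (norm (X n \<omega>)) \<partial>M) \<le> (\<integral>\<^sup>+\<omega>. ennreal (1 / 2) + ennreal (1 / 2) * ennreal ((norm (X n \<omega>))\<^sup>2) \<partial>M)"
  proof (rule nn_integral_mono)
    fix \<omega>
    have "0 \<le> (norm (X n \<omega>) - 1)\<^sup>2" by simp
    then have "norm (X n \<omega>) \<le> 1 / 2 + 1 / 2 * (norm (X n \<omega>))\<^sup>2" by (simp add: power2_eq_square algebra_simps)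
    then have "ennreal (norm (X n \<omega>)) \<le> ennreal (1 / 2 + 1 / 2 * (norm (X n \<omega>))\<^sup>2)" by (rule ennreal_leI)
    also have "\<dots> = ennreal (1 / 2) + ennreal (1 / 2) * ennreal ((norm (X n \<omega>))\<^sup>2)"
      by (subst ennreal_plus, simp, simp, subst ennreal_mult', simp, rule refl)
    finally show "ennreal (norm (X n \<omega>)) \<le> ennreal (1 / 2) + ennreal (1 / 2) * ennreal ((norm (X n \<omega>))\<^sup>2)" .
  qed
  also have "\<dots> = ennreal (1 / 2) + ennreal (1 / 2) * (\<integral>\<^sup>+\<omega>. ennreal ((norm (X n \<omega>))\<^sup>2) \<partial>M)"
    by (subst nn_integral_add) (auto simp: nn_integral_cmult M.emeasure_space_1)
  also have "\<dots> = ennreal (1 / 2) + ennreal (1 / 2)" using sg[OF n] by (simp add: normalized_subgaussian_def)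
  also have "\<dots> = 1" by (subst ennreal_plus[symmetric]) simp_all
  finally show ?thesis .
qed

end

section \<open>Sufficiency\<close>

lemma powr_tangent:
  fixes t r :: real
  assumes r: "r \<ge> 1" and t: "t \<ge> 0"
  shows "1 + r * (t - 1) \<le> t powr r"
proof (cases "t = 0")
  case True
  then show ?thesis using r by simp
next
  case False
  with t have t: "t > 0" by simp
  have "(t powr r) powr (1 / r) * 1 powr (1 - 1 / r) \<le> 1 / r * t powr r + (1 - 1 / r) * 1"
    by (rule Youngs_inequality_0) (use r t in auto)
  then have "t \<le> 1 / r * t powr r + (1 - 1 / r)" using r t by (simp add: powr_powr)
  then have "r * t \<le> r * (1 / r * t powr r + (1 - 1 / r))" using r by (intro mult_left_mono) auto
  also have "\<dots> = t powr r + r - 1" using r by (simp add: distrib_left right_diff_distrib)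
  finally show ?thesis by (simp add: algebra_simps)
qed

text \<open>Jensen's inequality by hand: \<open>y\<close>, the squared modulus of the lift over
  \<open>V\<close>, has mean 1, and the tangent of \<open>y powr (p / 2)\<close> at 1 is integrated.
  It is used as \<open>p / 2 * y \<le> y powr (p / 2) + (p / 2 - 1)\<close>, in which all terms are
  nonnegative since \<open>p \<ge> 2\<close>.\<close>

lemma hardy_power_2_le:
  assumes a: "a \<in> dirichlet_polys" and p: "p \<ge> 2"
  shows "ennreal ((\<Sum>n\<in>{n. a n \<noteq> 0} - {0}. (norm (a n))\<^sup>2) powr (p / 2)) \<le> hardy_power p a"
proof -
  interpret t: prob_space torus_measure by (rule prob_space_torus)
  let ?T = "{n. a n \<noteq> 0} - {0}"
  define V where "V = (\<Sum>n\<in>?T. (norm (a n))\<^sup>2)"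
  have T: "finite ?T" using a finite_support by auto
  show ?thesis
  proof (cases "V = 0")
    case True
    then show ?thesis by (simp add: V_def)
  next
    case False
    then have V: "V > 0" unfolding V_def using sum_nonneg[of ?T "\<lambda>n. (norm (a n))\<^sup>2"] by auto
    let ?y = "\<lambda>z. (norm (bohr_lift a z))\<^sup>2 / V"
    have h2: "(\<integral>\<^sup>+z. ennreal ((norm (bohr_lift a z))\<^sup>2) \<partial>torus_measure) = ennreal V"
      using parseval_torus[of ?T a] T by (simp add: hardy_power_def powr_numeral V_def)
    have "ennreal (p / 2) = ennreal (p / 2) * (\<integral>\<^sup>+z. ennreal (1 / V) * ennreal ((norm (bohr_lift a z))\<^sup>2) \<partial>torus_measure)"
      using V p by (subst nn_integral_cmult) (auto simp: h2 ennreal_mult'[symmetric])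
    also have "\<dots> = (\<integral>\<^sup>+z. ennreal (p / 2) * (ennreal (1 / V) * ennreal ((norm (bohr_lift a z))\<^sup>2)) \<partial>torus_measure)"
      by (rule nn_integral_cmult[symmetric]) measurable
    also have "\<dots> \<le> (\<integral>\<^sup>+z. ennreal (1 / V powr (p / 2)) * ennreal (norm (bohr_lift a z) powr p) + ennreal (p / 2 - 1) \<partial>torus_measure)"
    proof (rule nn_integral_mono)
      fix z
      have "1 + p / 2 * (?y z - 1) \<le> ?y z powr (p / 2)"
        using p V by (intro powr_tangent) auto
      also have "?y z powr (p / 2) = 1 / V powr (p / 2) * norm (bohr_lift a z) powr p"
        using V by (simp add: powr_divide powr_powr flip: powr_numeral)
      finally have "p / 2 * (1 / V * (norm (bohr_lift a z))\<^sup>2) \<le> 1 / V powr (p / 2) * norm (bohr_lift a z) powr p + (p / 2 - 1)"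
        by (simp add: algebra_simps)
      then have "ennreal (p / 2 * (1 / V * (norm (bohr_lift a z))\<^sup>2)) \<le> ennreal (1 / V powr (p / 2) * norm (bohr_lift a z) powr p + (p / 2 - 1))"
        by (rule ennreal_leI)
      also have "ennreal (1 / V powr (p / 2) * norm (bohr_lift a z) powr p + (p / 2 - 1))
         = ennreal (1 / V powr (p / 2)) * ennreal (norm (bohr_lift a z) powr p) + ennreal (p / 2 - 1)"
        using p by (subst ennreal_plus) (simp_all add: ennreal_mult'[symmetric])
      also have "ennreal (p / 2 * (1 / V * (norm (bohr_lift a z))\<^sup>2)) = ennreal (p / 2) * (ennreal (1 / V) * ennreal ((norm (bohr_lift a z))\<^sup>2))"
        using ennreal_mult'[of "p / 2" "1 / V * (norm (bohr_lift a z))\<^sup>2"]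
          ennreal_mult'[of "1 / V" "(norm (bohr_lift a z))\<^sup>2"] p V by simp
      finally show "ennreal (p / 2) * (ennreal (1 / V) * ennreal ((norm (bohr_lift a z))\<^sup>2))
         \<le> ennreal (1 / V powr (p / 2)) * ennreal (norm (bohr_lift a z) powr p) + ennreal (p / 2 - 1)" .
    qed
    also have "\<dots> = ennreal (1 / V powr (p / 2)) * hardy_power p a + ennreal (p / 2 - 1)"
      unfolding hardy_power_def
      by (subst nn_integral_add, measurable, subst nn_integral_cmult, measurable) (use t.emeasure_space_1 in simp)
    finally have "ennreal (p / 2) \<le> ennreal (1 / V powr (p / 2)) * hardy_power p a + ennreal (p / 2 - 1)" .
    moreover have "ennreal (p / 2) = 1 + ennreal (p / 2 - 1)"
      using p by (subst ennreal_1[symmetric], subst ennreal_plus[symmetric]) auto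
    ultimately have "1 \<le> ennreal (1 / V powr (p / 2)) * hardy_power p a"
      by (simp add: ennreal_add_left_cancel_le add.commute)
    then have "ennreal (V powr (p / 2)) * 1 \<le> ennreal (V powr (p / 2)) * (ennreal (1 / V powr (p / 2)) * hardy_power p a)"
      by (rule mult_left_mono) simp
    also have "\<dots> = hardy_power p a"
      using V by (simp add: mult.assoc[symmetric] ennreal_mult'[symmetric])
    finally show ?thesis by (simp add: V_def)
  qed
qed

text \<open>For a finite index set the square sums of the approximants converge, since the
  coefficients do. Fatou then transfers their uniform bound, and it does not depend on
  \<open>T\<close>.\<close>

lemma bergman_space_square_sum_bound:
  assumes p: "p \<ge> 2" and \<alpha>: "\<alpha> > -1" and f: "f \<in> bergman_space p \<alpha>"
  obtains B where "B \<ge> 0" "\<And>T. finite T \<Longrightarrow> 0 \<notin> T \<Longrightarrow> (\<integral>\<^sup>+\<sigma>. ennreal (square_sum f T \<sigma> powr (p / 2)) \<partial>bergman_weight \<alpha>) \<le> ennreal B"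
proof -
  have p0: "p > 0" using p by simp
  obtain P B where PP: "(\<forall>k. P k \<in> dirichlet_polys) \<and> bergman_Cauchy p \<alpha> P \<and> (\<forall>n\<ge>1. (\<lambda>k. P k n) \<longlonglongrightarrow> f n) \<and>
    (\<forall>\<^sub>F k in sequentially. bergman_power p \<alpha> (P k) \<le> ennreal B)"
    using bergman_space_approx[OF p0 \<alpha> f] by (elim exE)
  then have P: "P k \<in> dirichlet_polys"
    and coeff: "n \<ge> 1 \<Longrightarrow> (\<lambda>k. P k n) \<longlonglongrightarrow> f n"
    and PB: "\<forall>\<^sub>F k in sequentially. bergman_power p \<alpha> (P k) \<le> ennreal B" for k n
    by simp_all
  have "(\<integral>\<^sup>+\<sigma>. ennreal (square_sum f T \<sigma> powr (p / 2)) \<partial>bergman_weight \<alpha>) \<le> ennreal (max B 0)"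
    if T: "finite T" "0 \<notin> T" for T
  proof -
    have T1: "n \<ge> 1" if "n \<in> T" for n using that T(2) by (cases n) auto
    have lim: "(\<lambda>k. ennreal (square_sum (P k) T \<sigma> powr (p / 2))) \<longlonglongrightarrow> ennreal (square_sum f T \<sigma> powr (p / 2))" for \<sigma>
    proof (intro tendsto_ennrealI tendsto_powr2 tendsto_const)
      show "(\<lambda>k. square_sum (P k) T \<sigma>) \<longlonglongrightarrow> square_sum f T \<sigma>"
        unfolding square_sum_def by (intro tendsto_intros coeff T1)
    qed (use p in \<open>auto simp: square_sum_nonneg\<close>)
    have le: "ennreal (square_sum (P k) T \<sigma> powr (p / 2)) \<le> hardy_power p (dirichlet_shift \<sigma> (P k))" for k \<sigma>
    proof -
      let ?d = "dirichlet_shift \<sigma> (P k)"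
      have d: "?d \<in> dirichlet_polys" by (intro dirichlet_shift_polys P)
      let ?U = "{n. ?d n \<noteq> 0} - {0}"
      have U: "finite ?U" using d finite_support by auto
      have "(real n powr (- \<sigma>))\<^sup>2 = real n powr (- 2 * \<sigma>)" for n
        by (simp add: power2_eq_square powr_add[symmetric])
      then have "square_sum (P k) T \<sigma> = (\<Sum>n\<in>T. (norm (?d n))\<^sup>2)"
        by (simp add: square_sum_def dirichlet_shift_def norm_mult power_mult_distrib)
      also have "\<dots> \<le> (\<Sum>n\<in>T \<union> ?U. (norm (?d n))\<^sup>2)"
        using T U by (intro sum_mono2) auto
      also have "\<dots> = (\<Sum>n\<in>?U. (norm (?d n))\<^sup>2)"
        using T U by (intro sum.mono_neutral_right) auto
      finally have "square_sum (P k) T \<sigma> powr (p / 2) \<le> (\<Sum>n\<in>?U. (norm (?d n))\<^sup>2) powr (p / 2)"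
        using p by (intro powr_mono2) (auto simp: square_sum_nonneg)
      then show ?thesis using hardy_power_2_le[OF d p] by (meson ennreal_leI order_trans)
    qed
    have "(\<integral>\<^sup>+\<sigma>. ennreal (square_sum f T \<sigma> powr (p / 2)) \<partial>bergman_weight \<alpha>)
        = (\<integral>\<^sup>+\<sigma>. liminf (\<lambda>k. ennreal (square_sum (P k) T \<sigma> powr (p / 2))) \<partial>bergman_weight \<alpha>)"
      using lim_imp_Liminf[OF _ lim] by simp
    also have "\<dots> \<le> liminf (\<lambda>k. \<integral>\<^sup>+\<sigma>. ennreal (square_sum (P k) T \<sigma> powr (p / 2)) \<partial>bergman_weight \<alpha>)"
      by (rule nn_integral_liminf) measurable
    also have "\<dots> \<le> limsup (\<lambda>k. \<integral>\<^sup>+\<sigma>. ennreal (square_sum (P k) T \<sigma> powr (p / 2)) \<partial>bergman_weight \<alpha>)"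
      by (rule Liminf_le_Limsup) simp
    also have "\<dots> \<le> ennreal B"
    proof (rule Limsup_bounded)
      show "\<forall>\<^sub>F k in sequentially. (\<integral>\<^sup>+\<sigma>. ennreal (square_sum (P k) T \<sigma> powr (p / 2)) \<partial>bergman_weight \<alpha>) \<le> ennreal B"
        using PB
      proof eventually_elim
        case (elim k)
        have "(\<integral>\<^sup>+\<sigma>. ennreal (square_sum (P k) T \<sigma> powr (p / 2)) \<partial>bergman_weight \<alpha>) \<le> bergman_power p \<alpha> (P k)"
          unfolding bergman_power_def by (intro nn_integral_mono le)
        then show ?case using elim by (rule order_trans)
      qed
    qed
    also have "\<dots> \<le> ennreal (max B 0)" by (intro ennreal_leI) auto
    finally show ?thesis .
  qed
  then show ?thesis by (intro that[of "max B 0"]) auto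
qed

text \<open>Written as a \<open>lim\<close> so that measurability is immediate. For \<sigma> \<le> 0
  the limit may fail to exist and the value is arbitrary, but the weight has no mass there.\<close>

definition square_series :: "(nat \<Rightarrow> complex) \<Rightarrow> real \<Rightarrow> real" where
  "square_series f \<sigma> = lim (\<lambda>N. square_sum f {1..N} \<sigma>)"

lemma square_series_measurable [measurable]: "square_series f \<in> borel_measurable borel"
  unfolding square_series_def by measurable

lemma powr_integral_finite:
  assumes \<beta>: "\<beta> > -1" and c: "c < \<beta> + 1"
  shows "(\<integral>\<^sup>+\<sigma>. ennreal (\<sigma> powr (- c)) \<partial>bergman_weight \<beta>) < \<infinity>"
proof -
  have "(\<integral>\<^sup>+\<sigma>. ennreal (\<sigma> powr (- c)) \<partial>bergman_weight \<beta>) = ennreal (weight_const \<beta>) *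
    (\<integral>\<^sup>+\<sigma>. ennreal (indicator {0<..} \<sigma> * (\<sigma> powr \<beta> * exp (- 2 * \<sigma>))) * ennreal (\<sigma> powr (- c)) \<partial>lborel)"
    by (rule nn_integral_bergman_weight[OF _ \<beta>]) measurable
  also have "(\<integral>\<^sup>+\<sigma>. ennreal (indicator {0<..} \<sigma> * (\<sigma> powr \<beta> * exp (- 2 * \<sigma>))) * ennreal (\<sigma> powr (- c)) \<partial>lborel)
    = (\<integral>\<^sup>+\<sigma>. ennreal (indicator {0<..} \<sigma> * (\<sigma> powr (\<beta> - c + 1 - 1) * exp (- 2 * \<sigma>))) \<partial>lborel)"
  proof (rule nn_integral_cong)
    fix \<sigma> :: real
    show "ennreal (indicator {0<..} \<sigma> * (\<sigma> powr \<beta> * exp (- 2 * \<sigma>))) * ennreal (\<sigma> powr (- c))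
       = ennreal (indicator {0<..} \<sigma> * (\<sigma> powr (\<beta> - c + 1 - 1) * exp (- 2 * \<sigma>)))"
    proof (cases "\<sigma> > 0")
      case True
      have "\<sigma> powr \<beta> * exp (- 2 * \<sigma>) * \<sigma> powr (- c) = \<sigma> powr (\<beta> - c) * exp (- 2 * \<sigma>)"
        using True powr_add[of \<sigma> \<beta> "- c"] by simp
      then show ?thesis using True by (simp add: ennreal_mult'[symmetric])
    qed simp
  qed
  also have "\<dots> = ennreal (Gamma (\<beta> - c + 1) / 2 powr (\<beta> - c + 1))"
    using c by (intro nn_integral_gamma_scaled) auto
  finally show ?thesis by (simp add: ennreal_mult_less_top)
qed

text \<open>The square sums decrease in \<sigma>, so their value at \<sigma> times the mass of
  \<open>{0<..\<sigma>}\<close> is at most the integral; this yields the pointwise bound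
  \<open>D * \<sigma> powr (- 2 * \<kappa>)\<close>. In the strict case that bound is integrable by
  itself.\<close>

lemma square_series_integrable:
  assumes p: "p \<ge> 2" and q: "q > 0" and \<alpha>: "\<alpha> > -1" and \<beta>: "\<beta> > -1"
    and cond: "(\<alpha> + 1) / p < (\<beta> + 1) / q \<or> q \<ge> p \<and> (\<alpha> + 1) / p = (\<beta> + 1) / q"
    and B0: "B \<ge> 0" and B': "\<forall>N. (\<integral>\<^sup>+\<sigma>. ennreal (square_sum f {1..N} \<sigma> powr (p / 2)) \<partial>bergman_weight \<alpha>) \<le> ennreal B"
  shows "\<And>\<sigma> N. \<sigma> > 0 \<Longrightarrow> square_sum f {1..N} \<sigma> \<le> square_series f \<sigma>"
    and "\<And>\<sigma>. \<sigma> > 0 \<Longrightarrow> (\<lambda>N. square_sum f {1..N} \<sigma>) \<longlonglongrightarrow> square_series f \<sigma>"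
    and "(\<integral>\<^sup>+\<sigma>. ennreal (square_series f \<sigma> powr (q / 2)) \<partial>bergman_weight \<beta>) < \<infinity>"
proof -
  interpret wa: prob_space "bergman_weight \<alpha>" by (rule prob_space_bergman_weight[OF \<alpha>])
  interpret wb: prob_space "bergman_weight \<beta>" by (rule prob_space_bergman_weight[OF \<beta>])
  define \<kappa> where "\<kappa> = (\<alpha> + 1) / p"
  have \<kappa>: "\<kappa> > 0" using p \<alpha> by (simp add: \<kappa>_def)
  let ?V = "\<lambda>N. square_sum f {1..N}"
  define c where "c = weight_const \<alpha> * exp (- 2) / (\<alpha> + 1)"
  have c: "c > 0" using weight_const_pos[OF \<alpha>] \<alpha> by (simp add: c_def)
  \<comment> \<open>The mass of \<open>{0<..\<sigma>}\<close> is at least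
    \<open>c * \<sigma> powr (\<alpha> + 1)\<close> for \<sigma> \<le> 1; solving for the square sum
    raises \<open>B / c\<close> to the power \<open>2 / p\<close>.\<close>
  define D where "D = (B / c) powr (2 / p)"
  have D: "D \<ge> 0" by (simp add: D_def)
  have V01: "?V N \<sigma> \<le> D * \<sigma> powr (- 2 * \<kappa>)" if \<sigma>: "0 < \<sigma>" "\<sigma> \<le> 1" for N \<sigma>
  proof -
    have "ennreal (?V N \<sigma> powr (p / 2)) * ennreal (c * \<sigma> powr (\<alpha> + 1)) \<le> ennreal (?V N \<sigma> powr (p / 2)) * emeasure (bergman_weight \<alpha>) {0<..\<sigma>}"
      using bergman_weight_interval_ge[OF \<alpha>, of 0 \<sigma>] \<sigma> \<alpha> by (intro mult_left_mono) (auto simp: c_def)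
    also have "\<dots> = (\<integral>\<^sup>+t. ennreal (?V N \<sigma> powr (p / 2)) * indicator {0<..\<sigma>} t \<partial>bergman_weight \<alpha>)"
      by (rule nn_integral_cmult_indicator[symmetric]) simp
    also have "\<dots> \<le> (\<integral>\<^sup>+t. ennreal (?V N t powr (p / 2)) \<partial>bergman_weight \<alpha>)"
      using p by (intro nn_integral_mono)
        (auto split: split_indicator intro!: ennreal_leI powr_mono2 square_sum_antimono simp: square_sum_nonneg)
    also have "\<dots> \<le> ennreal B" using B' by simp
    finally have "?V N \<sigma> powr (p / 2) * (c * \<sigma> powr (\<alpha> + 1)) \<le> B"
      using c B0 by (simp add: ennreal_mult'[symmetric] ennreal_le_iff)
    then have "?V N \<sigma> powr (p / 2) \<le> B / c * \<sigma> powr (- (\<alpha> + 1))"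
    proof -
      have "\<sigma> powr (\<alpha> + 1) > 0" using \<sigma> by simp
      moreover have "\<sigma> powr (- (\<alpha> + 1)) = 1 / \<sigma> powr (\<alpha> + 1)"
        by (rule powr_minus_divide)
      ultimately show ?thesis
        using c \<open>?V N \<sigma> powr (p / 2) * (c * \<sigma> powr (\<alpha> + 1)) \<le> B\<close>
        by (simp add: pos_le_divide_eq mult.commute mult.left_commute)
    qed
    then have "(?V N \<sigma> powr (p / 2)) powr (2 / p) \<le> (B / c * \<sigma> powr (- (\<alpha> + 1))) powr (2 / p)"
      using p by (intro powr_mono2) auto
    also have "\<dots> = D * \<sigma> powr (- (\<alpha> + 1) * (2 / p))"
      unfolding D_def using B0 c by (subst powr_mult) (simp_all only: powr_powr)
    also have "- (\<alpha> + 1) * (2 / p) = - 2 * \<kappa>" by (simp add: \<kappa>_def)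
    finally show ?thesis using p by (simp add: powr_powr square_sum_nonneg)
  qed
  have V1: "?V N \<sigma> \<le> D" if "\<sigma> > 1" for N \<sigma>
    using square_sum_antimono[of "{1..N}" 1 \<sigma> f] V01[of 1 N] that by simp
  have bdd: "bdd_above (range (\<lambda>N. ?V N \<sigma>))" if "\<sigma> > 0" for \<sigma>
    using V01[of \<sigma>] V1[of \<sigma>] that by (cases "\<sigma> \<le> 1") (auto intro!: bdd_aboveI2)
  have inc: "incseq (\<lambda>N. ?V N \<sigma>)" for \<sigma>
    unfolding square_sum_def by (intro incseq_SucI sum_mono2) auto
  show lim: "(\<lambda>N. ?V N \<sigma>) \<longlonglongrightarrow> square_series f \<sigma>" if "\<sigma> > 0" for \<sigma>
    using LIMSEQ_incseq_SUP[OF bdd[OF that] inc] unfolding square_series_def by (simp add: limI)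
  show up: "?V N \<sigma> \<le> square_series f \<sigma>" if "\<sigma> > 0" for N \<sigma>
    by (rule incseq_le[OF inc lim[OF that]])
  have W01: "square_series f \<sigma> \<le> D * \<sigma> powr (- 2 * \<kappa>)" if "0 < \<sigma>" "\<sigma> \<le> 1" for \<sigma>
    by (rule LIMSEQ_le_const2[OF lim]) (use V01[OF that] that in auto)
  have W1: "square_series f \<sigma> \<le> D" if "1 < \<sigma>" for \<sigma>
    by (rule LIMSEQ_le_const2[OF lim]) (use V1[OF that] that in auto)
  have W0: "square_series f \<sigma> \<ge> 0" if "\<sigma> > 0" for \<sigma> using up[OF that, of 0] by (simp add: square_sum_def)

  show "(\<integral>\<^sup>+\<sigma>. ennreal (square_series f \<sigma> powr (q / 2)) \<partial>bergman_weight \<beta>) < \<infinity>"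
  proof (cases "(\<alpha> + 1) / p < (\<beta> + 1) / q")
    case True
    then have kq: "\<kappa> * q < \<beta> + 1" using q by (simp add: \<kappa>_def pos_less_divide_eq)
    have "(\<integral>\<^sup>+\<sigma>. ennreal (square_series f \<sigma> powr (q / 2)) \<partial>bergman_weight \<beta>)
       \<le> (\<integral>\<^sup>+\<sigma>. ennreal (D powr (q / 2)) * (1 + ennreal (\<sigma> powr (- (\<kappa> * q)))) \<partial>bergman_weight \<beta>)"
    proof (rule nn_integral_mono_AE, use AE_bergman_weight_pos in eventually_elim)
      fix \<sigma> :: real assume \<sigma>: "\<sigma> > 0"
      have "square_series f \<sigma> powr (q / 2) \<le> D powr (q / 2) * (1 + \<sigma> powr (- (\<kappa> * q)))"
      proof (cases "\<sigma> \<le> 1")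
        case True
        have "square_series f \<sigma> powr (q / 2) \<le> (D * \<sigma> powr (- 2 * \<kappa>)) powr (q / 2)"
          using W01[OF \<sigma> True] W0[OF \<sigma>] q by (intro powr_mono2) auto
        also have "\<dots> = D powr (q / 2) * \<sigma> powr (- (\<kappa> * q))"
          using D by (simp add: powr_mult powr_powr)
        also have "\<dots> \<le> D powr (q / 2) * (1 + \<sigma> powr (- (\<kappa> * q)))" by (intro mult_left_mono) auto
        finally show ?thesis .
      next
        case False
        have "square_series f \<sigma> powr (q / 2) \<le> D powr (q / 2) * 1"
          using W1 W0[OF \<sigma>] q False by (simp add: powr_mono2)
        also have "\<dots> \<le> D powr (q / 2) * (1 + \<sigma> powr (- (\<kappa> * q)))" by (intro mult_left_mono) auto
        finally show ?thesis .
      qed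
      then have "ennreal (square_series f \<sigma> powr (q / 2)) \<le> ennreal (D powr (q / 2) * (1 + \<sigma> powr (- (\<kappa> * q))))" by (rule ennreal_leI)
      also have "\<dots> = ennreal (D powr (q / 2)) * (1 + ennreal (\<sigma> powr (- (\<kappa> * q))))"
        by (subst ennreal_mult', simp, subst ennreal_plus, simp_all)
      finally show "ennreal (square_series f \<sigma> powr (q / 2)) \<le> ennreal (D powr (q / 2)) * (1 + ennreal (\<sigma> powr (- (\<kappa> * q))))" .
    qed
    also have "\<dots> = ennreal (D powr (q / 2)) * (1 + (\<integral>\<^sup>+\<sigma>. ennreal (\<sigma> powr (- (\<kappa> * q))) \<partial>bergman_weight \<beta>))"
      using wb.emeasure_space_1 by (subst nn_integral_cmult, measurable, subst nn_integral_add) auto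
    also have "\<dots> < \<infinity>" using powr_integral_finite[OF \<beta> kq] by (simp add: ennreal_mult_less_top)
    finally show ?thesis .
  next
    case False
    with cond have qp: "q \<ge> p" and eq: "(\<alpha> + 1) / p = (\<beta> + 1) / q" by auto
    \<comment> \<open>In the case of equality the pointwise bound alone would lead to a divergent
      integral. It is applied only to the surplus power \<open>(q - p) / 2\<close>; this costs
      \<open>\<sigma> powr (- \<gamma>)\<close>, and \<beta> - \<gamma> = \<alpha> turns the weight
      into the one for which the power \<open>p / 2\<close> is integrable.\<close>
    define \<gamma> where "\<gamma> = \<kappa> * (q - p)"
    have k1: "\<kappa> * p = \<alpha> + 1" using p by (simp add: \<kappa>_def)
    have k2: "\<kappa> * q = \<beta> + 1" using q eq by (simp add: \<kappa>_def)
    have \<gamma>: "\<beta> - \<gamma> = \<alpha>" using k1 k2 by (simp add: \<gamma>_def algebra_simps)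
    let ?K = "weight_const \<beta> / weight_const \<alpha>"
    have K: "?K > 0" using weight_const_pos[OF \<alpha>] weight_const_pos[OF \<beta>] by simp
    let ?W = "\<lambda>\<sigma>. ennreal (square_series f \<sigma> powr (p / 2))"
    have mW: "?W \<in> borel_measurable borel" by measurable
    have IW: "(\<integral>\<^sup>+\<sigma>. ?W \<sigma> \<partial>bergman_weight \<alpha>) \<le> ennreal B"
    proof -
      have "(\<integral>\<^sup>+\<sigma>. ?W \<sigma> \<partial>bergman_weight \<alpha>)
          = (\<integral>\<^sup>+\<sigma>. liminf (\<lambda>N. ennreal (?V N \<sigma> powr (p / 2))) \<partial>bergman_weight \<alpha>)"
      proof (rule nn_integral_cong_AE, use AE_bergman_weight_pos in eventually_elim)
        fix \<sigma> :: real assume \<sigma>: "\<sigma> > 0"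
        have "(\<lambda>N. ennreal (?V N \<sigma> powr (p / 2))) \<longlonglongrightarrow> ?W \<sigma>"
          by (intro tendsto_ennrealI tendsto_powr2 tendsto_const lim \<sigma>) (use p in \<open>auto simp: square_sum_nonneg\<close>)
        then show "?W \<sigma> = liminf (\<lambda>N. ennreal (?V N \<sigma> powr (p / 2)))"
          by (rule lim_imp_Liminf[symmetric, rotated]) simp
      qed
      also have "\<dots> \<le> liminf (\<lambda>N. \<integral>\<^sup>+\<sigma>. ennreal (?V N \<sigma> powr (p / 2)) \<partial>bergman_weight \<alpha>)"
        by (rule nn_integral_liminf) measurable
      also have "\<dots> \<le> limsup (\<lambda>N. \<integral>\<^sup>+\<sigma>. ennreal (?V N \<sigma> powr (p / 2)) \<partial>bergman_weight \<alpha>)"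
        by (rule Liminf_le_Limsup) simp
      also have "\<dots> \<le> ennreal B" by (rule Limsup_bounded) (use B' in auto)
      finally show ?thesis .
    qed
    have "(\<integral>\<^sup>+\<sigma>. ennreal (square_series f \<sigma> powr (q / 2)) \<partial>bergman_weight \<beta>)
       \<le> (\<integral>\<^sup>+\<sigma>. ennreal (D powr (q / 2)) + ennreal (D powr ((q - p) / 2)) * (?W \<sigma> * ennreal (\<sigma> powr (- \<gamma>))) \<partial>bergman_weight \<beta>)"
    proof (rule nn_integral_mono_AE, use AE_bergman_weight_pos in eventually_elim)
      fix \<sigma> :: real assume \<sigma>: "\<sigma> > 0"
      show "ennreal (square_series f \<sigma> powr (q / 2)) \<le> ennreal (D powr (q / 2)) + ennreal (D powr ((q - p) / 2)) * (?W \<sigma> * ennreal (\<sigma> powr (- \<gamma>)))"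
      proof (cases "\<sigma> \<le> 1")
        case True
        have "square_series f \<sigma> powr (q / 2) = square_series f \<sigma> powr (p / 2) * square_series f \<sigma> powr ((q - p) / 2)"
          by (simp add: powr_add[symmetric] diff_divide_distrib)
        also have "\<dots> \<le> square_series f \<sigma> powr (p / 2) * (D * \<sigma> powr (- 2 * \<kappa>)) powr ((q - p) / 2)"
          using W01[OF \<sigma> True] W0[OF \<sigma>] qp by (intro mult_left_mono powr_mono2) auto
        also have "(D * \<sigma> powr (- 2 * \<kappa>)) powr ((q - p) / 2) = D powr ((q - p) / 2) * \<sigma> powr (- \<gamma>)"
          using D by (simp add: powr_mult powr_powr \<gamma>_def)
        finally have "square_series f \<sigma> powr (q / 2) \<le> D powr ((q - p) / 2) * (square_series f \<sigma> powr (p / 2) * \<sigma> powr (- \<gamma>))"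
          by (simp add: mult_ac)
        then have "ennreal (square_series f \<sigma> powr (q / 2)) \<le> ennreal (D powr ((q - p) / 2)) * (?W \<sigma> * ennreal (\<sigma> powr (- \<gamma>)))"
          by (simp add: ennreal_mult'[symmetric] ennreal_leI)
        then show ?thesis by (rule order_trans) simp
      next
        case False
        have "ennreal (square_series f \<sigma> powr (q / 2)) \<le> ennreal (D powr (q / 2))"
          using W1 W0[OF \<sigma>] q False by (intro ennreal_leI powr_mono2) auto
        then show ?thesis by (rule order_trans) simp
      qed
    qed
    also have "\<dots> = ennreal (D powr (q / 2)) + ennreal (D powr ((q - p) / 2)) * (\<integral>\<^sup>+\<sigma>. ?W \<sigma> * ennreal (\<sigma> powr (- \<gamma>)) \<partial>bergman_weight \<beta>)"
    proof -
      have "(\<lambda>\<sigma>. ?W \<sigma> * ennreal (\<sigma> powr (- \<gamma>))) \<in> borel_measurable (bergman_weight \<beta>)"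
        using mW by measurable
      then show ?thesis using wb.emeasure_space_1 by (subst nn_integral_add) (auto simp: nn_integral_cmult)
    qed
    also have "(\<integral>\<^sup>+\<sigma>. ?W \<sigma> * ennreal (\<sigma> powr (- \<gamma>)) \<partial>bergman_weight \<beta>) = ennreal ?K * (\<integral>\<^sup>+\<sigma>. ?W \<sigma> \<partial>bergman_weight \<alpha>)"
    proof -
      have "(\<integral>\<^sup>+\<sigma>. ?W \<sigma> * ennreal (\<sigma> powr (- \<gamma>)) \<partial>bergman_weight \<beta>) = ennreal (weight_const \<beta>) *
        (\<integral>\<^sup>+\<sigma>. ennreal (indicator {0<..} \<sigma> * (\<sigma> powr \<beta> * exp (- 2 * \<sigma>))) * (?W \<sigma> * ennreal (\<sigma> powr (- \<gamma>))) \<partial>lborel)"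
        using mW by (intro nn_integral_bergman_weight \<beta>) measurable
      also have "(\<integral>\<^sup>+\<sigma>. ennreal (indicator {0<..} \<sigma> * (\<sigma> powr \<beta> * exp (- 2 * \<sigma>))) * (?W \<sigma> * ennreal (\<sigma> powr (- \<gamma>))) \<partial>lborel)
        = (\<integral>\<^sup>+\<sigma>. ennreal (indicator {0<..} \<sigma> * (\<sigma> powr \<alpha> * exp (- 2 * \<sigma>))) * ?W \<sigma> \<partial>lborel)"
      proof (rule nn_integral_cong)
        fix \<sigma> :: real
        show "ennreal (indicator {0<..} \<sigma> * (\<sigma> powr \<beta> * exp (- 2 * \<sigma>))) * (?W \<sigma> * ennreal (\<sigma> powr (- \<gamma>)))
           = ennreal (indicator {0<..} \<sigma> * (\<sigma> powr \<alpha> * exp (- 2 * \<sigma>))) * ?W \<sigma>"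
        proof (cases "\<sigma> > 0")
          case True
          have "\<sigma> powr \<alpha> = \<sigma> powr \<beta> * \<sigma> powr (- \<gamma>)" using \<gamma> by (simp add: powr_add[symmetric])
          then show ?thesis using True by (simp add: ennreal_mult'[symmetric] mult_ac)
        qed simp
      qed
      also have "ennreal (weight_const \<beta>) * \<dots> = ennreal ?K * (ennreal (weight_const \<alpha>) * (\<integral>\<^sup>+\<sigma>. ennreal (indicator {0<..} \<sigma> * (\<sigma> powr \<alpha> * exp (- 2 * \<sigma>))) * ?W \<sigma> \<partial>lborel))"
        using weight_const_pos[OF \<alpha>] weight_const_pos[OF \<beta>] by (simp add: mult.assoc[symmetric] ennreal_mult'[symmetric])
      also have "\<dots> = ennreal ?K * (\<integral>\<^sup>+\<sigma>. ?W \<sigma> \<partial>bergman_weight \<alpha>)"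
        using mW by (subst nn_integral_bergman_weight[OF _ \<alpha>]) auto
      finally show ?thesis .
    qed
    also have "ennreal (D powr (q / 2)) + ennreal (D powr ((q - p) / 2)) * (ennreal ?K * (\<integral>\<^sup>+\<sigma>. ?W \<sigma> \<partial>bergman_weight \<alpha>)) < \<infinity>"
      using le_less_trans[OF IW] by (simp add: ennreal_mult_less_top)
    finally show ?thesis .
  qed
qed

section \<open>Almost sure convergence of the randomised series\<close>

lemma bergman_power_diff_commute:
  assumes "a \<in> dirichlet_polys" "b \<in> dirichlet_polys"
  shows "bergman_power q \<beta> (\<lambda>n. a n - b n) = bergman_power q \<beta> (\<lambda>n. b n - a n)"
proof -
  have "dirichlet_shift \<sigma> (\<lambda>n. a n - b n) = (\<lambda>n. dirichlet_shift \<sigma> a n - dirichlet_shift \<sigma> b n)"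
    "dirichlet_shift \<sigma> (\<lambda>n. b n - a n) = (\<lambda>n. dirichlet_shift \<sigma> b n - dirichlet_shift \<sigma> a n)" for \<sigma>
    by (simp_all add: dirichlet_shift_def algebra_simps fun_eq_iff)
  then show ?thesis
    using assms by (simp add: bergman_power_def hardy_power_def bohr_lift_diff dirichlet_shift_polys norm_minus_commute)
qed

text \<open>Every use of the quasi-triangle inequality costs a factor \<open>K\<close>, so the
  increments have to decay faster than \<open>K powr (- k)\<close>. With the ratio
  \<open>2 * K\<close> the telescoped bound reproduces itself:
  \<open>K * (x + 2 * K * (x / (2 * K))) = 2 * K * x\<close>.\<close>

lemma bergman_Cauchy_geometric:
  fixes q :: real
  defines "K \<equiv> 2 powr q"
  assumes q: "q > 0" and \<beta>: "\<beta> > -1" and P: "\<And>k. P k \<in> dirichlet_polys" and s: "s \<ge> 0"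
    and Zk: "\<And>k. bergman_power q \<beta> (\<lambda>n. P (Suc k) n - P k n) \<le> ennreal (s / (2 * K) ^ k)"
  shows "bergman_Cauchy q \<beta> P"
proof -
  have K: "K \<ge> 1" using q by (simp add: K_def ge_one_powr_ge_zero)
  have tele: "bergman_power q \<beta> (\<lambda>n. P (k + d) n - P k n) \<le> ennreal (2 * K * (s / (2 * K) ^ k))" for k d
  proof (induction d arbitrary: k)
    case 0
    have "bergman_power q \<beta> (\<lambda>n. P (k + 0) n - P k n) = 0"
      using q by (simp add: bergman_power_def hardy_power_def dirichlet_shift_def bohr_lift_def)
    then show ?case by simp
  next
    case (Suc d)
    let ?x = "\<lambda>n. P (Suc k) n - P k n" and ?y = "\<lambda>n. P (Suc k + d) n - P (Suc k) n"
    let ?y' = "\<lambda>n. P (Suc k) n - P (Suc k + d) n"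
    have xy: "(\<lambda>n. P (k + Suc d) n - P k n) = (\<lambda>n. ?x n - ?y' n)" by (simp add: fun_eq_iff)
    have "bergman_power q \<beta> (\<lambda>n. ?x n - ?y' n) \<le> ennreal K * (bergman_power q \<beta> ?x + bergman_power q \<beta> ?y')"
      unfolding K_def by (intro bergman_power_diff_le dirichlet_polys_diff P q)
    also have "bergman_power q \<beta> ?y' = bergman_power q \<beta> ?y" by (rule bergman_power_diff_commute[OF P P])
    also have "ennreal K * (bergman_power q \<beta> ?x + bergman_power q \<beta> ?y)
       \<le> ennreal K * (ennreal (s / (2 * K) ^ k) + ennreal (2 * K * (s / (2 * K) ^ Suc k)))"
    proof (rule mult_left_mono, rule add_mono)
      show "bergman_power q \<beta> ?x \<le> ennreal (s / (2 * K) ^ k)" by (rule Zk)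
      show "bergman_power q \<beta> ?y \<le> ennreal (2 * K * (s / (2 * K) ^ Suc k))" by (rule Suc.IH)
    qed simp
    also have "\<dots> = ennreal (K * (s / (2 * K) ^ k + 2 * K * (s / (2 * K) ^ Suc k)))"
      using K s by (simp add: ennreal_mult'[symmetric] ennreal_plus[symmetric] del: ennreal_plus)
    also have "K * (s / (2 * K) ^ k + 2 * K * (s / (2 * K) ^ Suc k)) = 2 * K * (s / (2 * K) ^ k)"
      using K by (simp add: mult_ac)
    finally show ?case unfolding xy .
  qed
  show ?thesis
    unfolding bergman_Cauchy_def
  proof (intro allI impI)
    fix e :: real assume e: "e > 0"
    have "(\<lambda>k. 2 * K * (s * (1 / (2 * K)) ^ k)) \<longlonglongrightarrow> 2 * K * (s * 0)"
      using K by (intro tendsto_intros LIMSEQ_realpow_zero) auto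
    then have "\<forall>\<^sub>F k in sequentially. 2 * K * (s * (1 / (2 * K)) ^ k) < e powr q"
      using e by (intro order_tendstoD(2)) auto
    then obtain k0 where k0: "\<And>k. k \<ge> k0 \<Longrightarrow> 2 * K * (s * (1 / (2 * K)) ^ k) < e powr q"
      by (auto simp: eventually_sequentially)
    have le: "bergman_norm q \<beta> (\<lambda>n. P l n - P k n) < e" if kl: "k \<ge> k0" "l \<ge> k" for k l
    proof -
      obtain d where "l = k + d" using kl(2) le_Suc_ex by blast
      then have "bergman_power q \<beta> (\<lambda>n. P l n - P k n) \<le> ennreal (2 * K * (s / (2 * K) ^ k))" using tele by simp
      also have "\<dots> < ennreal (e powr q)"
        using k0[OF kl(1)] e by (intro ennreal_lessI) (auto simp: power_divide)
      finally show ?thesis using bergman_norm_less_iff[OF dirichlet_polys_diff[OF P P] q \<beta> e] by blast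
    qed
    have "bergman_norm q \<beta> (\<lambda>n. P k n - P l n) < e" if kl: "k \<ge> k0" "l \<ge> k0" for k l
    proof (cases "l \<le> k")
      case True
      then show ?thesis using le[of l k] kl by simp
    next
      case False
      then have "bergman_power q \<beta> (\<lambda>n. P l n - P k n) < ennreal (e powr q)"
        using le[of k l] kl bergman_norm_less_iff[OF dirichlet_polys_diff[OF P P] q \<beta> e] by simp
      then have "bergman_power q \<beta> (\<lambda>n. P k n - P l n) < ennreal (e powr q)"
        by (simp only: bergman_power_diff_commute[OF P P])
      then show ?thesis using bergman_norm_less_iff[OF dirichlet_polys_diff[OF P P] q \<beta> e] by blast
    qed
    then show "\<exists>k0. \<forall>k\<ge>k0. \<forall>l\<ge>k0. bergman_norm q \<beta> (\<lambda>n. P k n - P l n) < e" by blast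
  qed
qed

text \<open>Absolute convergence: the exponent \<open>1 / 2 + 2 * \<delta>\<close> is split into
  \<delta>, absorbed by the square-summable coefficients, and \<open>1 / 2 + \<delta>\<close>,
  square summable by itself. First moments of the \<open>X n\<close> at most 1 then make the
  expected sum finite.\<close>

lemma AE_summable_randomization:
  assumes M: "prob_space M" and Xm: "\<And>n. n \<ge> 1 \<Longrightarrow> X n \<in> borel_measurable M"
    and X1: "\<And>n. n \<ge> 1 \<Longrightarrow> (\<integral>\<^sup>+\<omega>. ennreal (norm (X n \<omega>)) \<partial>M) \<le> 1"
    and f: "\<And>\<delta>::real. \<delta> > 0 \<Longrightarrow> summable (\<lambda>n. (norm (f n))\<^sup>2 * real n powr (- 2 * \<delta>))"
  shows "AE \<omega> in M. \<forall>s\<in>half_plane (1/2). summable (dirichlet_term (randomization X \<omega> f) s)"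
proof -
  have one: "AE \<omega> in M. summable (\<lambda>n. norm (f n * X n \<omega>) * real n powr (- (1 / 2 + 2 * \<delta>)))" if \<delta>: "\<delta> > 0" for \<delta> :: real
  proof -
    let ?a = "\<lambda>n. norm (f n) * real n powr (- (1 / 2 + 2 * \<delta>))"
    have "summable ?a"
    proof (rule summable_comparison_test'[where N = 0])
      show "summable (\<lambda>n. (norm (f n))\<^sup>2 * real n powr (- 2 * \<delta>) + real n powr (- 1 - 2 * \<delta>))"
        using f[OF \<delta>] summable_real_powr_iff[of "- 1 - 2 * \<delta>"] \<delta> by (intro summable_add) auto
      show "norm (?a n) \<le> (norm (f n))\<^sup>2 * real n powr (- 2 * \<delta>) + real n powr (- 1 - 2 * \<delta>)" for n
      proof -
        define x where "x = norm (f n) * real n powr (- \<delta>)"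
        define y where "y = real n powr (- (1 / 2 + \<delta>))"
        have "?a n = x * y" by (simp add: x_def y_def mult.assoc powr_add[symmetric] algebra_simps)
        moreover have "x\<^sup>2 = (norm (f n))\<^sup>2 * real n powr (- 2 * \<delta>)" "y\<^sup>2 = real n powr (- 1 - 2 * \<delta>)"
          by (simp_all add: x_def y_def power_mult_distrib power2_eq_square powr_add[symmetric])
        moreover have "x * y \<le> x\<^sup>2 + y\<^sup>2"
        proof -
          have "2 * (x * y) \<le> x\<^sup>2 + y\<^sup>2" using sum_squares_bound[of x y] by (simp add: mult.assoc)
          then show ?thesis using zero_le_power2[of x] zero_le_power2[of y] by linarith
        qed
        moreover have "?a n \<ge> 0" by simp
        ultimately show ?thesis by simp
      qed
    qed
    have m: "(\<lambda>\<omega>. ennreal (?a n) * ennreal (norm (X n \<omega>))) \<in> borel_measurable M" for n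
      using Xm[of n] by (cases "n = 0") auto
    have "(\<integral>\<^sup>+\<omega>. (\<Sum>n. ennreal (?a n) * ennreal (norm (X n \<omega>))) \<partial>M)
        = (\<Sum>n. \<integral>\<^sup>+\<omega>. ennreal (?a n) * ennreal (norm (X n \<omega>)) \<partial>M)"
      by (rule nn_integral_suminf) (rule m)
    also have "\<dots> \<le> (\<Sum>n. ennreal (?a n))"
    proof (rule suminf_le)
      fix n
      show "(\<integral>\<^sup>+\<omega>. ennreal (?a n) * ennreal (norm (X n \<omega>)) \<partial>M) \<le> ennreal (?a n)"
      proof (cases "n = 0")
        case False
        then have n: "n \<ge> 1" by simp
        have "(\<integral>\<^sup>+\<omega>. ennreal (?a n) * ennreal (norm (X n \<omega>)) \<partial>M) = ennreal (?a n) * (\<integral>\<^sup>+\<omega>. ennreal (norm (X n \<omega>)) \<partial>M)"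
          by (rule nn_integral_cmult) (use Xm[OF n] in measurable)
        also have "\<dots> \<le> ennreal (?a n) * 1" by (rule mult_left_mono[OF X1[OF n]]) simp
        finally show ?thesis by simp
      qed simp
    qed auto
    also have "\<dots> = ennreal (suminf ?a)"
      using \<open>summable ?a\<close> by (intro suminf_ennreal2) auto
    finally have "(\<integral>\<^sup>+\<omega>. (\<Sum>n. ennreal (?a n) * ennreal (norm (X n \<omega>))) \<partial>M) \<noteq> \<infinity>"
      by (auto simp: top_unique)
    then have "AE \<omega> in M. (\<Sum>n. ennreal (?a n) * ennreal (norm (X n \<omega>))) \<noteq> \<infinity>"
      by (intro nn_integral_PInf_AE borel_measurable_suminf_order m)
    then show ?thesis
    proof eventually_elim
      case (elim \<omega>)
      have "(\<Sum>n. ennreal (?a n) * ennreal (norm (X n \<omega>))) = (\<Sum>n. ennreal (norm (f n * X n \<omega>) * real n powr (- (1 / 2 + 2 * \<delta>))))"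
        by (intro suminf_cong) (simp add: ennreal_mult'[symmetric] norm_mult mult_ac)
      with elim show ?case by (intro summable_suminf_not_top) auto
    qed
  qed
  \<comment> \<open>Countably many values of \<delta> tending to 0 give a single null set that
    serves every \<open>s\<close> in the half plane.\<close>
  have "AE \<omega> in M. \<forall>j::nat. summable (\<lambda>n. norm (f n * X n \<omega>) * real n powr (- (1 / 2 + 2 * (1 / real (Suc j)))))"
    unfolding AE_all_countable by (intro allI one) simp
  then show ?thesis
  proof eventually_elim
    case (elim \<omega>)
    show ?case
    proof
      fix s assume "s \<in> half_plane (1/2)"
      then have "(Re s - 1 / 2) / 2 > 0" by (simp add: half_plane_def)
      then obtain j where j: "1 / real (Suc j) < (Re s - 1 / 2) / 2" using nat_approx_posE by blast
      show "summable (dirichlet_term (randomization X \<omega> f) s)"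
      proof (rule summable_comparison_test'[OF elim[rule_format, of j], where N = 1])
        fix n :: nat assume n: "n \<ge> 1"
        have "real n powr (- Re s) \<le> real n powr (- (1 / 2 + 2 * (1 / real (Suc j))))"
          using n j by (intro powr_mono) auto
        then show "norm (dirichlet_term (randomization X \<omega> f) s n)
          \<le> norm (f n * X n \<omega>) * real n powr (- (1 / 2 + 2 * (1 / real (Suc j))))"
          unfolding norm_dirichlet_term randomization_def by (rule mult_left_mono) simp
      qed
    qed
  qed
qed

lemma ennreal_le_divideI:
  assumes "x > 0" "ennreal x * z \<le> ennreal s"
  shows "z \<le> ennreal (s / x)"
proof -
  have "ennreal (1 / x) * (ennreal x * z) \<le> ennreal (1 / x) * ennreal s"
    using assms(2) by (rule mult_left_mono) simp
  then show ?thesis using assms(1) by (simp add: mult.assoc[symmetric] ennreal_mult'[symmetric])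
qed

lemma square_sum_diff: "M \<le> N \<Longrightarrow> square_sum f {M<..N} \<sigma> = square_sum f {1..N} \<sigma> - square_sum f {1..M} \<sigma>"
proof -
  assume "M \<le> N"
  then have "{1..N} = {1..M} \<union> {M<..N}" by auto
  then show ?thesis unfolding square_sum_def by (subst \<open>{1..N} = _\<close>, subst sum.union_disjoint) auto
qed

text \<open>The random partial sums along a sparse sequence \<open>N\<close> approximate the
  randomised series. Khinchine's inequality bounds the expected increments by tails of the integral
  of \<open>square_series\<close>, and \<open>N\<close> is so sparse that almost surely the
  increments decay at the rate needed for a Cauchy sequence.\<close>

lemma randomization_in_bergman_space:
  assumes p: "p \<ge> 2" and q: "q > 0" and \<alpha>: "\<alpha> > -1" and \<beta>: "\<beta> > -1"
    and cond: "(\<alpha> + 1) / p < (\<beta> + 1) / q \<or> q \<ge> p \<and> (\<alpha> + 1) / p = (\<beta> + 1) / q"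
    and X: "standard_random_sequence M X" and f: "f \<in> bergman_space p \<alpha>"
  shows "AE \<omega> in M. randomization X \<omega> f \<in> bergman_space q \<beta>"
proof -
  have M: "prob_space M" and ind: "prob_space.indep_vars M (\<lambda>_. borel) X {1..}"
    using X by (simp_all add: standard_random_sequence_def)
  note sg = standard_random_sequence_subgaussian[OF X]
  note R = M ind sg
  interpret prob_space M by (rule M)
  interpret wb: prob_space "bergman_weight \<beta>" by (rule prob_space_bergman_weight[OF \<beta>])
  obtain B where B0: "B \<ge> 0" and "\<And>T. finite T \<Longrightarrow> 0 \<notin> T \<Longrightarrow> (\<integral>\<^sup>+\<sigma>. ennreal (square_sum f T \<sigma> powr (p / 2)) \<partial>bergman_weight \<alpha>) \<le> ennreal B"
    using bergman_space_square_sum_bound[OF p \<alpha> f] by metis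
  then have B: "\<forall>N. (\<integral>\<^sup>+\<sigma>. ennreal (square_sum f {1..N} \<sigma> powr (p / 2)) \<partial>bergman_weight \<alpha>) \<le> ennreal B"
    by simp
  note S = square_series_integrable[OF p q \<alpha> \<beta> cond B0 B]
  let ?V = "\<lambda>N. square_sum f {1..N}" and ?W = "square_series f"

  have summ: "summable (\<lambda>n. (norm (f n))\<^sup>2 * real n powr (- 2 * \<delta>))" if \<delta>: "\<delta> > 0" for \<delta>
  proof (rule bounded_imp_summable)
    fix n
    have "(\<Sum>k\<le>n. (norm (f k))\<^sup>2 * real k powr (- 2 * \<delta>)) = ?V n \<delta>"
      unfolding square_sum_def by (rule sum.mono_neutral_right) (auto simp: not_less_eq_eq)
    then show "(\<Sum>k\<le>n. (norm (f k))\<^sup>2 * real k powr (- 2 * \<delta>)) \<le> ?W \<delta>" using S(1)[OF \<delta>] by simp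
  qed simp
  have AEsum: "AE \<omega> in M. \<forall>s\<in>half_plane (1/2). summable (dirichlet_term (randomization X \<omega> f) s)"
    by (rule AE_summable_randomization[OF M random_measurable[OF R] random_abs_expectation_le[OF R] summ])
  \<comment> \<open>Dominated convergence, with \<open>?W \<sigma> powr (q / 2)\<close> as majorant,
    sends these tails to zero.\<close>
  define tail where "tail = (\<lambda>N. \<integral>\<^sup>+\<sigma>. ennreal ((?W \<sigma> - ?V N \<sigma>) powr (q / 2)) \<partial>bergman_weight \<beta>)"
  have "tail \<longlonglongrightarrow> (\<integral>\<^sup>+\<sigma>. 0 \<partial>bergman_weight \<beta>)"
    unfolding tail_def
  proof (rule nn_integral_dominated_convergence[where w = "\<lambda>\<sigma>. ennreal (?W \<sigma> powr (q / 2))"])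
    show "AE \<sigma> in bergman_weight \<beta>. ennreal ((?W \<sigma> - ?V N \<sigma>) powr (q / 2)) \<le> ennreal (?W \<sigma> powr (q / 2))" for N
      using AE_bergman_weight_pos
    proof eventually_elim
      case (elim \<sigma>)
      then show ?case using S(1)[OF elim, of N] q square_sum_nonneg[of f "{1..N}" \<sigma>]
        by (intro ennreal_leI powr_mono2) auto
    qed
    show "AE \<sigma> in bergman_weight \<beta>. (\<lambda>N. ennreal ((?W \<sigma> - ?V N \<sigma>) powr (q / 2))) \<longlonglongrightarrow> 0"
      using AE_bergman_weight_pos
    proof eventually_elim
      case (elim \<sigma>)
      have "(\<lambda>N. (?W \<sigma> - ?V N \<sigma>) powr (q / 2)) \<longlonglongrightarrow> (?W \<sigma> - ?W \<sigma>) powr (q / 2)"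
        using q S(1)[OF elim] by (intro tendsto_powr2 tendsto_diff tendsto_const S(2) elim) auto
      then have "(\<lambda>N. ennreal ((?W \<sigma> - ?V N \<sigma>) powr (q / 2))) \<longlonglongrightarrow> ennreal 0"
        by (intro tendsto_ennrealI) simp
      then show ?case by simp
    qed
    show "(\<integral>\<^sup>+\<sigma>. ennreal (?W \<sigma> powr (q / 2)) \<partial>bergman_weight \<beta>) < \<infinity>" by (rule S(3))
  qed measurable
  then have tail0: "tail \<longlonglongrightarrow> 0" by simp
  define K where "K = (2::real) powr q"
  have K: "K \<ge> 1" using q by (simp add: K_def ge_one_powr_ge_zero)
  define C where "C = khinchine_const q"
  have C: "C > 0" using q by (simp add: C_def khinchine_const_pos)
  \<comment> \<open>The factor \<open>1 / C\<close> cancels the Khinchine constant. The rate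
    \<open>4 * K\<close> leaves \<open>(1 / 2) ^ k\<close> after weighting with
    \<open>(2 * K) ^ k\<close>, so the weighted increments have a finite expected sum.\<close>
  have "\<exists>N. strict_mono N \<and> (\<forall>k. tail (N k) \<le> ennreal ((1 / C) * (1 / (4 * K)) ^ k))"
  proof -
    have ev: "\<exists>n>m. tail n \<le> ennreal ((1 / C) * (1 / (4 * K)) ^ k)" for m k
    proof -
      have "0 < ennreal ((1 / C) * (1 / (4 * K)) ^ k)" using C K by simp
      from order_tendstoD(2)[OF tail0 this]
      have "\<forall>\<^sub>F n in sequentially. tail n < ennreal ((1 / C) * (1 / (4 * K)) ^ k) \<and> n > m"
        using eventually_gt_at_top[of m] by (rule eventually_conj)
      from eventually_happens[OF this] show ?thesis by (auto intro: less_imp_le)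
    qed
    define g where "g = (\<lambda>m k. SOME n. n > m \<and> tail n \<le> ennreal ((1 / C) * (1 / (4 * K)) ^ k))"
    have g: "g m k > m \<and> tail (g m k) \<le> ennreal ((1 / C) * (1 / (4 * K)) ^ k)" for m k
      unfolding g_def by (rule someI_ex) (use ev in blast)
    define N where "N = rec_nat (g 0 0) (\<lambda>k n. g n (Suc k))"
    have N0: "N 0 = g 0 0" and NS: "N (Suc k) = g (N k) (Suc k)" for k by (simp_all add: N_def)
    have "strict_mono N" using g by (intro strict_monoI_Suc) (simp add: NS)
    moreover have "tail (N k) \<le> ennreal ((1 / C) * (1 / (4 * K)) ^ k)" for k
    proof (cases k)
      case 0
      then show ?thesis using g[of 0 0] by (simp only: N0)
    next
      case (Suc j)
      then show ?thesis using g[of "N j" "Suc j"] by (simp only: NS)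
    qed
    ultimately show ?thesis by blast
  qed
  then obtain N where N: "strict_mono N" and NT: "\<And>k. tail (N k) \<le> ennreal ((1 / C) * (1 / (4 * K)) ^ k)" by blast
  define P where "P = (\<lambda>\<omega> k. random_poly X \<omega> {1..N k} f)"
  have P: "P \<omega> k \<in> dirichlet_polys" for \<omega> k unfolding P_def by (rule random_poly_polys) simp
  define Z where "Z = (\<lambda>k \<omega>. bergman_power q \<beta> (random_poly X \<omega> {N k<..N (Suc k)} f))"
  have NN: "N k \<le> N (Suc k)" for k using N by (simp add: strict_mono_less_eq)
  have Zm: "Z k \<in> borel_measurable M" for k
    unfolding Z_def by (rule random_poly_fubini(2)[OF R _ _ sets.top \<beta>]) auto
  have ZP: "bergman_power q \<beta> (\<lambda>n. P \<omega> (Suc k) n - P \<omega> k n) = Z k \<omega>" for \<omega> k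
  proof -
    have "(\<lambda>n. P \<omega> (Suc k) n - P \<omega> k n) = random_poly X \<omega> {N k<..N (Suc k)} f"
      using NN[of k] by (auto simp: P_def random_poly_def fun_eq_iff)
    then show ?thesis by (simp add: Z_def)
  qed
  have EZ: "(\<integral>\<^sup>+\<omega>. Z k \<omega> \<partial>M) \<le> ennreal ((1 / (4 * K)) ^ k)" for k
  proof -
    have "(\<integral>\<^sup>+\<omega>. Z k \<omega> \<partial>M) \<le> ennreal C * (\<integral>\<^sup>+\<sigma>. ennreal (square_sum f {N k<..N (Suc k)} \<sigma> powr (q / 2)) \<partial>bergman_weight \<beta>)"
      unfolding Z_def C_def by (rule random_poly_expectation_le[OF R _ _ q \<beta>]) auto
    also have "\<dots> \<le> ennreal C * tail (N k)"
      unfolding tail_def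
    proof (rule mult_left_mono, rule nn_integral_mono_AE, use AE_bergman_weight_pos in eventually_elim)
      fix \<sigma> :: real assume \<sigma>: "\<sigma> > 0"
      show "ennreal (square_sum f {N k<..N (Suc k)} \<sigma> powr (q / 2)) \<le> ennreal ((?W \<sigma> - ?V (N k) \<sigma>) powr (q / 2))"
        using S(1)[OF \<sigma>, of "N (Suc k)"] q square_sum_diff[OF NN[of k], of f \<sigma>] square_sum_nonneg[of f "{N k<..N (Suc k)}" \<sigma>]
        by (intro ennreal_leI powr_mono2) auto
    qed simp
    also have "\<dots> \<le> ennreal C * ennreal ((1 / C) * (1 / (4 * K)) ^ k)" by (intro mult_left_mono NT) simp
    also have "\<dots> = ennreal ((1 / (4 * K)) ^ k)" using C by (simp add: ennreal_mult'[symmetric])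
    finally show ?thesis .
  qed
  have "(\<integral>\<^sup>+\<omega>. (\<Sum>k. ennreal ((2 * K) ^ k) * Z k \<omega>) \<partial>M) = (\<Sum>k. ennreal ((2 * K) ^ k) * (\<integral>\<^sup>+\<omega>. Z k \<omega> \<partial>M))"
    using Zm by (subst nn_integral_suminf) (auto simp: nn_integral_cmult)
  also have "\<dots> \<le> (\<Sum>k. ennreal ((1 / 2) ^ k))"
  proof (rule suminf_le)
    fix k
    have "ennreal ((2 * K) ^ k) * (\<integral>\<^sup>+\<omega>. Z k \<omega> \<partial>M) \<le> ennreal ((2 * K) ^ k) * ennreal ((1 / (4 * K)) ^ k)"
      by (intro mult_left_mono EZ) simp
    also have "\<dots> = ennreal ((2 * K) ^ k * (1 / (4 * K)) ^ k)" using K by (simp add: ennreal_mult')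
    also have "(2 * K) ^ k * (1 / (4 * K)) ^ k = (1 / 2) ^ k"
      unfolding power_mult_distrib[symmetric] using K by simp
    finally show "ennreal ((2 * K) ^ k) * (\<integral>\<^sup>+\<omega>. Z k \<omega> \<partial>M) \<le> ennreal ((1 / 2) ^ k)" .
  qed auto
  also have "\<dots> = ennreal (\<Sum>k. (1 / 2) ^ k)" by (rule suminf_ennreal2) (auto intro: summable_geometric)
  finally have fin: "(\<integral>\<^sup>+\<omega>. (\<Sum>k. ennreal ((2 * K) ^ k) * Z k \<omega>) \<partial>M) \<noteq> \<infinity>" by (auto simp: top_unique)
  have "AE \<omega> in M. (\<Sum>k. ennreal ((2 * K) ^ k) * Z k \<omega>) \<noteq> \<infinity>"
    by (rule nn_integral_PInf_AE[OF _ fin]) (use Zm in measurable)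
  with AEsum show ?thesis
  proof eventually_elim
    case (elim \<omega>)
    define s where "s = enn2real (\<Sum>k. ennreal ((2 * K) ^ k) * Z k \<omega>)"
    have s: "(\<Sum>k. ennreal ((2 * K) ^ k) * Z k \<omega>) = ennreal s" "s \<ge> 0"
      using elim(2) by (auto simp: s_def less_top)
    have Zk: "Z k \<omega> \<le> ennreal (s / (2 * K) ^ k)" for k
    proof -
      have "ennreal ((2 * K) ^ k) * Z k \<omega> = (\<Sum>i\<in>{k}. ennreal ((2 * K) ^ i) * Z i \<omega>)" by simp
      also have "\<dots> \<le> ennreal s" unfolding s(1)[symmetric] by (rule sum_le_suminf) auto
      finally have "ennreal ((2 * K) ^ k) * Z k \<omega> \<le> ennreal s" .
      moreover have "(2 * K) ^ k > 0" using K by simp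
      ultimately show ?thesis by (intro ennreal_le_divideI)
    qed
    have cauchy: "bergman_Cauchy q \<beta> (P \<omega>)"
      by (rule bergman_Cauchy_geometric[OF q \<beta> P s(2)]) (unfold ZP K_def[symmetric], rule Zk)
    have ev: "(\<lambda>k. dirichlet_eval (P \<omega> k) s) \<longlonglongrightarrow> dirichlet_eval (randomization X \<omega> f) s" if hs: "s \<in> half_plane (1/2)" for s
    proof -
      let ?t = "dirichlet_term (randomization X \<omega> f) s"
      have "dirichlet_eval (P \<omega> k) s = (\<Sum>n\<le>N k. ?t n)" for k
      proof -
        have "dirichlet_eval (P \<omega> k) s = (\<Sum>n\<le>N k. dirichlet_term (P \<omega> k) s n)"
          unfolding dirichlet_eval_def
          by (rule suminf_finite) (auto simp: dirichlet_term_def P_def random_poly_def)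
        also have "\<dots> = (\<Sum>n\<le>N k. ?t n)"
          by (intro sum.cong) (auto simp: dirichlet_term_def P_def random_poly_def randomization_def not_less_eq_eq)
        finally show ?thesis .
      qed
      moreover have "(\<lambda>n. \<Sum>i\<le>n. ?t i) \<longlonglongrightarrow> dirichlet_eval (randomization X \<omega> f) s"
        using elim(1) hs unfolding dirichlet_eval_def by (intro summable_LIMSEQ') auto
      ultimately show ?thesis
        using LIMSEQ_subseq_LIMSEQ[OF _ N] by (simp add: o_def)
    qed
    show ?case
      unfolding bergman_space_def mem_Collect_eq
      using elim(1) P cauchy ev by (intro conjI exI[of _ "P \<omega>"] ballI allI) simp_all
  qed
qed

section \<open>Gliding humps\<close>

lemma bohr_lift_scale:
  assumes "a \<in> dirichlet_polys"
  shows "bohr_lift (\<lambda>n. c * a n) z = c * bohr_lift a z"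
proof -
  let ?T = "{n. a n \<noteq> 0} - {0}"
  have "finite ?T" using assms finite_support by auto
  then show ?thesis
    by (subst (1 2) bohr_lift_superset[of ?T]) (auto simp: sum_distrib_left mult.assoc)
qed

lemma bergman_power_scale:
  assumes a: "a \<in> dirichlet_polys" and c: "c \<ge> 0"
  shows "bergman_power q \<beta> (\<lambda>n. of_real c * a n) = ennreal (c powr q) * bergman_power q \<beta> a"
proof -
  have "hardy_power q (dirichlet_shift \<sigma> (\<lambda>n. of_real c * a n)) = ennreal (c powr q) * hardy_power q (dirichlet_shift \<sigma> a)" for \<sigma>
  proof -
    have "dirichlet_shift \<sigma> (\<lambda>n. of_real c * a n) = (\<lambda>n. of_real c * dirichlet_shift \<sigma> a n)"
      by (simp add: dirichlet_shift_def mult.assoc fun_eq_iff)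
    then have "hardy_power q (dirichlet_shift \<sigma> (\<lambda>n. of_real c * a n))
        = (\<integral>\<^sup>+z. ennreal (c powr q) * ennreal (norm (bohr_lift (dirichlet_shift \<sigma> a) z) powr q) \<partial>torus_measure)"
      using c by (simp add: hardy_power_def bohr_lift_scale dirichlet_shift_polys a norm_mult powr_mult ennreal_mult')
    also have "\<dots> = ennreal (c powr q) * hardy_power q (dirichlet_shift \<sigma> a)"
      unfolding hardy_power_def by (rule nn_integral_cmult) measurable
    finally show ?thesis .
  qed
  then show ?thesis
    unfolding bergman_power_def using a by (simp add: nn_integral_cmult)
qed

lemma square_sum_scale: "square_sum (\<lambda>n. of_real c * a n) T \<sigma> = c\<^sup>2 * square_sum a T \<sigma>"
  by (simp add: square_sum_def norm_mult power_mult_distrib sum_distrib_left mult.assoc)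

text \<open>The condition \<open>n \<ge> 2\<close> excludes the number 1, which all blocks share.
  The bound on the absolute sum at 1/2 makes a series of scaled humps converge absolutely on the
  half plane, as membership in the Bergman space demands.\<close>

definition hump :: "real \<Rightarrow> real \<Rightarrow> real \<Rightarrow> real \<Rightarrow> real \<Rightarrow> nat set \<Rightarrow> (nat \<Rightarrow> complex) \<Rightarrow> bool" where
  "hump p \<alpha> q \<beta> K S Q \<longleftrightarrow> Q \<in> dirichlet_polys \<and> (\<forall>n. Q n \<noteq> 0 \<longrightarrow> n \<ge> 2 \<and> n \<in> prime_block S) \<and>
    bergman_power p \<alpha> Q \<le> 1 \<and> (\<Sum>n | Q n \<noteq> 0. norm (Q n) * real n powr (- 1 / 2)) \<le> 1 \<and>
    ennreal K \<le> (\<integral>\<^sup>+\<sigma>. ennreal (square_sum Q {n. Q n \<noteq> 0} \<sigma> powr (q / 2)) \<partial>bergman_weight \<beta>)"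

text \<open>A hump involves finitely many primes, so the next one can start beyond them. The choice
  runs over triples of a starting index, a polynomial and an end index, where each end is the next
  start.\<close>

lemma hump_sequence:
  fixes K :: "nat \<Rightarrow> real"
  assumes H: "\<And>d K. \<exists>Q. hump p \<alpha> q \<beta> K {d..} Q"
  shows "\<exists>d Q. strict_mono (d :: nat \<Rightarrow> nat) \<and> (\<forall>j. hump p \<alpha> q \<beta> (K j) {d j..<d (Suc j)} (Q j))"
proof -
  let ?R = "\<lambda>j (d, Q, e). d < e \<and> hump p \<alpha> q \<beta> (K j) {d..<e} Q"
  have ex: "\<exists>Q e. d < e \<and> hump p \<alpha> q \<beta> (K j) {d..<e} Q" for d j
  proof -
    obtain Q where Q: "hump p \<alpha> q \<beta> (K j) {d..} Q" using H by blast
    let ?V = "\<Union>m\<in>{m. Q m \<noteq> 0}. {i. prime_exponent i m \<noteq> 0}"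
    have sup: "n \<ge> 2 \<and> n \<in> prime_block {d..}" if "Q n \<noteq> 0" for n using Q that by (simp add: hump_def)
    have "finite ?V"
    proof (rule finite_UN_I)
      show "finite {m. Q m \<noteq> 0}" using Q by (simp add: hump_def finite_support)
      fix m assume "m \<in> {m. Q m \<noteq> 0}"
      then show "finite {i. prime_exponent i m \<noteq> 0}" using sup[of m] by (intro finite_prime_exponent) auto
    qed
    then have "\<exists>e. \<forall>i\<in>?V. i < e" by (rule finite_nat_set_iff_bounded[THEN iffD1])
    then obtain e where e: "\<forall>i\<in>?V. i < e" ..
    \<comment> \<open>The end is raised to \<open>Suc d\<close> because the starts must increase
      strictly even if \<open>Q\<close> involves no prime at all.\<close>
    have "n \<in> prime_block {d..<max e (Suc d)}" if n: "Q n \<noteq> 0" for n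
    proof -
      have "i < e" if "prime_exponent i n \<noteq> 0" for i using that n by (intro bspec[OF e] UN_I[of n]) auto
      then show ?thesis using sup[OF n] by (auto simp: prime_block_def less_max_iff_disj)
    qed
    then have "hump p \<alpha> q \<beta> (K j) {d..<max e (Suc d)} Q" using Q by (simp add: hump_def)
    then show ?thesis by (intro exI[of _ Q] exI[of _ "max e (Suc d)"]) auto
  qed
  have "\<exists>F. \<forall>j. ?R j (F j) \<and> snd (snd (F j)) = fst (F (Suc j))"
  proof (rule dependent_nat_choice)
    show "\<exists>x. ?R 0 x" using ex[of 0 0] by auto
    show "\<exists>y. ?R (Suc j) y \<and> snd (snd x) = fst y" for x j using ex[of "snd (snd x)" "Suc j"] by auto
  qed
  then obtain F where FF: "\<forall>j. ?R j (F j) \<and> snd (snd (F j)) = fst (F (Suc j))" ..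
  then have F: "?R j (F j)" "snd (snd (F j)) = fst (F (Suc j))" for j by simp_all
  have F': "fst (F j) < fst (F (Suc j)) \<and> hump p \<alpha> q \<beta> (K j) {fst (F j)..<fst (F (Suc j))} (fst (snd (F j)))" for j
    using F(1)[of j] F(2)[of j] by (simp add: case_prod_unfold)
  show ?thesis
    by (rule exI[of _ "\<lambda>j. fst (F j)"], rule exI[of _ "\<lambda>j. fst (snd (F j))"])
       (use F' in \<open>auto intro!: strict_monoI_Suc\<close>)
qed

lemma random_poly_block_part:
  assumes "\<And>n. n \<in> prime_block S \<Longrightarrow> f n = P n" "\<And>n. P n \<noteq> 0 \<Longrightarrow> n \<in> prime_block S"
  shows "block_part S (randomization X \<omega> f) = random_poly X \<omega> {n. P n \<noteq> 0} P"
  using assms by (auto simp: block_part_def randomization_def random_poly_def fun_eq_iff)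

text \<open>Gliding hump: the \<open>j\<close>-th block of the series has small quasi-norm in the
  source space, while the random block has size at least a multiple of \<open>j\<close> in the mean,
  even on an event where all random blocks obey one common bound.\<close>

lemma hump_randomization_not_in_bergman_space:
  fixes X :: "nat \<Rightarrow> 'w \<Rightarrow> complex"
  assumes p: "p > 0" and q: "q > 0" and \<alpha>: "\<alpha> > -1" and \<beta>: "\<beta> > -1" and X: "standard_random_sequence M X"
    and H: "\<And>d K. \<exists>Q. hump p \<alpha> q \<beta> K {d..} Q"
  shows "\<exists>f\<in>bergman_space p \<alpha>. \<not> (AE \<omega> in M. randomization X \<omega> f \<in> bergman_space q \<beta>)"
proof -
  have M: "prob_space M" and ind: "prob_space.indep_vars M (\<lambda>_. borel) X {1..}"
    using X by (simp_all add: standard_random_sequence_def)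
  note sg = standard_random_sequence_subgaussian[OF X]
  note R = M ind sg
  interpret prob_space M by (rule M)
  \<comment> \<open>Then \<open>c j powr p = 1 / (2 * 2 powr p) ^ j\<close>, precisely the rate that
    makes the partial sums Cauchy.\<close>
  define c where "c = (\<lambda>j::nat. (1 / (2 * 2 powr p)) powr (real j / p))"
  have c0: "c j > 0" for j by (simp add: c_def)
  have cp: "c j powr p = 1 / (2 * 2 powr p) ^ j" for j
    using p by (simp add: c_def powr_powr powr_realpow power_divide)
  have c2: "c j \<le> (1 / 2) ^ j" for j
  proof -
    have "c j powr p \<le> (1 / 2 powr p) ^ j"
      unfolding cp power_divide power_one by (intro divide_left_mono power_mono mult_pos_pos) auto
    also have "\<dots> = ((1 / 2) ^ j) powr p"
      by (simp add: powr_realpow[symmetric] powr_powr powr_divide mult.commute)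
    finally show ?thesis using p c0[of j]
      by (meson linorder_not_less powr_less_mono2 zero_le_power zero_le_divide_1_iff zero_le_numeral)
  qed
  \<comment> \<open>The hump is taken so large that scaling by \<open>c j\<close> still leaves an
    integral of at least \<open>j\<close>.\<close>
  define K where "K = (\<lambda>j. real j / c j powr q)"
  obtain d Q where d: "strict_mono (d :: nat \<Rightarrow> nat)" and hump: "\<And>j. hump p \<alpha> q \<beta> (K j) {d j..<d (Suc j)} (Q j)"
    using hump_sequence[OF H, of K] by blast
  define P where "P = (\<lambda>j n. of_real (c j) * Q j n)"
  let ?S = "\<lambda>j. {d j..<d (Suc j)}"
  have Qp: "Q j \<in> dirichlet_polys" for j using hump[of j] by (simp add: hump_def)
  have supp: "P j n \<noteq> 0 \<longleftrightarrow> Q j n \<noteq> 0" for j n using c0[of j] by (simp add: P_def)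
  have Pp: "P j \<in> dirichlet_polys" for j using Qp by (rule dirichlet_polys_subset) (simp add: supp)
  have blk: "n \<ge> 2" "n \<in> prime_block (?S j)" if "P j n \<noteq> 0" for j n
    using hump[of j] that unfolding supp hump_def by simp_all
  have idx: "\<exists>i. prime_exponent i n \<noteq> 0" if "n \<ge> 2" for n
    using prime_exponent_cong_imp_eq[of n 1] that by fastforce
  have disj: "i = j" if Pi: "P i n \<noteq> 0" and nj: "n \<in> prime_block (?S j)" for i j n
  proof -
    obtain k where "prime_exponent k n \<noteq> 0" using idx[OF blk(1)[OF Pi]] by blast
    then have "k \<in> ?S i" "k \<in> ?S j" using blk(2)[OF Pi] nj by (auto simp: prime_block_def)
    then have "d i < d (Suc j)" "d j < d (Suc i)" by auto
    then show "i = j" using d by (simp add: strict_mono_less)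
  qed
  \<comment> \<open>A prime of the \<open>j\<close>-th block divides \<open>n\<close>; its index is
    at least \<open>d j \<ge> j\<close>, and a prime exceeds its index. Hence the coefficient of the
    infinite series at \<open>n\<close> is the finite sum over \<open>j \<le> n\<close>.\<close>
  have late: "j \<le> n" if Pn: "P j n \<noteq> 0" for j n
  proof -
    obtain k where k: "prime_exponent k n \<noteq> 0" using idx[OF blk(1)[OF Pn]] by blast
    then have "d j \<le> k" using blk(2)[OF Pn] by (auto simp: prime_block_def)
    moreover have "j \<le> d j" using d by (rule strict_mono_imp_increasing)
    moreover have "nth_prime k dvd n"
      by (rule ccontr) (use k in \<open>simp add: prime_exponent_def not_dvd_imp_multiplicity_0\<close>)
    then have "nth_prime k \<le> n" using blk(1)[OF Pn] by (intro dvd_imp_le) auto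
    ultimately show ?thesis using nth_prime_ge[of k] by linarith
  qed
  define f where "f = (\<lambda>n. \<Sum>j\<le>n. P j n)"
  define S where "S = (\<lambda>k n. \<Sum>j<k. P j n)"
  have Sp: "S k \<in> dirichlet_polys" for k
  proof (rule dirichlet_polysI)
    have "{n. S k n \<noteq> 0} \<subseteq> (\<Union>j<k. {n. P j n \<noteq> 0})"
      by (auto simp: S_def elim!: sum.not_neutral_contains_not_neutral)
    then show "finite {n. S k n \<noteq> 0}" by (rule finite_subset) (auto intro: finite_support Pp)
  qed
  have Sf: "S k n = f n" if "k > n" for k n
    unfolding S_def f_def using that late by (intro sum.mono_neutral_right) auto
  have fblk: "f n = P j n" if "n \<in> prime_block (?S j)" for n j
  proof (cases "P j n = 0")
    case True
    have "P i n = 0" for i using disj[of i n j] that True by (cases "P i n = 0") auto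
    then show ?thesis by (simp add: f_def)
  next
    case False
    have "f n = (\<Sum>i\<in>{j}. P i n)"
      unfolding f_def using late[OF False] disj[of _ n j] that by (intro sum.mono_neutral_right) auto
    then show ?thesis by simp
  qed
  have bpP: "bergman_power p \<alpha> (P j) \<le> ennreal (1 / (2 * 2 powr p) ^ j)" for j
  proof -
    have "bergman_power p \<alpha> (P j) = ennreal (c j powr p) * bergman_power p \<alpha> (Q j)"
      unfolding P_def using c0[of j] by (intro bergman_power_scale Qp) simp
    also have "\<dots> \<le> ennreal (c j powr p) * 1" using hump[of j] by (intro mult_left_mono) (simp_all add: hump_def)
    finally show ?thesis by (simp add: cp)
  qed
  have SC: "bergman_Cauchy p \<alpha> S"
  proof (rule bergman_Cauchy_geometric[OF p \<alpha> Sp, of 1])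
    show "bergman_power p \<alpha> (\<lambda>n. S (Suc k) n - S k n) \<le> ennreal (1 / (2 * 2 powr p) ^ k)" for k
      using bpP[of k] by (simp add: S_def)
  qed simp
  \<comment> \<open>A common summable majorant for all partial sums on the whole half plane, for use
    in Tannery's theorem.\<close>
  define G where "G = (\<lambda>n. \<Sum>j\<le>n. norm (P j n) * real n powr (- 1 / 2))"
  have Gs: "summable G"
  proof (rule bounded_imp_summable)
    show "G n \<ge> 0" for n unfolding G_def by (intro sum_nonneg) auto
    fix N
    have "(\<Sum>n\<le>N. G n) \<le> (\<Sum>n\<le>N. \<Sum>j\<le>N. norm (P j n) * real n powr (- 1 / 2))"
      unfolding G_def by (intro sum_mono sum_mono2) auto
    also have "\<dots> = (\<Sum>j\<le>N. \<Sum>n\<le>N. norm (P j n) * real n powr (- 1 / 2))" by (rule sum.swap)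
    also have "\<dots> \<le> (\<Sum>j\<le>N. (1 / 2) ^ j)"
    proof (rule sum_mono)
      fix j
      have "(\<Sum>n\<le>N. norm (P j n) * real n powr (- 1 / 2)) = c j * (\<Sum>n\<le>N. norm (Q j n) * real n powr (- 1 / 2))"
        using c0[of j] by (simp add: P_def norm_mult sum_distrib_left mult.assoc)
      also have "(\<Sum>n\<le>N. norm (Q j n) * real n powr (- 1 / 2)) \<le> (\<Sum>n\<in>{..N} \<union> {n. Q j n \<noteq> 0}. norm (Q j n) * real n powr (- 1 / 2))"
        using finite_support[OF Qp[of j]] by (intro sum_mono2) auto
      also have "\<dots> = (\<Sum>n | Q j n \<noteq> 0. norm (Q j n) * real n powr (- 1 / 2))"
        using finite_support[OF Qp[of j]] by (intro sum.mono_neutral_right) auto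
      also have "\<dots> \<le> 1" using hump[of j] by (simp add: hump_def)
      finally show "(\<Sum>n\<le>N. norm (P j n) * real n powr (- 1 / 2)) \<le> (1 / 2) ^ j"
        using c2[of j] c0[of j] by simp
    qed
    also have "\<dots> \<le> (\<Sum>j. (1 / 2) ^ j)" by (rule sum_le_suminf) (auto intro: summable_geometric)
    finally show "(\<Sum>n\<le>N. G n) \<le> (\<Sum>j. (1 / 2) ^ j)" .
  qed
  have term_le: "norm (dirichlet_term g s n) \<le> G n" if s: "s \<in> half_plane (1/2)" and g: "norm (g n) \<le> (\<Sum>j\<le>n. norm (P j n))" for g s n
  proof (cases "n = 0")
    case False
    have "norm (dirichlet_term g s n) \<le> (\<Sum>j\<le>n. norm (P j n)) * real n powr (- 1 / 2)"
      unfolding norm_dirichlet_term using s g False by (intro mult_mono powr_mono) (auto simp: half_plane_def sum_nonneg)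
    then show ?thesis by (simp add: G_def sum_distrib_right)
  qed (simp add: dirichlet_term_def G_def sum_nonneg)
  have f_le: "norm (f n) \<le> (\<Sum>j\<le>n. norm (P j n))" for n unfolding f_def by (rule norm_sum)
  have S_le: "norm (S k n) \<le> (\<Sum>j\<le>n. norm (P j n))" for k n
  proof -
    have "norm (S k n) \<le> (\<Sum>j<k. norm (P j n))" unfolding S_def by (rule norm_sum)
    also have "\<dots> = (\<Sum>j\<in>{..<k} \<inter> {..n}. norm (P j n))"
      using late by (intro sum.mono_neutral_right) auto
    also have "\<dots> \<le> (\<Sum>j\<le>n. norm (P j n))" by (intro sum_mono2) auto
    finally show ?thesis .
  qed
  have fA: "f \<in> bergman_space p \<alpha>"
    unfolding bergman_space_def mem_Collect_eq
  proof (intro conjI ballI exI[of _ S] allI Sp SC)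
    fix s assume s: "s \<in> half_plane (1/2)"
    show "summable (dirichlet_term f s)"
      by (rule summable_comparison_test'[OF Gs, of 0]) (rule term_le[OF s f_le])
    have "(\<lambda>k. \<Sum>n. dirichlet_term (S k) s n) \<longlonglongrightarrow> (\<Sum>n. dirichlet_term f s n)"
    proof (rule tannerys_theorem[THEN conjunct2, THEN conjunct2, OF _ _ Gs])
      show "(\<lambda>k. dirichlet_term (S k) s n) \<longlonglongrightarrow> dirichlet_term f s n" for n
      proof (rule tendsto_eventually)
        show "\<forall>\<^sub>F k in sequentially. dirichlet_term (S k) s n = dirichlet_term f s n"
          using eventually_gt_at_top[of n] by eventually_elim (simp add: dirichlet_term_def Sf)
      qed
      show "\<forall>\<^sub>F (n, k) in at_top \<times>\<^sub>F sequentially. norm (dirichlet_term (S k) s n) \<le> G n"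
        by (intro always_eventually allI) (auto intro: term_le[OF s S_le])
    qed simp
    then show "(\<lambda>k. dirichlet_eval (S k) s) \<longlonglongrightarrow> dirichlet_eval f s" by (simp add: dirichlet_eval_def)
  qed
  have "\<not> (AE \<omega> in M. randomization X \<omega> f \<in> bergman_space q \<beta>)"
  proof
    assume AE: "AE \<omega> in M. randomization X \<omega> f \<in> bergman_space q \<beta>"
    let ?T = "\<lambda>j. {n. P j n \<noteq> 0}"
    define Z where "Z = (\<lambda>j \<omega>. bergman_power q \<beta> (random_poly X \<omega> (?T j) (P j)))"
    have T: "finite (?T j)" "0 \<notin> ?T j" for j using finite_support[OF Pp] blk(1)[of j 0] by auto
    have Zm [measurable]: "Z j \<in> borel_measurable M" for j
      unfolding Z_def by (rule random_poly_fubini(2)[OF R T sets.top \<beta>])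
    have bd: "AE \<omega> in M. \<exists>m::nat. \<forall>j. Z j \<omega> \<le> of_nat m"
      using AE
    proof eventually_elim
      case (elim \<omega>)
      obtain B :: real where B: "\<forall>S. finite S \<longrightarrow> block_part S (randomization X \<omega> f) \<in> dirichlet_polys \<longrightarrow>
          bergman_power q \<beta> (block_part S (randomization X \<omega> f)) \<le> ennreal B"
        using bergman_space_block_bound[OF q \<beta> elim] by blast
      obtain m :: nat where m: "B \<le> real m" using real_arch_simple by blast
      have "Z j \<omega> \<le> of_nat m" for j
      proof -
        have e: "block_part (?S j) (randomization X \<omega> f) = random_poly X \<omega> (?T j) (P j)"
          by (rule random_poly_block_part) (use fblk blk in auto)
        have "block_part (?S j) (randomization X \<omega> f) \<in> dirichlet_polys"
          unfolding e by (rule random_poly_polys[OF T(1)])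
        then have "Z j \<omega> \<le> ennreal B"
          unfolding Z_def e[symmetric] by (intro B[rule_format]) auto
        also have "\<dots> \<le> of_nat m" using m by (metis ennreal_leI ennreal_of_nat_eq_real_of_nat)
        finally show ?thesis .
      qed
      then show ?case by blast
    qed
    \<comment> \<open>The bound from membership depends on \<omega>. These events increase to a set
      of probability one, so one of them is large enough for the lower Khinchine inequality.\<close>
    define E where "E = (\<lambda>m::nat. {\<omega>\<in>space M. \<forall>j. Z j \<omega> \<le> of_nat m})"
    have Em [measurable]: "E m \<in> sets M" for m unfolding E_def by measurable
    have incE: "incseq E"
    proof (rule incseq_SucI)
      fix m
      have "(of_nat m :: ennreal) \<le> of_nat (Suc m)" by (rule of_nat_mono) simp
      then show "E m \<subseteq> E (Suc m)" unfolding E_def by (auto intro: order_trans)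
    qed
    have "(\<lambda>m. prob (E m)) \<longlonglongrightarrow> prob (\<Union>m. E m)"
      by (rule finite_Lim_measure_incseq) (use incE Em in auto)
    moreover have "prob (\<Union>m. E m) = 1"
    proof (rule prob_eq_1[THEN iffD2])
      show "AE \<omega> in M. \<omega> \<in> (\<Union>m. E m)"
        using bd AE_space by eventually_elim (auto simp: E_def)
    qed measurable
    ultimately have limE: "(\<lambda>m. prob (E m)) \<longlonglongrightarrow> 1" by simp
    obtain \<kappa> where \<kappa>: "\<kappa> > 0" and low:
      "\<And>(M :: 'w measure) Y (I :: nat set) c E. prob_space M \<Longrightarrow> prob_space.indep_vars M (\<lambda>_. borel) Y I \<Longrightarrow> finite I \<Longrightarrow>
      (\<And>i. i \<in> I \<Longrightarrow> normalized_subgaussian M (Y i)) \<Longrightarrow> E \<in> sets M \<Longrightarrow> measure M E \<ge> 1 - \<kappa> \<Longrightarrow>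
      ennreal (\<kappa> * (\<Sum>i\<in>I. (norm (c i))\<^sup>2) powr (q / 2))
        \<le> (\<integral>\<^sup>+\<omega>. ennreal (norm (\<Sum>i\<in>I. c i * Y i \<omega>) powr q) * indicator E \<omega> \<partial>M)"
      by (rule khinchine_lower_on_event[OF q]) blast
    have "\<forall>\<^sub>F m in sequentially. prob (E m) > 1 - \<kappa>"
      by (rule order_tendstoD(1)[OF limE]) (use \<kappa> in simp)
    then obtain m where m: "prob (E m) \<ge> 1 - \<kappa>" by (auto simp: eventually_sequentially intro: less_imp_le)
    \<comment> \<open>\<kappa> and \<open>m\<close> are fixed before \<open>j\<close>, so letting
      \<open>j\<close> grow is contradictory.\<close>
    have key: "\<kappa> * real j \<le> real m" for j
    proof -
      have "ennreal (\<kappa> * real j) = ennreal \<kappa> * (ennreal (c j powr q) * ennreal (K j))"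
        using \<kappa> c0[of j] by (simp add: K_def ennreal_mult'[symmetric])
      also have "\<dots> \<le> ennreal \<kappa> * (ennreal (c j powr q) * (\<integral>\<^sup>+\<sigma>. ennreal (square_sum (Q j) (?T j) \<sigma> powr (q / 2)) \<partial>bergman_weight \<beta>))"
        using hump[of j] by (intro mult_left_mono) (simp_all add: hump_def supp)
      also have "ennreal (c j powr q) * (\<integral>\<^sup>+\<sigma>. ennreal (square_sum (Q j) (?T j) \<sigma> powr (q / 2)) \<partial>bergman_weight \<beta>)
         = (\<integral>\<^sup>+\<sigma>. ennreal (c j powr q) * ennreal (square_sum (Q j) (?T j) \<sigma> powr (q / 2)) \<partial>bergman_weight \<beta>)"
        by (rule nn_integral_cmult[symmetric]) measurable
      also have "\<dots> = (\<integral>\<^sup>+\<sigma>. ennreal (square_sum (P j) (?T j) \<sigma> powr (q / 2)) \<partial>bergman_weight \<beta>)"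
      proof (rule nn_integral_cong)
        fix \<sigma>
        have "((c j)\<^sup>2) powr (q / 2) = c j powr q" using c0[of j] by (simp add: powr_powr flip: powr_numeral)
        then show "ennreal (c j powr q) * ennreal (square_sum (Q j) (?T j) \<sigma> powr (q / 2)) = ennreal (square_sum (P j) (?T j) \<sigma> powr (q / 2))"
          unfolding P_def square_sum_scale by (simp add: powr_mult square_sum_nonneg ennreal_mult')
      qed
      also have "ennreal \<kappa> * \<dots> \<le> (\<integral>\<^sup>+\<omega>. Z j \<omega> * indicator (E m) \<omega> \<partial>M)"
        unfolding Z_def
      proof (rule random_poly_expectation_ge[OF R T \<beta> Em \<kappa>])
        show "ennreal (\<kappa> * (\<Sum>n\<in>?T j. (norm (c n))\<^sup>2) powr (q / 2))
          \<le> (\<integral>\<^sup>+\<omega>. ennreal (norm (\<Sum>n\<in>?T j. c n * X n \<omega>) powr q) * indicator (E m) \<omega> \<partial>M)" for c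
          by (rule low[OF M indep_restrict[OF R T(2)] T(1) subgaussian_restrict[OF R T(2)] Em m])
      qed
      also have "\<dots> \<le> (\<integral>\<^sup>+\<omega>. of_nat m \<partial>M)"
        by (intro nn_integral_mono) (auto simp: E_def split: split_indicator)
      also have "\<dots> = ennreal (real m)" by (simp add: emeasure_space_1 ennreal_of_nat_eq_real_of_nat)
      finally show ?thesis by (simp add: ennreal_le_iff)
    qed
    obtain j :: nat where "real m / \<kappa> < real j" using reals_Archimedean2 by blast
    then have "real m < \<kappa> * real j" using \<kappa> by (simp add: pos_divide_less_eq mult.commute)
    with key[of j] show False by simp
  qed
  with fA show ?thesis by blast
qed

section \<open>Humps for small exponents\<close>

text \<open>Erdos: an integer is determined by its square part and the set of primes of odd exponent.\<close>

lemma nth_prime_le: "nth_prime j \<le> 4 ^ j + 1"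
proof -
  \<comment> \<open>Integers up to \<open>x\<close> have prime factors only among the first
    \<open>j\<close> primes. Counting pairs of a set of primes and a square part gives
    \<open>x \<le> 2 ^ j * m\<close> with \<open>m\<close> the integer square root of
    \<open>x\<close>, hence \<open>x \<le> 4 ^ j\<close>.\<close>
  define x where "x = nth_prime j - 1"
  have x: "nth_prime j = x + 1" using nth_prime_gt[of j] by (simp add: x_def)
  define m where "m = Max {s. s\<^sup>2 \<le> x}"
  have fin: "finite {s::nat. s\<^sup>2 \<le> x}"
  proof (rule finite_subset[of _ "{..x}"])
    show "{s. s\<^sup>2 \<le> x} \<subseteq> {..x}"
      using power2_nat_le_imp_le by auto
  qed simp
  have "0 \<in> {s::nat. s\<^sup>2 \<le> x}" by simp
  then have "m \<in> {s. s\<^sup>2 \<le> x}" unfolding m_def by (intro Max_in[OF fin]) blast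
  then have m2: "m\<^sup>2 \<le> x" by simp
  have mle: "s \<le> m" if "s\<^sup>2 \<le> x" for s using that fin by (auto simp: m_def)
  let ?h = "\<lambda>n. ({i. odd (prime_exponent i n)}, square_part n)"
  have "inj_on ?h {1..x}"
  proof (rule inj_onI)
    fix k n assume kn: "k \<in> {1..x}" "n \<in> {1..x}" "?h k = ?h n"
    show "k = n"
    proof (rule prime_exponent_cong_imp_eq)
      fix i
      have "prime_exponent i k div 2 = multiplicity (nth_prime i) (square_part k)"
        using prime_multiplicity_square_part[OF nth_prime_prime, of i k] by (simp add: prime_exponent_def)
      also have "\<dots> = prime_exponent i n div 2"
        using prime_multiplicity_square_part[OF nth_prime_prime, of i n] kn(3) by (simp add: prime_exponent_def)
      finally have "prime_exponent i k div 2 = prime_exponent i n div 2" .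
      moreover have "odd (prime_exponent i k) \<longleftrightarrow> odd (prime_exponent i n)" using kn(3) by auto
      ultimately show "prime_exponent i k = prime_exponent i n" by presburger
    qed (use kn in auto)
  qed
  moreover have "?h ` {1..x} \<subseteq> Pow {..<j} \<times> {1..m}"
  proof (rule image_subsetI)
    fix n assume n: "n \<in> {1..x}"
    have "i < j" if "odd (prime_exponent i n)" for i
    proof -
      have "nth_prime i dvd n"
        by (rule ccontr) (use that in \<open>simp add: prime_exponent_def not_dvd_imp_multiplicity_0\<close>)
      then have "nth_prime i \<le> n" using n by (intro dvd_imp_le) auto
      then have "nth_prime i < nth_prime j" using n x by simp
      then show "i < j" using nth_prime_strict_mono by (simp add: strict_mono_less)
    qed
    moreover have "(square_part n)\<^sup>2 \<le> n" using n by (intro dvd_imp_le) auto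
    then have "square_part n \<le> m" using n by (intro mle) auto
    moreover have "square_part n \<ge> 1"
      using n square_part_0_iff[of n] by (cases "square_part n") auto
    ultimately show "?h n \<in> Pow {..<j} \<times> {1..m}" by auto
  qed
  ultimately have "card {1..x} \<le> card (Pow {..<j} \<times> {1..m})"
    by (rule card_inj_on_le) simp
  then have le: "x \<le> 2 ^ j * m" by (simp add: card_Pow card_cartesian_product)
  have "m \<le> 2 ^ j"
  proof (cases "m = 0")
    case False
    have "m * m \<le> 2 ^ j * m" using order_trans[OF m2 le] by (simp only: power2_eq_square)
    then show ?thesis using False by simp
  qed simp
  then have "x \<le> 2 ^ j * 2 ^ j" using le by (meson mult_le_mono2 order_trans)
  then show ?thesis using x by (simp add: power_mult_distrib[symmetric])
qed

text \<open>Linear growth in the index: for humps made of N consecutive primes the shift may then be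
  of order 1 / N, which loses only a power of N against exponential gains.\<close>

lemma ln_nth_prime_le: "ln (real (nth_prime j)) \<le> 2 * (real j + 1)"
proof -
  have "real (nth_prime j) \<le> 4 ^ (j + 1)"
  proof -
    have "(1::nat) \<le> 4 ^ j" "(4::nat) ^ (j + 1) = 4 * 4 ^ j" by simp_all
    then have "nth_prime j \<le> 4 ^ (j + 1)" using nth_prime_le[of j] by linarith
    then have "real (nth_prime j) \<le> real (4 ^ (j + 1))" by (simp only: of_nat_le_iff)
    then show ?thesis by simp
  qed
  then have "ln (real (nth_prime j)) \<le> ln (4 ^ (j + 1))" using nth_prime_gt[of j] by (subst ln_le_cancel_iff) auto
  also have "\<dots> = (real j + 1) * ln 4" by (subst ln_realpow) (simp_all add: algebra_simps)
  also have "ln (4::real) \<le> 2"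
  proof -
    have "ln (2 ^ 2 :: real) = 2 * ln 2" by (subst ln_realpow) auto
    then show ?thesis using ln_2_less_1 by simp
  qed
  finally show ?thesis by (simp add: mult_left_mono mult.commute)
qed

text \<open>Strict concavity made quantitative. The difference of the two sides is convex on
  \<open>{0<..2}\<close>, since \<open>t powr (\<theta> - 2) \<ge> 1 / 4\<close> there, and it
  vanishes to first order at 1; half of 1/4 is the constant 1/8.\<close>

lemma powr_strict_tangent:
  fixes \<theta> t :: real
  assumes \<theta>: "0 < \<theta>" "\<theta> < 1" and t: "0 \<le> t" "t \<le> 2"
  shows "t powr \<theta> \<le> 1 + \<theta> * (t - 1) - \<theta> * (1 - \<theta>) / 8 * (t - 1)\<^sup>2"
proof (cases "t = 0")
  case True
  have "\<theta> * (1 - \<theta>) \<le> 1 * (1 - \<theta>)" using \<theta> by (intro mult_right_mono) auto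
  then have "\<theta> * (1 - \<theta>) / 8 \<le> (1 - \<theta>) / 8" by simp
  also have "\<dots> \<le> 1 - \<theta>" using \<theta> by simp
  finally have "\<theta> * (1 - \<theta>) / 8 \<le> 1 - \<theta>" .
  then show ?thesis using True \<theta> by simp
next
  case False
  with t have t0: "0 < t" by simp
  define h where "h = (\<lambda>t. 1 + \<theta> * (t - 1) - \<theta> * (1 - \<theta>) / 8 * (t - 1)\<^sup>2 - t powr \<theta>)"
  define h1 where "h1 = (\<lambda>t. \<theta> - \<theta> * (1 - \<theta>) / 4 * (t - 1) - \<theta> * t powr (\<theta> - 1))"
  have D1: "(h has_real_derivative h1 t) (at t)" if "t > 0" for t
    unfolding h_def h1_def using that
    by (auto intro!: derivative_eq_intros simp: field_simps power2_eq_square)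
  have D2: "(h1 has_real_derivative (- (\<theta> * (1 - \<theta>) / 4) + \<theta> * (1 - \<theta>) * t powr (\<theta> - 2))) (at t)" if "t > 0" for t
    unfolding h1_def using that
    by (auto intro!: derivative_eq_intros simp: field_simps power2_eq_square)
  have pos: "0 \<le> - (\<theta> * (1 - \<theta>) / 4) + \<theta> * (1 - \<theta>) * t powr (\<theta> - 2)" if "t \<in> {0<..2}" for t
  proof -
    have "1 / 4 = 2 powr (- 2 :: real)" by (simp add: powr_minus powr_numeral)
    also have "\<dots> \<le> 2 powr (\<theta> - 2)" using \<theta> by (intro powr_mono) auto
    also have "\<dots> \<le> t powr (\<theta> - 2)" using that \<theta> by (intro powr_mono2') auto
    finally have "\<theta> * (1 - \<theta>) * (1 / 4) \<le> \<theta> * (1 - \<theta>) * t powr (\<theta> - 2)" using \<theta> by (intro mult_left_mono) auto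
    then show ?thesis by simp
  qed
  have "convex_on {0<..2} h"
    by (rule f''_ge0_imp_convex[OF _ D1 D2 pos]) auto
  then have "h t - h 1 \<ge> h1 1 * (t - 1)"
    by (rule convex_on_imp_above_tangent) (use t0 t D1[of 1] in \<open>auto intro: has_field_derivative_at_within\<close>)
  then have "h t \<ge> 0" by (simp add: h_def h1_def)
  then show ?thesis by (simp add: h_def)
qed

lemma circle_integral_Re: "(\<integral>x. Re x \<partial>circle_measure) = 0"
  and circle_integral_Re_sq: "(\<integral>x. (Re x)\<^sup>2 \<partial>circle_measure) = 1 / 2"
proof -
  interpret c: prob_space circle_measure by (rule prob_space_circle)
  have i: "integrable circle_measure (\<lambda>x. x ^ k)" for k
    by (rule c.integrable_const_bound[of _ 1]) (use AE_circle_norm in \<open>auto elim!: eventually_mono simp: norm_power intro!: borel_measurable_continuous_onI continuous_intros simp: measurable_cong_sets[OF sets_circle refl]\<close>)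
  have z: "(\<integral>x. x ^ k \<partial>circle_measure) = 0" if "k \<noteq> 0" for k
    using circle_integral_power[OF that] by simp
  show "(\<integral>x. Re x \<partial>circle_measure) = 0" using integral_Re[OF i[of 1]] z[of 1] by simp
  have "(\<integral>x. (Re x)\<^sup>2 \<partial>circle_measure) = (\<integral>x. 1 / 2 + 1 / 2 * Re (x ^ 2) \<partial>circle_measure)"
  proof (rule integral_cong_AE)
    show "AE x in circle_measure. (Re x)\<^sup>2 = 1 / 2 + 1 / 2 * Re (x ^ 2)"
      using AE_circle_norm
    proof eventually_elim
      case (elim x)
      then have "(Re x)\<^sup>2 + (Im x)\<^sup>2 = 1" by (simp add: cmod_power2[symmetric])
      moreover have "Re (x ^ 2) = (Re x)\<^sup>2 - (Im x)\<^sup>2" by (simp add: power2_eq_square)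
      ultimately show ?case by linarith
    qed
  qed (simp_all add: measurable_cong_sets[OF sets_circle refl])
  also have "\<dots> = 1 / 2 + 1 / 2 * (\<integral>x. Re (x ^ 2) \<partial>circle_measure)"
    using integrable_Re[OF i[of 2]] by (subst Bochner_Integration.integral_add) (auto simp: c.prob_space[simplified])
  also have "(\<integral>x. Re (x ^ 2) \<partial>circle_measure) = 0" using integral_Re[OF i[of 2]] z[of 2] by simp
  finally show "(\<integral>x. (Re x)\<^sup>2 \<partial>circle_measure) = 1 / 2" by simp
qed

text \<open>\<open>2 powr (p / 2)\<close> is the value that the H^2 norm of \<open>1 + z\<close>
  would give, and \<open>l < 1\<close> is the gain from \<open>p < 2\<close>. The gain has to be
  uniform in \<open>r\<close> because a shift brings in all radii: for small \<open>r\<close> the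
  mean of the squared modulus drops below 2, for \<open>r\<close> near 1 its variance is positive.
  As \<open>g \<le> \<theta>\<close>, the two effects add up to at least
  \<open>g / 2\<close>.\<close>

lemma circle_norm_one_plus_powr:
  assumes p: "0 < p" "p < 2"
  obtains l where "0 < l" "l < 1"
    "\<And>r. 0 \<le> r \<Longrightarrow> r \<le> 1 \<Longrightarrow> (\<integral>\<^sup>+x. ennreal (norm (1 + of_real r * x) powr p) \<partial>circle_measure) \<le> ennreal (2 powr (p / 2) * l)"
proof -
  interpret c: prob_space circle_measure by (rule prob_space_circle)
  define \<theta> where "\<theta> = p / 2"
  have \<theta>: "0 < \<theta>" "\<theta> < 1" using p by (auto simp: \<theta>_def)
  define g where "g = \<theta> * (1 - \<theta>) / 8"
  have g: "0 < g" "g \<le> \<theta>" "g < 1"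
  proof -
    show "0 < g" using \<theta> by (simp add: g_def)
    have "\<theta> * (1 - \<theta>) \<le> \<theta> * 1" using \<theta> by (intro mult_left_mono) auto
    then show "g \<le> \<theta>" using \<theta> by (simp add: g_def)
    then show "g < 1" using \<theta> by simp
  qed
  have main: "(\<integral>\<^sup>+x. ennreal (norm (1 + of_real r * x) powr p) \<partial>circle_measure) \<le> ennreal (2 powr (p / 2) * (1 - g / 2))"
    if r: "0 \<le> r" "r \<le> 1" for r
  proof -
    define b where "b = (r\<^sup>2 - 1) / 2"
    let ?u = "\<lambda>x::complex. 1 + \<theta> * (b + r * Re x) - g * (b + r * Re x)\<^sup>2"
    have pt: "norm (1 + of_real r * x) powr p \<le> 2 powr (p / 2) * ?u x" if x: "norm x = 1" for x :: complex
    proof -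
      define t where "t = (norm (1 + of_real r * x))\<^sup>2 / 2"
      have "(Re x)\<^sup>2 + (Im x)\<^sup>2 = 1" using x by (simp add: cmod_power2[symmetric])
      then have "r\<^sup>2 * (Re x)\<^sup>2 + r\<^sup>2 * (Im x)\<^sup>2 = r\<^sup>2" by (simp add: distrib_left[symmetric])
      then have t1: "t - 1 = b + r * Re x"
        by (simp add: t_def b_def cmod_power2 power2_sum power_mult_distrib) (simp add: power2_eq_square field_simps)
      have "norm (1 + of_real r * x) \<le> 2"
        using norm_triangle_ineq[of 1 "of_real r * x"] r x by (simp add: norm_mult)
      then have "(norm (1 + of_real r * x))\<^sup>2 \<le> 2\<^sup>2" by (intro power_mono) auto
      then have t2: "0 \<le> t" "t \<le> 2" by (auto simp: t_def)
      have "norm (1 + of_real r * x) powr p = ((norm (1 + of_real r * x))\<^sup>2) powr \<theta>"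
        by (simp add: \<theta>_def powr_powr flip: powr_numeral)
      also have "\<dots> = (2 * t) powr \<theta>" by (simp add: t_def)
      also have "\<dots> = 2 powr \<theta> * t powr \<theta>" using t2 by (simp add: powr_mult)
      also have "\<dots> \<le> 2 powr \<theta> * (1 + \<theta> * (t - 1) - \<theta> * (1 - \<theta>) / 8 * (t - 1)\<^sup>2)"
        using powr_strict_tangent[OF \<theta> t2] by (intro mult_left_mono) auto
      finally show ?thesis unfolding t1 g_def by (simp add: \<theta>_def)
    qed
    have iR: "integrable circle_measure (\<lambda>x. Re x)"
    proof (rule c.integrable_const_bound[of _ 1])
      show "AE x in circle_measure. norm (Re x) \<le> 1"
        using AE_circle_norm
      proof eventually_elim
        case (elim x)
        then show ?case using abs_Re_le_cmod[of x] by simp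
      qed
    qed (simp add: measurable_cong_sets[OF sets_circle refl])
    have iR2: "integrable circle_measure (\<lambda>x. (Re x)\<^sup>2)"
    proof (rule c.integrable_const_bound[of _ 1])
      show "AE x in circle_measure. norm ((Re x)\<^sup>2) \<le> 1"
        using AE_circle_norm
      proof eventually_elim
        case (elim x)
        then show ?case using abs_Re_le_cmod[of x] by (simp add: abs_square_le_1)
      qed
    qed (simp add: measurable_cong_sets[OF sets_circle refl])
    have uexp: "?u = (\<lambda>x. (1 + \<theta> * b - g * b\<^sup>2) + (\<theta> * r - 2 * g * b * r) * Re x - g * r\<^sup>2 * (Re x)\<^sup>2)"
      by (simp add: fun_eq_iff power2_eq_square algebra_simps)
    have iu: "integrable circle_measure ?u"
      unfolding uexp using iR iR2 by (intro Bochner_Integration.integrable_diff Bochner_Integration.integrable_add integrable_mult_right) auto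
    have "(\<integral>x. ?u x \<partial>circle_measure) = (1 + \<theta> * b - g * b\<^sup>2) + (\<theta> * r - 2 * g * b * r) * (\<integral>x. Re x \<partial>circle_measure)
        - g * r\<^sup>2 * (\<integral>x. (Re x)\<^sup>2 \<partial>circle_measure)"
      unfolding uexp using iR iR2
      by (subst Bochner_Integration.integral_diff, simp, simp, subst Bochner_Integration.integral_add) (auto simp: c.prob_space[simplified])
    also have "\<dots> = 1 + \<theta> * b - g * b\<^sup>2 - g * r\<^sup>2 / 2" by (simp add: circle_integral_Re circle_integral_Re_sq)
    also have "\<dots> \<le> 1 - g / 2"
    proof -
      have "g * ((1 - r\<^sup>2) / 2) \<le> \<theta> * ((1 - r\<^sup>2) / 2)" using g r by (intro mult_right_mono) (auto simp: power_le_one)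
      moreover have "b = - ((1 - r\<^sup>2) / 2)" by (simp add: b_def field_simps)
      then have "\<theta> * b = - (\<theta> * ((1 - r\<^sup>2) / 2))" by (simp only: mult_minus_right)
      moreover have "g * ((1 - r\<^sup>2) / 2) = g / 2 - g * r\<^sup>2 / 2" by (simp add: field_simps)
      moreover have "g * b\<^sup>2 \<ge> 0" using g by simp
      ultimately show ?thesis by linarith
    qed
    finally have I: "(\<integral>x. ?u x \<partial>circle_measure) \<le> 1 - g / 2" .
    have u0: "AE x in circle_measure. 0 \<le> ?u x"
      using AE_circle_norm
    proof eventually_elim
      case (elim x)
      have "0 \<le> 2 powr (p / 2) * ?u x" using pt[OF elim] by (rule order_trans[rotated]) simp
      then show ?case by (simp add: zero_le_mult_iff)
    qed
    have "(\<integral>\<^sup>+x. ennreal (norm (1 + of_real r * x) powr p) \<partial>circle_measure) \<le> (\<integral>\<^sup>+x. ennreal (2 powr (p / 2) * ?u x) \<partial>circle_measure)"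
      by (rule nn_integral_mono_AE, use AE_circle_norm in eventually_elim) (intro ennreal_leI pt)
    also have "\<dots> = ennreal (\<integral>x. 2 powr (p / 2) * ?u x \<partial>circle_measure)"
      using iu u0 by (intro nn_integral_eq_integral integrable_mult_right) (auto elim: eventually_mono)
    also have "\<dots> \<le> ennreal (2 powr (p / 2) * (1 - g / 2))"
      using I by (intro ennreal_leI) (simp add: integral_mult_right_zero mult_left_mono)
    finally show ?thesis .
  qed
  show ?thesis by (rule that[of "1 - g / 2"]) (use g main in auto)
qed

text \<open>The extra prime with index \<open>d\<close> multiplies the whole product by the variable
  \<open>z d\<close>, so that the empty set does not produce the excluded integer 1.\<close>

definition block_int :: "nat \<Rightarrow> nat set \<Rightarrow> nat" where
  "block_int d S = nth_prime d * (\<Prod>i\<in>S. nth_prime i)"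

lemma prod_nth_prime_ge_1: "(\<Prod>i\<in>S. nth_prime i) \<ge> 1"
  using nth_prime_gt by (intro prod_ge_1) (auto intro: less_imp_le)

lemma block_int_ge_2: "block_int d S \<ge> 2"
proof -
  have "2 * 1 \<le> nth_prime d * (\<Prod>i\<in>S. nth_prime i)"
    using nth_prime_gt[of d] prod_nth_prime_ge_1[of S] by (intro mult_le_mono) auto
  then show ?thesis by (simp add: block_int_def)
qed

lemma prime_exponent_prod_nth_prime:
  "finite S \<Longrightarrow> prime_exponent j (\<Prod>i\<in>S. nth_prime i) = (if j \<in> S then 1 else 0)"
proof (induction S rule: finite_induct)
  case (insert i S)
  have "prime_exponent j (nth_prime i * (\<Prod>i\<in>S. nth_prime i)) = prime_exponent j (nth_prime i) + prime_exponent j (\<Prod>i\<in>S. nth_prime i)"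
    using nth_prime_gt[of i] prod_nth_prime_ge_1[of S] by (intro prime_exponent_mult) auto
  then show ?case using insert by auto
qed simp

lemma prime_exponent_block_int:
  assumes "finite S"
  shows "prime_exponent j (block_int d S) = (if j = d then 1 else 0) + (if j \<in> S then 1 else 0)"
  unfolding block_int_def using nth_prime_gt[of d] prod_nth_prime_ge_1[of S] assms
  by (subst prime_exponent_mult) (auto simp: prime_exponent_prod_nth_prime)

lemma inj_on_block_int:
  assumes "finite I" "d \<notin> I"
  shows "inj_on (block_int d) (Pow I)"
proof (rule inj_onI)
  fix S T assume ST: "S \<in> Pow I" "T \<in> Pow I" "block_int d S = block_int d T"
  have "finite S" "finite T" using ST assms by (auto intro: finite_subset)
  show "S = T"
  proof (rule Set.set_eqI)
    fix j
    have "(if j = d then 1 else 0) + (if j \<in> S then 1 else 0) = (if j = d then 1 else 0) + (if j \<in> T then 1 else (0::nat))"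
      using prime_exponent_block_int[OF \<open>finite S\<close>, of j d] prime_exponent_block_int[OF \<open>finite T\<close>, of j d]
      unfolding ST(3) by (rule trans[OF sym])
    then have "(if j \<in> S then 1 else 0) = (if j \<in> T then 1 else (0::nat))" by (rule add_left_imp_eq)
    then show "j \<in> S \<longleftrightarrow> j \<in> T" by (cases "j \<in> S"; cases "j \<in> T") simp_all
  qed
qed

lemma bohr_monomial_block_int:
  assumes "finite S"
  shows "bohr_monomial z (block_int d S) = z d * (\<Prod>i\<in>S. z i)"
proof -
  have "bohr_monomial z (\<Prod>i\<in>S. nth_prime i) = (\<Prod>i\<in>S. z i)"
    using assms
  proof (induction S rule: finite_induct)
    case (insert i S)
    have "bohr_monomial z (nth_prime i * (\<Prod>i\<in>S. nth_prime i)) = bohr_monomial z (nth_prime i) * bohr_monomial z (\<Prod>i\<in>S. nth_prime i)"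
      using nth_prime_gt[of i] prod_nth_prime_ge_1[of S] by (intro bohr_monomial_mult) auto
    then show ?case using insert by simp
  qed simp
  then show ?thesis
    unfolding block_int_def using nth_prime_gt[of d] prod_nth_prime_ge_1[of S] by (subst bohr_monomial_mult) auto
qed

lemma block_int_powr: "real (block_int d S) powr s = real (nth_prime d) powr s * (\<Prod>i\<in>S. real (nth_prime i) powr s)"
  by (simp add: block_int_def powr_mult prod_nonneg flip: prod_powr_distrib)

text \<open>The coefficients of \<open>c * z d * (\<Prod>i\<in>I. 1 + z i)\<close>: expanding the
  product gives one squarefree integer for each subset of \<open>I\<close>, provided
  \<open>d\<close> lies outside \<open>I\<close>.\<close>

definition product_poly :: "real \<Rightarrow> nat \<Rightarrow> nat set \<Rightarrow> nat \<Rightarrow> complex" where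
  "product_poly c d I n = (if n \<in> block_int d ` Pow I then of_real c else 0)"

lemma sum_Pow_prod:
  fixes x :: "nat \<Rightarrow> 'a :: comm_ring_1"
  assumes "finite I"
  shows "(\<Sum>S\<in>Pow I. \<Prod>i\<in>S. x i) = (\<Prod>i\<in>I. 1 + x i)"
  using prod_add[OF assms, of x "\<lambda>_. 1"] by (simp add: add.commute)

context
  fixes c :: real and d :: nat and I :: "nat set"
  assumes I: "finite I" "d \<notin> I" and c: "c > 0"
begin

lemma product_poly_support: "{n. product_poly c d I n \<noteq> 0} = block_int d ` Pow I"
  using c by (auto simp: product_poly_def)

lemma product_poly_polys: "product_poly c d I \<in> dirichlet_polys"
  by (rule dirichlet_polysI) (simp add: product_poly_support I)

lemma product_poly_sum:
  fixes g :: "nat \<Rightarrow> 'a :: comm_monoid_add"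
  shows "(\<Sum>n | product_poly c d I n \<noteq> 0. g n) = (\<Sum>S\<in>Pow I. g (block_int d S))"
  unfolding product_poly_support by (rule sum.reindex_cong[OF inj_on_block_int[OF I]]) auto

lemma product_poly_apply: "S \<subseteq> I \<Longrightarrow> product_poly c d I (block_int d S) = of_real c"
  by (auto simp: product_poly_def)

lemma product_poly_bohr_lift:
  "bohr_lift (product_poly c d I) z = of_real c * z d * (\<Prod>i\<in>I. 1 + z i)"
proof -
  have "bohr_lift (product_poly c d I) z = (\<Sum>n | product_poly c d I n \<noteq> 0. product_poly c d I n * bohr_monomial z n)"
    by (rule bohr_lift_superset)
       (use I block_int_ge_2[of d] in \<open>auto simp: product_poly_support product_poly_def split: if_splits\<close>, metis not_numeral_le_zero)
  also have "\<dots> = (\<Sum>S\<in>Pow I. of_real c * z d * (\<Prod>i\<in>S. z i))"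
    unfolding product_poly_sum
    using I by (intro sum.cong) (auto simp: product_poly_apply bohr_monomial_block_int finite_subset mult.assoc)
  also have "\<dots> = of_real c * z d * (\<Sum>S\<in>Pow I. \<Prod>i\<in>S. z i)" by (rule sum_distrib_left[symmetric])
  finally show ?thesis by (simp add: sum_Pow_prod[OF I(1)])
qed

lemma product_poly_square_sum:
  "square_sum (product_poly c d I) {n. product_poly c d I n \<noteq> 0} \<sigma>
    = c\<^sup>2 * real (nth_prime d) powr (- 2 * \<sigma>) * (\<Prod>i\<in>I. 1 + real (nth_prime i) powr (- 2 * \<sigma>))"
proof -
  have "square_sum (product_poly c d I) {n. product_poly c d I n \<noteq> 0} \<sigma>
     = (\<Sum>S\<in>Pow I. c\<^sup>2 * real (nth_prime d) powr (- 2 * \<sigma>) * (\<Prod>i\<in>S. real (nth_prime i) powr (- 2 * \<sigma>)))"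
    unfolding square_sum_def product_poly_sum
    by (intro sum.cong) (auto simp: product_poly_apply block_int_powr mult.assoc)
  also have "\<dots> = c\<^sup>2 * real (nth_prime d) powr (- 2 * \<sigma>) * (\<Sum>S\<in>Pow I. \<Prod>i\<in>S. real (nth_prime i) powr (- 2 * \<sigma>))"
    by (rule sum_distrib_left[symmetric])
  finally show ?thesis by (simp only: sum_Pow_prod[OF I(1)])
qed

lemma product_poly_abs_sum:
  "(\<Sum>n | product_poly c d I n \<noteq> 0. norm (product_poly c d I n) * real n powr s)
    = c * real (nth_prime d) powr s * (\<Prod>i\<in>I. 1 + real (nth_prime i) powr s)"
proof -
  have "(\<Sum>n | product_poly c d I n \<noteq> 0. norm (product_poly c d I n) * real n powr s)
     = (\<Sum>S\<in>Pow I. c * real (nth_prime d) powr s * (\<Prod>i\<in>S. real (nth_prime i) powr s))"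
    unfolding product_poly_sum using c
    by (intro sum.cong) (auto simp: product_poly_apply block_int_powr mult.assoc)
  also have "\<dots> = c * real (nth_prime d) powr s * (\<Sum>S\<in>Pow I. \<Prod>i\<in>S. real (nth_prime i) powr s)"
    by (rule sum_distrib_left[symmetric])
  finally show ?thesis by (simp only: sum_Pow_prod[OF I(1)])
qed

lemma product_poly_block: "product_poly c d I n \<noteq> 0 \<Longrightarrow> n \<ge> 2 \<and> n \<in> prime_block (insert d I)"
proof -
  assume "product_poly c d I n \<noteq> 0"
  then obtain S where S: "S \<subseteq> I" "n = block_int d S" by (auto simp: product_poly_def split: if_splits)
  then have "finite S" using I finite_subset by auto
  have "n \<ge> 2" using S block_int_ge_2 by simp
  moreover have "n \<in> prime_block (insert d I)"
    using S \<open>n \<ge> 2\<close> prime_exponent_block_int[OF \<open>finite S\<close>, of _ d]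
    by (auto simp: prime_block_def split: if_splits)
  ultimately show ?thesis by simp
qed

text \<open>A shift only puts a radius at most 1 on each variable, and the factors remain
  independent, so the integral is at most the product of one-variable integrals.\<close>

lemma product_poly_hardy_power:
  assumes p: "p > 0" and \<sigma>: "\<sigma> \<ge> 0" and l: "l \<ge> 0"
    and bound: "\<And>r. 0 \<le> r \<Longrightarrow> r \<le> 1 \<Longrightarrow> (\<integral>\<^sup>+x. ennreal (norm (1 + of_real r * x) powr p) \<partial>circle_measure) \<le> ennreal l"
  shows "hardy_power p (dirichlet_shift \<sigma> (product_poly c d I)) \<le> ennreal (c powr p * l ^ card I)"
proof -
  interpret t: prob_space torus_measure by (rule prob_space_torus)
  let ?r = "\<lambda>i. real (nth_prime i) powr (- \<sigma>)"
  have r: "0 \<le> ?r i" "?r i \<le> 1" for i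
    using \<sigma> nth_prime_gt[of i] powr_mono[of "- \<sigma>" 0 "real (nth_prime i)"] by auto
  let ?f = "\<lambda>i x. ennreal (norm (1 + of_real (?r i) * x) powr p)"
  have "hardy_power p (dirichlet_shift \<sigma> (product_poly c d I))
      \<le> (\<integral>\<^sup>+z. ennreal (c powr p) * (\<Prod>i\<in>I. ?f i (z i)) \<partial>torus_measure)"
    unfolding hardy_power_def
  proof (rule nn_integral_mono_AE, use AE_torus_norm in eventually_elim)
    fix z :: "nat \<Rightarrow> complex" assume z: "\<forall>j. norm (z j) = 1"
    have "norm (bohr_lift (dirichlet_shift \<sigma> (product_poly c d I)) z) = c * ?r d * (\<Prod>i\<in>I. norm (1 + of_real (?r i) * z i))"
      using c z by (simp add: bohr_lift_shift product_poly_polys product_poly_bohr_lift norm_mult prod_norm)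
    also have "\<dots> \<le> c * (\<Prod>i\<in>I. norm (1 + of_real (?r i) * z i))"
      using c r[of d] by (intro mult_right_mono prod_nonneg) (auto simp: mult_left_le)
    finally have "norm (bohr_lift (dirichlet_shift \<sigma> (product_poly c d I)) z) powr p \<le> (c * (\<Prod>i\<in>I. norm (1 + of_real (?r i) * z i))) powr p"
      using p by (intro powr_mono2) auto
    also have "\<dots> = c powr p * (\<Prod>i\<in>I. norm (1 + of_real (?r i) * z i) powr p)"
      using c by (simp add: powr_mult prod_nonneg prod_powr_distrib)
    finally have "ennreal (norm (bohr_lift (dirichlet_shift \<sigma> (product_poly c d I)) z) powr p) \<le> ennreal (c powr p * (\<Prod>i\<in>I. norm (1 + of_real (?r i) * z i) powr p))"
      by (rule ennreal_leI)
    also have "\<dots> = ennreal (c powr p) * (\<Prod>i\<in>I. ?f i (z i))"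
      by (simp add: ennreal_mult' prod_ennreal)
    finally show "ennreal (norm (bohr_lift (dirichlet_shift \<sigma> (product_poly c d I)) z) powr p) \<le> ennreal (c powr p) * (\<Prod>i\<in>I. ?f i (z i))" .
  qed
  also have "\<dots> = ennreal (c powr p) * (\<integral>\<^sup>+z. (\<Prod>i\<in>I. ?f i (z i)) \<partial>torus_measure)"
    by (rule nn_integral_cmult) measurable
  also have "(\<integral>\<^sup>+z. (\<Prod>i\<in>I. ?f i (z i)) \<partial>torus_measure) = (\<Prod>i\<in>I. \<integral>\<^sup>+z. ?f i (z i) \<partial>torus_measure)"
  proof (rule t.indep_vars_nn_integral[OF I(1)])
    have ind: "t.indep_vars (\<lambda>_. borel) (\<lambda>j z. z j) I" by (rule t.indep_vars_subset[OF torus_indep]) simp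
    show "t.indep_vars (\<lambda>_. borel) (\<lambda>i z. ?f i (z i)) I"
      by (rule t.indep_vars_compose2[OF ind]) measurable
  qed simp
  also have "\<dots> = (\<Prod>i\<in>I. \<integral>\<^sup>+x. ?f i x \<partial>circle_measure)"
  proof (rule prod.cong[OF refl])
    fix i
    have "(\<integral>\<^sup>+x. ?f i x \<partial>distr torus_measure borel (\<lambda>z. z i)) = (\<integral>\<^sup>+z. ?f i (z i) \<partial>torus_measure)"
      by (subst nn_integral_distr) auto
    then show "(\<integral>\<^sup>+z. ?f i (z i) \<partial>torus_measure) = (\<integral>\<^sup>+x. ?f i x \<partial>circle_measure)"
      by (simp only: distr_torus_component)
  qed
  also have "ennreal (c powr p) * (\<Prod>i\<in>I. \<integral>\<^sup>+x. ?f i x \<partial>circle_measure) \<le> ennreal (c powr p) * (\<Prod>i\<in>I. ennreal l)"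
    using bound[OF r] by (intro mult_left_mono prod_mono_ennreal) auto
  also have "\<dots> = ennreal (c powr p * l ^ card I)"
    using l by (simp add: ennreal_mult' ennreal_power)
  finally show ?thesis .
qed

end

lemma prime_block_mono: "S \<subseteq> T \<Longrightarrow> prime_block S \<subseteq> prime_block T"
  by (auto simp: prime_block_def)

lemma hump_mono:
  assumes "hump p \<alpha> q \<beta> K S Q" "S \<subseteq> T" "L \<le> K"
  shows "hump p \<alpha> q \<beta> L T Q"
proof -
  have "ennreal L \<le> ennreal K" using assms(3) by (rule ennreal_leI)
  moreover have "prime_block S \<subseteq> prime_block T" using assms(2) by (rule prime_block_mono)
  ultimately show ?thesis using assms(1) unfolding hump_def by (meson order_trans subsetD)
qed

lemma exp_beats_powr:
  fixes g C \<delta> E B :: real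
  assumes "g > 0" "C > 0" "\<delta> > 0" "E \<ge> 0" "B > 0"
  shows "filterlim (\<lambda>N::nat. C * (exp (g * real N) * (\<delta> / (2 * (E + real N + 1))) powr B)) at_top sequentially"
  using assms by real_asymp

text \<open>Each factor is \<open>\<Lambda> * (1 + z) / sqrt 2\<close> with
  \<open>\<Lambda> > 1\<close> so close to 1 that its H^p norm stays at most 1, while its H^2 norm
  exceeds 1. Over N factors the square sum grows like \<open>\<Lambda> ^ N\<close> for all \<sigma>
  up to order 1 / N, and the mass of that interval is only polynomially small.\<close>

lemma hump_exponent_less_2:
  assumes p: "0 < p" "p < 2" and q: "q > 0" and \<alpha>: "\<alpha> > -1" and \<beta>: "\<beta> > -1"
  shows "\<exists>Q. hump p \<alpha> q \<beta> K {d..} Q"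
proof -
  interpret wa: prob_space "bergman_weight \<alpha>" by (rule prob_space_bergman_weight[OF \<alpha>])
  obtain l where l: "0 < l" "l < 1" and lb:
    "\<And>r. 0 \<le> r \<Longrightarrow> r \<le> 1 \<Longrightarrow> (\<integral>\<^sup>+x. ennreal (norm (1 + of_real r * x) powr p) \<partial>circle_measure) \<le> ennreal (2 powr (p / 2) * l)"
    using circle_norm_one_plus_powr[OF p] by metis
  \<comment> \<open>The first entry gives \<open>\<Lambda> powr p * l \<le> 1\<close>. The second
    serves the absolute sum at 1/2, whose factors are then at most
    \<open>\<Lambda> / sqrt 2 * (5 / 4) \<le> 1\<close>.\<close>
  define \<Lambda> where "\<Lambda> = min (l powr (- 1 / p)) (11 / 10)"
  have L1: "\<Lambda> > 1"
  proof -
    have "1 < (1 / l) powr (1 / p)" using l p by (intro gr_one_powr) auto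
    also have "(1 / l) powr (1 / p) = l powr (- 1 / p)" using l by (simp add: powr_divide powr_minus_divide)
    finally show ?thesis by (simp add: \<Lambda>_def)
  qed
  have L2: "\<Lambda> \<le> 11 / 10" by (simp add: \<Lambda>_def)
  have Lp: "\<Lambda> powr p * l \<le> 1"
  proof -
    have "\<Lambda> powr p \<le> (l powr (- 1 / p)) powr p" using p L1 by (intro powr_mono2) (auto simp: \<Lambda>_def)
    also have "\<dots> = l powr (- 1)" using p by (simp only: powr_powr) simp
    also have "\<dots> = 1 / l" using l by (simp add: powr_minus_divide)
    finally show ?thesis using l by (simp add: pos_le_divide_eq)
  qed
  \<comment> \<open>From index 14 on the primes are at least 16, so
    \<open>nth_prime i powr (- 1 / 2) \<le> 1 / 4\<close>.\<close>
  define e where "e = max d 14"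
  \<comment> \<open>As long as \<open>nth_prime i powr (- 2 * \<sigma>) \<ge> y\<close>, one factor
    of the square sum is at least \<open>\<Lambda>^2 / 2 * (1 + y) = \<Lambda>\<close>.\<close>
  define y where "y = 2 / \<Lambda> - 1"
  have y: "0 < y" "y < 1" using L1 L2 by (auto simp: y_def field_simps)
  define \<delta> where "\<delta> = - ln y / 2"
  have \<delta>: "\<delta> > 0" using y by (simp add: \<delta>_def)
  have ey: "exp (- 2 * \<delta>) = y" using y by (simp add: \<delta>_def)
  define b where "b = weight_const \<beta> * exp (- 2) / (\<beta> + 1)"
  have b: "b > 0" using weight_const_pos[OF \<beta>] \<beta> by (simp add: b_def)
  \<comment> \<open>The largest prime used has logarithm at most \<open>2 * (e + N + 1)\<close>, so
    \<sigma> up to \<open>?t N\<close> keeps \<sigma> times that logarithm below \<delta>, which is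
    what \<open>y\<close> allows.\<close>
  let ?t = "\<lambda>N::nat. \<delta> / (2 * (real (e + N) + 1))"
  let ?low = "\<lambda>N::nat. (y * \<Lambda> ^ N) powr (q / 2) * (b * ?t N powr (\<beta> + 1))"
  have "filterlim ?low at_top sequentially"
  proof -
    define g where "g = ln \<Lambda> * (q / 2)"
    have g: "g > 0" using L1 q by (simp add: g_def)
    have "filterlim (\<lambda>N::nat. y powr (q / 2) * b * (exp (g * real N) * (\<delta> / (2 * (real (e + N) + 1))) powr (\<beta> + 1))) at_top sequentially"
      unfolding of_nat_add by (rule exp_beats_powr) (use g y b \<delta> \<beta> in auto)
    moreover have "?low N = y powr (q / 2) * b * (exp (g * real N) * (\<delta> / (2 * (real (e + N) + 1))) powr (\<beta> + 1))" for N
    proof -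
      have "(\<Lambda> ^ N) powr (q / 2) = exp (g * real N)"
        using L1 by (simp add: powr_def ln_realpow g_def mult_ac)
      then show ?thesis using y L1 by (simp add: powr_mult mult_ac)
    qed
    ultimately show ?thesis by (simp only:)
  qed
  then have "\<forall>\<^sub>F N in sequentially. ?low N \<ge> K" by (simp add: filterlim_at_top)
  moreover have "\<forall>\<^sub>F N::nat in sequentially. \<delta> \<le> 2 * (real (e + N) + 1)" by real_asymp
  ultimately have "\<forall>\<^sub>F N in sequentially. ?low N \<ge> K \<and> \<delta> \<le> 2 * (real (e + N) + 1)" by (rule eventually_conj)
  then obtain N where N: "?low N \<ge> K" "\<delta> \<le> 2 * (real (e + N) + 1)"
    by (auto simp: eventually_sequentially)
  define I where "I = {e<..e + N}"
  define c where "c = (\<Lambda> / sqrt 2) ^ N"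
  have I: "finite I" "e \<notin> I" "card I = N" by (auto simp: I_def)
  have c: "c > 0" using L1 by (simp add: c_def)
  note R = I(1,2) c
  let ?Q = "product_poly c e I"
  have "hump p \<alpha> q \<beta> K {e..} ?Q"
    unfolding hump_def
  proof (intro conjI allI impI)
    show "?Q \<in> dirichlet_polys" by (rule product_poly_polys[OF R])
    fix n assume "?Q n \<noteq> 0"
    then have "n \<ge> 2 \<and> n \<in> prime_block (insert e I)" by (rule product_poly_block[OF R])
    moreover have "insert e I \<subseteq> {e..}" by (auto simp: I_def)
    ultimately show "2 \<le> n" "n \<in> prime_block {e..}" using prime_block_mono[of "insert e I" "{e..}"] by auto
  next
    have "bergman_power p \<alpha> ?Q \<le> (\<integral>\<^sup>+\<sigma>. 1 \<partial>bergman_weight \<alpha>)"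
      unfolding bergman_power_def
    proof (rule nn_integral_mono_AE, use AE_bergman_weight_pos in eventually_elim)
      fix \<sigma> :: real assume "\<sigma> > 0"
      then have "hardy_power p (dirichlet_shift \<sigma> ?Q) \<le> ennreal (c powr p * (2 powr (p / 2) * l) ^ card I)"
        by (intro product_poly_hardy_power[OF R p(1) _ _ lb]) (use l in auto)
      also have "c powr p = (\<Lambda> powr p / 2 powr (p / 2)) ^ N"
        using L1 by (simp add: c_def powr_realpow[symmetric] powr_powr powr_divide powr_half_sqrt[symmetric] mult.commute)
      also have "(\<Lambda> powr p / 2 powr (p / 2)) ^ N * (2 powr (p / 2) * l) ^ card I = (\<Lambda> powr p * l) ^ N"
        unfolding I(3) power_mult_distrib[symmetric] by simp
      also have "ennreal ((\<Lambda> powr p * l) ^ N) \<le> ennreal 1"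
        using Lp l by (intro ennreal_leI power_le_one) auto
      finally show "hardy_power p (dirichlet_shift \<sigma> ?Q) \<le> 1" by simp
    qed
    then show "bergman_power p \<alpha> ?Q \<le> 1" using wa.emeasure_space_1 by simp
  next
    have le14: "real (nth_prime i) powr (- 1 / 2) \<le> 1 / 4" if "i \<ge> e" for i
    proof -
      have "real (nth_prime i) \<ge> 16" using nth_prime_ge[of i] that by (simp add: e_def)
      then have "real (nth_prime i) powr (- 1 / 2) \<le> 16 powr (- 1 / 2)" by (intro powr_mono2') auto
      also have "(16::real) powr (- 1 / 2) = 1 / 4"
      proof -
        have "(16::real) = 4 powr 2" by (simp add: powr_numeral)
        then show ?thesis by (simp only: powr_powr) (simp add: powr_minus)
      qed
      finally show ?thesis .
    qed
    have "(\<Sum>n | ?Q n \<noteq> 0. norm (?Q n) * real n powr (- 1 / 2))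
       = c * real (nth_prime e) powr (- 1 / 2) * (\<Prod>i\<in>I. 1 + real (nth_prime i) powr (- 1 / 2))"
      by (rule product_poly_abs_sum[OF R])
    also have "\<dots> \<le> c * 1 * (\<Prod>i\<in>I. 5 / 4)"
    proof (intro mult_mono prod_mono conjI)
      show "real (nth_prime e) powr (- 1 / 2) \<le> 1" using le14[of e] by simp
      show "1 + real (nth_prime i) powr (- 1 / 2) \<le> 5 / 4" if "i \<in> I" for i
        using le14[of i] that by (simp add: I_def)
    qed (use c in \<open>auto intro!: prod_nonneg\<close>)
    also have "\<dots> = (\<Lambda> / sqrt 2 * (5 / 4)) ^ N" using I(3) by (simp add: c_def power_mult_distrib[symmetric])
    also have "\<dots> \<le> 1"
    proof (rule power_le_one)
      have "\<Lambda> * (5 / 4) \<le> sqrt 2"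
        using L2 by (intro real_le_rsqrt order_trans[of "(\<Lambda> * (5 / 4))\<^sup>2" "(11 / 8)\<^sup>2" 2] power_mono) (use L1 in \<open>auto simp: power2_eq_square\<close>)
      then show "\<Lambda> / sqrt 2 * (5 / 4) \<le> 1" by (simp add: field_simps)
    qed (use L1 in simp)
    finally show "(\<Sum>n | ?Q n \<noteq> 0. norm (?Q n) * real n powr (- 1 / 2)) \<le> 1" .
  next
    have low: "y * \<Lambda> ^ N \<le> square_sum ?Q {n. ?Q n \<noteq> 0} \<sigma>" if \<sigma>: "0 < \<sigma>" "\<sigma> \<le> ?t N" for \<sigma>
    proof -
      have pw: "y \<le> real (nth_prime i) powr (- 2 * \<sigma>)" if "i \<le> e + N" for i
      proof -
        have "ln (real (nth_prime i)) \<le> 2 * (real (e + N) + 1)" using ln_nth_prime_le[of i] that by simp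
        then have "\<sigma> * ln (real (nth_prime i)) \<le> ?t N * (2 * (real (e + N) + 1))"
          using \<sigma> nth_prime_gt[of i] by (intro mult_mono) auto
        also have "\<dots> = \<delta>" by simp
        finally have "\<sigma> * ln (real (nth_prime i)) \<le> \<delta>" .
        then have "exp (- 2 * \<delta>) \<le> exp (- 2 * (\<sigma> * ln (real (nth_prime i))))"
          unfolding exp_le_cancel_iff by linarith
        moreover have "real (nth_prime i) powr (- 2 * \<sigma>) = exp (- 2 * (\<sigma> * ln (real (nth_prime i))))"
          using nth_prime_gt[of i] by (simp add: powr_def mult_ac)
        ultimately show ?thesis by (simp only: ey)
      qed
      have "y * \<Lambda> ^ N = c\<^sup>2 * y * (\<Prod>i\<in>I. 1 + y)"
      proof -
        have "c\<^sup>2 = ((\<Lambda> / sqrt 2)\<^sup>2) ^ N" unfolding c_def by (simp only: power_mult[symmetric] mult.commute)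
        also have "(\<Lambda> / sqrt 2)\<^sup>2 = \<Lambda>\<^sup>2 / 2" by (simp add: power_divide)
        finally have "c\<^sup>2 = (\<Lambda>\<^sup>2 / 2) ^ N" .
        moreover have "(\<Lambda>\<^sup>2 / 2) ^ N * (1 + y) ^ N = \<Lambda> ^ N"
          unfolding power_mult_distrib[symmetric] using L1 by (simp add: y_def power2_eq_square)
        ultimately show ?thesis using I(3) by simp
      qed
      also have "\<dots> \<le> c\<^sup>2 * real (nth_prime e) powr (- 2 * \<sigma>) * (\<Prod>i\<in>I. 1 + real (nth_prime i) powr (- 2 * \<sigma>))"
        using y pw by (intro mult_mono prod_mono conjI) (auto simp: I_def intro!: prod_nonneg)
      finally show ?thesis by (simp only: product_poly_square_sum[OF R])
    qed
    have t: "0 < ?t N" "?t N \<le> 1" using \<delta> N(2) by (auto simp: field_simps)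
    have "ennreal K \<le> ennreal (?low N)" using N(1) by (rule ennreal_leI)
    also have "\<dots> = ennreal ((y * \<Lambda> ^ N) powr (q / 2)) * ennreal (b * (?t N powr (\<beta> + 1) - 0 powr (\<beta> + 1)))"
      using \<beta> by (simp add: ennreal_mult')
    also have "\<dots> \<le> ennreal ((y * \<Lambda> ^ N) powr (q / 2)) * emeasure (bergman_weight \<beta>) {0<..?t N}"
      unfolding b_def using t by (intro mult_left_mono bergman_weight_interval_ge \<beta>) auto
    also have "\<dots> = (\<integral>\<^sup>+\<sigma>. ennreal ((y * \<Lambda> ^ N) powr (q / 2)) * indicator {0<..?t N} \<sigma> \<partial>bergman_weight \<beta>)"
      by (rule nn_integral_cmult_indicator[symmetric]) simp
    also have "\<dots> \<le> (\<integral>\<^sup>+\<sigma>. ennreal (square_sum ?Q {n. ?Q n \<noteq> 0} \<sigma> powr (q / 2)) \<partial>bergman_weight \<beta>)"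
      using low y L1 q by (intro nn_integral_mono) (auto split: split_indicator intro!: ennreal_leI powr_mono2)
    finally show "ennreal K \<le> (\<integral>\<^sup>+\<sigma>. ennreal (square_sum ?Q {n. ?Q n \<noteq> 0} \<sigma> powr (q / 2)) \<partial>bergman_weight \<beta>)" .
  qed
  then have "hump p \<alpha> q \<beta> K {d..} ?Q" by (rule hump_mono) (auto simp: e_def)
  then show ?thesis by blast
qed

section \<open>Humps for large exponents\<close>

text \<open>The summands are dominated by increments, over the
  disjoint intervals \<open>[u, 2 u]\<close>, of the bounded function \<open>u powr a / (1 + u powr a)\<close>.\<close>

lemma lacunary_sum_bound:
  fixes a :: real
  assumes a: "a > 0"
  obtains G where "G > 0"
    "\<And>u N. (\<And>i::nat. u i > (0::real)) \<Longrightarrow> (\<And>i. 2 * u i \<le> u (Suc i)) \<Longrightarrow> (\<Sum>i<N. u i powr a * exp (- 2 * u i)) \<le> G"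
proof -
  define \<Phi> where "\<Phi> = (\<lambda>u::real. u powr a / (1 + u powr a))"
  have \<Phi>: "\<Phi> u = 1 - 1 / (1 + u powr a)" for u
  proof -
    have "1 + u powr a > 0" by (simp add: add_pos_nonneg)
    then show ?thesis by (simp add: \<Phi>_def field_simps)
  qed
  define A where "A = 2 powr a"
  have A: "A > 1" using a by (simp add: A_def)
  \<comment> \<open>The increment has denominator \<open>(1 + A * x) * (1 + x)\<close>, at most
    \<open>2 * A * (1 + x^2)\<close>, and \<open>x^2\<close> is at most
    \<open>(2 * a) powr (2 * a)\<close> times an exponential; the factor \<open>A - 1\<close> comes
    from its numerator.\<close>
  define G where "G = A * 2 * (1 + (2 * a) powr (2 * a)) / (A - 1)"
  have G: "G > 0" using A by (simp add: G_def add_pos_nonneg)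
  have step: "u powr a * exp (- 2 * u) \<le> G * (\<Phi> (2 * u) - \<Phi> u)" if u: "u > 0" for u
  proof -
    define x where "x = u powr a"
    have x: "x > 0" using u by (simp add: x_def)
    have d: "\<Phi> (2 * u) - \<Phi> u = (A - 1) * x / ((1 + A * x) * (1 + x))"
    proof -
      have "1 + A * x > 0" "1 + x > 0" using x A by (auto intro: add_pos_pos)
      then show ?thesis using u x A unfolding \<Phi> by (simp add: powr_mult x_def[symmetric] A_def[symmetric] field_simps)
    qed
    have "x\<^sup>2 = u powr (2 * a)" by (simp add: x_def powr_powr power2_eq_square powr_add[symmetric])
    also have "\<dots> \<le> (2 * a) powr (2 * a) * exp u" using a u by (intro powr_le_exp) auto
    finally have x2: "x\<^sup>2 \<le> (2 * a) powr (2 * a) * exp u" .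
    have "(1 + A * x) * (1 + x) \<le> (A + A * x) * (1 + x)" using x A by (intro mult_right_mono) auto
    also have "\<dots> = A * (1 + x)\<^sup>2" by (simp add: power2_eq_square algebra_simps)
    also have "(1 + x)\<^sup>2 \<le> 2 * (1 + x\<^sup>2)"
      using zero_le_power2[of "1 - x"] by (simp add: power2_eq_square algebra_simps)
    also have "2 * (1 + x\<^sup>2) \<le> 2 * (exp (2 * u) + (2 * a) powr (2 * a) * exp (2 * u))"
    proof -
      have "(2 * a) powr (2 * a) * exp u \<le> (2 * a) powr (2 * a) * exp (2 * u)" using u by (intro mult_left_mono) auto
      moreover have "1 \<le> exp (2 * u)" using u by simp
      ultimately have "1 + x\<^sup>2 \<le> exp (2 * u) + (2 * a) powr (2 * a) * exp (2 * u)"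
        using x2 by (intro add_mono) auto
      then show ?thesis by (rule mult_left_mono) simp
    qed
    finally have "(1 + A * x) * (1 + x) \<le> A * (2 * (exp (2 * u) + (2 * a) powr (2 * a) * exp (2 * u)))"
      using A by (simp add: mult_left_mono)
    also have "\<dots> = A * 2 * (1 + (2 * a) powr (2 * a)) * exp (2 * u)" by (simp add: algebra_simps)
    also have "A * 2 * (1 + (2 * a) powr (2 * a)) = G * (A - 1)" using A by (simp add: G_def)
    finally have le: "(1 + A * x) * (1 + x) \<le> G * (A - 1) * exp (2 * u)" .
    have pos: "(1 + A * x) * (1 + x) > 0" using x A by (intro mult_pos_pos add_pos_pos) auto
    have "x * exp (- 2 * u) * ((1 + A * x) * (1 + x)) \<le> x * exp (- 2 * u) * (G * (A - 1) * exp (2 * u))"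
      using le x by (intro mult_left_mono) auto
    also have "\<dots> = G * ((A - 1) * x)" by (simp add: exp_minus)
    finally have "x * exp (- 2 * u) \<le> G * ((A - 1) * x) / ((1 + A * x) * (1 + x))"
      using pos by (simp add: pos_le_divide_eq)
    then show ?thesis unfolding d x_def[symmetric] by simp
  qed
  have main: "(\<Sum>i<N. u i powr a * exp (- 2 * u i)) \<le> G"
    if u: "\<And>i::nat. u i > (0::real)" "\<And>i. 2 * u i \<le> u (Suc i)" for u N
  proof -
    have mono: "\<Phi> s \<le> \<Phi> t" if "0 < s" "s \<le> t" for s t
    proof -
      have "s powr a \<le> t powr a" using that a by (intro powr_mono2) auto
      then have "1 / (1 + t powr a) \<le> 1 / (1 + s powr a)"
        by (intro divide_left_mono mult_pos_pos add_pos_nonneg) auto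
      then show ?thesis unfolding \<Phi> by simp
    qed
    have "(\<Sum>i<N. u i powr a * exp (- 2 * u i)) \<le> (\<Sum>i<N. G * (\<Phi> (u (Suc i)) - \<Phi> (u i)))"
    proof (rule sum_mono)
      fix i
      have "u i powr a * exp (- 2 * u i) \<le> G * (\<Phi> (2 * u i) - \<Phi> (u i))" by (rule step[OF u(1)])
      also have "\<dots> \<le> G * (\<Phi> (u (Suc i)) - \<Phi> (u i))"
        using mono[of "2 * u i" "u (Suc i)"] u G by (intro mult_left_mono) auto
      finally show "u i powr a * exp (- 2 * u i) \<le> G * (\<Phi> (u (Suc i)) - \<Phi> (u i))" .
    qed
    also have "\<dots> = G * (\<Phi> (u N) - \<Phi> (u 0))"
      by (simp only: sum_distrib_left[symmetric] sum_lessThan_telescope[of "\<lambda>i. \<Phi> (u i)"])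
    also have "\<dots> \<le> G * 1"
    proof (rule mult_left_mono)
      have "1 / (1 + u 0 powr a) \<le> 1" by (simp add: add_pos_nonneg divide_le_eq)
      moreover have "1 / (1 + u N powr a) \<ge> 0" by (simp add: add_pos_nonneg less_imp_le)
      ultimately show "\<Phi> (u N) - \<Phi> (u 0) \<le> 1" unfolding \<Phi> by linarith
    qed (use G in simp)
    finally show ?thesis by simp
  qed
  show ?thesis by (rule that[OF G main])
qed

text \<open>Taking the square of a prime as the next index makes the next prime exceed that square,
  so the logarithms at least double from term to term.\<close>

primrec lacunary_index :: "nat \<Rightarrow> nat \<Rightarrow> nat" where
  "lacunary_index D 0 = D"
| "lacunary_index D (Suc i) = (nth_prime (lacunary_index D i))\<^sup>2"

definition lacunary_prime :: "nat \<Rightarrow> nat \<Rightarrow> nat" where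
  "lacunary_prime D i = nth_prime (lacunary_index D i)"

lemma lacunary_prime_square_le: "(lacunary_prime D i)\<^sup>2 \<le> lacunary_prime D (Suc i)"
  using nth_prime_ge[of "(nth_prime (lacunary_index D i))\<^sup>2"] by (simp add: lacunary_prime_def)

lemma lacunary_index_strict_mono: "strict_mono (lacunary_index D)"
proof (rule strict_monoI_Suc)
  fix i
  have "lacunary_index D i < nth_prime (lacunary_index D i)" using nth_prime_ge[of "lacunary_index D i"] by simp
  also have "\<dots> \<le> (nth_prime (lacunary_index D i))\<^sup>2"
    using nth_prime_gt[of "lacunary_index D i"] by (simp add: power2_eq_square)
  finally show "lacunary_index D i < lacunary_index D (Suc i)" by simp
qed

lemma lacunary_ln:
  fixes D
  defines "L \<equiv> \<lambda>i. ln (real (lacunary_prime D i))"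
  shows "L i > 0" "2 * L i \<le> L (Suc i)" "i \<le> k \<Longrightarrow> L i \<le> L k" "ln (real D) \<le> L i"
proof -
  have g1: "lacunary_prime D i > 1" for i unfolding lacunary_prime_def by (rule nth_prime_gt)
  show pos: "L i > 0" for i unfolding L_def using g1[of i] by simp
  show dbl: "2 * L i \<le> L (Suc i)" for i
  proof -
    have "real ((lacunary_prime D i)\<^sup>2) \<le> real (lacunary_prime D (Suc i))"
      using lacunary_prime_square_le by (simp only: of_nat_le_iff)
    then have "(real (lacunary_prime D i))\<^sup>2 \<le> real (lacunary_prime D (Suc i))" by simp
    then have "ln ((real (lacunary_prime D i))\<^sup>2) \<le> L (Suc i)"
      unfolding L_def using g1[of i] g1[of "Suc i"] by (subst ln_le_cancel_iff) auto
    then show ?thesis using g1[of i] by (simp add: L_def ln_realpow)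
  qed
  have "L i \<le> L (Suc i)" for i using pos[of i] dbl[of i] by linarith
  then show m: "i \<le> k \<Longrightarrow> L i \<le> L k" for i k using lift_Suc_mono_le[of L] by blast
  have "ln (real D) \<le> L 0"
  proof (cases "D = 0")
    case False
    have "D \<le> nth_prime D" using nth_prime_ge[of D] by simp
    then show ?thesis using False by (simp add: L_def lacunary_prime_def)
  qed (use pos[of 0] in simp)
  then show "ln (real D) \<le> L i" using m[of 0 i] by simp
qed

definition lacunary_poly :: "real \<Rightarrow> real \<Rightarrow> nat \<Rightarrow> nat \<Rightarrow> nat \<Rightarrow> complex" where
  "lacunary_poly A \<kappa> D N n = (if n \<in> lacunary_prime D ` {..<N} then of_real (A * ln (real n) powr \<kappa>) else 0)"

text \<open>The terms live on separate scales \<sigma> ~ 1 / L. From above, each contributes the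
  same constant to the integral for \<open>p\<close>, so \<open>A powr p\<close> is of order 1 / N.
  From below, the \<open>i\<close>-th term contributes \<open>A powr q * L i powr \<tau>\<close> up
  to a constant, in total at least a multiple of
  \<open>N powr (1 - q / p) * L 0 powr \<tau>\<close>.\<close>

lemma hump_exponent_ge_2:
  assumes p: "p \<ge> 2" and q: "q > 0" and \<alpha>: "\<alpha> > -1" and \<beta>: "\<beta> > -1"
    and cond: "(\<beta> + 1) / q < (\<alpha> + 1) / p \<or> q < p \<and> (\<beta> + 1) / q = (\<alpha> + 1) / p"
  shows "\<exists>Q. hump p \<alpha> q \<beta> K {d..} Q"
proof -
  define \<kappa> where "\<kappa> = (\<alpha> + 1) / p"
  have \<kappa>: "\<kappa> > 0" using p \<alpha> by (simp add: \<kappa>_def)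
  have kp: "\<kappa> * p = \<alpha> + 1" using p by (simp add: \<kappa>_def)
  have p0: "p > 0" using p by simp
  obtain G where G: "G > 0" and Gb:
    "\<And>u N. (\<And>i::nat. u i > (0::real)) \<Longrightarrow> (\<And>i. 2 * u i \<le> u (Suc i)) \<Longrightarrow> (\<Sum>i<N. u i powr (2 * \<kappa>) * exp (- 2 * u i)) \<le> G"
    by (rule lacunary_sum_bound[of "2 * \<kappa>"]) (use \<kappa> in auto)
  define H where "H = weight_const \<alpha> * Gamma (2 * \<kappa>) / 2 powr (2 * \<kappa>)"
  have H: "H > 0" using weight_const_pos[OF \<alpha>] Gamma_real_pos[of "2 * \<kappa>"] \<kappa> by (simp add: H_def)
  define J where "J = khinchine_const p * G powr (p / 2 - 1) * H"
  have J: "J > 0" using khinchine_const_pos[OF p0] G H by (simp add: J_def)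
  define b where "b = weight_const \<beta> * exp (- 2) / (\<beta> + 1) * (1 - 2 powr (- (\<beta> + 1)))"
  have b: "b > 0"
  proof -
    have "2 powr (- (\<beta> + 1)) < 2 powr (0::real)" using \<beta> by (intro powr_less_mono) auto
    then show ?thesis using weight_const_pos[OF \<beta>] \<beta> by (simp add: b_def)
  qed
  \<comment> \<open>\<open>L powr (\<kappa> * q)\<close> comes from the coefficient and
    \<open>L powr (- (\<beta> + 1))\<close> from the mass of its scale; \<tau> is zero exactly when
    the two ratios are equal.\<close>
  define \<tau> where "\<tau> = \<kappa> * q - (\<beta> + 1)"
  have \<tau>: "\<tau> \<ge> 0" using cond q by (auto simp: \<tau>_def \<kappa>_def pos_divide_less_eq field_simps)
  \<comment> \<open>Collects the factor from \<open>A powr q\<close>, the damping on the scale of a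
    term and the mass of that scale.\<close>
  define lowc where "lowc = J powr (- q / p) * exp (- q) * b"
  have lowc: "lowc > 0" using J b by (simp add: lowc_def)
  \<comment> \<open>Two ways to exceed \<open>K\<close>: for \<tau> > 0 a single prime with large
    logarithm, for \<tau> = 0, where \<open>q < p\<close>, a large number of primes.\<close>
  have "\<exists>N D0. N \<ge> 1 \<and> (\<forall>l. l \<ge> D0 \<longrightarrow> K \<le> lowc * real N powr (1 - q / p) * l powr \<tau>)"
  proof (cases "\<tau> > 0")
    case True
    then have "filterlim (\<lambda>l. lowc * 1 powr (1 - q / p) * l powr \<tau>) at_top at_top" using lowc by real_asymp
    then have "\<forall>\<^sub>F l in at_top. K \<le> lowc * 1 powr (1 - q / p) * l powr \<tau>" by (simp add: filterlim_at_top)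
    then obtain D0 where "\<forall>l\<ge>D0. K \<le> lowc * 1 powr (1 - q / p) * l powr \<tau>" by (auto simp: eventually_at_top_linorder)
    then show ?thesis by (intro exI[of _ 1] exI[of _ D0]) auto
  next
    case False
    with \<tau> have t0: "\<tau> = 0" by simp
    then have "(\<beta> + 1) / q = (\<alpha> + 1) / p" using q by (simp add: \<tau>_def \<kappa>_def field_simps)
    with cond have "q < p" by auto
    then have e: "1 - q / p > 0" using p0 by simp
    then have "filterlim (\<lambda>N::nat. lowc * real N powr (1 - q / p)) at_top sequentially" using lowc by real_asymp
    then have "\<forall>\<^sub>F N in sequentially. K \<le> lowc * real N powr (1 - q / p)" by (simp add: filterlim_at_top)
    then have "\<forall>\<^sub>F N in sequentially. K \<le> lowc * real N powr (1 - q / p) \<and> N \<ge> 1"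
      using eventually_ge_at_top[of 1] by (rule eventually_conj)
    then obtain N where "K \<le> lowc * real N powr (1 - q / p)" "N \<ge> 1" by (auto simp: eventually_sequentially)
    then show ?thesis by (intro exI[of _ N] exI[of _ 1]) (auto simp: t0)
  qed
  then obtain N D0 where N: "N \<ge> 1" and D0: "\<And>l. l \<ge> D0 \<Longrightarrow> K \<le> lowc * real N powr (1 - q / p) * l powr \<tau>" by blast
  define A where "A = (J * real N) powr (- 1 / p)"
  have A: "A > 0" using J N by (simp add: A_def)
  have Ap: "A powr p * (J * real N) = 1"
  proof -
    have "A powr p = (J * real N) powr (- 1)" using p0 by (simp only: A_def powr_powr) simp
    then show ?thesis using J N by (simp add: powr_minus_divide)
  qed
  have Aq: "A powr q = J powr (- q / p) * real N powr (- q / p)"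
    using J N by (simp add: A_def powr_powr powr_mult)
  \<comment> \<open>\<open>N\<close> and \<open>A\<close> are fixed by now, so starting at a large
    enough prime makes every term of the absolute sum at 1/2 at most 1 / N.\<close>
  have "((\<lambda>l. A * real N * (l powr \<kappa> * exp (- l / 2))) \<longlongrightarrow> 0) at_top" by real_asymp
  then have "\<forall>\<^sub>F l in at_top. A * real N * (l powr \<kappa> * exp (- l / 2)) < 1" by (rule order_tendstoD(2)) simp
  then obtain D1 where D1: "\<And>l. l \<ge> D1 \<Longrightarrow> A * real N * (l powr \<kappa> * exp (- l / 2)) < 1" by (auto simp: eventually_at_top_linorder)
  have "\<forall>\<^sub>F D::nat in sequentially. ln (real D) \<ge> max 1 (max D0 D1)"
  proof -
    have "filterlim (\<lambda>D::nat. ln (real D)) at_top sequentially" by real_asymp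
    then have "\<forall>Z. \<forall>\<^sub>F D::nat in sequentially. Z \<le> ln (real D)" by (rule filterlim_at_top[THEN iffD1])
    then show ?thesis by (rule spec)
  qed
  then have "\<forall>\<^sub>F D::nat in sequentially. ln (real D) \<ge> max 1 (max D0 D1) \<and> D \<ge> d"
    using eventually_ge_at_top[of d] by (rule eventually_conj)
  then obtain D where D: "ln (real D) \<ge> max 1 (max D0 D1)" "D \<ge> d" by (auto simp: eventually_sequentially)
  define L where "L = (\<lambda>i. ln (real (lacunary_prime D i)))"
  have Lpos: "L i > 0" and Ldbl: "2 * L i \<le> L (Suc i)" and L1: "L i \<ge> 1" and LD0: "L i \<ge> D0" and LD1: "L i \<ge> D1" for i
    using lacunary_ln(1)[of D i] lacunary_ln(2)[of D i] lacunary_ln(4)[of D i] D(1) unfolding L_def by linarith+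
  have Lmono: "L i \<le> L k" if "i \<le> k" for i k unfolding L_def by (rule lacunary_ln(3)[OF that])
  have lp1: "lacunary_prime D i > 1" for i unfolding lacunary_prime_def by (rule nth_prime_gt)
  have inj: "inj_on (lacunary_prime D) S" for S
  proof -
    have "inj (lacunary_prime D)"
      unfolding lacunary_prime_def
      using strict_mono_imp_inj_on[OF lacunary_index_strict_mono] inj_nth_prime
      by (intro injI) (auto dest!: injD)
    then show ?thesis by (rule inj_on_subset) simp
  qed
  have lpow: "real (lacunary_prime D i) powr s = exp (s * L i)" for i s
    using lp1[of i] by (simp add: L_def powr_def)
  let ?Q = "lacunary_poly A \<kappa> D N"
  have Qi: "?Q (lacunary_prime D i) = of_real (A * L i powr \<kappa>)" if "i < N" for i
    using that by (auto simp: lacunary_poly_def L_def)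
  have Qn: "norm (?Q (lacunary_prime D i)) = A * L i powr \<kappa>" if "i < N" for i
    using A unfolding Qi[OF that] norm_of_real by simp
  have supp: "{n. ?Q n \<noteq> 0} = lacunary_prime D ` {..<N}"
  proof
    show "{n. ?Q n \<noteq> 0} \<subseteq> lacunary_prime D ` {..<N}" by (auto simp: lacunary_poly_def split: if_splits)
    show "lacunary_prime D ` {..<N} \<subseteq> {n. ?Q n \<noteq> 0}"
    proof (rule image_subsetI)
      fix i assume "i \<in> {..<N}"
      then have "?Q (lacunary_prime D i) = of_real (A * L i powr \<kappa>)" by (intro Qi) simp
      moreover have "A * L i powr \<kappa> \<noteq> 0" using A Lpos[of i] by simp
      ultimately show "lacunary_prime D i \<in> {n. ?Q n \<noteq> 0}" by (simp only: mem_Collect_eq of_real_eq_0_iff simp_thms)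
    qed
  qed
  have poly: "?Q \<in> dirichlet_polys" by (rule dirichlet_polysI) (simp add: supp)
  have T: "finite {n. ?Q n \<noteq> 0}" "0 \<notin> {n. ?Q n \<noteq> 0}" using lp1 by (auto simp: supp, metis not_one_less_zero)
  have sumQ: "(\<Sum>n | ?Q n \<noteq> 0. g n) = (\<Sum>i<N. g (lacunary_prime D i))" for g :: "nat \<Rightarrow> real"
    unfolding supp by (rule sum.reindex_cong[OF inj]) auto
  have sumQc: "(\<Sum>n | ?Q n \<noteq> 0. g n) = (\<Sum>i<N. g (lacunary_prime D i))" for g :: "nat \<Rightarrow> complex"
    unfolding supp by (rule sum.reindex_cong[OF inj]) auto
  have ss: "square_sum ?Q {n. ?Q n \<noteq> 0} \<sigma> = A\<^sup>2 * (\<Sum>i<N. L i powr (2 * \<kappa>) * exp (- 2 * \<sigma> * L i))" for \<sigma>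
  proof -
    have "square_sum ?Q {n. ?Q n \<noteq> 0} \<sigma> = (\<Sum>i<N. A\<^sup>2 * (L i powr (2 * \<kappa>) * exp (- 2 * \<sigma> * L i)))"
      unfolding square_sum_def sumQ
    proof (rule sum.cong)
      fix i assume "i \<in> {..<N}"
      then have "norm (?Q (lacunary_prime D i)) = A * L i powr \<kappa>" by (intro Qn) simp
      moreover have "(L i powr \<kappa>)\<^sup>2 = L i powr (2 * \<kappa>)" by (simp add: power2_eq_square powr_add[symmetric])
      ultimately show "(norm (?Q (lacunary_prime D i)))\<^sup>2 * real (lacunary_prime D i) powr (- 2 * \<sigma>) = A\<^sup>2 * (L i powr (2 * \<kappa>) * exp (- 2 * \<sigma> * L i))"
        by (simp add: lpow power_mult_distrib)
    qed simp
    then show ?thesis by (simp add: sum_distrib_left)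
  qed
  have "hump p \<alpha> q \<beta> K {d..} ?Q"
    unfolding hump_def
  proof (intro conjI allI impI)
    show "?Q \<in> dirichlet_polys" by (rule poly)
    fix n assume "?Q n \<noteq> 0"
    then obtain i where i: "n = lacunary_prime D i" using supp by auto
    show "2 \<le> n" using lp1[of i] i by simp
    have "D \<le> lacunary_index D i"
      using lacunary_index_strict_mono[of D] strict_mono_less_eq[of "lacunary_index D" 0 i] by simp
    then show "n \<in> prime_block {d..}" using D(2) nth_prime_gt[of "lacunary_index D i"]
      by (auto simp: i lacunary_prime_def prime_block_def)
  next
    have upper: "hardy_power p (dirichlet_shift \<sigma> ?Q) \<le> ennreal (khinchine_const p * square_sum ?Q {n. ?Q n \<noteq> 0} \<sigma> powr (p / 2))" for \<sigma>
    proof -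
      interpret t: prob_space torus_measure by (rule prob_space_torus)
      let ?I = "lacunary_index D ` {..<N}"
      let ?c = "\<lambda>j. ?Q (nth_prime j) * of_real (real (nth_prime j) powr (- \<sigma>))"
      have injI: "inj_on (lacunary_index D) {..<N}" by (rule strict_mono_imp_inj_on[OF lacunary_index_strict_mono])
      have lift: "bohr_lift (dirichlet_shift \<sigma> ?Q) z = (\<Sum>j\<in>?I. ?c j * z j)" for z
      proof -
        have "bohr_lift (dirichlet_shift \<sigma> ?Q) z = (\<Sum>n | ?Q n \<noteq> 0. ?Q n * of_real (real n powr (- \<sigma>)) * bohr_monomial z n)"
          by (rule bohr_lift_shift_sum) (use T in auto)
        also have "\<dots> = (\<Sum>i<N. ?c (lacunary_index D i) * z (lacunary_index D i))"
          unfolding sumQc by (simp add: lacunary_prime_def)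
        also have "\<dots> = (\<Sum>j\<in>?I. ?c j * z j)" by (simp add: sum.reindex[OF injI])
        finally show ?thesis .
      qed
      have sq: "(\<Sum>j\<in>?I. (norm (?c j))\<^sup>2) = square_sum ?Q {n. ?Q n \<noteq> 0} \<sigma>"
      proof -
        have "(real n powr (- \<sigma>))\<^sup>2 = real n powr (- 2 * \<sigma>)" for n :: nat
          by (simp add: power2_eq_square powr_add[symmetric])
        then show ?thesis
          unfolding square_sum_def sumQ sum.reindex[OF injI]
          by (simp add: lacunary_prime_def norm_mult power_mult_distrib)
      qed
      have ind: "t.indep_vars (\<lambda>_. borel) (\<lambda>j z. z j) ?I" by (rule t.indep_vars_subset[OF torus_indep]) simp
      have sg: "normalized_subgaussian torus_measure (\<lambda>z. z j)" for j
        by (rule normalized_subgaussian_steinhaus) (auto simp: prob_space_torus steinhaus_var_def distr_torus_component)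
      show ?thesis
        unfolding hardy_power_def lift sq[symmetric]
        by (rule khinchine_upper[OF prob_space_torus ind _ sg p0]) simp
    qed
    have M_le: "(\<Sum>i<N. L i powr (2 * \<kappa>) * exp (- 2 * \<sigma> * L i)) \<le> G * \<sigma> powr (- 2 * \<kappa>)" if \<sigma>: "\<sigma> > 0" for \<sigma>
    proof -
      have "(\<Sum>i<N. (\<sigma> * L i) powr (2 * \<kappa>) * exp (- 2 * (\<sigma> * L i))) \<le> G"
        using Lpos Ldbl \<sigma> by (intro Gb) auto
      then have "\<sigma> powr (2 * \<kappa>) * (\<Sum>i<N. L i powr (2 * \<kappa>) * exp (- 2 * \<sigma> * L i)) \<le> G"
        using \<sigma> Lpos by (simp add: powr_mult sum_distrib_left mult.assoc less_imp_le)
      moreover have "\<sigma> powr (- 2 * \<kappa>) = 1 / \<sigma> powr (2 * \<kappa>)" using powr_minus_divide[of \<sigma> "2 * \<kappa>"] by simp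
      ultimately show ?thesis using \<sigma> by (simp add: pos_le_divide_eq mult.commute)
    qed
    \<comment> \<open>One factor \<open>M\<close> of \<open>M powr (p / 2)\<close> is kept and the
      others are bounded by \<open>M_le\<close>, which makes the estimate linear in the terms at the
      price \<open>\<sigma> powr (- ?e)\<close>. Since
      \<open>\<alpha> - ?e = 2 * \<kappa> - 1\<close>, each term becomes a gamma integral of order
      \<open>L i powr (- 2 * \<kappa>)\<close>, cancelling its weight.\<close>
    let ?e = "2 * \<kappa> * (p / 2 - 1)"
    have pw: "khinchine_const p * square_sum ?Q {n. ?Q n \<noteq> 0} \<sigma> powr (p / 2)
        \<le> (\<Sum>i<N. khinchine_const p * A powr p * G powr (p / 2 - 1) * (L i powr (2 * \<kappa>) * (\<sigma> powr (- ?e) * exp (- 2 * \<sigma> * L i))))" if \<sigma>: "\<sigma> > 0" for \<sigma>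
    proof -
      define M where "M = (\<Sum>i<N. L i powr (2 * \<kappa>) * exp (- 2 * \<sigma> * L i))"
      have M0: "M \<ge> 0" unfolding M_def by (intro sum_nonneg) auto
      have "square_sum ?Q {n. ?Q n \<noteq> 0} \<sigma> powr (p / 2) = A powr p * M powr (p / 2)"
      proof -
        have "(A\<^sup>2) powr (p / 2) = A powr p" using A by (simp add: powr_powr flip: powr_numeral)
        then show ?thesis unfolding ss M_def[symmetric] by (simp add: powr_mult M0)
      qed
      also have "M powr (p / 2) = M * M powr (p / 2 - 1)"
      proof (cases "M = 0")
        case False
        then show ?thesis using M0 by (simp add: powr_mult_base)
      qed simp
      also have "M powr (p / 2 - 1) \<le> (G * \<sigma> powr (- 2 * \<kappa>)) powr (p / 2 - 1)"
        using M_le[OF \<sigma>] M0 p by (intro powr_mono2) (auto simp: M_def)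
      also have "(G * \<sigma> powr (- 2 * \<kappa>)) powr (p / 2 - 1) = G powr (p / 2 - 1) * \<sigma> powr (- ?e)"
        using G by (simp add: powr_mult powr_powr)
      finally have "square_sum ?Q {n. ?Q n \<noteq> 0} \<sigma> powr (p / 2) \<le> A powr p * (M * (G powr (p / 2 - 1) * \<sigma> powr (- ?e)))"
        using M0 A by (simp add: mult_left_mono)
      then have "khinchine_const p * square_sum ?Q {n. ?Q n \<noteq> 0} \<sigma> powr (p / 2) \<le> khinchine_const p * (A powr p * (M * (G powr (p / 2 - 1) * \<sigma> powr (- ?e))))"
        using khinchine_const_pos[OF p0] by (intro mult_left_mono) auto
      also have "\<dots> = khinchine_const p * A powr p * G powr (p / 2 - 1) * \<sigma> powr (- ?e) * M" by (simp only: mult_ac)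
      also have "\<dots> = (\<Sum>i<N. khinchine_const p * A powr p * G powr (p / 2 - 1) * (L i powr (2 * \<kappa>) * (\<sigma> powr (- ?e) * exp (- 2 * \<sigma> * L i))))"
        unfolding M_def sum_distrib_left by (intro sum.cong refl) (simp only: mult_ac)
      finally show ?thesis .
    qed
    have gam: "(\<integral>\<^sup>+\<sigma>. ennreal (\<sigma> powr (- ?e) * exp (- 2 * \<sigma> * l)) \<partial>bergman_weight \<alpha>) \<le> ennreal (H * l powr (- 2 * \<kappa>))" if l: "l > 0" for l
    proof -
      have ex: "\<alpha> - ?e = 2 * \<kappa> - 1" using kp by (simp add: algebra_simps)
      have "(\<integral>\<^sup>+\<sigma>. ennreal (\<sigma> powr (- ?e) * exp (- 2 * \<sigma> * l)) \<partial>bergman_weight \<alpha>)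
        = ennreal (weight_const \<alpha>) * (\<integral>\<^sup>+\<sigma>. ennreal (indicator {0<..} \<sigma> * (\<sigma> powr \<alpha> * exp (- 2 * \<sigma>))) * ennreal (\<sigma> powr (- ?e) * exp (- 2 * \<sigma> * l)) \<partial>lborel)"
        by (rule nn_integral_bergman_weight[OF _ \<alpha>]) measurable
      also have "(\<integral>\<^sup>+\<sigma>. ennreal (indicator {0<..} \<sigma> * (\<sigma> powr \<alpha> * exp (- 2 * \<sigma>))) * ennreal (\<sigma> powr (- ?e) * exp (- 2 * \<sigma> * l)) \<partial>lborel)
        = (\<integral>\<^sup>+\<sigma>. ennreal (indicator {0<..} \<sigma> * (\<sigma> powr (2 * \<kappa> - 1) * exp (- (2 * (1 + l)) * \<sigma>))) \<partial>lborel)"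
      proof (rule nn_integral_cong)
        fix \<sigma> :: real
        show "ennreal (indicator {0<..} \<sigma> * (\<sigma> powr \<alpha> * exp (- 2 * \<sigma>))) * ennreal (\<sigma> powr (- ?e) * exp (- 2 * \<sigma> * l))
          = ennreal (indicator {0<..} \<sigma> * (\<sigma> powr (2 * \<kappa> - 1) * exp (- (2 * (1 + l)) * \<sigma>)))"
        proof (cases "\<sigma> > 0")
          case True
          have "\<sigma> powr (2 * \<kappa> - 1) = \<sigma> powr \<alpha> * \<sigma> powr (- ?e)" unfolding ex[symmetric] using powr_add[of \<sigma> \<alpha> "- ?e"] by simp
          moreover have "exp (- (2 * (1 + l)) * \<sigma>) = exp (- 2 * \<sigma>) * exp (- 2 * \<sigma> * l)"
            unfolding exp_add[symmetric] by (simp add: algebra_simps)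
          ultimately have "\<sigma> powr (2 * \<kappa> - 1) * exp (- (2 * (1 + l)) * \<sigma>) = (\<sigma> powr \<alpha> * exp (- 2 * \<sigma>)) * (\<sigma> powr (- ?e) * exp (- 2 * \<sigma> * l))"
            by (simp only: mult_ac)
          then show ?thesis using True by (simp only: ennreal_mult'[symmetric] indicator_simps mult_1 greaterThan_iff mult_nonneg_nonneg powr_ge_zero exp_ge_zero)
        qed simp
      qed
      also have "\<dots> = ennreal (Gamma (2 * \<kappa>) / (2 * (1 + l)) powr (2 * \<kappa>))"
        using \<kappa> l by (intro nn_integral_gamma_scaled) auto
      also have "ennreal (weight_const \<alpha>) * \<dots> = ennreal (weight_const \<alpha> * (Gamma (2 * \<kappa>) / (2 * (1 + l)) powr (2 * \<kappa>)))"
        by (rule ennreal_mult'[symmetric]) (rule less_imp_le[OF weight_const_pos[OF \<alpha>]])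
      also have "\<dots> \<le> ennreal (H * l powr (- 2 * \<kappa>))"
      proof (rule ennreal_leI)
        have "Gamma (2 * \<kappa>) / (2 * (1 + l)) powr (2 * \<kappa>) \<le> Gamma (2 * \<kappa>) / (2 * l) powr (2 * \<kappa>)"
          using l \<kappa> Gamma_real_pos[of "2 * \<kappa>"] by (intro divide_left_mono powr_mono2 mult_pos_pos) auto
        then have "weight_const \<alpha> * (Gamma (2 * \<kappa>) / (2 * (1 + l)) powr (2 * \<kappa>)) \<le> weight_const \<alpha> * (Gamma (2 * \<kappa>) / (2 * l) powr (2 * \<kappa>))"
          using weight_const_pos[OF \<alpha>] by (intro mult_left_mono) auto
        also have "\<dots> = H * l powr (- 2 * \<kappa>)"
        proof -
          have "l powr (- 2 * \<kappa>) = 1 / l powr (2 * \<kappa>)" using powr_minus_divide[of l "2 * \<kappa>"] by simp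
          then show ?thesis using l by (simp add: H_def powr_mult)
        qed
        finally show "weight_const \<alpha> * (Gamma (2 * \<kappa>) / (2 * (1 + l)) powr (2 * \<kappa>)) \<le> H * l powr (- 2 * \<kappa>)" .
      qed
      finally show ?thesis .
    qed
    let ?k = "\<lambda>i. khinchine_const p * A powr p * G powr (p / 2 - 1) * L i powr (2 * \<kappa>)"
    have k0: "?k i \<ge> 0" for i using khinchine_const_pos[OF p0] by simp
    have "bergman_power p \<alpha> ?Q \<le> (\<integral>\<^sup>+\<sigma>. (\<Sum>i<N. ennreal (?k i) * ennreal (\<sigma> powr (- ?e) * exp (- 2 * \<sigma> * L i))) \<partial>bergman_weight \<alpha>)"
      unfolding bergman_power_def
    proof (rule nn_integral_mono_AE, use AE_bergman_weight_pos in eventually_elim)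
      fix \<sigma> :: real assume \<sigma>: "\<sigma> > 0"
      have "hardy_power p (dirichlet_shift \<sigma> ?Q) \<le> ennreal (\<Sum>i<N. khinchine_const p * A powr p * G powr (p / 2 - 1) * (L i powr (2 * \<kappa>) * (\<sigma> powr (- ?e) * exp (- 2 * \<sigma> * L i))))"
        using upper[of \<sigma>] ennreal_leI[OF pw[OF \<sigma>]] by (rule order_trans)
      also have "\<dots> = (\<Sum>i<N. ennreal (khinchine_const p * A powr p * G powr (p / 2 - 1) * (L i powr (2 * \<kappa>) * (\<sigma> powr (- ?e) * exp (- 2 * \<sigma> * L i)))))"
        using khinchine_const_pos[OF p0] by (intro sum_ennreal[symmetric]) auto
      also have "\<dots> = (\<Sum>i<N. ennreal (?k i) * ennreal (\<sigma> powr (- ?e) * exp (- 2 * \<sigma> * L i)))"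
        unfolding ennreal_mult'[OF k0, symmetric] by (intro sum.cong refl arg_cong[of _ _ ennreal]) (simp only: mult.assoc)
      finally show "hardy_power p (dirichlet_shift \<sigma> ?Q) \<le> (\<Sum>i<N. ennreal (?k i) * ennreal (\<sigma> powr (- ?e) * exp (- 2 * \<sigma> * L i)))" .
    qed
    also have "\<dots> = (\<Sum>i<N. ennreal (?k i) * (\<integral>\<^sup>+\<sigma>. ennreal (\<sigma> powr (- ?e) * exp (- 2 * \<sigma> * L i)) \<partial>bergman_weight \<alpha>))"
      by (subst nn_integral_sum) (auto intro!: sum.cong nn_integral_cmult)
    also have "\<dots> \<le> (\<Sum>i<N. ennreal (?k i) * ennreal (H * L i powr (- 2 * \<kappa>)))"
      by (intro sum_mono mult_left_mono gam Lpos) simp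
    also have "\<dots> = (\<Sum>i<N. ennreal (A powr p * J))"
    proof (rule sum.cong[OF refl])
      fix i
      have "L i powr (2 * \<kappa>) * L i powr (- 2 * \<kappa>) = 1" using Lpos[of i] by (simp add: powr_add[symmetric])
      then have "?k i * (H * L i powr (- 2 * \<kappa>)) = khinchine_const p * A powr p * G powr (p / 2 - 1) * H"
        by (simp add: mult_ac)
      also have "\<dots> = A powr p * J" by (simp add: J_def mult_ac)
      finally show "ennreal (?k i) * ennreal (H * L i powr (- 2 * \<kappa>)) = ennreal (A powr p * J)"
        unfolding ennreal_mult'[OF k0, symmetric] by (rule arg_cong)
    qed
    also have "\<dots> = ennreal (\<Sum>i<N. A powr p * J)" using J by (intro sum_ennreal) auto
    also have "(\<Sum>i<N. A powr p * J) = 1" using Ap by (simp add: mult_ac)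
    finally show "bergman_power p \<alpha> ?Q \<le> 1" by simp
  next
    have "(\<Sum>n | ?Q n \<noteq> 0. norm (?Q n) * real n powr (- 1 / 2)) = (\<Sum>i<N. A * L i powr \<kappa> * exp (- L i / 2))"
      unfolding sumQ by (intro sum.cong) (auto simp: Qn lpow)
    also have "\<dots> \<le> (\<Sum>i<N. 1 / real N)"
    proof (rule sum_mono)
      fix i
      have "A * real N * (L i powr \<kappa> * exp (- L i / 2)) \<le> 1" using D1[OF LD1] by (rule less_imp_le)
      then show "A * L i powr \<kappa> * exp (- L i / 2) \<le> 1 / real N" using N by (simp add: pos_le_divide_eq mult_ac)
    qed
    also have "\<dots> = 1" using N by simp
    finally show "(\<Sum>n | ?Q n \<noteq> 0. norm (?Q n) * real n powr (- 1 / 2)) \<le> 1" .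
  next
    \<comment> \<open>Disjoint for different terms since the logarithms at least double. On
      \<open>?J i\<close> the product of \<sigma> and \<open>L i\<close> is at most 1, so the
      \<open>i\<close>-th term of the square sum keeps at least the fraction
      \<open>exp (- 2)\<close>.\<close>
    let ?J = "\<lambda>i. {1 / (2 * L i)<..1 / L i}"
    let ?c = "\<lambda>i. (A * L i powr \<kappa> * exp (- 1)) powr q"
    have disj: "i = k" if "\<sigma> \<in> ?J i" "\<sigma> \<in> ?J k" for i k \<sigma>
    proof -
      have *: False if "i < k" "\<sigma> \<in> ?J i" "\<sigma> \<in> ?J k" for i k
      proof -
        have "2 * L i \<le> L k" using Ldbl[of i] Lmono[of "Suc i" k] that(1) by simp
        then have "1 / L k \<le> 1 / (2 * L i)" using Lpos[of i] by (intro divide_left_mono mult_pos_pos) (auto intro: Lpos)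
        then show False using that by simp
      qed
      then show ?thesis using that by (cases i k rule: linorder_cases) auto
    qed
    have single: "?c i \<le> square_sum ?Q {n. ?Q n \<noteq> 0} \<sigma> powr (q / 2)" if i: "i < N" and \<sigma>: "\<sigma> \<in> ?J i" for i \<sigma>
    proof -
      have "\<sigma> * L i \<le> 1" using \<sigma> Lpos[of i] by (simp add: pos_le_divide_eq)
      then have "exp (- 2) \<le> exp (- 2 * \<sigma> * L i)" by simp
      then have "(A * L i powr \<kappa> * exp (- 1))\<^sup>2 \<le> A\<^sup>2 * (L i powr (2 * \<kappa>) * exp (- 2 * \<sigma> * L i))"
      proof -
        have "(A * L i powr \<kappa> * exp (- 1))\<^sup>2 = A\<^sup>2 * (L i powr (2 * \<kappa>) * exp (- 2))"
          by (simp add: power2_eq_square exp_add[symmetric] mult_ac powr_add[symmetric])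
        also have "\<dots> \<le> A\<^sup>2 * (L i powr (2 * \<kappa>) * exp (- 2 * \<sigma> * L i))"
          using \<open>exp (- 2) \<le> exp (- 2 * \<sigma> * L i)\<close> by (intro mult_left_mono) auto
        finally show ?thesis .
      qed
      also have "\<dots> \<le> square_sum ?Q {n. ?Q n \<noteq> 0} \<sigma>"
        unfolding ss using i by (intro mult_left_mono member_le_sum) auto
      finally have "((A * L i powr \<kappa> * exp (- 1))\<^sup>2) powr (q / 2) \<le> square_sum ?Q {n. ?Q n \<noteq> 0} \<sigma> powr (q / 2)"
        using q by (intro powr_mono2) auto
      moreover have "((A * L i powr \<kappa> * exp (- 1))\<^sup>2) powr (q / 2) = ?c i"
      proof -
        have "A * L i powr \<kappa> * exp (- 1) > 0" using A Lpos[of i] by simp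
        then show ?thesis by (simp add: powr_powr flip: powr_numeral)
      qed
      ultimately show ?thesis by simp
    qed
    have pt: "(\<Sum>i<N. ennreal (?c i) * indicator (?J i) \<sigma>) \<le> ennreal (square_sum ?Q {n. ?Q n \<noteq> 0} \<sigma> powr (q / 2))" for \<sigma>
    proof (cases "\<exists>i<N. \<sigma> \<in> ?J i")
      case True
      then obtain i where i: "i < N" "\<sigma> \<in> ?J i" by blast
      have "(\<Sum>k<N. ennreal (?c k) * indicator (?J k) \<sigma>) = (\<Sum>k\<in>{i}. ennreal (?c k) * indicator (?J k) \<sigma>)"
      proof (rule sum.mono_neutral_right)
        show "\<forall>k\<in>{..<N} - {i}. ennreal (?c k) * indicator (?J k) \<sigma> = 0"
        proof
          fix k assume k: "k \<in> {..<N} - {i}"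
          have "\<sigma> \<notin> ?J k" using disj[OF i(2), of k] k by blast
          then show "ennreal (?c k) * indicator (?J k) \<sigma> = 0" by (simp only: indicator_simps mult_zero_right not_False_eq_True)
        qed
      qed (use i in auto)
      also have "\<dots> = ennreal (?c i)" using i(2) by (simp only: sum.insert sum.empty indicator_simps finite.emptyI empty_iff not_False_eq_True) simp
      also have "\<dots> \<le> ennreal (square_sum ?Q {n. ?Q n \<noteq> 0} \<sigma> powr (q / 2))" by (rule ennreal_leI[OF single[OF i]])
      finally show ?thesis .
    next
      case False
      have "(\<Sum>i<N. ennreal (?c i) * indicator (?J i) \<sigma>) = 0"
      proof (rule sum.neutral, rule ballI)
        fix k assume "k \<in> {..<N}"
        then have "\<sigma> \<notin> ?J k" using False by blast
        then show "ennreal (?c k) * indicator (?J k) \<sigma> = 0" by (simp only: indicator_simps mult_zero_right not_False_eq_True)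
      qed
      then show ?thesis by simp
    qed
    have mass: "ennreal (b * L i powr (- (\<beta> + 1))) \<le> emeasure (bergman_weight \<beta>) (?J i)" for i
    proof -
      have "(1 / L i) powr (\<beta> + 1) - (1 / (2 * L i)) powr (\<beta> + 1) = (1 - 2 powr (- (\<beta> + 1))) * L i powr (- (\<beta> + 1))"
        using Lpos[of i] by (simp only: powr_minus_divide powr_divide powr_mult powr_one_eq_one) (simp add: powr_mult field_simps)
      then have "b * L i powr (- (\<beta> + 1)) = weight_const \<beta> * exp (- 2) / (\<beta> + 1) * ((1 / L i) powr (\<beta> + 1) - (1 / (2 * L i)) powr (\<beta> + 1))"
        by (simp only: b_def mult.assoc)
      moreover have "ennreal (weight_const \<beta> * exp (- 2) / (\<beta> + 1) * ((1 / L i) powr (\<beta> + 1) - (1 / (2 * L i)) powr (\<beta> + 1))) \<le> emeasure (bergman_weight \<beta>) (?J i)"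
        using L1[of i] by (intro bergman_weight_interval_ge \<beta>) (auto simp: field_simps)
      ultimately show ?thesis by simp
    qed
    have "ennreal K \<le> ennreal (lowc * real N powr (1 - q / p) * L 0 powr \<tau>)"
      by (rule ennreal_leI[OF D0[OF LD0]])
    also have "lowc * real N powr (1 - q / p) * L 0 powr \<tau> = (\<Sum>i<N. A powr q * exp (- q) * b * L 0 powr \<tau>)"
    proof -
      have "real N powr (1 - q / p) = real N * real N powr (- q / p)" using N powr_add[of "real N" 1 "- q / p"] by simp
      then show ?thesis by (simp add: lowc_def Aq)
    qed
    also have "ennreal \<dots> \<le> ennreal (\<Sum>i<N. ?c i * (b * L i powr (- (\<beta> + 1))))"
    proof (intro ennreal_leI sum_mono)
      fix i
      have "L 0 powr \<tau> \<le> L i powr \<tau>" using Lmono[of 0 i] Lpos[of 0] \<tau> by (intro powr_mono2) auto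
      also have "\<dots> = L i powr (\<kappa> * q) * L i powr (- (\<beta> + 1))"
        unfolding \<tau>_def diff_conv_add_uminus by (rule powr_add)
      finally have "A powr q * exp (- q) * b * L 0 powr \<tau> \<le> A powr q * exp (- q) * b * (L i powr (\<kappa> * q) * L i powr (- (\<beta> + 1)))"
        using b by (intro mult_left_mono) auto
      also have "\<dots> = ?c i * (b * L i powr (- (\<beta> + 1)))"
      proof -
        have "exp (- 1 :: real) powr q = exp (- q)" by (simp add: powr_def)
        then have "?c i = A powr q * L i powr (\<kappa> * q) * exp (- q)" using A by (simp add: powr_mult powr_powr)
        then show ?thesis by (simp only: mult_ac)
      qed
      finally show "A powr q * exp (- q) * b * L 0 powr \<tau> \<le> ?c i * (b * L i powr (- (\<beta> + 1)))" .
    qed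
    also have "\<dots> = (\<Sum>i<N. ennreal (?c i) * ennreal (b * L i powr (- (\<beta> + 1))))"
      using b by (subst sum_ennreal[symmetric]) (auto simp: ennreal_mult')
    also have "\<dots> \<le> (\<Sum>i<N. ennreal (?c i) * emeasure (bergman_weight \<beta>) (?J i))"
      by (intro sum_mono mult_left_mono mass) simp
    also have "\<dots> = (\<Sum>i<N. \<integral>\<^sup>+\<sigma>. ennreal (?c i) * indicator (?J i) \<sigma> \<partial>bergman_weight \<beta>)"
      by (intro sum.cong refl nn_integral_cmult_indicator[symmetric]) simp
    also have "\<dots> = (\<integral>\<^sup>+\<sigma>. (\<Sum>i<N. ennreal (?c i) * indicator (?J i) \<sigma>) \<partial>bergman_weight \<beta>)"
      by (rule nn_integral_sum[symmetric]) measurable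
    also have "\<dots> \<le> (\<integral>\<^sup>+\<sigma>. ennreal (square_sum ?Q {n. ?Q n \<noteq> 0} \<sigma> powr (q / 2)) \<partial>bergman_weight \<beta>)"
      by (intro nn_integral_mono pt)
    finally show "ennreal K \<le> (\<integral>\<^sup>+\<sigma>. ennreal (square_sum ?Q {n. ?Q n \<noteq> 0} \<sigma> powr (q / 2)) \<partial>bergman_weight \<beta>)" .
  qed
  then show ?thesis by blast
qed

theorem theorem1p3:
  fixes p q \<alpha> \<beta> :: real and M :: "'w measure" and X :: "nat \<Rightarrow> 'w \<Rightarrow> complex"
  assumes "0 < p" and "0 < q" and "- 1 < \<alpha>" and "- 1 < \<beta>"
    and "standard_random_sequence M X"
  shows "(\<forall>f\<in>bergman_space p \<alpha>. AE \<omega> in M. randomization X \<omega> f \<in> bergman_space q \<beta>) \<longleftrightarrow>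
    (p \<ge> 2 \<and> (\<alpha> + 1) / p < (\<beta> + 1) / q) \<or>
    (q \<ge> p \<and> p \<ge> 2 \<and> (\<alpha> + 1) / p = (\<beta> + 1) / q)"
    (is "?L \<longleftrightarrow> ?R")
proof
  assume ?R
  then have "p \<ge> 2" "(\<alpha> + 1) / p < (\<beta> + 1) / q \<or> q \<ge> p \<and> (\<alpha> + 1) / p = (\<beta> + 1) / q" by auto
  then show ?L using assms by (intro ballI randomization_in_bergman_space)
next
  assume L: ?L
  show ?R
  proof (rule ccontr)
    assume not: "\<not> ?R"
    have "\<exists>Q. hump p \<alpha> q \<beta> K {d..} Q" for d K
    proof (cases "p < 2")
      case True
      then show ?thesis using assms by (intro hump_exponent_less_2)
    next
      case False
      with not have "(\<beta> + 1) / q < (\<alpha> + 1) / p \<or> q < p \<and> (\<beta> + 1) / q = (\<alpha> + 1) / p" by auto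
      then show ?thesis using False assms by (intro hump_exponent_ge_2) auto
    qed
    from hump_randomization_not_in_bergman_space[OF assms this] L show False by blast
  qed
qed

end
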